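(* Let $(\Delta_n)_n$ be a sequence of finite subsets of $[1,\infty)$ such that, as $n\to\infty$, $$|\Delta_n| \to \infty,\qquad \frac{\min_{T \neq T' \in \Delta_n}|\log T -\log T'|}{\log|\Delta_n|} \to \infty,\qquad \frac{\min_{T \in \Delta_n}\log T}{\log|\Delta_n|} \to \infty .$$ For $r\in\mathbb{N}$ put $\mathfrak{m}^{(r)}(\Delta_n;\alpha):=\min_{T \in \Delta_n}k^{(r)}_0(T;\alpha)$, and put $\mathfrak{M}^{(1)}(\Delta_n;\alpha):=\max_{T \in \Delta_n}k^{(1)}_0(T;\alpha)$. Then, as $n\to\infty$, the following convergences in distribution hold with respect to Lebesgue measure on $\mathbb{T}$ (in the variable $\alpha$): $$|\Delta_n|\,\mathfrak{m}^{(r)}(\Delta_n; \cdot)\Longrightarrow \mathrm{Wei}\left(\frac{12}{\pi^2r^2}, 1\right)\quad\text{for all } r\geq 1,$$ $$|\Delta_n|^{1/2}\,(\log|\Delta_n|)^{1/2}\,\bigl(1-\mathfrak{M}^{(1)}(\Delta_n; \cdot)\bigr)\Longrightarrow \mathrm{Wei}\left(\frac{3}{\pi^2}, 2\right).$$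
   Context: $\mathbb{T}=\mathbb{R}/\mathbb{Z}$ with distance $d(x,y)=\min_{p\in\mathbb{Z}}|x-y+p|$. For $\alpha\in\mathbb{T}$, $r\in\mathbb{N}=\{1,2,\dots\}$ and real $T\ge r$, let $d^{(r)}_0(T;\alpha)$ be the $r$-th minimum (the $r$-th smallest value, counted with multiplicity over $q$) among the numbers $d(q\alpha,0)$, $q$ an integer with $1\le q\le T$, and set $k^{(r)}_0(T;\alpha):=T\cdot d^{(r)}_0(T;\alpha)$. (The hypotheses on $\Delta_n$ imply $\min\Delta_n\to\infty$, so for fixed $r$ the quantities above are defined for all large $n$.) For $\lambda,a>0$, $\mathrm{Wei}(\lambda,a)$ is the probability distribution with cumulative distribution function $F(t)=1-e^{-\lambda t^a}$ for $t>0$ and $F(t)=0$ for $t\le 0$. *)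

theory Defs
  imports "HOL-Probability.Probability" "HOL-Real_Asymp.Real_Asymp"
begin

text \<open>
  Points of \<open>\<real>/\<int>\<close> are given by real representatives. All functions of \<open>\<alpha>\<close> below are
  1-periodic (lemmas \<open>circle_dist_add_int\<close> and \<open>k0_add_int\<close>), and Lebesgue measure on
  \<open>\<real>/\<int>\<close> is Lebesgue measure on the fundamental domain \<open>[0,1)\<close>.
\<close>

definition circle_dist :: "real \<Rightarrow> real \<Rightarrow> real" where
  "circle_dist x y = (INF p::int. \<bar>x - y + of_int p\<bar>)"

definition circle_measure :: "real measure" where
  "circle_measure = restrict_space lborel {0..<1}"

text \<open>
  List positions start at 0, so the \<open>r\<close>-th smallest value is at position \<open>r - 1\<close>; it is
  meaningful for \<open>1 \<le> r \<le> T\<close>.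
\<close>

definition rth_min_dist :: "nat \<Rightarrow> real \<Rightarrow> real \<Rightarrow> real" where
  "rth_min_dist r T \<alpha> =
     sorted_list_of_multiset
       {# circle_dist (real q * \<alpha>) 0. q \<in># mset_set {q::nat. 1 \<le> q \<and> real q \<le> T} #} ! (r - 1)"

definition k0 :: "nat \<Rightarrow> real \<Rightarrow> real \<Rightarrow> real" where
  "k0 r T \<alpha> = T * rth_min_dist r T \<alpha>"

definition min_k0 :: "nat \<Rightarrow> real set \<Rightarrow> real \<Rightarrow> real" where
  "min_k0 r D \<alpha> = Min ((\<lambda>T. k0 r T \<alpha>) ` D)"

definition max_k0 :: "nat \<Rightarrow> real set \<Rightarrow> real \<Rightarrow> real" where
  "max_k0 r D \<alpha> = Max ((\<lambda>T. k0 r T \<alpha>) ` D)"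

definition weibull_cdf :: "real \<Rightarrow> real \<Rightarrow> real \<Rightarrow> real" where
  "weibull_cdf c a t = (if t > 0 then 1 - exp (- c * t powr a) else 0)"

definition weibull :: "real \<Rightarrow> real \<Rightarrow> real measure" where
  "weibull c a = interval_measure (weibull_cdf c a)"

lemma circle_dist_attained: "\<exists>p::int. circle_dist x y = \<bar>x - y + of_int p\<bar>"
proof
  let ?f = "\<lambda>p::int. \<bar>x - y + of_int p\<bar>"
  define p0 where "p0 = - round (x - y)"
  have le: "?f p0 \<le> ?f p" for p
    using round_diff_minimal[of "x - y" "- p"] by (simp add: p0_def)
  have "(INF p. ?f p) = ?f p0"
    by (rule cInf_eq_minimum) (use le in auto)
  then show "circle_dist x y = \<bar>x - y + of_int p0\<bar>"
    by (simp add: circle_dist_def)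
qed

lemma circle_dist_le: "circle_dist x y \<le> \<bar>x - y + of_int p\<bar>"
  unfolding circle_dist_def by (rule cINF_lower) (auto intro: bdd_belowI[of _ 0])

lemma circle_dist_add_int: "circle_dist (x + of_int k) y = circle_dist x y"
proof (rule antisym)
  obtain p where "circle_dist x y = \<bar>x - y + of_int p\<bar>"
    using circle_dist_attained by blast
  then show "circle_dist (x + of_int k) y \<le> circle_dist x y"
    using circle_dist_le[of "x + of_int k" y "p - k"] by (simp add: algebra_simps)
next
  obtain p where "circle_dist (x + of_int k) y = \<bar>x + of_int k - y + of_int p\<bar>"
    using circle_dist_attained by blast
  then show "circle_dist x y \<le> circle_dist (x + of_int k) y"
    using circle_dist_le[of x y "p + k"] by (simp add: algebra_simps)
qed

lemma k0_add_int: "k0 r T (\<alpha> + of_int k) = k0 r T \<alpha>"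
proof -
  have "circle_dist (real q * (\<alpha> + of_int k)) 0 = circle_dist (real q * \<alpha>) 0" for q
    using circle_dist_add_int[of "real q * \<alpha>" "int q * k" 0] by (simp add: algebra_simps)
  then show ?thesis
    by (simp add: k0_def rth_min_dist_def)
qed

lemma prob_space_circle_measure: "prob_space circle_measure"
  unfolding circle_measure_def
  by (rule prob_spaceI) (simp add: emeasure_restrict_space space_restrict_space)

lemma
  assumes "c > 0" "a > 0"
  shows real_distribution_weibull: "real_distribution (weibull c a)"
    and cdf_weibull: "cdf (weibull c a) = weibull_cdf c a"
proof -
  let ?F = "weibull_cdf c a"
  have eq: "?F = (\<lambda>t. 1 - exp (- c * max 0 t powr a))"
    using assms by (auto simp: weibull_cdf_def fun_eq_iff max_def)
  have mono: "?F x \<le> ?F y" if "x \<le> y" for x y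
    using assms that unfolding eq by (auto intro!: powr_mono2)
  have "isCont ?F x" for x
    unfolding eq using assms
    by (intro continuous_intros continuous_on_interior[of UNIV] continuous_on_powr') auto
  then have cont: "continuous (at_right x) ?F" for x
    using continuous_at_imp_continuous_at_within by blast
  have "\<forall>\<^sub>F t in at_bot. ?F t = 0"
    using eventually_le_at_bot[of "0::real"] by eventually_elim (simp add: weibull_cdf_def)
  then have bot: "(?F \<longlongrightarrow> 0) at_bot"
    by (rule tendsto_eventually)
  have "((\<lambda>t. 1 - exp (- c * t powr a)) \<longlongrightarrow> 1) at_top"
    using assms by real_asymp
  moreover have "\<forall>\<^sub>F t in at_top. 1 - exp (- c * t powr a) = ?F t"
    using eventually_gt_at_top[of "0::real"] by eventually_elim (simp add: weibull_cdf_def)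
  ultimately have top: "(?F \<longlongrightarrow> 1) at_top"
    by (rule Lim_transform_eventually)
  show "real_distribution (weibull c a)"
    unfolding weibull_def by (rule real_distribution_interval_measure[OF mono cont bot top])
  show "cdf (weibull c a) = ?F"
    unfolding weibull_def by (rule cdf_interval_measure[OF mono cont bot])
qed

end

theory Submission
  imports Defs "HOL-Number_Theory.Number_Theory"
begin

text \<open>
  Let \<open>N = card (\<Delta> n)\<close>. For a single scale \<open>T\<close> the event that \<open>k0 r T \<alpha> <= t / N\<close>, and likewise
  the event that \<open>k0 1 T \<alpha> >= 1 - t / sqrt (N ln N)\<close>, has measure close to \<open>\<Lambda> / N\<close>, where
  \<open>\<Lambda> = 12 t / (\<pi>\<^sup>2 r\<^sup>2)\<close> in the first case and \<open>\<Lambda> = 3 t\<^sup>2 / \<pi>\<^sup>2\<close> in the second. The rescaled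
  minimum, or the rescaled distance of the maximum from 1, exceeds \<open>t\<close> iff none of the \<open>N\<close> events
  occurs. If they were independent, this would have probability \<open>(1 - \<Lambda> / N) ^ N\<close>, which tends to
  \<open>exp (- \<Lambda>)\<close>, the tail of the Weibull law. So two things have to be shown: the measures at one
  scale, and asymptotic independence of widely spaced scales.

  Independence. The ratio of two scales exceeds any fixed power of \<open>N\<close>. For a scale \<open>T\<close>, cut the
  circle into the Farey intervals of order \<open>T / N ^ C\<close>. An event at an earlier scale \<open>T'\<close> is
  described by a \<open>T'\<^sup>2\<close>-Lipschitz function, and most of these intervals are much shorter than
  \<open>1 / T'\<^sup>2\<close>; hence the event is, up to a small measure, a union of such intervals
  (\<open>cut_measure\<close>). The event at scale \<open>T\<close>, in turn, takes at least its proportional share \<open>\<Lambda> / N\<close>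
  of each single interval, up to a small relative error. Together with the upper bound \<open>\<Lambda> / N\<close> on
  the whole circle, this determines its share of every union of intervals, because an excess there
  would have to be compensated outside. This is \<open>void_probability\<close>. It is important that only
  lower bounds are needed locally: they can be obtained by restricting attention to convenient
  fractions.

  Small values at one scale. For \<open>2 s < 1\<close>, \<open>k0 r T \<alpha> <= s\<close> holds iff some reduced fraction
  \<open>p / q\<close> with \<open>q <= T / r\<close> has \<open>\<bar>q \<alpha> - p\<bar> <= s / (r T)\<close>, since the \<open>r\<close> good denominators must all
  be multiples of one. The measure is thus \<open>2 s / (r T)\<close> times the sum of \<open>\<phi>(q) / q\<close> over
  \<open>q <= T / r\<close>, and \<open>\<phi>(q) / q\<close> has mean \<open>6 / \<pi>\<^sup>2\<close> (\<open>ratio_sum_asymptotic\<close>). Inside a Farey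
  interval with end denominators \<open>q1, q2\<close> the reduced fractions have denominators \<open>a q1 + b q2\<close>
  with coprime \<open>a, b\<close>, and the same computation applies (\<open>fraction_sum_lower\<close>).

  Large values at one scale. \<open>k0 1 T\<close> is close to 1 only between consecutive fractions of order
  \<open>T\<close> with denominators \<open>q, q'\<close> such that \<open>T < q + q' < T / (1 - eps)\<close>, on an interval of length
  \<open>(T - (1 - eps) (q + q')) / (T q q')\<close>. Summed over all such pairs this gives about \<open>6 / \<pi>\<^sup>2\<close>
  times \<open>eps\<^sup>2 ln (1 / eps)\<close>; the logarithm comes from the smaller denominator, which ranges from
  \<open>eps T\<close> to \<open>T\<close>. On the whole circle this needs only counts of coprime integers. In a Farey
  interval, however, a pair is a matrix of determinant 1, and fixing the second coordinate \<open>B\<close> of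
  its mediant leaves solutions of a congruence \<open>A b \<equiv> \<plusminus>1\<close> modulo \<open>B\<close> in a box one of whose sides
  may be as short as \<open>eps B\<close>. Such solutions are equidistributed when \<open>B\<close> has a large prime factor
  \<open>p\<close> that divides it exactly once, because Kloosterman sums modulo \<open>p\<close> are \<open>O(p\<^bsup>3/4\<^esup>)\<close>, which is
  Kloosterman's elementary estimate by the fourth moment. All but a small proportion of the moduli
  have such a prime factor (\<open>card_no_large_prime\<close>), and the others may be discarded in a lower
  bound.
\<close>

section \<open>The mean value of the totient ratio\<close>

definition totient_ratio :: "nat => real" where
  "totient_ratio n = real (totient n) / real n"

definition ratio_sum :: "nat => real" where
  "ratio_sum n = (\<Sum>k=1..n. totient_ratio k)"

lemma totient_ratio_bounds: "0 <= totient_ratio n" "totient_ratio n <= 1"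
  using totient_le[of n] by (auto simp: totient_ratio_def divide_le_eq)

lemma ratio_sum_bounds: "0 <= ratio_sum n" "ratio_sum n <= real n"
proof -
  show "0 <= ratio_sum n"
    unfolding ratio_sum_def by (intro sum_nonneg totient_ratio_bounds)
  have "ratio_sum n <= (\<Sum>k=1..n. 1)"
    unfolding ratio_sum_def by (intro sum_mono totient_ratio_bounds)
  then show "ratio_sum n <= real n" by simp
qed

text \<open>Gauss's identity \<open>(\<Sum>d | d dvd n. \<phi>(d)) = n\<close>, divided by \<open>n\<close>.\<close>

lemma ratio_convolution:
  assumes "n > 0"
  shows "(\<Sum>d | d dvd n. totient_ratio d / real (n div d)) = 1"
proof -
  have "totient_ratio d / real (n div d) = real (totient d) / real n" if "d dvd n" for d
    using that assms by (auto simp: totient_ratio_def elim!: dvdE)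
  then have "(\<Sum>d | d dvd n. totient_ratio d / real (n div d)) = (\<Sum>d | d dvd n. real (totient d) / real n)"
    by (intro sum.cong) auto
  also have "... = real (\<Sum>d | d dvd n. totient d) / real n"
    by (simp add: sum_divide_distrib)
  also have "... = 1" using assms by (simp add: totient_divisor_sum)
  finally show ?thesis .
qed

text \<open>The previous identity summed over \<open>1..n\<close> and grouped by the complementary divisor.\<close>

lemma ratio_sum_hyperbola: "(\<Sum>e=1..n. ratio_sum (n div e) / real e) = real n"
proof -
  have "(\<Sum>e=1..n. ratio_sum (n div e) / real e)
      = (\<Sum>e=1..n. \<Sum>d=1..n div e. totient_ratio d / real e)"
    by (simp add: ratio_sum_def sum_divide_distrib)
  also have "... = (\<Sum>(e,d)\<in>(SIGMA e:{1..n}. {1..n div e}). totient_ratio d / real e)"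
    by (simp add: sum.Sigma)
  also have "... = (\<Sum>(m,d)\<in>(SIGMA m:{1..n}. {d. d dvd m}). totient_ratio d / real (m div d))"
  proof (rule sum.reindex_bij_witness[where i = "\<lambda>(m,d). (m div d, d)" and j = "\<lambda>(e,d). (e * d, d)"])
    fix x assume "x \<in> (SIGMA e:{1..n}. {1..n div e})"
    then obtain e d where x: "x = (e,d)" "1 <= e" "1 <= d" "d <= n div e" by auto
    have "e * d <= n" using x by (simp add: less_eq_div_iff_mult_less_eq mult.commute)
    then show "(case x of (e, d) => (e * d, d)) \<in> (SIGMA m:{1..n}. {d. d dvd m})"
      using x by (auto simp: Suc_le_eq)
  next
    fix x assume "x \<in> (SIGMA m:{1..n}. {d. d dvd m})"
    then obtain m d where x: "x = (m,d)" "1 <= m" "m <= n" "d dvd m" by auto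
    then obtain e where e: "m = d * e" by blast
    have "d > 0" "e > 0" using x e by auto
    then have "d <= n div e" using x e by (simp add: less_eq_div_iff_mult_less_eq)
    moreover have "e <= n" using x e \<open>d > 0\<close> by (meson le_trans dvd_imp_le dvd_triv_right order.strict_trans1 less_le_trans zero_less_one less_eq_Suc_le)
    ultimately show "(case x of (m, d) => (m div d, d)) \<in> (SIGMA e:{1..n}. {1..n div e})"
      using x e \<open>d > 0\<close> \<open>e > 0\<close> by auto
  qed auto
  also have "... = (\<Sum>m=1..n. \<Sum>d | d dvd m. totient_ratio d / real (m div d))"
    by (subst sum.Sigma) auto
  also have "... = (\<Sum>m=1..n. 1)"
    by (intro sum.cong refl ratio_convolution) auto
  finally show ?thesis by simp
qed

lemma sum_inverse_squares: "(\<lambda>n. \<Sum>e=1..n. 1 / (real e)^2) \<longlonglongrightarrow> pi\<^sup>2 / 6"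
proof -
  have "(\<lambda>n. \<Sum>e<n. 1 / (real e + 1)^2) \<longlonglongrightarrow> pi\<^sup>2 / 6"
    using inverse_squares_sums by (simp add: sums_def add.commute)
  also have "(\<lambda>n. \<Sum>e<n. 1 / (real e + 1)^2) = (\<lambda>n. \<Sum>e=1..n. 1 / (real e)^2)"
    by (rule ext, rule sum.reindex_bij_witness[where i = "\<lambda>e. e - 1" and j = Suc]) auto
  finally show ?thesis .
qed

lemma sum_inverse_squares_le: "(\<Sum>e=1..n. 1 / (real e)^2) <= pi\<^sup>2 / 6"
  by (rule incseq_le[OF _ sum_inverse_squares]) (auto intro!: incseq_SucI)

lemma harmonic_le: "n >= 1 ==> (\<Sum>e=1..n. 1 / real e) <= 1 + ln (real n)"
proof (induction n rule: nat_induct_at_least)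
  case base show ?case by simp
next
  case (Suc n)
  have "ln (real n / real (Suc n)) <= real n / real (Suc n) - 1"
    using Suc by (intro ln_le_minus_one) auto
  then have "1 / real (Suc n) <= ln (real (Suc n)) - ln (real n)"
    using Suc by (simp add: ln_div field_simps)
  then show ?case using Suc by simp
qed

lemma nat_div_lower: "real n / real e - 1 <= real (n div e)"
proof -
  have "real n / real e - 1 <= real_of_int \<lfloor>real n / real e\<rfloor>" by linarith
  then show ?thesis by (simp add: floor_divide_of_nat_eq)
qed

lemma sum_div_div_limit: "(\<lambda>n. (\<Sum>e=1..n. real (n div e) / real e) / real n) \<longlonglongrightarrow> pi\<^sup>2 / 6"
proof (rule tendsto_sandwich[OF _ _ _ sum_inverse_squares])
  let ?H = "\<lambda>n. \<Sum>e=1..n. 1 / (real e)^2"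
  have "(\<lambda>n. (1 + ln (real n)) / real n) \<longlonglongrightarrow> 0" by real_asymp
  from tendsto_diff[OF sum_inverse_squares this]
  show "(\<lambda>n. ?H n - (1 + ln (real n)) / real n) \<longlonglongrightarrow> pi\<^sup>2 / 6" by simp
  show "\<forall>\<^sub>F n in sequentially. (\<Sum>e=1..n. real (n div e) / real e) / real n <= ?H n"
  proof (rule eventually_sequentiallyI[of 1])
    fix n :: nat assume n: "n >= 1"
    have "(\<Sum>e=1..n. real (n div e) / real e) <= (\<Sum>e=1..n. real n / real e / real e)"
      by (intro sum_mono divide_right_mono of_nat_div_le_of_nat) auto
    also have "... = real n * ?H n" by (simp add: sum_distrib_left power2_eq_square)
    finally show "(\<Sum>e=1..n. real (n div e) / real e) / real n <= ?H n"
      using n by (simp add: divide_le_eq mult.commute)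
  qed
  show "\<forall>\<^sub>F n in sequentially. ?H n - (1 + ln (real n)) / real n <= (\<Sum>e=1..n. real (n div e) / real e) / real n"
  proof (rule eventually_sequentiallyI[of 1])
    fix n :: nat assume n: "n >= 1"
    have "real n * ?H n - (\<Sum>e=1..n. 1 / real e) = (\<Sum>e=1..n. (real n / real e - 1) / real e)"
      by (simp add: sum_distrib_left power2_eq_square sum_subtractf diff_divide_distrib)
    also have "... <= (\<Sum>e=1..n. real (n div e) / real e)"
    proof (intro sum_mono divide_right_mono)
      fix e assume "e \<in> {1..n}"
      show "real n / real e - 1 <= real (n div e)"
        by (rule nat_div_lower)
    qed auto
    finally have "real n * ?H n - (1 + ln (real n)) <= (\<Sum>e=1..n. real (n div e) / real e)"
      using harmonic_le[OF n] by linarith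
    moreover have "x - y / real n <= z / real n" if "real n * x - y <= z" for x y z
      using divide_right_mono[OF that, of "real n"] n by (simp add: diff_divide_distrib)
    ultimately show "?H n - (1 + ln (real n)) / real n <= (\<Sum>e=1..n. real (n div e) / real e) / real n"
      by blast
  qed
qed

lemma tail_inverse_squares:
  assumes "m >= 1" shows "(\<Sum>e\<in>{m<..n}. 1 / (real e)^2) <= 1 / real m"
proof (cases "m <= n")
  case True
  have "(\<Sum>e\<in>{m<..n}. 1 / (real e)^2) <= 1 / real m - 1 / real n"
    using True
  proof (induction n rule: dec_induct)
    case (step n)
    have "1 / (real (Suc n))^2 <= 1 / (real n * real (Suc n))"
      using step assms by (intro divide_left_mono) (auto simp: power2_eq_square)
    also have "... = 1 / real n - 1 / real (Suc n)"
      using step assms by (simp add: field_simps)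
    finally have "1 / (real (Suc n))^2 <= 1 / real n - 1 / real (Suc n)" .
    moreover have "{m<..Suc n} = insert (Suc n) {m<..n}" using step by auto
    ultimately show ?case using step by simp
  qed auto
  then show ?thesis by (rule order_trans) simp
qed (use assms in auto)

text \<open>
  A contraction argument. Write \<open>ratio_sum n = n (c + u n)\<close>. The hyperbola identity bounds \<open>\<bar>u n\<bar>\<close>
  by \<open>o(1)\<close> plus the average of \<open>\<bar>u (n div e)\<bar>\<close> over \<open>e >= 2\<close> with weights \<open>1 / e\<^sup>2\<close>. Their total
  mass \<open>\<pi>\<^sup>2 / 6 - 1\<close> is below \<open>2 / 3\<close>, so each application improves an eventual bound on \<open>\<bar>u\<bar>\<close> by
  the factor \<open>3 / 4\<close>.
\<close>

lemma ratio_sum_asymptotic: "(\<lambda>n. ratio_sum n / real n) \<longlonglongrightarrow> 6 / pi\<^sup>2"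
proof -
  define c where "c = 6 / pi\<^sup>2"
  define u where "u n = ratio_sum n / real n - c" for n
  define \<delta> where "\<delta> n = \<bar>1 - c * ((\<Sum>e=1..n. real (n div e) / real e) / real n)\<bar>" for n
  have pi2: "9 <= pi\<^sup>2" "pi\<^sup>2 < 10"
  proof -
    have "3 <= pi" using pi_gt3 by simp
    then show "9 <= pi\<^sup>2" using power_mono[of 3 pi 2] by simp
    have "pi < 3.15" using pi_approx by simp
    then have "pi\<^sup>2 < 3.15\<^sup>2" by (intro power_strict_mono) auto
    then show "pi\<^sup>2 < 10" by (simp add: power2_eq_square)
  qed
  have c: "0 < c" "c <= 1" using pi2 by (auto simp: c_def)
  have u1: "\<bar>u n\<bar> <= 1" for n
  proof -
    have "0 <= ratio_sum n / real n" "ratio_sum n / real n <= 1"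
      using ratio_sum_bounds[of n] by (auto simp: divide_le_eq)
    then show ?thesis using c unfolding u_def by linarith
  qed
  have S: "ratio_sum n = real n * (c + u n)" for n
    using ratio_sum_bounds[of n] by (cases "n = 0") (auto simp: u_def)
  have "(\<lambda>n. 1 - c * ((\<Sum>e=1..n. real (n div e) / real e) / real n)) \<longlonglongrightarrow> 1 - c * (pi\<^sup>2 / 6)"
    by (intro tendsto_intros sum_div_div_limit)
  then have \<delta>0: "\<delta> \<longlonglongrightarrow> 0"
    unfolding \<delta>_def by (intro tendsto_rabs_zero) (simp add: c_def)
  have rec: "\<bar>u n\<bar> <= \<delta> n + (\<Sum>e=2..n. \<bar>u (n div e)\<bar> / (real e)^2)" if n: "n >= 1" for n
  proof -
    have "real n = (\<Sum>e=1..n. real (n div e) * (c + u (n div e)) / real e)"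
      using ratio_sum_hyperbola[of n] by (simp add: S)
    also have "... = c * (\<Sum>e=1..n. real (n div e) / real e) + (\<Sum>e=1..n. real (n div e) * u (n div e) / real e)"
      by (simp add: algebra_simps sum.distrib sum_distrib_left add_divide_distrib)
    also have "(\<Sum>e=1..n. real (n div e) * u (n div e) / real e)
        = real n * u n + (\<Sum>e=2..n. real (n div e) * u (n div e) / real e)"
      using n by (subst sum.atLeast_Suc_atMost) (auto simp: numeral_2_eq_2)
    finally have "real n * u n = real n - c * (\<Sum>e=1..n. real (n div e) / real e) - (\<Sum>e=2..n. real (n div e) * u (n div e) / real e)"
      by linarith
    moreover have "x = (1 - c * (a / real n)) - b / real n" if "real n * x = real n - c * a - b" for a b x
    proof -
      have "x = (real n * x) / real n" using n by simp
      also have "... = (real n - c * a - b) / real n" by (simp only: that)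
      finally show ?thesis using n by (simp add: diff_divide_distrib)
    qed
    ultimately have "u n = (1 - c * ((\<Sum>e=1..n. real (n div e) / real e) / real n)) - (\<Sum>e=2..n. real (n div e) * u (n div e) / real e) / real n"
      by blast
    moreover have "\<bar>x\<bar> <= \<bar>y\<bar> + \<bar>z\<bar>" if "x = y - z" for x y z :: real
      using that by linarith
    ultimately have "\<bar>u n\<bar> <= \<delta> n + \<bar>(\<Sum>e=2..n. real (n div e) * u (n div e) / real e) / real n\<bar>"
      unfolding \<delta>_def by blast
    also have "\<bar>(\<Sum>e=2..n. real (n div e) * u (n div e) / real e) / real n\<bar> <= (\<Sum>e=2..n. \<bar>real (n div e) * u (n div e) / real e / real n\<bar>)"
      unfolding sum_divide_distrib by (rule sum_abs)
    also have "... <= (\<Sum>e=2..n. \<bar>u (n div e)\<bar> / (real e)^2)"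
    proof (rule sum_mono)
      fix e assume e: "e \<in> {2..n}"
      have "real (n div e) / real n <= 1 / real e"
        using of_nat_div_le_of_nat[of n e, where 'a = real] n e by (simp add: field_simps)
      then have "(real (n div e) / real n) * (\<bar>u (n div e)\<bar> / real e) <= (1 / real e) * (\<bar>u (n div e)\<bar> / real e)"
        by (intro mult_right_mono) auto
      then show "\<bar>real (n div e) * u (n div e) / real e / real n\<bar> <= \<bar>u (n div e)\<bar> / (real e)^2"
        by (simp add: abs_mult power2_eq_square mult.commute)
    qed
    finally show ?thesis by linarith
  qed
  have step: "\<exists>M\<ge>1. \<forall>m\<ge>M. \<bar>u m\<bar> <= (3/4)^k" for k
  proof (induction k)
    case 0 then show ?case using u1 by auto
  next
    case (Suc k)
    then obtain M where M: "M >= 1" "\<And>m. m >= M ==> \<bar>u m\<bar> <= (3/4)^k" by blast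
    define U :: real where "U = (3/4)^k"
    have U: "U > 0" by (simp add: U_def)
    have "(\<lambda>n. \<delta> n + 1 / real (n div M)) \<longlonglongrightarrow> 0 + 0"
    proof (intro tendsto_add \<delta>0)
      have "filterlim (\<lambda>n. n div M) at_top sequentially"
        using M(1) by (intro filterlim_at_top_div_const_nat) auto
      then have "filterlim (\<lambda>n. real (n div M)) at_top sequentially"
        by (rule filterlim_compose[OF filterlim_real_sequentially])
      then show "(\<lambda>n. 1 / real (n div M)) \<longlonglongrightarrow> 0"
        by (intro tendsto_divide_0[OF tendsto_const] filterlim_at_top_imp_at_infinity)
    qed
    then have "\<forall>\<^sub>F n in sequentially. \<delta> n + 1 / real (n div M) < U / 12"
      using U by (intro order_tendstoD(2)) auto
    then obtain M' where M': "\<And>n. n >= M' ==> \<delta> n + 1 / real (n div M) < U / 12"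
      by (auto simp: eventually_sequentially)
    show ?case
    proof (intro exI[of _ "max M' M"] conjI allI impI)
      fix n assume n: "max M' M <= n"
      \<comment> \<open>For e up to r the index n div e is at least M, where the previous bound applies; beyond r the trivial bound 1 is enough.\<close>
      define r where "r = n div M"
      have r: "r >= 1" using n M by (simp add: r_def Suc_le_eq div_greater_zero_iff)
      have rn: "r <= n" by (simp add: r_def)
      have "(\<Sum>e=2..n. \<bar>u (n div e)\<bar> / (real e)^2) <= (\<Sum>e=2..n. (if e <= r then U / (real e)^2 else 1 / (real e)^2))"
      proof (rule sum_mono)
        fix e assume e: "e \<in> {2..n}"
        have "n div e >= M" if "e <= r"
          using that e M(1) unfolding r_def by (simp add: less_eq_div_iff_mult_less_eq mult.commute)
        then show "\<bar>u (n div e)\<bar> / (real e)^2 <= (if e <= r then U / (real e)^2 else 1 / (real e)^2)"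
          using M(2) u1 by (auto intro!: divide_right_mono simp: U_def)
      qed
      also have "... <= U * (\<Sum>e=2..n. 1 / (real e)^2) + (\<Sum>e\<in>{r<..n}. 1 / (real e)^2)"
      proof -
        have "(\<Sum>e=2..n. (if e <= r then U / (real e)^2 else 1 / (real e)^2))
           <= (\<Sum>e=2..n. U / (real e)^2 + (if e \<in> {r<..n} then 1 / (real e)^2 else 0))"
          using U by (intro sum_mono) auto
        also have "... = U * (\<Sum>e=2..n. 1 / (real e)^2) + (\<Sum>e\<in>{2..n} \<inter> {r<..n}. 1 / (real e)^2)"
          by (simp add: sum.distrib sum_distrib_left sum.inter_restrict)
        also have "(\<Sum>e\<in>{2..n} \<inter> {r<..n}. 1 / (real e)^2) <= (\<Sum>e\<in>{r<..n}. 1 / (real e)^2)"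
          by (intro sum_mono2) auto
        finally show ?thesis by simp
      qed
      also have "(\<Sum>e\<in>{r<..n}. 1 / (real e)^2) <= 1 / real r" by (rule tail_inverse_squares[OF r])
      also have "(\<Sum>e=2..n. 1 / (real e)^2) <= 2/3"
      proof -
        have "(\<Sum>e=1..n. 1 / (real e)^2) = 1 + (\<Sum>e=2..n. 1 / (real e)^2)"
          using n M by (subst sum.atLeast_Suc_atMost) (auto simp: numeral_2_eq_2)
        then show ?thesis using sum_inverse_squares_le[of n] pi2 by simp
      qed
      finally have "(\<Sum>e=2..n. \<bar>u (n div e)\<bar> / (real e)^2) <= U * (2/3) + 1 / real r"
        using U by (simp add: mult_left_mono)
      then have "\<bar>u n\<bar> <= U * (2/3) + U / 12"
        using rec[of n] M'[of n] n M(1) unfolding r_def by linarith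
      then show "\<bar>u n\<bar> <= (3/4)^Suc k" by (simp add: U_def)
    qed (use M in auto)
  qed
  have "u \<longlonglongrightarrow> 0"
  proof (rule LIMSEQ_I)
    fix e :: real assume "e > 0"
    then obtain k where k: "(3/4::real)^k < e" using real_arch_pow_inv[of e "3/4"] by auto
    obtain M where "\<forall>m\<ge>M. \<bar>u m\<bar> <= (3/4)^k" using step[of k] by blast
    then have "\<forall>n\<ge>M. norm (u n - 0) < e" using k by force
    then show "\<exists>no. \<forall>n\<ge>no. norm (u n - 0) < e" by blast
  qed
  then have "(\<lambda>n. u n + c) \<longlonglongrightarrow> 0 + c" by (intro tendsto_intros)
  then show ?thesis by (simp add: u_def c_def)
qed

section \<open>Kloosterman sums and modular hyperbolas\<close>

text \<open>The additive character \<open>k \<mapsto> e\<^bsup>2\<pi>ik/p\<^esup>\<close> modulo \<open>p\<close>.\<close>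

definition ee :: "nat => int => complex" where
  "ee p k = cis (2 * pi * of_int k / of_nat p)"

lemma ee_add: "ee p (a + b) = ee p a * ee p b"
  by (simp add: ee_def cis_mult add_divide_distrib distrib_left)

lemma ee_0 [simp]: "ee p 0 = 1" by (simp add: ee_def)

lemma norm_ee [simp]: "norm (ee p k) = 1" by (simp add: ee_def)

lemma cnj_ee: "cnj (ee p k) = ee p (- k)"
  by (simp add: ee_def cis_cnj)

lemma ee_of_nat_mult: "ee p (int m * k) = ee p k ^ m"
  by (simp add: ee_def Complex.DeMoivre field_simps)

lemma ee_dvd:
  assumes "p > 0" "int p dvd k" shows "ee p k = 1"
proof -
  obtain j where "k = int p * j" using assms by blast
  then have "2 * pi * of_int k / of_nat p = 2 * pi * of_int j" using assms by simp
  then show ?thesis unfolding ee_def by (simp add: cis_multiple_2pi)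
qed

lemma ee_cong:
  assumes "p > 0" "[a = b] (mod int p)" shows "ee p a = ee p b"
proof -
  have "int p dvd (a - b)" using assms(2) by (simp add: cong_iff_dvd_diff)
  then have "ee p (a - b) = 1" using assms(1) ee_dvd by blast
  then show ?thesis using ee_add[of p "a - b" b] by simp
qed

lemma norm_one_minus_cis: "norm (1 - cis t) = 2 * \<bar>sin (t / 2)\<bar>"
proof -
  have "(norm (1 - cis t))\<^sup>2 = (1 - cos t)\<^sup>2 + (sin t)\<^sup>2"
    by (simp add: cmod_power2)
  also have "... = 2 - 2 * cos t" using sin_cos_squared_add[of t] by (simp add: power2_diff)
  also have "... = (2 * \<bar>sin (t / 2)\<bar>)\<^sup>2"
    using cos_double_sin[of "t / 2"] by (simp add: power_mult_distrib)
  finally show ?thesis by (subst (asm) power2_eq_iff_nonneg) auto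
qed

lemma sin_pi_lower:
  assumes "0 <= x" "x <= 1 / 2" shows "x <= sin (pi * x)"
proof -
  define t where "t = pi * x"
  have t: "0 <= t" "t <= pi / 2" using assms by (auto simp: t_def)
  have "t / 2 <= sin t"
  \<comment> \<open>The derivative of sin t - t / 2 is nonnegative up to pi / 3; beyond, sin t is at least sin (pi / 3).\<close>
  proof (cases "t <= pi / 3")
    case True
    have "sin 0 - 0 / 2 <= sin t - t / 2"
    proof (rule DERIV_nonneg_imp_nondecreasing[of 0 t "\<lambda>t. sin t - t / 2"])
      fix y assume y: "0 <= y" "y <= t"
      have "cos (pi / 3) <= cos y" using y True by (intro cos_monotone_0_pi_le) auto
      then have "0 <= cos y - 1 / 2" by (simp add: cos_60)
      moreover have "((\<lambda>t. sin t - t / 2) has_real_derivative (cos y - 1 / 2)) (at y)"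
        by (auto intro!: derivative_eq_intros)
      ultimately show "\<exists>z. ((\<lambda>t. sin t - t / 2) has_real_derivative z) (at y) \<and> 0 <= z" by blast
    qed (use t in auto)
    then show ?thesis by simp
  next
    case False
    have "sin (pi / 3) <= sin t" using t False by (intro sin_monotone_2pi_le) auto
    moreover have "1.7 <= sqrt (3::real)" by (rule real_le_rsqrt) (simp add: power2_eq_square)
    moreover have "t / 2 <= 0.85" using t pi_approx by auto
    ultimately show ?thesis by (simp add: sin_60)
  qed
  moreover have "x <= pi * x / 2" using assms pi_gt3 mult_right_mono[of 2 pi x] by simp
  ultimately show ?thesis by (simp add: t_def)
qed

lemma sum_ee:
  assumes "p > 0"
  shows "(\<Sum>m<p. ee p (int m * k)) = (if int p dvd k then of_nat p else 0)"
proof (cases "int p dvd k")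
  case True
  then have "ee p (int m * k) = 1" for m using assms by (intro ee_dvd) auto
  then show ?thesis using True by simp
next
  case False
  have ne: "ee p k ~= 1"
  proof
    assume "ee p k = 1"
    then have "cos (2 * pi * of_int k / of_nat p) = 1" unfolding ee_def by (auto simp: complex_eq_iff)
    then obtain j :: int where "2 * pi * of_int k / of_nat p = of_int j * 2 * pi"
      using cos_one_2pi_int by blast
    then have "of_int k = (of_int (j * int p) :: real)" using assms by (simp add: field_simps)
    then have "k = j * int p" by linarith
    then show False using False by simp
  qed
  have "(\<Sum>m<p. ee p (int m * k)) = (\<Sum>m<p. ee p k ^ m)" by (simp add: ee_of_nat_mult)
  also have "... = (ee p k ^ p - 1) / (ee p k - 1)" using ne by (rule geometric_sum)
  also have "ee p k ^ p = 1"
    using assms ee_of_nat_mult[of p p k] ee_dvd[of p "int p * k"] by simp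
  finally show ?thesis using False by simp
qed

lemma sum_swap4:
  fixes f :: "'a => 'b => 'c => 'd => 'e :: comm_monoid_add"
  shows "(\<Sum>m\<in>M. \<Sum>n\<in>N. \<Sum>i\<in>I. \<Sum>j\<in>J. f m n i j) = (\<Sum>i\<in>I. \<Sum>j\<in>J. \<Sum>m\<in>M. \<Sum>n\<in>N. f m n i j)"
proof -
  have "(\<Sum>m\<in>M. \<Sum>n\<in>N. \<Sum>i\<in>I. \<Sum>j\<in>J. f m n i j) = (\<Sum>m\<in>M. \<Sum>i\<in>I. \<Sum>n\<in>N. \<Sum>j\<in>J. f m n i j)"
    by (rule sum.cong[OF refl], rule sum.swap)
  also have "... = (\<Sum>m\<in>M. \<Sum>i\<in>I. \<Sum>j\<in>J. \<Sum>n\<in>N. f m n i j)"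
    by (rule sum.cong[OF refl], rule sum.cong[OF refl], rule sum.swap)
  also have "... = (\<Sum>i\<in>I. \<Sum>m\<in>M. \<Sum>j\<in>J. \<Sum>n\<in>N. f m n i j)"
    by (rule sum.swap)
  also have "... = (\<Sum>i\<in>I. \<Sum>j\<in>J. \<Sum>m\<in>M. \<Sum>n\<in>N. f m n i j)"
    by (rule sum.cong[OF refl], rule sum.swap)
  finally show ?thesis .
qed

text \<open>Orthogonality of characters: the second moment counts coincidences of frequencies.\<close>

lemma parseval_ee:
  fixes a b :: "'i => int"
  assumes "p > 0" "finite I"
  shows "(\<Sum>m<p. \<Sum>n<p. (norm (\<Sum>i\<in>I. ee p (int m * a i + int n * b i)))\<^sup>2)
     = real p ^ 2 * real (card {(i, j) \<in> I \<times> I. [a i = a j] (mod int p) \<and> [b i = b j] (mod int p)})"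
proof -
  have "complex_of_real (\<Sum>m<p. \<Sum>n<p. (norm (\<Sum>i\<in>I. ee p (int m * a i + int n * b i)))\<^sup>2)
     = (\<Sum>m<p. \<Sum>n<p. (\<Sum>i\<in>I. ee p (int m * a i + int n * b i)) * (\<Sum>j\<in>I. ee p (- (int m * a j + int n * b j))))"
    by (simp add: complex_norm_square cnj_ee del: of_real_power)
  also have "... = (\<Sum>m<p. \<Sum>n<p. \<Sum>i\<in>I. \<Sum>j\<in>I. ee p (int m * (a i - a j)) * ee p (int n * (b i - b j)))"
    by (simp add: sum_product ee_add[symmetric] algebra_simps)
  also have "... = (\<Sum>i\<in>I. \<Sum>j\<in>I. (\<Sum>m<p. ee p (int m * (a i - a j))) * (\<Sum>n<p. ee p (int n * (b i - b j))))"
    unfolding sum_product by (rule sum_swap4)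
  also have "... = (\<Sum>i\<in>I. \<Sum>j\<in>I. if [a i = a j] (mod int p) \<and> [b i = b j] (mod int p) then of_nat p ^ 2 else 0)"
    using assms by (intro sum.cong refl) (simp add: sum_ee cong_iff_dvd_diff power2_eq_square)
  also have "... = (\<Sum>x\<in>I \<times> I. if [a (fst x) = a (snd x)] (mod int p) \<and> [b (fst x) = b (snd x)] (mod int p) then of_nat p ^ 2 else 0)"
    by (simp add: sum.cartesian_product case_prod_beta)
  also have "... = of_nat p ^ 2 * of_nat (card {(i, j) \<in> I \<times> I. [a i = a j] (mod int p) \<and> [b i = b j] (mod int p)})"
  proof -
    have "{(i, j) \<in> I \<times> I. [a i = a j] (mod int p) \<and> [b i = b j] (mod int p)}
       = {x \<in> I \<times> I. [a (fst x) = a (snd x)] (mod int p) \<and> [b (fst x) = b (snd x)] (mod int p)}" by auto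
    then show ?thesis using assms by (simp add: sum.If_cases Int_def)
  qed
  finally have "complex_of_real (\<Sum>m<p. \<Sum>n<p. (norm (\<Sum>i\<in>I. ee p (int m * a i + int n * b i)))\<^sup>2)
      = complex_of_real (real p ^ 2 * real (card {(i, j) \<in> I \<times> I. [a i = a j] (mod int p) \<and> [b i = b j] (mod int p)}))"
    by simp
  then show ?thesis by (simp only: of_real_eq_iff)
qed

text \<open>The modular hyperbola \<open>x y \<equiv> u\<close>, with coordinates represented in \<open>[0, p)\<close>.\<close>

definition hyp :: "nat => int => (int \<times> int) set" where
  "hyp p u = {(x, y). 0 <= x \<and> x < int p \<and> 0 <= y \<and> y < int p \<and> [x * y = u] (mod int p)}"

lemma finite_hyp: "finite (hyp p u)"
  by (rule finite_subset[of _ "{0..<int p} \<times> {0..<int p}"]) (auto simp: hyp_def)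

lemma prime_coprime_int:
  assumes "prime p" "\<not> int p dvd a" shows "coprime a (int p)"
  using assms by (metis coprime_commute prime_imp_coprime prime_nat_int_transfer)

lemma hyp_fst_inj:
  assumes "prime p" "\<not> int p dvd u" "(x, y) \<in> hyp p u" "(x', y') \<in> hyp p u" "[x = x'] (mod int p)"
  shows "x = x'" "y = y'"
proof -
  show xx: "x = x'"
    using assms by (auto simp: hyp_def cong_def)
  have "\<not> int p dvd x"
    using assms by (auto simp: hyp_def) (meson cong_dvd_iff dvd_mult2)
  moreover have "[x * y = x * y'] (mod int p)"
    using assms xx by (auto simp: hyp_def) (meson cong_sym cong_trans)
  ultimately have "[y = y'] (mod int p)"
    using assms(1) prime_coprime_int cong_mult_lcancel by blast
  then show "y = y'" using assms by (auto simp: hyp_def cong_def)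
qed

lemma hyp_ex:
  assumes "prime p" "\<not> int p dvd u" "\<not> int p dvd x" "0 <= x" "x < int p"
  shows "\<exists>y. (x, y) \<in> hyp p u"
proof -
  obtain z where z: "[x * z = 1] (mod int p)"
    using cong_solve_coprime_int[of x "int p"] prime_coprime_int assms by blast
  have p: "int p > 0" using assms(1) by (simp add: prime_gt_0_nat)
  have "[x * (z * u mod int p) = x * (z * u)] (mod int p)" by (simp add: cong_def mod_mult_right_eq)
  also have "[x * (z * u) = 1 * u] (mod int p)"
    unfolding mult.assoc[symmetric] by (intro cong_mult z) auto
  finally show ?thesis using assms p by (intro exI[of _ "z * u mod int p"]) (auto simp: hyp_def)
qed

lemma card_hyp:
  assumes "prime p" "\<not> int p dvd u" shows "card (hyp p u) = p - 1"
proof -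
  have "bij_betw fst (hyp p u) {1..<int p}"
  proof (rule bij_betw_imageI)
    show "inj_on fst (hyp p u)"
      using hyp_fst_inj[OF assms] by (force intro!: inj_onI)
    show "fst ` hyp p u = {1..<int p}"
    proof safe
      fix x y assume h: "(x, y) \<in> hyp p u"
      then have "\<not> int p dvd x"
        using assms by (auto simp: hyp_def) (meson cong_dvd_iff dvd_mult2)
      then have "x ~= 0" by auto
      then show "fst (x, y) \<in> {1..<int p}" using h by (auto simp: hyp_def)
    next
      fix x assume x: "x \<in> {1..<int p}"
      then have "\<not> int p dvd x" by (auto dest: zdvd_imp_le)
      then obtain y where "(x, y) \<in> hyp p u" using hyp_ex[OF assms, of x] x by auto
      then show "x \<in> fst ` hyp p u" by force
    qed
  qed
  then have "card (hyp p u) = card {1..<int p}" by (rule bij_betw_same_card)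
  then show ?thesis using prime_gt_0_nat[OF assms(1)] by simp
qed

definition kloosterman :: "nat => int => int => int => complex" where
  "kloosterman p u m n = (\<Sum>(x, y)\<in>hyp p u. ee p (m * x + n * y))"

lemma kloosterman_cong:
  assumes "p > 0" "[m = m'] (mod int p)" "[n = n'] (mod int p)"
  shows "kloosterman p u m n = kloosterman p u m' n'"
proof -
  have "ee p (m * x + n * y) = ee p (m' * x + n' * y)" for x y
    using assms by (intro ee_cong cong_add cong_mult) auto
  then show ?thesis by (simp add: kloosterman_def)
qed

text \<open>The hyperbola is invariant under \<open>(x, y) \<mapsto> (t x, t\<^sup>-\<^sup>1 y)\<close>.\<close>

lemma kloosterman_dilate:
  assumes p: "prime p" "\<not> int p dvd u" and t: "[t * t' = 1] (mod int p)"
  shows "kloosterman p u (t * m) (t' * n) = kloosterman p u m n"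
proof -
  have p0: "int p > 0" "p > 0" using p by (simp_all add: prime_gt_0_nat)
  have t2: "[t' * t = 1] (mod int p)" using t by (simp add: mult.commute)
  have canc: "z * (w * x mod int p) mod int p = x" if "0 <= x" "x < int p" "[z * w = 1] (mod int p)" for z w x
  proof -
    have "z * (w * x mod int p) mod int p = (z * w) * x mod int p" by (simp add: mod_mult_right_eq mult.assoc)
    also have "... = 1 * x mod int p" using that(3) by (metis cong_def mod_mult_left_eq)
    also have "... = x" using that by simp
    finally show ?thesis .
  qed
  have mem: "(z * x mod int p, w * y mod int p) \<in> hyp p u" if "(x, y) \<in> hyp p u" "[z * w = 1] (mod int p)" for z w x y
  proof -
    have "[(z * x mod int p) * (w * y mod int p) = (z * x) * (w * y)] (mod int p)"
      by (simp add: cong_def mod_mult_eq)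
    also have "(z * x) * (w * y) = (z * w) * (x * y)" by simp
    also have "[(z * w) * (x * y) = 1 * u] (mod int p)"
      using that by (intro cong_mult) (auto simp: hyp_def)
    finally show ?thesis using p0 by (simp add: hyp_def)
  qed
  show ?thesis
    unfolding kloosterman_def
  proof (rule sum.reindex_bij_witness[where i = "\<lambda>(x, y). (t' * x mod int p, t * y mod int p)"
        and j = "\<lambda>(x, y). (t * x mod int p, t' * y mod int p)"])
    fix a assume a: "a \<in> hyp p u"
    obtain x y where xy: "a = (x, y)" by (cases a)
    have b: "0 <= x" "x < int p" "0 <= y" "y < int p" using a xy by (auto simp: hyp_def)
    show "(case case a of (x, y) => (t * x mod int p, t' * y mod int p) of (x, y) => (t' * x mod int p, t * y mod int p)) = a"
      using b canc t t2 by (simp add: xy)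
    show "(case a of (x, y) => (t * x mod int p, t' * y mod int p)) \<in> hyp p u"
      using a mem t by (simp add: xy)
    show "(case case a of (x, y) => (t' * x mod int p, t * y mod int p) of (x, y) => (t * x mod int p, t' * y mod int p)) = a"
      using b canc t t2 by (simp add: xy)
    show "(case a of (x, y) => (t' * x mod int p, t * y mod int p)) \<in> hyp p u"
      using a mem t2 by (simp add: xy)
    have "ee p (m * (t * x mod int p) + n * (t' * y mod int p)) = ee p (t * m * x + t' * n * y)"
      using p0 by (intro ee_cong cong_add) (auto simp: cong_def mod_mult_right_eq mult_ac)
    then show "(case (case a of (x, y) => (t * x mod int p, t' * y mod int p)) of (x, y) => ee p (m * x + n * y)) = (case a of (x, y) => ee p (t * m * x + t' * n * y))"
      by (simp add: xy)
  qed
qed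

text \<open>
  If the sum \<open>(s, t)\<close> of two points of the hyperbola has \<open>s ~= 0\<close>, then also \<open>t ~= 0\<close>, and the
  product of the first coordinates is \<open>u s / t\<close>; so these are determined up to order as the roots
  of a quadratic. If \<open>s = 0\<close>, one point still determines the other.
\<close>

lemma hyp_energy_single:
  assumes p: "prime p" "\<not> int p dvd u" and z1: "(x1, y1) \<in> hyp p u" and z2: "(x2, y2) \<in> hyp p u"
  shows "card {((x3, y3), (x4, y4)) \<in> hyp p u \<times> hyp p u.
            [x1 + x2 = x3 + x4] (mod int p) \<and> [y1 + y2 = y3 + y4] (mod int p)}
       <= 2 + (if [x1 + x2 = 0] (mod int p) then card (hyp p u) else 0)" (is "card ?J <= _")
proof -
  have fst_eq: "z = w" if "z \<in> hyp p u" "w \<in> hyp p u" "[fst z = fst w] (mod int p)" for z w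
    using hyp_fst_inj[OF p, of "fst z" "snd z" "fst w" "snd w"] that unfolding prod_eq_iff prod.collapse by blast
  show ?thesis
  proof (cases "[x1 + x2 = 0] (mod int p)")
    case True
    have "inj_on fst ?J"
    proof (rule inj_onI)
      fix a b assume a: "a \<in> ?J" and b: "b \<in> ?J" and ab: "fst a = fst b"
      obtain x3 y3 x4 y4 where A: "a = ((x3, y3), (x4, y4))" by (metis surj_pair)
      obtain x4' y4' where B: "b = ((x3, y3), (x4', y4'))" using ab A by (metis fst_conv surj_pair)
      have "[x3 + x4 = x3 + x4'] (mod int p)" using a b A B by (auto intro: cong_trans cong_sym)
      then have "[x4 = x4'] (mod int p)" by (simp add: cong_add_lcancel)
      then have "(x4, y4) = (x4', y4')" using a b A B by (intro fst_eq) auto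
      then show "a = b" using A B by simp
    qed
    then have "card ?J = card (fst ` ?J)" by (simp add: card_image)
    also have "... <= card (hyp p u)" by (rule card_mono[OF finite_hyp]) auto
    finally show ?thesis using True by simp
  next
    case False
    have "?J \<subseteq> {((x1, y1), (x2, y2)), ((x2, y2), (x1, y1))}"
    proof
      fix a assume a: "a \<in> ?J"
      obtain x3 y3 x4 y4 where A: "a = ((x3, y3), (x4, y4))" by (metis surj_pair)
      have h: "(x3, y3) \<in> hyp p u" "(x4, y4) \<in> hyp p u" and s: "[x1 + x2 = x3 + x4] (mod int p)" and t: "[y1 + y2 = y3 + y4] (mod int p)"
        using a A by auto
      have d: "int p dvd x1 * y1 - u" "int p dvd x2 * y2 - u" "int p dvd x3 * y3 - u" "int p dvd x4 * y4 - u"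
        using z1 z2 h by (auto simp: hyp_def cong_iff_dvd_diff)
      have ds: "int p dvd (x1 + x2) - (x3 + x4)" and dt: "int p dvd (y1 + y2) - (y3 + y4)"
        using s t by (auto simp: cong_iff_dvd_diff)
      have pp: "prime (int p)" using p by simp
      have k1: "int p dvd x3 * x4 * (y3 + y4) - u * (x3 + x4)"
      proof -
        have "x3 * x4 * (y3 + y4) - u * (x3 + x4) = x4 * (x3 * y3 - u) + x3 * (x4 * y4 - u)" by (simp add: algebra_simps)
        then show ?thesis using d by simp
      qed
      have k2: "int p dvd x1 * x2 * (y1 + y2) - u * (x1 + x2)"
      proof -
        have "x1 * x2 * (y1 + y2) - u * (x1 + x2) = x2 * (x1 * y1 - u) + x1 * (x2 * y2 - u)" by (simp add: algebra_simps)
        then show ?thesis using d by simp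
      qed
      have "int p dvd (x1 * x2 - x3 * x4) * (y1 + y2)"
      proof -
        have eq: "(x1 * x2 - x3 * x4) * (y1 + y2) = (x1 * x2 * (y1 + y2) - u * (x1 + x2)) - (x3 * x4 * (y3 + y4) - u * (x3 + x4))
           + u * ((x1 + x2) - (x3 + x4)) - x3 * x4 * ((y1 + y2) - (y3 + y4))" by (simp add: algebra_simps)
        show ?thesis unfolding eq
          by (rule dvd_diff[OF dvd_add[OF dvd_diff[OF k2 k1] dvd_mult[OF ds, of u]] dvd_mult[OF dt, of "x3 * x4"]])
      qed
      moreover have "\<not> int p dvd (y1 + y2)"
      proof
        assume "int p dvd y1 + y2"
        then have "int p dvd x1 * x2 * (y1 + y2)" by simp
        from dvd_diff[OF this k2] have "int p dvd u * (x1 + x2)" by (simp only: diff_diff_eq2 add_diff_cancel_left')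
        then show False using pp p(2) False by (auto simp: prime_dvd_mult_iff cong_0_iff)
      qed
      ultimately have prod: "int p dvd x1 * x2 - x3 * x4" using pp by (auto simp: prime_dvd_mult_iff)
      \<comment> \<open>x3 is a root of the quadratic with roots x1 and x2.\<close>
      have "int p dvd (x3 - x1) * (x3 - x2)"
      proof -
        have "(x3 - x1) * (x3 - x2) = (x1 * x2 - x3 * x4) - x3 * ((x1 + x2) - (x3 + x4))" by (simp add: algebra_simps)
        then show ?thesis using prod ds by simp
      qed
      then have "[x3 = x1] (mod int p) \<or> [x3 = x2] (mod int p)" using pp by (auto simp: prime_dvd_mult_iff cong_iff_dvd_diff)
      then show "a \<in> {((x1, y1), (x2, y2)), ((x2, y2), (x1, y1))}"
      proof
        assume e: "[x3 = x1] (mod int p)"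
        then have "(x3, y3) = (x1, y1)" using h z1 by (intro fst_eq) auto
        moreover have "[x1 + x2 = x1 + x4] (mod int p)" using s calculation by simp
        then have "[x4 = x2] (mod int p)" unfolding cong_add_lcancel by (rule cong_sym)
        then have "(x4, y4) = (x2, y2)" using h z2 by (intro fst_eq) auto
        ultimately show ?thesis using A by simp
      next
        assume e: "[x3 = x2] (mod int p)"
        then have "(x3, y3) = (x2, y2)" using h z2 by (intro fst_eq) auto
        moreover have "[x2 + x1 = x2 + x4] (mod int p)" using s calculation by (simp add: add.commute)
        then have "[x4 = x1] (mod int p)" unfolding cong_add_lcancel by (rule cong_sym)
        then have "(x4, y4) = (x1, y1)" using h z1 by (intro fst_eq) auto
        ultimately show ?thesis using A by simp
      qed
    qed
    then have "card ?J <= card {((x1, y1), (x2, y2)), ((x2, y2), (x1, y1))}" by (intro card_mono) auto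
    also have "... <= 2" using card_length[of "[((x1, y1), (x2, y2)), ((x2, y2), (x1, y1))]"] by simp
    finally show ?thesis using False by simp
  qed
qed

text \<open>
  The square of the sum is an exponential sum over pair sums of hyperbola points, so its second
  moment counts coincidences among the pair sums.
\<close>

lemma kloosterman_fourth_moment:
  assumes p: "prime p" "\<not> int p dvd u"
  shows "(\<Sum>m<p. \<Sum>n<p. norm (kloosterman p u (int m) (int n)) ^ 4) <= 3 * real p ^ 2 * real (p - 1) ^ 2"
proof -
  define H where "H = hyp p u"
  define I where "I = H \<times> H"
  define a :: "(int \<times> int) \<times> (int \<times> int) => int" where "a = (\<lambda>((x1, y1), (x2, y2)). x1 + x2)"
  define b :: "(int \<times> int) \<times> (int \<times> int) => int" where "b = (\<lambda>((x1, y1), (x2, y2)). y1 + y2)"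
  define E where "E = {(i, j) \<in> I \<times> I. [a i = a j] (mod int p) \<and> [b i = b j] (mod int p)}"
  have finH: "finite H" by (simp add: H_def finite_hyp)
  then have finI: "finite I" by (simp add: I_def)
  have sq: "kloosterman p u m n ^ 2 = (\<Sum>i\<in>I. ee p (m * a i + n * b i))" for m n
  proof -
    have e: "ee p (m * x1 + n * y1) * ee p (m * x2 + n * y2) = ee p (m * (x1 + x2) + n * (y1 + y2))" for x1 y1 x2 y2
      by (simp add: ee_add[symmetric] distrib_left add_ac)
    show ?thesis
      unfolding kloosterman_def power2_eq_square sum_product sum.cartesian_product I_def a_def b_def H_def case_prod_beta e
      by (rule refl)
  qed
  have "norm (kloosterman p u m n) ^ 4 = (norm (\<Sum>i\<in>I. ee p (m * a i + n * b i)))\<^sup>2" for m n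
    by (simp add: sq[symmetric] norm_power power_mult[symmetric])
  then have "(\<Sum>m<p. \<Sum>n<p. norm (kloosterman p u (int m) (int n)) ^ 4) = real p ^ 2 * real (card E)"
    using parseval_ee[of p I a b] finI p by (simp add: prime_gt_0_nat E_def)
  moreover have "card E <= 3 * (p - 1) ^ 2"
  proof -
    have cH: "card H = p - 1" unfolding H_def by (rule card_hyp[OF p])
    have "E = (SIGMA i:I. {j \<in> I. [a i = a j] (mod int p) \<and> [b i = b j] (mod int p)})"
      by (auto simp: E_def)
    then have "card E = (\<Sum>i\<in>I. card {j \<in> I. [a i = a j] (mod int p) \<and> [b i = b j] (mod int p)})"
      using finI by (simp add: card_SigmaI)
    also have "... <= (\<Sum>i\<in>I. 2 + (if [a i = 0] (mod int p) then card H else 0))"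
    proof (rule sum_mono)
      fix i assume i: "i \<in> I"
      obtain x1 y1 x2 y2 where I: "i = ((x1, y1), (x2, y2))" by (metis surj_pair)
      have "{j \<in> I. [a i = a j] (mod int p) \<and> [b i = b j] (mod int p)}
        = {((x3, y3), (x4, y4)) \<in> H \<times> H. [x1 + x2 = x3 + x4] (mod int p) \<and> [y1 + y2 = y3 + y4] (mod int p)}"
        by (auto simp: I a_def b_def I_def)
      then show "card {j \<in> I. [a i = a j] (mod int p) \<and> [b i = b j] (mod int p)} <= 2 + (if [a i = 0] (mod int p) then card H else 0)"
        using hyp_energy_single[OF p, of x1 y1 x2 y2] i unfolding H_def[symmetric]
        by (simp only: I a_def I_def case_prod_conv mem_Times_iff fst_conv snd_conv)
    qed
    also have "... = 2 * card I + card {i \<in> I. [a i = 0] (mod int p)} * card H"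
    proof -
      have "(\<Sum>i\<in>I. if [a i = 0] (mod int p) then card H else 0) = card {i \<in> I. [a i = 0] (mod int p)} * card H"
        using finI by (simp add: sum.If_cases Int_def)
      moreover have "(\<Sum>i\<in>I. 2) = 2 * card I" by simp
      ultimately show ?thesis by (simp only: sum.distrib)
    qed
    also have "card {i \<in> I. [a i = 0] (mod int p)} <= card H"
    proof -
      have "inj_on fst {i \<in> I. [a i = 0] (mod int p)}"
      proof (rule inj_onI)
        fix i j assume i: "i \<in> {i \<in> I. [a i = 0] (mod int p)}" and j: "j \<in> {i \<in> I. [a i = 0] (mod int p)}" and ij: "fst i = fst j"
        obtain x1 y1 x2 y2 where I: "i = ((x1, y1), (x2, y2))" by (metis surj_pair)
        obtain x2' y2' where J: "j = ((x1, y1), (x2', y2'))" using ij I by (metis fst_conv surj_pair)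
        have "[x1 + x2 = x1 + x2'] (mod int p)" using i j I J by (auto simp: a_def intro: cong_trans cong_sym)
        then have "[x2 = x2'] (mod int p)" by (simp add: cong_add_lcancel)
        then show "i = j" using hyp_fst_inj[OF p, of x2 y2 x2' y2'] i j I J by (auto simp: I_def H_def)
      qed
      then have "card {i \<in> I. [a i = 0] (mod int p)} = card (fst ` {i \<in> I. [a i = 0] (mod int p)})" by (simp add: card_image)
      also have "... <= card H" by (rule card_mono[OF finH]) (auto simp: I_def)
      finally show ?thesis .
    qed
    finally have "card E <= 2 * card I + card H * card H" by (simp add: mult_le_mono1)
    then show ?thesis by (simp add: I_def card_cartesian_product cH power2_eq_square)
  qed
  then have "real (card E) <= 3 * real (p - 1) ^ 2"
    by (metis (mono_tags, lifting) of_nat_le_iff of_nat_mult of_nat_numeral of_nat_power)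
  ultimately show ?thesis
    using mult_left_mono[of "real (card E)" "3 * real (p - 1) ^ 2" "real p ^ 2"] by simp
qed

text \<open>
  Kloosterman's argument: by dilation invariance the value at \<open>(m, n)\<close> is attained by \<open>p - 1\<close>
  different terms of the fourth moment.
\<close>

lemma kloosterman_bound:
  assumes p: "prime p" "\<not> int p dvd u" and mn: "\<not> (int p dvd m \<and> int p dvd n)"
  shows "norm (kloosterman p u m n) ^ 4 <= 3 * real p ^ 3"
proof -
  have p0: "p > 0" "int p > 0" and p1: "p > 1" using prime_gt_0_nat[OF p(1)] prime_gt_1_nat[OF p(1)] by simp_all
  have nd1: "\<not> int p dvd 1" using p1 by simp
  define f where "f = (\<lambda>(t, t'). (nat (t * m mod int p), nat (t' * n mod int p)))"
  have inj: "inj_on f (hyp p 1)"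
  proof (rule inj_onI)
    fix a b assume a: "a \<in> hyp p 1" and b: "b \<in> hyp p 1" and ab: "f a = f b"
    obtain t t' where A: "a = (t, t')" by (cases a)
    obtain s s' where B: "b = (s, s')" by (cases b)
    have "[t * m = s * m] (mod int p)" "[t' * n = s' * n] (mod int p)"
      using ab p0 by (auto simp: f_def A B cong_def eq_nat_nat_iff)
    then have "int p dvd (t - s) * m" "int p dvd (t' - s') * n"
      by (simp_all add: cong_iff_dvd_diff algebra_simps)
    then have "[t = s] (mod int p) \<or> [t' = s'] (mod int p)"
      using mn p by (auto simp: prime_dvd_mult_iff cong_iff_dvd_diff)
    then show "a = b"
    proof
      assume "[t = s] (mod int p)"
      then show ?thesis using hyp_fst_inj[OF p(1) nd1, of t t' s s'] a b by (auto simp: A B)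
    next
      assume e: "[t' = s'] (mod int p)"
      have "(t', t) \<in> hyp p 1" "(s', s) \<in> hyp p 1" using a b by (auto simp: A B hyp_def mult.commute)
      then show ?thesis using hyp_fst_inj[OF p(1) nd1, of t' t s' s] e by (auto simp: A B)
    qed
  qed
  let ?g = "\<lambda>(m', n'). norm (kloosterman p u (int m') (int n')) ^ 4"
  have const: "?g (f a) = norm (kloosterman p u m n) ^ 4" if "a \<in> hyp p 1" for a
  proof -
    obtain t t' where A: "a = (t, t')" by (cases a)
    have "kloosterman p u (int (nat (t * m mod int p))) (int (nat (t' * n mod int p))) = kloosterman p u (t * m) (t' * n)"
      using p0 by (intro kloosterman_cong) (auto simp: cong_def)
    also have "... = kloosterman p u m n"
      using that by (intro kloosterman_dilate[OF p]) (auto simp: A hyp_def)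
    finally show ?thesis by (simp add: f_def A)
  qed
  have "real (p - 1) * norm (kloosterman p u m n) ^ 4 = (\<Sum>a\<in>hyp p 1. ?g (f a))"
    using card_hyp[OF p(1) nd1] const by simp
  also have "... = (\<Sum>b\<in>f ` hyp p 1. ?g b)"
    using inj by (simp add: sum.reindex)
  also have "... <= (\<Sum>b\<in>{..<p} \<times> {..<p}. ?g b)"
    using p0 by (intro sum_mono2) (auto simp: f_def nat_less_iff)
  also have "... = (\<Sum>m<p. \<Sum>n<p. norm (kloosterman p u (int m) (int n)) ^ 4)"
    by (simp add: sum.cartesian_product)
  also have "... <= 3 * real p ^ 2 * real (p - 1) ^ 2" by (rule kloosterman_fourth_moment[OF p])
  finally have "real (p - 1) * norm (kloosterman p u m n) ^ 4 <= real (p - 1) * (3 * real p ^ 2 * real (p - 1))"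
    by (simp add: power2_eq_square mult_ac)
  then have "norm (kloosterman p u m n) ^ 4 <= 3 * real p ^ 2 * real (p - 1)"
    using p1 by (subst (asm) mult_le_cancel_left_pos) auto
  also have "... <= 3 * real p ^ 2 * real p" by (intro mult_left_mono) auto
  finally show ?thesis by (simp add: power2_eq_square power3_eq_cube)
qed

text \<open>
  A geometric sum is at most \<open>p / min m (p - m)\<close>; bounding the maximum of the two quotients by
  their sum makes the bound easy to add up over \<open>m\<close>.
\<close>

lemma norm_sum_ee_interval:
  assumes "p > 0" "0 < m" "m < p"
  shows "norm (\<Sum>x\<in>{x0<..x0 + int n}. ee p (int m * x)) <= real p / real m + real p / real (p - m)"
proof -
  define z where "z = ee p (int m)"
  define q where "q = min m (p - m)"
  have q: "q > 0" "real q / real p <= 1 / 2" using assms by (auto simp: q_def min_def field_simps)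
  have "2 * (real q / real p) <= norm (1 - z)"
  proof -
    have "\<bar>sin (pi * (real q / real p))\<bar> = \<bar>sin (pi * (real m / real p))\<bar>"
    proof (cases "q = m")
      case False
      then have "q = p - m" by (auto simp: q_def min_def)
      then have "pi * (real q / real p) = pi - pi * (real m / real p)"
        using assms by (simp add: field_simps of_nat_diff)
      then show ?thesis by simp
    qed simp
    moreover have "norm (1 - z) = 2 * \<bar>sin (pi * (real m / real p))\<bar>"
      unfolding z_def ee_def norm_one_minus_cis by simp
    ultimately show ?thesis using sin_pi_lower[of "real q / real p"] q by simp
  qed
  moreover have qp: "real q / real p > 0" using q assms by simp
  ultimately have nz: "norm (1 - z) > 0" "2 * (real q / real p) <= norm (1 - z)" by linarith+
  have "(\<Sum>x\<in>{x0<..x0 + int n}. ee p (int m * x)) = (\<Sum>j<n. ee p (int m * (x0 + 1)) * z ^ j)"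
  proof (rule sum.reindex_bij_witness[where i = "\<lambda>j. x0 + 1 + int j" and j = "\<lambda>x. nat (x - x0 - 1)"])
    fix x assume x: "x \<in> {x0<..x0 + int n}"
    have "ee p (int m * (x0 + 1)) * z ^ nat (x - x0 - 1) = ee p (int m * (x0 + 1) + int (nat (x - x0 - 1)) * int m)"
      unfolding z_def ee_add ee_of_nat_mult ..
    also have "int m * (x0 + 1) + int (nat (x - x0 - 1)) * int m = int m * x"
      using x by (simp add: algebra_simps)
    finally show "ee p (int m * (x0 + 1)) * z ^ nat (x - x0 - 1) = ee p (int m * x)" .
  qed auto
  also have "... = ee p (int m * (x0 + 1)) * (\<Sum>j<n. z ^ j)" by (simp add: sum_distrib_left)
  also have "norm ... = norm (\<Sum>j<n. z ^ j)" by (simp add: norm_mult)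
  also have "... = norm (z ^ n - 1) / norm (1 - z)"
    using nz by (subst geometric_sum) (auto simp: norm_divide norm_minus_commute)
  also have "... <= 2 / norm (1 - z)"
  proof (rule divide_right_mono)
    have "norm (z ^ n - 1) <= norm (z ^ n) + norm (1::complex)" by (rule norm_triangle_ineq4)
    also have "... = 2" by (simp add: z_def norm_power)
    finally show "norm (z ^ n - 1) <= 2" .
  qed auto
  also have "... <= 2 / (2 * (real q / real p))"
    using nz qp by (intro divide_left_mono mult_pos_pos) auto
  also have "... = real p / real q" by simp
  also have "... <= real p / real m + real p / real (p - m)"
    using assms by (auto simp: q_def min_def)
  finally show ?thesis .
qed

definition box_log :: "nat => real" where "box_log p = 2 * (1 + ln (real p))"

lemma sum_norm_ee_interval:
  assumes "p >= 2"
  shows "(\<Sum>m\<in>{1..<p}. norm (\<Sum>x\<in>{x0<..x0 + int n}. ee p (int m * x))) <= real p * box_log p"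
proof -
  have "(\<Sum>m\<in>{1..<p}. norm (\<Sum>x\<in>{x0<..x0 + int n}. ee p (int m * x)))
      <= (\<Sum>m\<in>{1..<p}. real p / real m + real p / real (p - m))"
    using assms by (intro sum_mono norm_sum_ee_interval) auto
  also have "... = (\<Sum>m\<in>{1..<p}. real p / real m) + (\<Sum>m\<in>{1..<p}. real p / real (p - m))"
    by (simp add: sum.distrib)
  also have "(\<Sum>m\<in>{1..<p}. real p / real (p - m)) = (\<Sum>m\<in>{1..<p}. real p / real m)"
    by (rule sum.reindex_bij_witness[where i = "\<lambda>m. p - m" and j = "\<lambda>m. p - m"]) auto
  also have "(\<Sum>m\<in>{1..<p}. real p / real m) <= real p * (1 + ln (real p))"
  proof -
    have "(\<Sum>m\<in>{1..<p}. real p / real m) = real p * (\<Sum>m\<in>{1..<p}. 1 / real m)"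
      by (simp add: sum_distrib_left)
    also have "(\<Sum>m\<in>{1..<p}. 1 / real m) <= (\<Sum>m=1..p. 1 / real m)"
      by (intro sum_mono2) auto
    also have "... <= 1 + ln (real p)" using assms by (intro harmonic_le) auto
    finally show ?thesis by (simp add: mult_left_mono)
  qed
  finally show ?thesis by (simp add: box_log_def algebra_simps)
qed

lemma hyp_box_indicator:
  assumes p: "prime p"
  shows "(if [x * y = u] (mod int p) then (real p)\<^sup>2 else 0) =
     Re (\<Sum>(a, b)\<in>hyp p u. (\<Sum>m<p. ee p (int m * (x - a))) * (\<Sum>n<p. ee p (int n * (y - b))))"
proof -
  have p0: "p > 0" "int p > 0" using p by (simp_all add: prime_gt_0_nat)
  have "(\<Sum>(a, b)\<in>hyp p u. (\<Sum>m<p. ee p (int m * (x - a))) * (\<Sum>n<p. ee p (int n * (y - b))))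
     = (\<Sum>(a, b)\<in>hyp p u. if (a, b) = (x mod int p, y mod int p) then (of_nat p)\<^sup>2 else 0)"
  proof (rule sum.cong[OF refl], clarify)
    fix a b assume ab: "(a, b) \<in> hyp p u"
    have "int p dvd x - a \<longleftrightarrow> a = x mod int p" "int p dvd y - b \<longleftrightarrow> b = y mod int p"
      using ab by (auto simp: hyp_def mod_eq_dvd_iff[symmetric])
    then show "(\<Sum>m<p. ee p (int m * (x - a))) * (\<Sum>n<p. ee p (int n * (y - b)))
      = (if (a, b) = (x mod int p, y mod int p) then (of_nat p)\<^sup>2 else 0)"
      using p0 by (simp add: sum_ee power2_eq_square)
  qed
  also have "... = (if (x mod int p, y mod int p) \<in> hyp p u then (of_nat p)\<^sup>2 else 0)"
    unfolding case_prod_beta prod.collapse by (simp add: finite_hyp)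
  also have "(x mod int p, y mod int p) \<in> hyp p u \<longleftrightarrow> [x * y = u] (mod int p)"
    using p0 by (simp add: hyp_def cong_def mod_mult_eq)
  finally show ?thesis by (simp add: power2_eq_square)
qed

text \<open>
  Detect the congruence by characters. The zero frequency gives the main term, and every other one
  contains a nontrivial Kloosterman sum, for which \<open>3\<^bsup>1/4\<^esup>\<close> is rounded up to 2.
\<close>

lemma hyp_box_count:
  fixes x0 y0 u :: int
  assumes p: "prime p" "\<not> int p dvd u"
  shows "real (card {(x, y) \<in> {x0<..x0 + int n1} \<times> {y0<..y0 + int n2}. [x * y = u] (mod int p)})
     >= real n1 * real n2 * real (p - 1) / real p ^ 2
       - 2 * real p powr (3/4) * ((real n1 + real n2) * box_log p / real p + box_log p ^ 2)"
proof -
  define I where "I = {x0<..x0 + int n1}"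
  define J where "J = {y0<..y0 + int n2}"
  define S1 where "S1 m = (\<Sum>x\<in>I. ee p (int m * x))" for m
  define S2 where "S2 m = (\<Sum>x\<in>J. ee p (int m * x))" for m
  define L where "L = box_log p"
  define M where "M = 2 * real p powr (3/4)"
  define K where "K m n = kloosterman p u (- int m) (- int n)" for m n :: nat
  have p0: "p > 0" and p2: "p >= 2" using prime_gt_0_nat[OF p(1)] prime_ge_2_nat[OF p(1)] by simp_all
  have fin: "finite I" "finite J" by (auto simp: I_def J_def)
  define cnt where "cnt = real (card {(x, y) \<in> I \<times> J. [x * y = u] (mod int p)})"
  have "cnt * (real p)\<^sup>2 = (\<Sum>x\<in>I. \<Sum>y\<in>J. if [x * y = u] (mod int p) then (real p)\<^sup>2 else 0)"
  proof -
    have "{(x, y) \<in> I \<times> J. [x * y = u] (mod int p)} = {z \<in> I \<times> J. [fst z * snd z = u] (mod int p)}" by auto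
    then show ?thesis using fin unfolding cnt_def sum.cartesian_product case_prod_beta
      by (simp add: sum.If_cases Int_def)
  qed
  also have "... = Re (\<Sum>x\<in>I. \<Sum>y\<in>J. \<Sum>(a, b)\<in>hyp p u. (\<Sum>m<p. ee p (int m * (x - a))) * (\<Sum>n<p. ee p (int n * (y - b))))"
    unfolding Re_sum by (intro sum.cong refl) (simp only: hyp_box_indicator[OF p(1)] Re_sum)
  also have "(\<Sum>x\<in>I. \<Sum>y\<in>J. \<Sum>(a, b)\<in>hyp p u. (\<Sum>m<p. ee p (int m * (x - a))) * (\<Sum>n<p. ee p (int n * (y - b))))
     = (\<Sum>m<p. \<Sum>n<p. S1 m * S2 n * K m n)"
  proof -
    have "(\<Sum>x\<in>I. \<Sum>y\<in>J. \<Sum>(a, b)\<in>hyp p u. (\<Sum>m<p. ee p (int m * (x - a))) * (\<Sum>n<p. ee p (int n * (y - b))))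
      = (\<Sum>x\<in>I. \<Sum>y\<in>J. \<Sum>m<p. \<Sum>n<p. \<Sum>(a, b)\<in>hyp p u. ee p (int m * (x - a)) * ee p (int n * (y - b)))"
    proof (intro sum.cong refl)
      fix x y
      have "(\<Sum>(a, b)\<in>hyp p u. (\<Sum>m<p. ee p (int m * (x - a))) * (\<Sum>n<p. ee p (int n * (y - b))))
        = (\<Sum>c\<in>hyp p u. \<Sum>m<p. \<Sum>n<p. ee p (int m * (x - fst c)) * ee p (int n * (y - snd c)))"
        by (simp add: sum_product case_prod_beta)
      also have "... = (\<Sum>m<p. \<Sum>c\<in>hyp p u. \<Sum>n<p. ee p (int m * (x - fst c)) * ee p (int n * (y - snd c)))"
        by (rule sum.swap)
      also have "... = (\<Sum>m<p. \<Sum>n<p. \<Sum>c\<in>hyp p u. ee p (int m * (x - fst c)) * ee p (int n * (y - snd c)))"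
        by (rule sum.cong[OF refl], rule sum.swap)
      finally show "(\<Sum>(a, b)\<in>hyp p u. (\<Sum>m<p. ee p (int m * (x - a))) * (\<Sum>n<p. ee p (int n * (y - b))))
        = (\<Sum>m<p. \<Sum>n<p. \<Sum>(a, b)\<in>hyp p u. ee p (int m * (x - a)) * ee p (int n * (y - b)))"
        by (simp add: case_prod_beta)
    qed
    also have "... = (\<Sum>x\<in>I. \<Sum>y\<in>J. \<Sum>m<p. \<Sum>n<p. ee p (int m * x) * ee p (int n * y) * K m n)"
    proof (intro sum.cong refl)
      fix x y m n
      have "ee p (int m * (x - a)) * ee p (int n * (y - b)) = ee p (int m * x) * ee p (int n * y) * ee p (- int m * a + - int n * b)" for a b
        by (simp add: ee_add[symmetric] algebra_simps)
      then show "(\<Sum>(a, b)\<in>hyp p u. ee p (int m * (x - a)) * ee p (int n * (y - b))) = ee p (int m * x) * ee p (int n * y) * K m n"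
        unfolding K_def kloosterman_def sum_distrib_left case_prod_beta by (simp only:)
    qed
    also have "... = (\<Sum>m<p. \<Sum>n<p. \<Sum>x\<in>I. \<Sum>y\<in>J. ee p (int m * x) * ee p (int n * y) * K m n)"
      by (rule sum_swap4)
    also have "... = (\<Sum>m<p. \<Sum>n<p. S1 m * S2 n * K m n)"
      unfolding S1_def S2_def sum_product unfolding sum_distrib_right ..
    finally show ?thesis .
  qed
  also have "(\<Sum>m<p. \<Sum>n<p. S1 m * S2 n * K m n)
      = S1 0 * S2 0 * K 0 0 + (\<Sum>(m, n)\<in>{..<p} \<times> {..<p} - {(0, 0)}. S1 m * S2 n * K m n)"
    using p0 by (simp add: sum.cartesian_product sum.remove[of _ "(0, 0)"])
  also have "S1 0 * S2 0 * K 0 0 = of_nat (n1 * n2 * (p - 1))"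
    using card_hyp[OF p] by (simp add: S1_def S2_def K_def kloosterman_def I_def J_def case_prod_beta)
  finally have main: "cnt * (real p)\<^sup>2 = real (n1 * n2 * (p - 1)) + Re (\<Sum>(m, n)\<in>{..<p} \<times> {..<p} - {(0, 0)}. S1 m * S2 n * K m n)"
    by (simp only: plus_complex.sel complex_Re_of_nat)
  have Kb: "norm (K m n) <= M" if "(m, n) \<in> {..<p} \<times> {..<p} - {(0, 0)}" for m n
  proof -
    have "\<not> (int p dvd - int m \<and> int p dvd - int n)"
      using that by (auto dest!: nat_dvd_not_less[rotated])
    then have "norm (K m n) ^ 4 <= 3 * real p ^ 3"
      unfolding K_def by (rule kloosterman_bound[OF p])
    also have "... <= M ^ 4"
    proof -
      have "(real p powr (3/4)) ^ 4 = real p powr 3" using p0 by (subst powr_power) auto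
      also have "... = real p ^ 3" using p0 by (simp add: powr_numeral)
      finally show ?thesis by (simp add: M_def power_mult_distrib)
    qed
    finally show ?thesis by (subst (asm) power_mono_iff) (auto simp: M_def)
  qed
  have s1: "(\<Sum>m<p. norm (S1 m)) <= real n1 + real p * L"
  proof -
    have "{..<p} = insert 0 {1..<p}" using p0 by auto
    then have "(\<Sum>m<p. norm (S1 m)) = norm (S1 0) + (\<Sum>m\<in>{1..<p}. norm (S1 m))" by simp
    also have "norm (S1 0) = real n1" by (simp add: S1_def I_def)
    also have "(\<Sum>m\<in>{1..<p}. norm (S1 m)) <= real p * L"
      unfolding S1_def I_def L_def by (rule sum_norm_ee_interval[OF p2])
    finally show ?thesis by simp
  qed
  have s2: "(\<Sum>m<p. norm (S2 m)) <= real n2 + real p * L"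
  proof -
    have "{..<p} = insert 0 {1..<p}" using p0 by auto
    then have "(\<Sum>m<p. norm (S2 m)) = norm (S2 0) + (\<Sum>m\<in>{1..<p}. norm (S2 m))" by simp
    also have "norm (S2 0) = real n2" by (simp add: S2_def J_def)
    also have "(\<Sum>m\<in>{1..<p}. norm (S2 m)) <= real p * L"
      unfolding S2_def J_def L_def by (rule sum_norm_ee_interval[OF p2])
    finally show ?thesis by simp
  qed
  have "norm (\<Sum>(m, n)\<in>{..<p} \<times> {..<p} - {(0, 0)}. S1 m * S2 n * K m n)
      <= (\<Sum>(m, n)\<in>{..<p} \<times> {..<p} - {(0, 0)}. norm (S1 m) * norm (S2 n) * M)"
    using Kb by (intro sum_norm_le) (auto simp: norm_mult intro!: mult_left_mono)
  also have "... = (\<Sum>(m, n)\<in>{..<p} \<times> {..<p}. norm (S1 m) * norm (S2 n) * M) - norm (S1 0) * norm (S2 0) * M"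
    using p0 by (simp add: sum.remove[of "{..<p} \<times> {..<p}" "(0, 0)"])
  also have "... = ((\<Sum>m<p. norm (S1 m)) * (\<Sum>m<p. norm (S2 m)) - real n1 * real n2) * M"
  proof -
    have "(\<Sum>(m, n)\<in>{..<p} \<times> {..<p}. norm (S1 m) * norm (S2 n) * M) = (\<Sum>m<p. norm (S1 m)) * (\<Sum>m<p. norm (S2 m)) * M"
      unfolding sum_product unfolding sum_distrib_right sum.cartesian_product case_prod_beta ..
    moreover have "norm (S1 0) = real n1" "norm (S2 0) = real n2" by (simp_all add: S1_def S2_def I_def J_def)
    ultimately show ?thesis by (simp only: left_diff_distrib)
  qed
  also have "... <= ((real n1 + real p * L) * (real n2 + real p * L) - real n1 * real n2) * M"
    using s1 s2 by (intro mult_right_mono diff_right_mono mult_mono) (auto simp: M_def intro!: sum_nonneg order_trans[OF _ s1])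
  also have "... = M * ((real n1 + real n2) * L / real p + L ^ 2) * (real p)\<^sup>2"
    using p0 by (simp add: field_simps power2_eq_square)
  finally have "Re (\<Sum>(m, n)\<in>{..<p} \<times> {..<p} - {(0, 0)}. S1 m * S2 n * K m n) >= - (M * ((real n1 + real n2) * L / real p + L ^ 2) * (real p)\<^sup>2)"
    using abs_Re_le_cmod[of "\<Sum>(m, n)\<in>{..<p} \<times> {..<p} - {(0, 0)}. S1 m * S2 n * K m n"] by linarith
  then have "cnt * (real p)\<^sup>2 >= (real n1 * real n2 * real (p - 1) / real p ^ 2 - M * ((real n1 + real n2) * L / real p + L ^ 2)) * (real p)\<^sup>2"
    using main p0 by (simp add: left_diff_distrib)
  then have "cnt >= real n1 * real n2 * real (p - 1) / real p ^ 2 - M * ((real n1 + real n2) * L / real p + L ^ 2)"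
    using p0 by (subst (asm) mult_le_cancel_right_pos) auto
  then show ?thesis by (simp only: cnt_def I_def J_def M_def L_def)
qed

section \<open>Summation by parts and counting coprime integers\<close>

text \<open>For nonincreasing weights, an error \<open>E\<close> in the partial sums costs only \<open>E\<close> times the first
  weight.\<close>

lemma abel_lower:
  fixes g w :: "nat => real"
  assumes G: "\<And>s. s <= n ==> (\<Sum>k=1..s. g k) >= \<rho> * real s - E"
    and w0: "\<And>k. 1 <= k ==> k <= n ==> 0 <= w k"
    and wd: "\<And>k. 1 <= k ==> k < n ==> w (Suc k) <= w k"
    and n: "n >= 1"
  shows "(\<Sum>k=1..n. g k * w k) >= \<rho> * (\<Sum>k=1..n. w k) - E * w 1"
proof -
  define D where "D s = (\<Sum>k=1..s. g k - \<rho>)" for s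
  have D: "D s >= - E" if "s <= n" for s
    using G[OF that] by (simp add: D_def sum_subtractf mult.commute)
  have parts: "(\<Sum>k=1..m. (g k - \<rho>) * w k) = D m * w m + (\<Sum>k=1..<m. D k * (w k - w (Suc k)))" if "m >= 1" for m
    using that
  proof (induction m rule: nat_induct_at_least)
    case base then show ?case by (simp add: D_def)
  next
    case (Suc m)
    have "{1..<Suc m} = insert m {1..<m}" using Suc by auto
    then have S: "(\<Sum>k=1..<Suc m. D k * (w k - w (Suc k))) = D m * (w m - w (Suc m)) + (\<Sum>k=1..<m. D k * (w k - w (Suc k)))"
      by simp
    have g: "g (Suc m) - \<rho> = D (Suc m) - D m" by (simp add: D_def)
    have "(\<Sum>k=1..Suc m. (g k - \<rho>) * w k) = (\<Sum>k=1..m. (g k - \<rho>) * w k) + (D (Suc m) - D m) * w (Suc m)"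
      unfolding g[symmetric] by simp
    then show ?case unfolding S Suc.IH by (simp add: algebra_simps)
  qed
  have tel: "(\<Sum>k=1..<m. w k - w (Suc k)) = w 1 - w m" if "m >= 1" for m
    using that by (induction m rule: nat_induct_at_least) auto
  have "(\<Sum>k=1..n. (g k - \<rho>) * w k) >= (- E) * w n + (\<Sum>k=1..<n. (- E) * (w k - w (Suc k)))"
    unfolding parts[OF n] using w0 wd D n by (intro add_mono sum_mono mult_right_mono) auto
  also have "(- E) * w n + (\<Sum>k=1..<n. (- E) * (w k - w (Suc k))) = - E * w 1"
    unfolding sum_distrib_left[symmetric] tel[OF n] by (simp add: algebra_simps)
  finally show ?thesis by (simp add: left_diff_distrib sum_subtractf sum_distrib_left)
qed

lemma abel_upper:
  fixes g w :: "nat => real"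
  assumes G: "\<And>s. s <= n ==> (\<Sum>k=1..s. g k) <= \<rho> * real s + E"
    and w0: "\<And>k. 1 <= k ==> k <= n ==> 0 <= w k"
    and wd: "\<And>k. 1 <= k ==> k < n ==> w (Suc k) <= w k"
    and n: "n >= 1"
  shows "(\<Sum>k=1..n. g k * w k) <= \<rho> * (\<Sum>k=1..n. w k) + E * w 1"
proof -
  have "(\<Sum>k=1..n. (- g k) * w k) >= (- \<rho>) * (\<Sum>k=1..n. w k) - E * w 1"
    by (rule abel_lower[where w = w and n = n]) (use G w0 wd n in \<open>force simp: sum_negf\<close>)+
  then show ?thesis by (simp add: sum_negf)
qed

lemma card_int_interval:
  fixes x y :: real assumes "x <= y"
  shows "\<bar>real (card {c::int. x < of_int c \<and> of_int c <= y}) - (y - x)\<bar> <= 1"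
proof -
  have "{c::int. x < of_int c \<and> of_int c <= y} = {\<lfloor>x\<rfloor><..\<lfloor>y\<rfloor>}"
    by (auto simp: floor_less_iff le_floor_iff)
  moreover have "\<lfloor>x\<rfloor> <= \<lfloor>y\<rfloor>" using assms by (rule floor_mono)
  ultimately show ?thesis by simp linarith
qed

text \<open>
  The Legendre sieve: among the integers left by the other primes, the multiples of \<open>p\<close> are \<open>p\<close>
  times the sifted integers of an interval shortened by the factor \<open>p\<close>. Each prime doubles the
  error.
\<close>

lemma sieve_primes:
  fixes x y :: real
  assumes "finite Ps" "\<And>p. p \<in> Ps ==> prime (p::nat)" "x <= y"
  shows "\<bar>real (card {c::int. x < of_int c \<and> of_int c <= y \<and> (\<forall>p\<in>Ps. \<not> int p dvd c)})
           - (\<Prod>p\<in>Ps. 1 - 1 / real p) * (y - x)\<bar> <= 2 ^ card Ps"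
  using assms
proof (induction Ps arbitrary: x y rule: finite_induct)
  case empty
  then show ?case using card_int_interval[of x y] by simp
next
  case (insert p Ps)
  have p: "prime p" "p > 0" using insert.prems prime_gt_0_nat by auto
  define N where "N x y = {c::int. x < of_int c \<and> of_int c <= y \<and> (\<forall>p\<in>Ps. \<not> int p dvd c)}" for x y :: real
  have finN: "finite (N x y)" for x y :: real
    by (rule finite_subset[of _ "{\<lfloor>x\<rfloor>..\<lfloor>y\<rfloor>}"]) (auto simp: N_def floor_le_iff le_floor_iff)
  have nd: "\<not> int q dvd int p" if "q \<in> Ps" for q
    using that insert.hyps insert.prems(1)[of q] p primes_dvd_imp_eq[of q p] by (metis insertI2 of_nat_dvd_iff)
  have dv: "int q dvd int p * c \<longleftrightarrow> int q dvd c" if "q \<in> Ps" for q c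
    using that nd insert.prems(1)[of q] prime_dvd_mult_iff[of "int q" "int p" c] by auto
  have eq: "{c::int. x < of_int c \<and> of_int c <= y \<and> (\<forall>q\<in>insert p Ps. \<not> int q dvd c)}
     = N x y - (\<lambda>c. int p * c) ` N (x / p) (y / p)"
  proof (rule Set.set_eqI, rule iffI)
    fix c :: int
    assume "c \<in> {c::int. x < of_int c \<and> of_int c <= y \<and> (\<forall>q\<in>insert p Ps. \<not> int q dvd c)}"
    then show "c \<in> N x y - (\<lambda>c. int p * c) ` N (x / p) (y / p)" by (auto simp: N_def)
  next
    fix c :: int
    assume c: "c \<in> N x y - (\<lambda>c. int p * c) ` N (x / p) (y / p)"
    have "\<not> int p dvd c"
    proof
      assume "int p dvd c"
      then obtain d where d: "c = int p * d" by blast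
      then have "d \<in> N (x / p) (y / p)" using c p dv by (auto simp: N_def field_simps)
      then show False using c d by blast
    qed
    then show "c \<in> {c::int. x < of_int c \<and> of_int c <= y \<and> (\<forall>q\<in>insert p Ps. \<not> int q dvd c)}"
      using c by (auto simp: N_def)
  qed
  have sub: "(\<lambda>c. int p * c) ` N (x / p) (y / p) \<subseteq> N x y"
    using p dv by (auto simp: N_def field_simps)
  have "card (N x y - (\<lambda>c. int p * c) ` N (x / p) (y / p)) = card (N x y) - card (N (x / p) (y / p))"
    using p sub finN by (subst card_Diff_subset) (auto simp: card_image inj_on_def)
  moreover have "card (N (x / p) (y / p)) <= card (N x y)"
    using card_mono[OF finN sub] p by (simp add: card_image inj_on_def)
  ultimately have "real (card (N x y - (\<lambda>c. int p * c) ` N (x / p) (y / p))) = real (card (N x y)) - real (card (N (x / p) (y / p)))"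
    by simp
  moreover have "\<bar>real (card (N x y)) - (\<Prod>p\<in>Ps. 1 - 1 / real p) * (y - x)\<bar> <= 2 ^ card Ps"
    unfolding N_def using insert by auto
  moreover have "\<bar>real (card (N (x / p) (y / p))) - (\<Prod>p\<in>Ps. 1 - 1 / real p) * (y / p - x / p)\<bar> <= 2 ^ card Ps"
    unfolding N_def using insert p by (intro insert.IH) (auto simp: divide_right_mono)
  moreover have "(\<Prod>p\<in>insert p Ps. 1 - 1 / real p) * (y - x)
      = (\<Prod>p\<in>Ps. 1 - 1 / real p) * (y - x) - (\<Prod>p\<in>Ps. 1 - 1 / real p) * (y / p - x / p)"
    using insert p by (simp add: field_simps)
  moreover have "(2::real) ^ card (insert p Ps) = 2 ^ card Ps + 2 ^ card Ps" using insert by simp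
  ultimately show ?case unfolding eq by linarith
qed

lemma two_power_prime_factors_le:
  assumes "n > 0" shows "(2::real) ^ card (prime_factors n) <= 2 * sqrt (real n)"
proof -
  define h :: "nat => real" where "h p = (if p = 2 then 2 else if p = 3 then 4 / 3 else 1)" for p
  let ?S = "prime_factors n"
  have "(4::real) ^ card ?S = (\<Prod>p\<in>?S. 4)" by simp
  also have "... <= (\<Prod>p\<in>?S. real p * h p)"
  proof (rule prod_mono, safe)
    fix p assume "p \<in> ?S"
    then have "p >= 2" by (simp add: prime_ge_2_nat in_prime_factors_iff)
    then show "4 <= real p * h p" by (auto simp: h_def)
  qed auto
  also have "... = real (\<Prod>p\<in>?S. p) * (\<Prod>p\<in>?S. h p)" by (simp add: prod.distrib)
  also have "... <= real n * (8 / 3)"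
  proof (rule mult_mono)
    have "(\<Prod>p\<in>?S. p) dvd (\<Prod>p\<in>?S. p ^ multiplicity p n)"
      by (rule prod_dvd_prod) (auto intro!: dvd_power simp: prime_factors_multiplicity)
    also have "... = n" using assms by (simp add: prime_factorization_nat[symmetric])
    finally show "real (\<Prod>p\<in>?S. p) <= real n" using assms by (simp add: dvd_imp_le del: of_nat_prod)
    have "(\<Prod>p\<in>?S. h p) <= (\<Prod>p\<in>?S \<union> {2, 3}. h p)"
      by (rule prod_mono2) (auto simp: h_def)
    also have "... = (\<Prod>p\<in>{2, 3}. h p)"
      by (rule prod.mono_neutral_right) (auto simp: h_def)
    also have "... = 8 / 3" by (simp add: h_def)
    finally show "(\<Prod>p\<in>?S. h p) <= 8 / 3" .
  qed (auto intro!: prod_nonneg simp: h_def)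
  finally have "(2 ^ card ?S)\<^sup>2 <= 4 * real n"
    by (simp add: power_mult[symmetric] mult.commute[of _ 2] power_mult)
  then have "2 ^ card ?S <= sqrt (4 * real n)" by (intro real_le_rsqrt) auto
  then show ?thesis by (simp add: real_sqrt_mult)
qed

text \<open>The error \<open>2 ^ \<omega>(n)\<close> of the sieve is relaxed to \<open>2 sqrt n\<close>, which is easy to sum.\<close>

lemma coprime_count:
  fixes x y :: real
  assumes "n > 0" "x <= y"
  shows "\<bar>real (card {c::int. x < of_int c \<and> of_int c <= y \<and> coprime c (int n)}) - totient_ratio n * (y - x)\<bar> <= 2 * sqrt (real n)"
proof -
  have "coprime c (int n) \<longleftrightarrow> (\<forall>p\<in>prime_factors n. \<not> int p dvd c)" for c
  proof
    assume c: "coprime c (int n)"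
    show "\<forall>p\<in>prime_factors n. \<not> int p dvd c"
    proof (intro ballI notI)
      fix p assume p: "p \<in> prime_factors n" "int p dvd c"
      then have "int p dvd int n" "prime p" by auto
      then show False using p c by (metis coprime_common_divisor not_prime_unit prime_nat_int_transfer)
    qed
  next
    assume c: "\<forall>p\<in>prime_factors n. \<not> int p dvd c"
    show "coprime c (int n)"
    proof (rule ccontr)
      assume "\<not> coprime c (int n)"
      then have "\<not> coprime (nat \<bar>c\<bar>) n" by (simp add: coprime_nat_abs_left_iff)
      then have "gcd (nat \<bar>c\<bar>) n ~= 1" unfolding coprime_iff_gcd_eq_1 .
      then obtain p where p: "prime p" "p dvd gcd (nat \<bar>c\<bar>) n" using prime_factor_nat by blast
      have "p dvd n" "p dvd nat \<bar>c\<bar>" by (rule dvd_trans[OF p(2) gcd_dvd2], rule dvd_trans[OF p(2) gcd_dvd1])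
      then have "p \<in> prime_factors n" "p dvd nat \<bar>c\<bar>" using p assms by (simp_all add: prime_factors_dvd)
      moreover from this have "int p dvd c" by simp
      ultimately show False using c by blast
    qed
  qed
  moreover have "totient_ratio n = (\<Prod>p\<in>prime_factors n. 1 - 1 / real p)"
    using assms totient_formula2[of n] by (simp add: totient_ratio_def)
  moreover have "\<bar>real (card {c::int. x < of_int c \<and> of_int c <= y \<and> (\<forall>p\<in>prime_factors n. \<not> int p dvd c)})
           - (\<Prod>p\<in>prime_factors n. 1 - 1 / real p) * (y - x)\<bar> <= 2 * sqrt (real n)"
    by (rule order_trans[OF sieve_primes two_power_prime_factors_le]) (use assms in auto)
  ultimately show ?thesis by (simp only:)
qed

section \<open>Moduli with a large simple prime factor\<close>

lemma log_prime_eq_card: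
  assumes "prime p" "1 <= B" "B <= M"
  shows "multiplicity p B = card {k\<in>{1..M}. p ^ k dvd B}"
proof -
  have "{k\<in>{1..M}. p ^ k dvd B} = {1..multiplicity p B}"
  proof -
    have iff: "p ^ k dvd B \<longleftrightarrow> k <= multiplicity p B" for k
      using assms by (intro power_dvd_iff_le_multiplicity) (auto simp: not_prime_unit)
    have "multiplicity p B <= M"
    proof -
      have "multiplicity p B < p ^ multiplicity p B"
        using prime_ge_2_nat[OF assms(1)] less_exp[of "multiplicity p B"] power_mono[of 2 p "multiplicity p B"] by linarith
      also have "... <= B" using assms multiplicity_dvd by (intro dvd_imp_le) auto
      finally show ?thesis using assms by simp
    qed
    then show ?thesis unfolding iff by auto
  qed
  then show ?thesis by (simp only: card_atLeastAtMost diff_Suc_1 One_nat_def diff_Suc_Suc)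
qed

lemma card_multiples_le:
  assumes "d > 0" shows "real (card {B\<in>{1..M}. d dvd B}) <= real M / real d"
proof -
  have "{B\<in>{1..M}. d dvd B} \<subseteq> (\<lambda>k. d * k) ` {1..M div d}"
    using assms by (auto simp: less_eq_div_iff_mult_less_eq mult.commute Suc_le_eq elim!: dvdE)
  then have "card {B\<in>{1..M}. d dvd B} <= card ((\<lambda>k. d * k) ` {1..M div d})"
    by (rule card_mono[rotated]) auto
  also have "... <= card {1..M div d}" by (rule card_image_le) auto
  finally have "card {B\<in>{1..M}. d dvd B} <= M div d" by simp
  then have "real (card {B\<in>{1..M}. d dvd B}) <= real (M div d)" by simp
  also have "... <= real M / real d" by (rule of_nat_div_le_of_nat)
  finally show ?thesis .
qed

lemma card_multiples_ge:
  assumes "d > 0" "d <= M" shows "real (card {B\<in>{1..M}. d dvd B}) >= real M / (2 * real d)"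
proof -
  have "(\<lambda>k. d * k) ` {1..M div d} \<subseteq> {B\<in>{1..M}. d dvd B}"
    using assms by (auto simp: less_eq_div_iff_mult_less_eq mult.commute Suc_le_eq)
  then have "card ((\<lambda>k. d * k) ` {1..M div d}) <= card {B\<in>{1..M}. d dvd B}"
    by (rule card_mono[rotated]) auto
  then have "M div d <= card {B\<in>{1..M}. d dvd B}"
    using assms by (simp add: card_image inj_on_def)
  moreover have "real M / (2 * real d) <= real (M div d)"
  proof -
    have "M div d >= 1" using assms by (simp add: Suc_le_eq div_greater_zero_iff)
    then have "1 <= real (M div d)" by linarith
    moreover have "real M / real d - 1 <= real (M div d)" by (rule nat_div_lower)
    moreover have "real M / (2 * real d) = (real M / real d) / 2" by simp
    ultimately show ?thesis by linarith
  qed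
  ultimately show ?thesis by linarith
qed

lemma ln_eq_sum_primes:
  assumes "B >= 1"
  shows "ln (real B) = (\<Sum>p\<in>prime_factors B. real (multiplicity p B) * ln (real p))"
proof -
  have "real B = (\<Prod>p\<in>prime_factors B. real p ^ multiplicity p B)"
  proof -
    have "B = (\<Prod>p\<in>prime_factors B. p ^ multiplicity p B)" using assms by (intro prime_factorization_nat) auto
    then have "real B = real (\<Prod>p\<in>prime_factors B. p ^ multiplicity p B)" by (rule arg_cong)
    then show ?thesis unfolding of_nat_prod of_nat_power .
  qed
  then have "ln (real B) = ln (\<Prod>p\<in>prime_factors B. real p ^ multiplicity p B)" by (rule arg_cong)
  also have "... = (\<Sum>p\<in>prime_factors B. ln (real p ^ multiplicity p B))"
    by (rule ln_prod) (auto simp: prime_gt_0_nat in_prime_factors_iff)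
  also have "... = (\<Sum>p\<in>prime_factors B. real (multiplicity p B) * ln (real p))"
    by (intro sum.cong refl) (auto simp: ln_realpow prime_gt_0_nat in_prime_factors_iff)
  finally show ?thesis .
qed

text \<open>
  An upper bound in Mertens' theorem, with a constant that is not sharp: at least \<open>P / (2 p)\<close> of
  the integers up to \<open>P\<close> are divisible by \<open>p\<close>, and the prime divisors of \<open>B\<close> contribute at most
  \<open>ln B\<close>.
\<close>

lemma mertens_upper:
  assumes "P >= 1"
  shows "(\<Sum>p | prime p \<and> p <= P. ln (real p) / real p) <= 2 * ln (real P)"
proof -
  let ?Pr = "{p. prime p \<and> p <= P}"
  have fin: "finite ?Pr" by (rule finite_subset[of _ "{..P}"]) auto
  have "(\<Sum>p\<in>?Pr. ln (real p) * (real P / (2 * real p))) <= (\<Sum>p\<in>?Pr. ln (real p) * real (card {B\<in>{1..P}. p dvd B}))"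
    using prime_gt_0_nat by (intro sum_mono mult_left_mono card_multiples_ge) (auto simp: Suc_le_eq)
  also have "... = (\<Sum>p\<in>?Pr. \<Sum>B=1..P. if p dvd B then ln (real p) else 0)"
    by (intro sum.cong refl) (simp add: sum.If_cases Int_def mult.commute)
  also have "... = (\<Sum>B=1..P. \<Sum>p\<in>?Pr. if p dvd B then ln (real p) else 0)"
    by (rule sum.swap)
  also have "... <= (\<Sum>B=1..P. ln (real P))"
  proof (rule sum_mono)
    fix B assume B: "B \<in> {1..P}"
    have "(\<Sum>p\<in>?Pr. if p dvd B then ln (real p) else 0) = (\<Sum>p\<in>prime_factors B. ln (real p))"
    proof -
      have "prime_factors B = {p \<in> ?Pr. p dvd B}"
        using B by (auto simp: prime_factors_dvd dest: dvd_imp_le)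
      then show ?thesis using fin by (simp add: sum.If_cases Int_def)
    qed
    also have "... <= (\<Sum>p\<in>prime_factors B. real (multiplicity p B) * ln (real p))"
    proof (rule sum_mono)
      fix p assume p: "p \<in> prime_factors B"
      then have "1 <= real (multiplicity p B)" by (simp add: prime_factors_multiplicity)
      moreover have "0 <= ln (real p)" using p prime_gt_0_nat by (auto simp: in_prime_factors_iff Suc_le_eq)
      ultimately show "ln (real p) <= real (multiplicity p B) * ln (real p)"
        using mult_right_mono[of 1 "real (multiplicity p B)" "ln (real p)"] by simp
    qed
    also have "... = ln (real B)" using B ln_eq_sum_primes[of B] by simp
    also have "... <= ln (real P)" using B by simp
    finally show "(\<Sum>p\<in>?Pr. if p dvd B then ln (real p) else 0) <= ln (real P)" .
  qed
  also have "... = real P * ln (real P)" by simp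
  also have "(\<Sum>p\<in>?Pr. ln (real p) * (real P / (2 * real p))) = real P * ((\<Sum>p\<in>?Pr. ln (real p) / real p) / 2)"
    by (simp add: sum_distrib_left sum_divide_distrib mult_ac)
  finally show ?thesis using assms by simp
qed

text \<open>
  The prime has to divide \<open>B\<close> exactly once, so that it is coprime to its cofactor and a congruence
  modulo \<open>B\<close> splits.
\<close>

definition has_large_prime :: "nat => nat => bool" where
  "has_large_prime P B \<longleftrightarrow> (\<exists>p. prime p \<and> P <= p \<and> p dvd B \<and> \<not> p ^ 2 dvd B)"

text \<open>
  Primes up to \<open>P\<close> contribute to \<open>ln (fact M)\<close> only \<open>O(M ln P)\<close>, by Mertens; for \<open>P\<close>-smooth
  integers these are all contributions.
\<close>

lemma smooth_log_sum:
  fixes P M :: nat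
  assumes "P >= 1"
  defines "S \<equiv> {B\<in>{1..M}. \<forall>p. prime p --> p dvd B --> p <= P}"
  shows "(\<Sum>B\<in>S. ln (real B)) <= 4 * real M * ln (real P)"
proof -
  let ?Pr = "{p. prime p \<and> p <= P}"
  have fin: "finite ?Pr" by (rule finite_subset[of _ "{..P}"]) auto
  have finS: "finite S" by (simp add: S_def)
  have lnn: "0 <= ln (real p)" if "p \<in> ?Pr" for p using that prime_gt_0_nat by (auto simp: Suc_le_eq)
  have "(\<Sum>B\<in>S. ln (real B)) <= (\<Sum>B\<in>S. \<Sum>p\<in>?Pr. real (multiplicity p B) * ln (real p))"
  proof (rule sum_mono)
    fix B assume B: "B \<in> S"
    then have "ln (real B) = (\<Sum>p\<in>prime_factors B. real (multiplicity p B) * ln (real p))"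
      by (intro ln_eq_sum_primes) (auto simp: S_def)
    also have "... <= (\<Sum>p\<in>?Pr. real (multiplicity p B) * ln (real p))"
      using B fin lnn by (intro sum_mono2) (auto simp: S_def prime_factors_dvd)
    finally show "ln (real B) <= (\<Sum>p\<in>?Pr. real (multiplicity p B) * ln (real p))" .
  qed
  also have "... <= (\<Sum>B=1..M. \<Sum>p\<in>?Pr. real (multiplicity p B) * ln (real p))"
    using lnn by (intro sum_mono2) (auto simp: S_def intro!: sum_nonneg)
  also have "... = (\<Sum>p\<in>?Pr. ln (real p) * (\<Sum>B=1..M. real (multiplicity p B)))"
    by (subst sum.swap) (simp add: sum_distrib_left mult.commute)
  also have "... <= (\<Sum>p\<in>?Pr. ln (real p) * (2 * real M / real p))"
  proof (intro sum_mono mult_left_mono lnn)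
    fix p assume p: "p \<in> ?Pr"
    then have p2: "p >= 2" using prime_ge_2_nat by simp
    have "(\<Sum>B=1..M. real (multiplicity p B)) = (\<Sum>B=1..M. \<Sum>k=1..M. if p ^ k dvd B then 1 else 0)"
      using p by (intro sum.cong refl) (simp add: log_prime_eq_card[of p _ M] sum.If_cases Int_def)
    also have "... = (\<Sum>k=1..M. \<Sum>B=1..M. if p ^ k dvd B then 1 else 0)"
      by (rule sum.swap)
    also have "... = (\<Sum>k=1..M. real (card {B\<in>{1..M}. p ^ k dvd B}))"
      by (intro sum.cong refl) (simp add: sum.If_cases Int_def)
    also have "... <= (\<Sum>k=1..M. real M / real (p ^ k))"
      using p2 by (intro sum_mono card_multiples_le) auto
    also have "... = real M * (\<Sum>k=1..M. (1 / real p) ^ k)"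
      by (simp add: sum_distrib_left power_divide)
    also have "(\<Sum>k=1..M. (1 / real p) ^ k) <= 2 / real p"
    proof -
      have key: "(\<Sum>k=1..M. (1 / real p) ^ k) + (1 / real p) ^ M <= 2 / real p" if "M >= 1"
        using that
      proof (induction M rule: nat_induct_at_least)
        case (Suc m)
        have "2 * (1 / real p) ^ Suc m <= (1 / real p) ^ m"
          using p2 by (simp add: field_simps)
        then show ?case using Suc by simp
      qed simp
      have nn: "(1 / real p) ^ M >= 0" by simp
      show ?thesis
      proof (cases "M >= 1")
        case True
        show ?thesis using key[OF True] nn by linarith
      qed auto
    qed
    finally show "(\<Sum>B=1..M. real (multiplicity p B)) <= 2 * real M / real p"
      by (simp add: mult_left_mono mult.commute[of 2])
  qed
  also have "... = 2 * real M * (\<Sum>p\<in>?Pr. ln (real p) / real p)"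
    by (simp add: sum_distrib_left mult_ac)
  also have "... <= 2 * real M * (2 * ln (real P))"
    using mertens_upper[OF assms(1)] by (intro mult_left_mono) auto
  finally show ?thesis by simp
qed

text \<open>
  An exception is at most \<open>sqrt M\<close>, or is divisible by the square of an integer \<open>k >= P\<close>, or is
  \<open>P\<close>-smooth with \<open>ln B >= ln M / 2\<close>.
\<close>

lemma card_no_large_prime:
  assumes P: "P >= 2" and M: "M >= 2"
  shows "real (card {B\<in>{1..M}. \<not> has_large_prime P B}) <= sqrt (real M) + real M * (2 / real P + 8 * ln (real P) / ln (real M))"
proof -
  define S where "S = {B\<in>{1..M}. \<forall>p. prime p --> p dvd B --> p <= P}"
  define S' where "S' = {B\<in>S. sqrt (real M) < real B}"
  define Q where "Q = {B\<in>{1..M}. \<exists>k\<in>{P - 1<..M}. k ^ 2 dvd B}"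
  define R where "R = {B\<in>{1..M}. real B <= sqrt (real M)}"
  have sub: "{B\<in>{1..M}. \<not> has_large_prime P B} \<subseteq> R \<union> Q \<union> S'"
  proof
    fix B assume B: "B \<in> {B\<in>{1..M}. \<not> has_large_prime P B}"
    show "B \<in> R \<union> Q \<union> S'"
    proof (cases "real B <= sqrt (real M) \<or> B \<in> Q")
      case True then show ?thesis using B by (auto simp: R_def)
    next
      case False
      have "p <= P" if p: "prime p" "p dvd B" for p
      proof (rule ccontr)
        assume "\<not> p <= P"
        then have "p ^ 2 dvd B" using B p by (auto simp: has_large_prime_def)
        moreover have "p <= M" using p B by (auto dest: dvd_imp_le)
        ultimately have "B \<in> Q" using B \<open>\<not> p <= P\<close> unfolding Q_def by auto
        then show False using False by simp
      qed
      then show ?thesis using B False by (auto simp: S'_def S_def)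
    qed
  qed
  have fin: "finite R" "finite Q" "finite S'" by (auto simp: R_def Q_def S'_def S_def)
  have cR: "real (card R) <= sqrt (real M)"
  proof -
    have "R \<subseteq> {1..nat \<lfloor>sqrt (real M)\<rfloor>}" by (auto simp: R_def le_nat_floor)
    then have "card R <= nat \<lfloor>sqrt (real M)\<rfloor>" using card_mono[of "{1..nat \<lfloor>sqrt (real M)\<rfloor>}" R] by simp
    also have "real (nat \<lfloor>sqrt (real M)\<rfloor>) <= sqrt (real M)" by simp
    finally show ?thesis by simp
  qed
  have cQ: "real (card Q) <= real M * (2 / real P)"
  proof -
    have "Q = (\<Union>k\<in>{P - 1<..M}. {B\<in>{1..M}. k ^ 2 dvd B})" by (auto simp: Q_def)
    then have "card Q <= (\<Sum>k\<in>{P - 1<..M}. card {B\<in>{1..M}. k ^ 2 dvd B})"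
      by (simp add: card_UN_le)
    then have "real (card Q) <= (\<Sum>k\<in>{P - 1<..M}. real (card {B\<in>{1..M}. k ^ 2 dvd B}))"
      by (metis of_nat_le_iff of_nat_sum)
    also have "... <= (\<Sum>k\<in>{P - 1<..M}. real M / real (k ^ 2))"
      using P by (intro sum_mono card_multiples_le) auto
    also have "... = real M * (\<Sum>k\<in>{P - 1<..M}. 1 / (real k)^2)" by (simp add: sum_distrib_left)
    also have "... <= real M * (1 / real (P - 1))"
      using P by (intro mult_left_mono tail_inverse_squares) auto
    also have "... <= real M * (2 / real P)"
      using P by (intro mult_left_mono) (auto simp: field_simps of_nat_diff)
    finally show ?thesis .
  qed
  have cS: "real (card S') <= real M * (8 * ln (real P) / ln (real M))"
  proof -
    have lM: "ln (real M) > 0" using M by simp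
    have "real (card S') * (ln (real M) / 2) = (\<Sum>B\<in>S'. ln (real M) / 2)" by simp
    also have "... <= (\<Sum>B\<in>S'. ln (real B))"
    proof (rule sum_mono)
      fix B assume B: "B \<in> S'"
      have "ln (real M) / 2 = ln (sqrt (real M))" using M by (simp add: ln_sqrt)
      also have "... <= ln (real B)"
      proof (rule ln_mono)
        show "0 < sqrt (real M)" using M by simp
        show "sqrt (real M) <= real B" using B by (simp add: S'_def)
      qed
      finally show "ln (real M) / 2 <= ln (real B)" .
    qed
    also have "... <= (\<Sum>B\<in>S. ln (real B))"
      by (rule sum_mono2) (auto simp: S'_def S_def)
    also have "... <= 4 * real M * ln (real P)"
      unfolding S_def using P by (intro smooth_log_sum) auto
    finally show ?thesis using lM by (simp add: field_simps)
  qed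
  have "card {B\<in>{1..M}. \<not> has_large_prime P B} <= card (R \<union> Q \<union> S')"
    using sub fin by (intro card_mono) auto
  also have "... <= card R + card Q + card S'"
    by (meson add_le_mono1 card_Un_le le_trans)
  finally show ?thesis using cR cQ cS by (simp add: distrib_left)
qed

section \<open>Modular hyperbolas in boxes, composite moduli\<close>

lemma progression_count:
  fixes a A0 :: int
  assumes "d > 0"
  obtains j0 :: int and n :: nat where
    "\<And>j. A0 < a + int d * j \<and> a + int d * j <= A0 + int H \<longleftrightarrow> j \<in> {j0<..j0 + int n}"
    "real n >= real H / real d - 1" "real n <= real H / real d + 1"
proof -
  define j0 where "j0 = (A0 - a) div int d"
  define j1 where "j1 = (A0 + int H - a) div int d"
  have le: "j0 <= j1" unfolding j0_def j1_def using assms by (intro zdiv_mono1) auto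
  have b: "x div int d <= real_of_int x / real d" "real_of_int x / real d - 1 <= x div int d" for x
  proof -
    have e: "x div int d = \<lfloor>real_of_int x / real d\<rfloor>" by (metis floor_divide_of_int_eq of_int_of_nat_eq)
    show "x div int d <= real_of_int x / real d" "real_of_int x / real d - 1 <= x div int d"
      unfolding e by linarith+
  qed
  have dv: "x div int d < j \<longleftrightarrow> x < j * int d" "j <= x div int d \<longleftrightarrow> j * int d <= x" for x j :: int
  proof -
    have e: "x div int d = \<lfloor>real_of_int x / real d\<rfloor>" by (metis floor_divide_of_int_eq of_int_of_nat_eq)
    have "j <= x div int d \<longleftrightarrow> real_of_int (j * int d) <= real_of_int x"
      unfolding e using assms by (simp add: le_floor_iff field_simps)
    then show "j <= x div int d \<longleftrightarrow> j * int d <= x" by linarith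
    then show "x div int d < j \<longleftrightarrow> x < j * int d" by linarith
  qed
  have hd: "real_of_int (A0 + int H - a) / real d = real_of_int (A0 - a) / real d + real H / real d"
    by (simp add: add_divide_distrib diff_divide_distrib)
  show ?thesis
  proof (rule that[of j0 "nat (j1 - j0)"])
    fix j
    have "int (nat (j1 - j0)) = j1 - j0" using le by simp
    then have "j \<in> {j0<..j0 + int (nat (j1 - j0))} \<longleftrightarrow> j0 < j \<and> j <= j1" by simp
    also have "... \<longleftrightarrow> A0 - a < j * int d \<and> j * int d <= A0 + int H - a" by (simp only: j0_def j1_def dv)
    also have "... \<longleftrightarrow> A0 < a + int d * j \<and> a + int d * j <= A0 + int H" by (auto simp: mult.commute)
    finally show "A0 < a + int d * j \<and> a + int d * j <= A0 + int H \<longleftrightarrow> j \<in> {j0<..j0 + int (nat (j1 - j0))}" ..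
    have "real (nat (j1 - j0)) = real_of_int j1 - real_of_int j0" using le by simp
    then show "real H / real d - 1 <= real (nat (j1 - j0))" "real (nat (j1 - j0)) <= real H / real d + 1"
      using b[of "A0 - a"] b[of "A0 + int H - a"] hd unfolding j0_def[symmetric] j1_def[symmetric] by linarith+
  qed
qed

lemma box_log_bounds:
  assumes "p >= 2"
  shows "2 <= box_log p" "box_log p ^ 2 <= 1024 * real p powr (1/8)"
proof -
  have "0 <= ln (real p)" using assms by simp
  then show "2 <= box_log p" by (simp add: box_log_def)
  \<comment> \<open>ln y is at most y - 1, applied to the 16th root of p.\<close>
  have "1 + ln (real p powr (1/16)) <= real p powr (1/16)"
    using ln_le_minus_one[of "real p powr (1/16)"] assms by simp
  then have "1 + ln (real p) / 16 <= real p powr (1/16)" using assms by (simp add: ln_powr)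
  then have "1 + ln (real p) <= 16 * real p powr (1/16)" by linarith
  then have "box_log p <= 32 * real p powr (1/16)" by (simp add: box_log_def)
  then have "box_log p ^ 2 <= (32 * real p powr (1/16)) ^ 2"
    using \<open>0 <= ln (real p)\<close> by (intro power_mono) (auto simp: box_log_def)
  also have "... = 1024 * real p powr (1/8)"
    using assms by (simp add: power_mult_distrib power2_eq_square powr_add[symmetric])
  finally show "box_log p ^ 2 <= 1024 * real p powr (1/8)" .
qed

text \<open>
  Once the residues of \<open>x, y\<close> modulo the cofactor \<open>d\<close> are fixed, the congruence becomes one modulo
  \<open>p\<close> for the quotients, which range over a box with sides shorter by the factor \<open>d\<close>.
\<close>

lemma modular_box_class:
  fixes a b A0 b0 \<sigma> :: int
  assumes p: "prime p" and pd: "\<not> p dvd d" and d: "d > 0"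
    and \<sigma>: "\<not> int p dvd \<sigma>" and ab: "[a * b = \<sigma>] (mod int d)"
  shows "real (card {(x, y) \<in> {A0<..A0 + int H1} \<times> {b0<..b0 + int H2}.
             [x = a] (mod int d) \<and> [y = b] (mod int d) \<and> [x * y = \<sigma>] (mod int (p * d))})
     >= (real H1 / real d) * (real H2 / real d) * real (p - 1) / real p ^ 2
       - 4 * real p powr (3/4) * box_log p ^ 2 * ((real H1 / real d + real H2 / real d) / real p + 1)"
proof -
  define L where "L = box_log p"
  define M where "M = real p powr (3/4)"
  have p2: "p >= 2" "p > 0" using prime_ge_2_nat[OF p] prime_gt_0_nat[OF p] by simp_all
  have L: "L >= 2" using box_log_bounds[OF p2(1)] by (simp add: L_def)
  have M: "M >= 1" using p2 by (simp add: M_def ge_one_powr_ge_zero)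
  obtain j0 n1 where j: "\<And>j. A0 < a + int d * j \<and> a + int d * j <= A0 + int H1 \<longleftrightarrow> j \<in> {j0<..j0 + int n1}"
    and n1: "real n1 >= real H1 / real d - 1" "real n1 <= real H1 / real d + 1"
    by (rule progression_count[OF d, of A0 a H1]) (rule that, assumption+)
  obtain i0 n2 where i: "\<And>i. b0 < b + int d * i \<and> b + int d * i <= b0 + int H2 \<longleftrightarrow> i \<in> {i0<..i0 + int n2}"
    and n2: "real n2 >= real H2 / real d - 1" "real n2 <= real H2 / real d + 1"
    by (rule progression_count[OF d, of b0 b H2]) (rule that, assumption+)
  have pp: "prime (int p)" using p by simp
  have cop: "coprime (int d) (int p)" using p pd by (metis coprime_commute coprime_int_iff prime_imp_coprime)
  then obtain d' where d': "[int d * d' = 1] (mod int p)" using cong_solve_coprime_int by blast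
  have nd': "\<not> int p dvd d'"
  proof
    assume "int p dvd d'"
    then have "[int d * d' = 0] (mod int p)" by (simp add: cong_0_iff)
    then have "[1 = 0] (mod int p)" using d' cong_sym cong_trans by blast
    then have "int p dvd 1" by (simp add: cong_0_iff)
    then show False using p2 by simp
  qed
  \<comment> \<open>With d' inverse to d modulo p, a + d j is congruent to d (j + a d'), so the shifted quotients lie on the hyperbola of sigma / d^2.\<close>
  define u where "u = \<sigma> * d' * d'"
  have u: "\<not> int p dvd u" using \<sigma> nd' pp by (simp add: u_def prime_dvd_mult_iff)
  define x0 where "x0 = j0 + a * d'"
  define y0 where "y0 = i0 + b * d'"
  define S where "S = {(x, y) \<in> {x0<..x0 + int n1} \<times> {y0<..y0 + int n2}. [x * y = u] (mod int p)}"
  define R where "R = {(x, y) \<in> {A0<..A0 + int H1} \<times> {b0<..b0 + int H2}.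
             [x = a] (mod int d) \<and> [y = b] (mod int d) \<and> [x * y = \<sigma>] (mod int (p * d))}"
  define f where "f = (\<lambda>(x, y). (a + int d * (x - a * d'), b + int d * (y - b * d')))"
  have "inj_on f S" using d by (auto simp: f_def inj_on_def)
  moreover have "f ` S \<subseteq> R"
  proof
    fix z assume "z \<in> f ` S"
    then obtain x y where xy: "(x, y) \<in> S" and z: "z = (a + int d * (x - a * d'), b + int d * (y - b * d'))"
      by (auto simp: f_def)
    define X where "X = a + int d * (x - a * d')"
    define Y where "Y = b + int d * (y - b * d')"
    have "x - a * d' \<in> {j0<..j0 + int n1}" "y - b * d' \<in> {i0<..i0 + int n2}"
      using xy by (auto simp: S_def x0_def y0_def)
    then have range: "X \<in> {A0<..A0 + int H1}" "Y \<in> {b0<..b0 + int H2}"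
      using j[of "x - a * d'"] i[of "y - b * d'"] by (auto simp: X_def Y_def)
    have Xa: "[X = a] (mod int d)" and Yb: "[Y = b] (mod int d)"
      by (auto simp: X_def Y_def cong_iff_dvd_diff)
    have "[X * Y = \<sigma>] (mod int d)" using cong_trans[OF cong_mult[OF Xa Yb] ab] .
    moreover have "[X * Y = \<sigma>] (mod int p)"
    proof -
      have e: "[a + int d * (x - a * d') = int d * x] (mod int p)" for a x
      proof -
        have "int p dvd int d * d' - 1" using d' by (simp add: cong_iff_dvd_diff)
        then have "int p dvd - a * (int d * d' - 1)" by (rule dvd_mult)
        also have "- a * (int d * d' - 1) = (a + int d * (x - a * d')) - int d * x" by (simp add: algebra_simps)
        finally show ?thesis by (simp only: cong_iff_dvd_diff)
      qed
      have "[X * Y = (int d * x) * (int d * y)] (mod int p)"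
        unfolding X_def Y_def by (intro cong_mult e)
      also have "(int d * x) * (int d * y) = (int d * int d) * (x * y)" by simp
      also have "[(int d * int d) * (x * y) = (int d * int d) * u] (mod int p)"
        using xy by (intro cong_mult) (auto simp: S_def)
      also have "(int d * int d) * u = \<sigma> * ((int d * d') * (int d * d'))" by (simp add: u_def mult_ac)
      also have "[\<sigma> * ((int d * d') * (int d * d')) = \<sigma> * (1 * 1)] (mod int p)"
        using d' by (intro cong_mult) auto
      finally show ?thesis by simp
    qed
    ultimately have "[X * Y = \<sigma>] (mod int p * int d)"
      using cop by (intro coprime_cong_mult) (auto simp: coprime_commute)
    then have "(X, Y) \<in> R" using range Xa Yb by (simp add: R_def)
    then show "z \<in> R" by (simp only: z X_def Y_def)
  qed
  moreover have "finite R"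
    by (rule finite_subset[of _ "{A0<..A0 + int H1} \<times> {b0<..b0 + int H2}"]) (auto simp: R_def)
  ultimately have "card S <= card R" by (metis card_image card_mono)
  moreover have "real n1 * real n2 * real (p - 1) / real p ^ 2 - 2 * M * ((real n1 + real n2) * L / real p + L ^ 2) <= real (card S)"
    unfolding S_def M_def L_def by (rule hyp_box_count[OF p u])
  moreover define x where "x = real H1 / real d"
  moreover define y where "y = real H2 / real d"
  have xy: "x >= 0" "y >= 0" by (auto simp: x_def y_def)
  have "x * y * real (p - 1) / real p ^ 2 - 4 * M * L ^ 2 * ((x + y) / real p + 1)
     <= real n1 * real n2 * real (p - 1) / real p ^ 2 - 2 * M * ((real n1 + real n2) * L / real p + L ^ 2)"
  proof -
    have "x * y - x - y <= real n1 * real n2"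
    proof (cases "x >= 1 \<and> y >= 1")
      case True
      then have "(x - 1) * (y - 1) <= real n1 * real n2"
        using n1 n2 by (intro mult_mono) (auto simp: x_def y_def)
      then show ?thesis by (simp add: algebra_simps)
    next
      case False
      have "x * y <= x + y"
      proof (cases "x >= 1")
        case True
        then have "x * y <= x * 1" using False xy by (intro mult_left_mono) auto
        then show ?thesis using xy by simp
      next
        case False
        then have "x * y <= 1 * y" using xy by (intro mult_right_mono) auto
        then show ?thesis using xy by simp
      qed
      moreover have "0 <= real n1 * real n2" by simp
      ultimately show ?thesis by linarith
    qed
    then have *: "(x * y - x - y) * (real (p - 1) / real p ^ 2) <= real n1 * real n2 * (real (p - 1) / real p ^ 2)"
      by (intro mult_right_mono) auto
    then have k1: "x * y * real (p - 1) / real p ^ 2 - (x + y) * (real (p - 1) / real p ^ 2) <= real n1 * real n2 * real (p - 1) / real p ^ 2"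
    proof -
      have "x * y * k - (x + y) * k <= z * k" if "(x * y - x - y) * k <= z * k" for z k :: real
        using that by (simp add: algebra_simps)
      from this[OF *] show ?thesis by simp
    qed
    have "real (p - 1) / real p ^ 2 <= real p / real p ^ 2"
      by (intro divide_right_mono) auto
    also have "... = 1 / real p" by (simp add: power2_eq_square)
    finally have "(x + y) * (real (p - 1) / real p ^ 2) <= (x + y) * (1 / real p)"
      using xy by (intro mult_left_mono) auto
    also have "... = 1 * ((x + y) / real p)" by simp
    also have "... <= M * L ^ 2 * ((x + y) / real p)"
    proof (intro mult_right_mono)
      have "1 <= L ^ 2" using L by (simp add: one_le_power)
      then show "1 <= M * L ^ 2" using M mult_mono[of 1 M 1 "L ^ 2"] by simp
    qed (use xy in auto)
    finally have k2: "(x + y) * (real (p - 1) / real p ^ 2) <= M * L ^ 2 * ((x + y) / real p)" .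
    have k3: "2 * M * ((real n1 + real n2) * L / real p + L ^ 2) <= M * L ^ 2 * ((x + y) / real p) + 4 * M * L ^ 2"
    proof -
      have "(real n1 + real n2) * L / real p <= (x + y + 2) * L / real p"
        using n1 n2 L by (intro divide_right_mono mult_right_mono) (auto simp: x_def y_def)
      also have "... = L * ((x + y) / real p) + L * (2 / real p)"
        using p2 by (simp add: field_simps)
      also have "... <= (L ^ 2 / 2) * ((x + y) / real p) + L ^ 2"
      proof (intro add_mono mult_right_mono)
        have "L * 2 <= L * L" using L by (intro mult_left_mono) auto
        then show "L <= L ^ 2 / 2" by (simp add: power2_eq_square)
        have "2 / real p <= L" using p2 L by (intro order_trans[OF _ L]) (auto simp: divide_le_eq)
        then show "L * (2 / real p) <= L ^ 2" using L mult_left_mono[of "2 / real p" L L] by (simp add: power2_eq_square)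
      qed (use xy in auto)
      finally have "(real n1 + real n2) * L / real p + L ^ 2 <= (L ^ 2 / 2) * ((x + y) / real p) + 2 * L ^ 2" by simp
      then have "2 * M * ((real n1 + real n2) * L / real p + L ^ 2) <= 2 * M * ((L ^ 2 / 2) * ((x + y) / real p) + 2 * L ^ 2)"
        using M by (intro mult_left_mono) auto
      moreover have "2 * M * ((L ^ 2 / 2) * ((x + y) / real p) + 2 * L ^ 2) = M * L ^ 2 * ((x + y) / real p) + 4 * M * L ^ 2"
        using p2 by (simp add: field_simps)
      ultimately show ?thesis by linarith
    qed
    have "0 <= M * L ^ 2 * ((x + y) / real p)" using M xy by simp
    moreover have "4 * M * L ^ 2 * ((x + y) / real p + 1) = 4 * (M * L ^ 2 * ((x + y) / real p)) + 4 * M * L ^ 2"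
      by (simp only: distrib_left mult_1_right mult.assoc)
    ultimately show ?thesis using k1 k2 k3 by linarith
  qed
  ultimately show ?thesis unfolding x_def y_def M_def L_def R_def by linarith
qed

text \<open>
  Sum over the \<open>\<phi>(d)\<close> classes of \<open>x\<close>, each of which determines that of \<open>y\<close>. Of the relative saving
  \<open>p\<^bsup>-1/4\<^esup>\<close> of the Kloosterman bound, half is given away to absorb the logarithms.
\<close>

lemma modular_box_count:
  fixes A0 b0 \<sigma> :: int
  assumes p: "prime p" and pd: "\<not> p dvd d" and d: "d > 0" and \<sigma>: "coprime \<sigma> (int (p * d))"
  shows "real (card {(x, y) \<in> {A0<..A0 + int H1} \<times> {b0<..b0 + int H2}. [x * y = \<sigma>] (mod int (p * d))})
     >= totient_ratio (p * d) / real (p * d) * real H1 * real H2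
       - 4096 * real p powr (- 1/8) * (real (p * d) + real H1 + real H2)"
proof -
  define B where "B = p * d"
  define R where "R a b = {(x, y) \<in> {A0<..A0 + int H1} \<times> {b0<..b0 + int H2}.
             [x = a] (mod int d) \<and> [y = b] (mod int d) \<and> [x * y = \<sigma>] (mod int (p * d))}" for a b
  have p2: "p >= 2" "p > 0" using prime_ge_2_nat[OF p] prime_gt_0_nat[OF p] by simp_all
  have cops: "coprime \<sigma> (int d)" "coprime \<sigma> (int p)" using \<sigma> by simp_all
  have nps: "\<not> int p dvd \<sigma>"
  proof
    assume "int p dvd \<sigma>"
    then have "int p dvd 1" using coprime_common_divisor[OF cops(2), of "int p"] by simp
    then show False using p2 by simp
  qed
  have "\<exists>b. [int a * b = \<sigma>] (mod int d)" if "a \<in> totatives d" for a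
  proof -
    have "coprime (int a) (int d)" using that by (simp add: totatives_def)
    then obtain c where "[int a * c = 1] (mod int d)" using cong_solve_coprime_int by blast
    then have "[int a * c * \<sigma> = 1 * \<sigma>] (mod int d)" by (intro cong_mult) auto
    then show ?thesis by (intro exI[of _ "c * \<sigma>"]) (simp add: mult.assoc)
  qed
  then obtain bb where bb: "\<And>a. a \<in> totatives d ==> [int a * bb a = \<sigma>] (mod int d)" by metis
  define T where "T = {(x, y) \<in> {A0<..A0 + int H1} \<times> {b0<..b0 + int H2}. [x * y = \<sigma>] (mod int (p * d))}"
  define c where "c = (real H1 / real d) * (real H2 / real d) * real (p - 1) / real p ^ 2"
  define e where "e = 4 * real p powr (3/4) * box_log p ^ 2 * ((real H1 / real d + real H2 / real d) / real p + 1)"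
  have e0: "e >= 0" by (auto simp: e_def)
  have finT: "finite T"
    by (rule finite_subset[of _ "{A0<..A0 + int H1} \<times> {b0<..b0 + int H2}"]) (auto simp: T_def)
  have finR: "finite (R a b)" for a b
    by (rule finite_subset[of _ "{A0<..A0 + int H1} \<times> {b0<..b0 + int H2}"]) (auto simp: R_def)
  have disj: "R (int a) (bb a) \<inter> R (int a') (bb a') = {}" if "a \<in> totatives d" "a' \<in> totatives d" "a ~= a'" for a a'
  proof (rule ccontr)
    assume "R (int a) (bb a) \<inter> R (int a') (bb a') ~= {}"
    then obtain x where "[x = int a] (mod int d)" "[x = int a'] (mod int d)" by (auto simp: R_def)
    then have "[int a = int a'] (mod int d)" using cong_sym cong_trans by blast
    then have "int d dvd int a - int a'" by (simp add: cong_iff_dvd_diff)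
    moreover have "\<bar>int a - int a'\<bar> < int d" using that by (auto simp: totatives_def)
    ultimately have "int a - int a' = 0" by (metis dvd_imp_le_int abs_of_nat not_less)
    then show False using that by simp
  qed
  have "real (totient d) * (c - e) = (\<Sum>a\<in>totatives d. c - e)" by (simp add: totient_def)
  also have "... <= (\<Sum>a\<in>totatives d. real (card (R (int a) (bb a))))"
    unfolding c_def e_def R_def
    by (intro sum_mono modular_box_class[OF p pd d nps] bb)
  also have "... = real (card (\<Union>a\<in>totatives d. R (int a) (bb a)))"
    using finR disj by (subst card_UN_disjoint) auto
  also have "... <= real (card T)"
    using finT by (intro of_nat_mono card_mono) (auto simp: R_def T_def)
  finally have key: "real (totient d) * (c - e) <= real (card T)" .
  have cop: "coprime p d" using p pd by (simp add: prime_imp_coprime)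
  have "totient B = totient p * totient d" unfolding B_def using cop by (rule totient_mult_coprime)
  then have tB: "real (totient B) = real (p - 1) * real (totient d)" using p by (simp add: totient_prime)
  have "real (totient d) * c = totient_ratio B / real B * real H1 * real H2"
    unfolding c_def totient_ratio_def tB unfolding B_def using d p2 by (simp add: field_simps power2_eq_square)
  moreover have "real (totient d) * e <= 4096 * real p powr (- 1/8) * (real B + real H1 + real H2)"
  proof -
    have "real (totient d) * e <= real d * e" using e0 totient_le by (intro mult_right_mono) auto
    also have "... = 4 * real p powr (3/4) * box_log p ^ 2 * ((real B + real H1 + real H2) / real p)"
      using d p2 by (simp add: e_def B_def field_simps)
    also have "... <= 4 * real p powr (3/4) * (1024 * real p powr (1/8)) * ((real B + real H1 + real H2) / real p)"
      using box_log_bounds[OF p2(1)] by (intro mult_right_mono mult_left_mono) auto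
    also have "... = 4096 * (real p powr (3/4) * real p powr (1/8) * real p powr (-1)) * (real B + real H1 + real H2)"
      using p2 by (simp add: powr_minus_divide)
    also have "real p powr (3/4) * real p powr (1/8) * real p powr (-1) = real p powr (- 1/8)"
    proof -
      have "real p powr (3/4) * real p powr (1/8) * real p powr (-1) = real p powr (3/4 + 1/8 + (-1))"
        by (simp only: powr_add)
      then show ?thesis by simp
    qed
    finally show ?thesis .
  qed
  ultimately have "totient_ratio B / real B * real H1 * real H2 - 4096 * real p powr (- 1/8) * (real B + real H1 + real H2) <= real (card T)"
    using key unfolding right_diff_distrib by linarith
  then show ?thesis unfolding T_def B_def .
qed

section \<open>Weighted sums\<close>

text \<open>\<open>abel_lower\<close> in each variable in turn.\<close>

lemma abel_lower_2d:
  fixes g :: "nat => nat => real"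
  assumes G: "\<And>s t. s <= m ==> t <= n ==> (\<Sum>i=1..s. \<Sum>j=1..t. g i j) >= \<rho> * real s * real t - E"
    and v0: "\<And>k. 1 <= k ==> k <= m ==> 0 <= v k"
    and vd: "\<And>k. 1 <= k ==> k < m ==> v (Suc k) <= v k"
    and w0: "\<And>k. 1 <= k ==> k <= n ==> 0 <= w k"
    and wd: "\<And>k. 1 <= k ==> k < n ==> w (Suc k) <= w k"
    and m: "m >= 1" and n: "n >= 1"
  shows "(\<Sum>i=1..m. \<Sum>j=1..n. g i j * v i * w j) >= \<rho> * (\<Sum>i=1..m. v i) * (\<Sum>j=1..n. w j) - E * v 1 * w 1"
proof -
  have "(\<Sum>i=1..s. \<Sum>j=1..n. g i j * w j) >= \<rho> * (\<Sum>j=1..n. w j) * real s - E * w 1" if s: "s <= m" for s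
  proof -
    have "(\<Sum>j=1..n. (\<Sum>i=1..s. g i j) * w j) >= (\<rho> * real s) * (\<Sum>j=1..n. w j) - E * w 1"
    proof (rule abel_lower[where w = w and n = n, OF _ w0 wd n])
      fix t assume t: "t <= n"
      have "(\<Sum>j=1..t. \<Sum>i=1..s. g i j) = (\<Sum>i=1..s. \<Sum>j=1..t. g i j)" by (rule sum.swap)
      then show "\<rho> * real s * real t - E <= (\<Sum>j=1..t. \<Sum>i=1..s. g i j)" using G[OF s t] by simp
    qed
    moreover have "(\<Sum>j=1..n. (\<Sum>i=1..s. g i j) * w j) = (\<Sum>i=1..s. \<Sum>j=1..n. g i j * w j)"
      unfolding sum_distrib_right by (rule sum.swap)
    ultimately show ?thesis by (simp add: mult_ac)
  qed
  then have "(\<Sum>i=1..m. (\<Sum>j=1..n. g i j * w j) * v i) >= (\<rho> * (\<Sum>j=1..n. w j)) * (\<Sum>i=1..m. v i) - (E * w 1) * v 1"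
    by (intro abel_lower v0 vd m) auto
  moreover have "(\<Sum>i=1..m. (\<Sum>j=1..n. g i j * w j) * v i) = (\<Sum>i=1..m. \<Sum>j=1..n. g i j * v i * w j)"
    unfolding sum_distrib_right by (intro sum.cong refl) (simp add: mult_ac)
  ultimately show ?thesis by (simp add: mult_ac)
qed

text \<open>Times \<open>d\<close>, the left side is an upper Riemann sum for the area \<open>w0\<^sup>2 / 2\<close> of a triangle.\<close>

lemma linear_ramp_sum:
  fixes w0 d :: real
  assumes d: "d > 0" and w0: "w0 >= 0" and n: "real n * d >= w0"
  shows "(\<Sum>i=1..n. max 0 (w0 - (real i - 1) * d)) >= w0 ^ 2 / (2 * d)"
proof -
  define F where "F x = (max 0 x) ^ 2 / 2" for x :: real
  have step: "F x - F (x - d) <= d * max 0 x" for x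
  proof (cases "x >= d")
    case True
    have "0 <= d * d" by simp
    moreover have "max 0 x = x" "max 0 (x - d) = x - d" using True d by auto
    ultimately show ?thesis by (simp add: F_def power2_eq_square field_simps)
  next
    case False
    show ?thesis
    proof (cases "x >= 0")
      case True
      then have "x * x <= d * (2 * x)" using False d by (simp add: mult_mono)
      moreover have "max 0 x = x" "max 0 (x - d) = 0" using True False by auto
      ultimately show ?thesis by (simp add: F_def power2_eq_square)
    qed (use d in \<open>auto simp: F_def\<close>)
  qed
  have tel: "(\<Sum>i=1..n. F (w0 - (real i - 1) * d) - F (w0 - real i * d)) = F w0 - F (w0 - real n * d)" for n
  proof (induction n)
    case (Suc n)
    then show ?case by (simp add: algebra_simps)
  qed (simp add: F_def)
  have "F w0 - F (w0 - real n * d) <= (\<Sum>i=1..n. d * max 0 (w0 - (real i - 1) * d))"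
    unfolding tel[symmetric]
  proof (rule sum_mono)
    fix i
    have e: "w0 - real i * d = (w0 - (real i - 1) * d) - d" by (simp add: algebra_simps)
    show "F (w0 - (real i - 1) * d) - F (w0 - real i * d) <= d * max 0 (w0 - (real i - 1) * d)"
      unfolding e by (rule step)
  qed
  moreover have "F (w0 - real n * d) = 0" "F w0 = w0 ^ 2 / 2" using n w0 by (auto simp: F_def)
  ultimately have "w0 ^ 2 / 2 <= d * (\<Sum>i=1..n. max 0 (w0 - (real i - 1) * d))"
    by (simp add: sum_distrib_left)
  then show ?thesis using d by (simp add: field_simps)
qed

lemma ln_step: "x > 0 ==> d > 0 ==> ln ((x + d) / x) <= d / x" for x d :: real
  using ln_add_one_self_le_self[of "d / x"] by (simp add: add_divide_distrib)

lemma harmonic_progression_lower: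
  fixes x d :: real
  assumes x: "x >= 0" and d: "d > 0"
  shows "(\<Sum>a=1..n. 1 / (real a * d + x)) >= ln ((real (Suc n) * d + x) / (d + x)) / d"
proof (induction n)
  case 0
  then show ?case using x d by simp
next
  case (Suc n)
  have p: "real (Suc n) * d + x > 0" "real (Suc (Suc n)) * d + x > 0" "d + x > 0" using x d by (auto intro: add_pos_nonneg)
  have "ln ((real (Suc (Suc n)) * d + x) / (d + x)) = ln ((real (Suc n) * d + x) / (d + x)) + ln ((real (Suc n) * d + x + d) / (real (Suc n) * d + x))"
    using p by (simp add: ln_div algebra_simps)
  also have "... <= ln ((real (Suc n) * d + x) / (d + x)) + d / (real (Suc n) * d + x)"
    using ln_step[OF p(1) d] by simp
  finally have "ln ((real (Suc (Suc n)) * d + x) / (d + x)) / d <= (ln ((real (Suc n) * d + x) / (d + x)) + d / (real (Suc n) * d + x)) / d"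
    using d by (intro divide_right_mono) auto
  also have "... = ln ((real (Suc n) * d + x) / (d + x)) / d + 1 / (real (Suc n) * d + x)"
    using d by (simp add: add_divide_distrib)
  finally show ?case using Suc by simp
qed

lemma sum_inverse_sqrt_le: "(\<Sum>b=1..n. 1 / sqrt (real b)) <= 2 * sqrt (real n)"
proof (induction n)
  case (Suc n)
  define s where "s = sqrt (real n)"
  define t where "t = sqrt (real (Suc n))"
  have st: "0 <= s" "0 < t" "t * t = s * s + 1" by (auto simp: s_def t_def)
  have "0 <= (t - s) * (t - s)" by simp
  then have "1 + 2 * (s * t) <= 2 * (t * t)" using st by (simp add: algebra_simps)
  then have "1 / t <= 2 * t - 2 * s" using st by (simp add: field_simps)
  then show ?case using Suc by (simp add: s_def t_def)
qed simp

lemma sum_ln_le: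
  assumes "M >= 1" shows "(\<Sum>m=1..M. ln (real m)) <= (real M + 1) * ln (real M + 1) - real M"
  using assms
proof (induction M rule: nat_induct_at_least)
  case base
  have "ln (1 / 2 :: real) <= 1 / 2 - 1" by (rule ln_le_minus_one) simp
  then show ?case by (simp add: ln_div)
next
  case (Suc M)
  define x where "x = real M + 1"
  have x: "x > 0" by (simp add: x_def)
  have "ln (x / (x + 1)) <= x / (x + 1) - 1" using x by (intro ln_le_minus_one) auto
  then have "(x + 1) * ln (x / (x + 1)) <= (x + 1) * (x / (x + 1) - 1)" using x by (intro mult_left_mono) auto
  also have "... = - 1" using x by (simp add: field_simps)
  finally have "(x + 1) * ln x + 1 <= (x + 1) * ln (x + 1)" using x by (simp add: ln_div algebra_simps)
  then have "x * ln x - real M + ln x <= (x + 1) * ln (x + 1) - (real M + 1)" by (simp add: algebra_simps)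
  then show ?case using Suc by (simp add: x_def add_ac)
qed

text \<open>The limit of \<open>ratio_sum n / n\<close> in the form in which summation by parts consumes it.\<close>

lemma ratio_sum_lower:
  assumes "k > 0" shows "\<exists>E\<ge>0. \<forall>s. ratio_sum s >= (6 / pi\<^sup>2 - k) * real s - E"
proof -
  have "\<forall>\<^sub>F n in sequentially. ratio_sum n / real n > 6 / pi\<^sup>2 - k"
    using assms by (intro order_tendstoD(1)[OF ratio_sum_asymptotic]) auto
  then obtain s0 where s0: "\<And>n. n >= s0 ==> ratio_sum n / real n > 6 / pi\<^sup>2 - k"
    by (auto simp: eventually_sequentially)
  define E where "E = max 0 (6 / pi\<^sup>2 - k) * real s0"
  have "(6 / pi\<^sup>2 - k) * real s - E <= ratio_sum s" for s
  proof (cases "s >= s0 \<and> s > 0")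
    case True
    then have "(6 / pi\<^sup>2 - k) * real s <= ratio_sum s" using s0[of s] by (simp add: field_simps)
    moreover have "0 <= E" by (simp add: E_def)
    ultimately show ?thesis by linarith
  next
    case False
    then have "real s <= real s0" by auto
    then have "(6 / pi\<^sup>2 - k) * real s <= E"
      unfolding E_def by (meson max.cobounded1 max.cobounded2 mult_mono of_nat_0_le_iff)
    then show ?thesis using ratio_sum_bounds(1)[of s] by linarith
  qed
  then show ?thesis by (intro exI[of _ E]) (auto simp: E_def)
qed

lemma ratio_sum_upper:
  assumes "k > 0" shows "\<exists>E\<ge>0. \<forall>s. ratio_sum s <= (6 / pi\<^sup>2 + k) * real s + E"
proof -
  have "\<forall>\<^sub>F n in sequentially. ratio_sum n / real n < 6 / pi\<^sup>2 + k"
    using assms by (intro order_tendstoD(2)[OF ratio_sum_asymptotic]) auto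
  then obtain s0 where s0: "\<And>n. n >= s0 ==> ratio_sum n / real n < 6 / pi\<^sup>2 + k"
    by (auto simp: eventually_sequentially)
  have nn: "0 <= (6 / pi\<^sup>2 + k) * real s" for s using assms by simp
  have "ratio_sum s <= (6 / pi\<^sup>2 + k) * real s + real s0" for s
  proof (cases "s >= s0 \<and> s > 0")
    case True
    then have "ratio_sum s <= (6 / pi\<^sup>2 + k) * real s" using s0[of s] by (simp add: field_simps)
    then show ?thesis by simp
  next
    case False
    then have "real s <= real s0" by auto
    then show ?thesis using ratio_sum_bounds(2)[of s] nn[of s] by linarith
  qed
  then show ?thesis by (intro exI[of _ "real s0"]) auto
qed

lemma coprime_count_nat:
  assumes "b > 0"
  shows "\<bar>(\<Sum>a=1..s. if coprime (x0 + a) b then 1 else 0) - totient_ratio b * real s\<bar> <= 2 * sqrt (real b)"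
proof -
  have "{c::int. real x0 < of_int c \<and> of_int c <= real (x0 + s) \<and> coprime c (int b)} = (\<lambda>a. int (x0 + a)) ` {a\<in>{1..s}. coprime (x0 + a) b}"
  proof (rule Set.set_eqI, rule iffI)
    fix c :: int assume c: "c \<in> {c::int. real x0 < of_int c \<and> of_int c <= real (x0 + s) \<and> coprime c (int b)}"
    then have "real_of_int (int x0) < real_of_int c" "real_of_int c <= real_of_int (int (x0 + s))" by auto
    then have r: "int x0 < c" "c <= int (x0 + s)" "coprime c (int b)"
      using c unfolding of_int_less_iff of_int_le_iff by blast+
    define a where "a = nat c - x0"
    have ca: "c = int (x0 + a)" "a >= 1" "a <= s" using r by (auto simp: a_def)
    then have "coprime (x0 + a) b" using r(3) by (metis coprime_int_iff)
    then show "c \<in> (\<lambda>a. int (x0 + a)) ` {a\<in>{1..s}. coprime (x0 + a) b}" using ca by auto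
  next
    fix c :: int assume "c \<in> (\<lambda>a. int (x0 + a)) ` {a\<in>{1..s}. coprime (x0 + a) b}"
    then obtain a where a: "c = int (x0 + a)" "1 <= a" "a <= s" "coprime (x0 + a) b" by auto
    then have "coprime c (int b)" by (metis coprime_int_iff)
    then show "c \<in> {c::int. real x0 < of_int c \<and> of_int c <= real (x0 + s) \<and> coprime c (int b)}" using a by auto
  qed
  then have "card {c::int. real x0 < of_int c \<and> of_int c <= real (x0 + s) \<and> coprime c (int b)} = card {a\<in>{1..s}. coprime (x0 + a) b}"
    by (simp add: card_image inj_on_def)
  moreover have "(\<Sum>a=1..s. if coprime (x0 + a) b then 1 else (0::real)) = real (card {a\<in>{1..s}. coprime (x0 + a) b})"
    by (simp add: sum.If_cases Int_def)
  ultimately show ?thesis using coprime_count[OF assms, of "real x0" "real (x0 + s)"] by simp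
qed

section \<open>Reduced fractions inside a Farey interval\<close>

text \<open>
  The sum of \<open>1 / q\<close> over the reduced fractions with denominator \<open>q <= Z\<close> inside a Farey interval
  with end denominators \<open>q1, q2\<close>: these fractions are \<open>(a p1 + b p2) / (a q1 + b q2)\<close>.
\<close>

definition fraction_sum :: "nat => nat => real => real" where
  "fraction_sum q1 q2 Z = (\<Sum>(a, b) \<in> {(a, b). a >= 1 \<and> b >= 1 \<and> coprime a b \<and> real (a * q1 + b * q2) <= Z}. 1 / real (a * q1 + b * q2))"

lemma finite_fraction_set:
  assumes "q1 >= 1" "q2 >= 1"
  shows "finite {(a, b). a >= 1 \<and> b >= 1 \<and> coprime a b \<and> real (a * q1 + b * q2) <= Z}"
proof (rule finite_subset[of _ "{..nat \<lfloor>Z\<rfloor>} \<times> {..nat \<lfloor>Z\<rfloor>}"])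
  show "{(a, b). a >= 1 \<and> b >= 1 \<and> coprime a b \<and> real (a * q1 + b * q2) <= Z} \<subseteq> {..nat \<lfloor>Z\<rfloor>} \<times> {..nat \<lfloor>Z\<rfloor>}"
  proof clarify
    fix a b assume "real (a * q1 + b * q2) <= Z"
    then have "a * q1 + b * q2 <= nat \<lfloor>Z\<rfloor>" by (rule le_nat_floor)
    moreover have "a <= a * q1" "b <= b * q2" using assms by auto
    ultimately show "a \<in> {..nat \<lfloor>Z\<rfloor>} \<and> b \<in> {..nat \<lfloor>Z\<rfloor>}" unfolding atMost_iff by linarith
  qed
qed auto

lemma fraction_sum_commute: "fraction_sum q1 q2 Z = fraction_sum q2 q1 Z"
  unfolding fraction_sum_def
  by (rule sum.reindex_bij_witness[where i = "\<lambda>(a, b). (b, a)" and j = "\<lambda>(a, b). (b, a)"])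
     (auto simp: coprime_commute add.commute)

text \<open>
  For fixed \<open>b\<close> the sum over \<open>a\<close> coprime to \<open>b\<close> is about \<open>\<phi>(b) / b\<close> times \<open>ln (Y / b) / q1\<close>, and
  summing over \<open>b <= Y\<close> replaces \<open>\<phi>(b) / b\<close> by its mean and \<open>ln (Y / b)\<close> by its average 1. The
  order \<open>q1 <= q2\<close> makes the range of \<open>a\<close> nonempty for every \<open>b < \<lfloor>Y\<rfloor>\<close>.
\<close>

lemma fraction_sum_lower_ordered:
  assumes q: "1 <= q1" "q1 <= q2" and rho: "\<And>s. ratio_sum s >= \<rho> * real s - E" and E: "E >= 0" and \<rho>: "\<rho> >= 0"
    and Y: "Y = Z / real q2" "Y >= 3"
  shows "fraction_sum q1 q2 Z * real q1 >= \<rho> * (Y - 3 - 2 * ln Y) - E * ln Y - 4 * sqrt Y"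
proof -
  define M where "M = nat \<lfloor>Y\<rfloor>"
  have M: "M >= 3" "real M <= Y" "Y < real M + 1"
    using Y by (auto simp: M_def le_nat_floor)
  have Z: "Z = Y * real q2" using Y q by simp
  define n where "n b = nat \<lfloor>(Z - real (b * q2)) / real q1\<rfloor>" for b
  define S where "S = {(a, b). a >= 1 \<and> b >= 1 \<and> coprime a b \<and> real (a * q1 + b * q2) <= Z}"
  have q0: "real q1 > 0" "real q2 > 0" using q by auto
  have nb: "n b >= 1" "real (n b * q1 + b * q2) <= Z" "Z < real (Suc (n b) * q1 + b * q2)" if b: "b \<in> {1..<M}" for b
  proof -
    have "real (b + 1) <= Y" using b M by auto
    then have "real (b + 1) * real q2 <= Z" unfolding Z by (intro mult_right_mono) auto
    then have g: "real q1 <= Z - real (b * q2)" using q by (simp add: algebra_simps)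
    then have "1 <= (Z - real (b * q2)) / real q1" using q0 by (simp add: field_simps)
    then have "1 <= \<lfloor>(Z - real (b * q2)) / real q1\<rfloor>" by linarith
    then show "n b >= 1" unfolding n_def by linarith
    have "real (n b) <= (Z - real (b * q2)) / real q1" "(Z - real (b * q2)) / real q1 < real (Suc (n b))"
      using \<open>1 <= \<lfloor>(Z - real (b * q2)) / real q1\<rfloor>\<close> unfolding n_def by linarith+
    then show "real (n b * q1 + b * q2) <= Z" "Z < real (Suc (n b) * q1 + b * q2)"
      using q0 by (auto simp: field_simps)
  qed
  have inner: "(\<Sum>a=1..n b. (if coprime a b then 1 else 0) * (1 / (real a * real q1 + real (b * q2))))
      >= totient_ratio b * (ln (Y / real (Suc b)) / real q1) - 2 / (sqrt (real b) * real q1)" if b: "b \<in> {1..<M}" for b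
  proof -
    have b0: "b > 0" using b by simp
    define w where "w a = 1 / (real a * real q1 + real (b * q2))" for a
    have pos: "real a * real q1 + real (b * q2) > 0" for a using q0 b0 by (intro add_nonneg_pos) auto
    have "(\<Sum>a=1..n b. (if coprime a b then 1 else 0) * w a) >= totient_ratio b * (\<Sum>a=1..n b. w a) - (2 * sqrt (real b)) * w 1"
    proof (rule abel_lower[OF _ _ _ nb(1)[OF b]])
      fix s show "(\<Sum>a=1..s. if coprime a b then 1 else 0) >= totient_ratio b * real s - 2 * sqrt (real b)"
        using coprime_count_nat[OF b0, of 0 s] by (simp add: abs_le_iff)
    next
      fix k show "w (Suc k) <= w k" unfolding w_def using pos[of k] q0 by (intro divide_left_mono mult_pos_pos pos) (auto simp: algebra_simps)
    qed (use pos in \<open>auto simp: w_def less_imp_le\<close>)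
    moreover have "(\<Sum>a=1..n b. w a) >= ln (Y / real (Suc b)) / real q1"
    proof -
      have "ln (Y / real (Suc b)) <= ln ((real (Suc (n b)) * real q1 + real (b * q2)) / (real q1 + real (b * q2)))"
      proof (rule ln_mono)
        show "0 < Y / real (Suc b)" using Y(2) by simp
        have "Y / real (Suc b) = Z / (real (Suc b) * real q2)" using q0 by (simp add: Z)
        also have "... <= (real (Suc (n b)) * real q1 + real (b * q2)) / (real q1 + real (b * q2))"
          using nb[OF b] q q0 by (intro frac_le) (auto simp: algebra_simps Z Y(2) intro: add_pos_nonneg)
        finally show "Y / real (Suc b) <= (real (Suc (n b)) * real q1 + real (b * q2)) / (real q1 + real (b * q2))" .
      qed
      then have "ln (Y / real (Suc b)) / real q1 <= ln ((real (Suc (n b)) * real q1 + real (b * q2)) / (real q1 + real (b * q2))) / real q1"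
        using q0 by (intro divide_right_mono) auto
      also have "... <= (\<Sum>a=1..n b. w a)" unfolding w_def using q0 by (intro harmonic_progression_lower) auto
      finally show ?thesis .
    qed
    then have "totient_ratio b * (ln (Y / real (Suc b)) / real q1) <= totient_ratio b * (\<Sum>a=1..n b. w a)"
      by (intro mult_left_mono totient_ratio_bounds)
    moreover have "(2 * sqrt (real b)) * w 1 <= 2 / (sqrt (real b) * real q1)"
    proof -
      have "w 1 <= 1 / (real b * real q1)"
        unfolding w_def using q q0 b0 pos[of 1] by (intro divide_left_mono mult_pos_pos) (auto intro: mult_left_mono add_increasing)
      then have "(2 * sqrt (real b)) * w 1 <= (2 * sqrt (real b)) * (1 / (real b * real q1))" by (intro mult_left_mono) auto
      also have "... = 2 * (sqrt (real b) / real b) / real q1" by simp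
      also have "sqrt (real b) / real b = 1 / sqrt (real b)" using b0 by (simp add: field_simps)
      finally show ?thesis by simp
    qed
    ultimately show ?thesis unfolding w_def by linarith
  qed
  have "(\<Sum>b\<in>{1..<M}. totient_ratio b * (ln (Y / real (Suc b)) / real q1) - 2 / (sqrt (real b) * real q1))
     <= (\<Sum>b\<in>{1..<M}. \<Sum>a=1..n b. (if coprime a b then 1 else 0) * (1 / (real a * real q1 + real (b * q2))))"
    by (intro sum_mono inner)
  also have "... = (\<Sum>(b, a)\<in>(SIGMA b:{1..<M}. {1..n b}). if coprime a b then 1 / real (a * q1 + b * q2) else 0)"
    by (subst sum.Sigma) (auto intro!: sum.cong)
  also have "... = (\<Sum>(b, a)\<in>{(b, a). b \<in> {1..<M} \<and> a \<in> {1..n b} \<and> coprime a b}. 1 / real (a * q1 + b * q2))"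
    by (rule sum.mono_neutral_cong_right) (auto intro!: finite_SigmaI split: if_splits)
  also have "... = (\<Sum>(a, b)\<in>{(a, b). b \<in> {1..<M} \<and> a \<in> {1..n b} \<and> coprime a b}. 1 / real (a * q1 + b * q2))"
    by (rule sum.reindex_bij_witness[where i = "\<lambda>(a, b). (b, a)" and j = "\<lambda>(a, b). (b, a)"]) auto
  also have "... <= (\<Sum>(a, b)\<in>S. 1 / real (a * q1 + b * q2))"
  proof (rule sum_mono2)
    show "finite S" unfolding S_def using q by (intro finite_fraction_set) auto
    show "{(a, b). b \<in> {1..<M} \<and> a \<in> {1..n b} \<and> coprime a b} \<subseteq> S"
    proof clarify
      fix a b assume b: "b \<in> {1..<M}" and a: "a \<in> {1..n b}" and c: "coprime a b"
      have "a * q1 + b * q2 <= n b * q1 + b * q2" using a by simp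
      then have "real (a * q1 + b * q2) <= Z" using nb(2)[OF b] by (meson of_nat_le_iff order_trans)
      then show "(a, b) \<in> S" using a b c by (auto simp: S_def)
    qed
  qed auto
  finally have fs: "(\<Sum>b\<in>{1..<M}. totient_ratio b * (ln (Y / real (Suc b)) / real q1) - 2 / (sqrt (real b) * real q1)) <= fraction_sum q1 q2 Z"
    by (simp add: fraction_sum_def S_def)
  have Mset: "{1..<M} = {1..M - 1}" using M by auto
  have "(\<Sum>b\<in>{1..<M}. totient_ratio b * (ln (Y / real (Suc b)) / real q1) - 2 / (sqrt (real b) * real q1)) * real q1
     = (\<Sum>b=1..M - 1. totient_ratio b * ln (Y / real (Suc b))) - 2 * (\<Sum>b=1..M - 1. 1 / sqrt (real b))"
    unfolding Mset sum_distrib_right sum_distrib_left sum_subtractf[symmetric]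
    using q0 by (intro sum.cong refl) (simp add: field_simps)
  moreover have "(\<Sum>b=1..M - 1. totient_ratio b * ln (Y / real (Suc b))) >= \<rho> * (\<Sum>b=1..M - 1. ln (Y / real (Suc b))) - E * ln (Y / real (Suc 1))"
  proof (rule abel_lower)
    fix s show "(\<Sum>k=1..s. totient_ratio k) >= \<rho> * real s - E" using rho[of s] by (simp add: ratio_sum_def)
  next
    fix k assume "1 <= k" "k <= M - 1"
    then have "real (Suc k) <= Y" using M by linarith
    then have "1 <= Y / real (Suc k)" by simp
    then show "0 <= ln (Y / real (Suc k))" by simp
  next
    fix k show "ln (Y / real (Suc (Suc k))) <= ln (Y / real (Suc k))"
      using Y(2) by (intro ln_mono divide_left_mono divide_pos_pos mult_pos_pos) auto
  qed (use M in auto)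
  moreover have "(\<Sum>b=1..M - 1. ln (Y / real (Suc b))) >= Y - 3 - 2 * ln Y"
  proof -
    have "(\<Sum>b=1..M - 1. ln (Y / real (Suc b))) = (\<Sum>b=1..M - 1. ln Y - ln (real (Suc b)))"
      using Y(2) by (intro sum.cong refl) (simp add: ln_div)
    also have "... = (real M - 1) * ln Y - (\<Sum>b=1..M - 1. ln (real (Suc b)))"
      using M by (simp add: sum_subtractf of_nat_diff)
    finally have e1: "(\<Sum>b=1..M - 1. ln (Y / real (Suc b))) = (real M - 1) * ln Y - (\<Sum>b=1..M - 1. ln (real (Suc b)))" .
    have "(\<Sum>b=1..M - 1. ln (real (Suc b))) = (\<Sum>m=2..M. ln (real m))"
      by (rule sum.reindex_bij_witness[where i = "\<lambda>m. m - 1" and j = Suc]) (use M in auto)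
    also have "... = (\<Sum>m=1..M. ln (real m))"
      using M by (subst (2) sum.atLeast_Suc_atMost) (auto simp: numeral_2_eq_2)
    also have "... <= (real M + 1) * ln (real M + 1) - real M"
      using M by (intro sum_ln_le) auto
    finally have a: "(real M - 1) * ln Y - ((real M + 1) * ln (real M + 1) - real M) <= (\<Sum>b=1..M - 1. ln (Y / real (Suc b)))"
      unfolding e1 by linarith
    have "ln (real M + 1) <= ln (real M) + 1 / real M"
      using ln_step[of "real M" 1] M by (simp add: ln_div)
    then have "(real M + 1) * ln (real M + 1) <= (real M + 1) * (ln (real M) + 1 / real M)"
      by (intro mult_left_mono) auto
    also have "... <= (real M + 1) * ln Y + 2"
    proof -
      have "(real M + 1) * ln (real M) <= (real M + 1) * ln Y" using M by (intro mult_left_mono ln_mono) auto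
      moreover have "(real M + 1) * (1 / real M) <= 2" using M by (simp add: field_simps)
      ultimately show ?thesis unfolding distrib_left by linarith
    qed
    finally have h: "(real M + 1) * ln (real M + 1) <= (real M + 1) * ln Y + 2" .
    have "(real M + 1) * ln Y - (real M - 1) * ln Y = 2 * ln Y" by (simp add: algebra_simps)
    then show ?thesis using a h M(3) by linarith
  qed
  then have "\<rho> * (Y - 3 - 2 * ln Y) <= \<rho> * (\<Sum>b=1..M - 1. ln (Y / real (Suc b)))"
    using \<rho> by (intro mult_left_mono) auto
  moreover have "E * ln (Y / real (Suc 1)) <= E * ln Y" using E Y by (intro mult_left_mono ln_mono) auto
  moreover have "(\<Sum>b=1..M - 1. 1 / sqrt (real b)) <= 2 * sqrt Y"
  proof -
    have "(\<Sum>b=1..M - 1. 1 / sqrt (real b)) <= 2 * sqrt (real (M - 1))" by (rule sum_inverse_sqrt_le)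
    also have "... <= 2 * sqrt Y" using M by (intro mult_left_mono real_sqrt_le_mono) auto
    finally show ?thesis .
  qed
  moreover have "(\<Sum>b\<in>{1..<M}. totient_ratio b * (ln (Y / real (Suc b)) / real q1) - 2 / (sqrt (real b) * real q1)) * real q1 <= fraction_sum q1 q2 Z * real q1"
    using fs by (intro mult_right_mono) auto
  ultimately show ?thesis by linarith
qed

lemma fraction_sum_lower:
  assumes k: "0 < k" "k < 1 / 2"
  shows "\<exists>X>0. \<forall>q1 q2 Z. 1 <= q1 --> 1 <= q2 --> X * real q1 <= Z --> X * real q2 <= Z -->
           fraction_sum q1 q2 Z >= (6 / pi\<^sup>2 - k) * Z / (real q1 * real q2)"
proof -
  obtain E where E: "E >= 0" "\<And>s. ratio_sum s >= (6 / pi\<^sup>2 - k / 2) * real s - E"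
    using ratio_sum_lower[of "k / 2"] k by auto
  define \<rho> where "\<rho> = 6 / pi\<^sup>2 - k / 2"
  have rho: "\<rho> > 0"
  proof -
    have "pi < 3.15" using pi_approx by simp
    then have "pi\<^sup>2 < 3.15\<^sup>2" by (intro power_strict_mono) auto
    then have "pi\<^sup>2 < 12" by (simp add: power2_eq_square)
    then have "6 / pi\<^sup>2 > 6 / 12" by (intro divide_strict_left_mono) auto
    then show ?thesis using k unfolding \<rho>_def by linarith
  qed
  have "((\<lambda>Y::real. (\<rho> * (Y - 3 - 2 * ln Y) - E * ln Y - 4 * sqrt Y) / Y) \<longlongrightarrow> \<rho>) at_top"
    using rho by real_asymp
  then have "\<forall>\<^sub>F Y in at_top. (\<rho> * (Y - 3 - 2 * ln Y) - E * ln Y - 4 * sqrt Y) / Y > \<rho> - k / 2"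
    using k by (intro order_tendstoD(1)) auto
  then obtain X0 where X0: "\<And>Y. Y >= X0 ==> (\<rho> * (Y - 3 - 2 * ln Y) - E * ln Y - 4 * sqrt Y) / Y > \<rho> - k / 2"
    by (auto simp: eventually_at_top_linorder)
  define X where "X = max X0 3"
  have ord: "fraction_sum q1 q2 Z >= (6 / pi\<^sup>2 - k) * Z / (real q1 * real q2)"
    if q: "1 <= q1" "q1 <= q2" and Z: "X * real q2 <= Z" for q1 q2 Z
  proof -
    define Y where "Y = Z / real q2"
    have Y: "Y >= X" using Z q by (simp add: Y_def field_simps)
    then have Y3: "Y >= 3" "Y > 0" by (auto simp: X_def)
    have "(\<rho> - k / 2) * Y <= \<rho> * (Y - 3 - 2 * ln Y) - E * ln Y - 4 * sqrt Y"
      using X0[of Y] Y Y3 by (simp add: X_def field_simps)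
    also have "... <= fraction_sum q1 q2 Z * real q1"
      using E rho q Y3 by (intro fraction_sum_lower_ordered) (auto simp: \<rho>_def Y_def)
    finally have "(\<rho> - k / 2) * Y / real q1 <= fraction_sum q1 q2 Z" using q by (simp add: divide_le_eq)
    then show ?thesis by (simp add: \<rho>_def Y_def mult.commute[of "real q2" "real q1"])
  qed
  show ?thesis
  proof (intro exI[of _ X] conjI allI impI)
    fix q1 q2 :: nat and Z assume q: "1 <= q1" "1 <= q2" "X * real q1 <= Z" "X * real q2 <= Z"
    show "(6 / pi\<^sup>2 - k) * Z / (real q1 * real q2) <= fraction_sum q1 q2 Z"
    proof (cases "q1 <= q2")
      case True then show ?thesis using ord[of q1 q2 Z] q by simp
    next
      case False
      then have "(6 / pi\<^sup>2 - k) * Z / (real q2 * real q1) <= fraction_sum q2 q1 Z" using ord[of q2 q1 Z] q by simp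
      then show ?thesis unfolding fraction_sum_commute[of q1 q2] mult.commute[of "real q1" "real q2"] .
    qed
  qed (auto simp: X_def)
qed

section \<open>Consecutive fractions inside a Farey interval\<close>

text \<open>
  The pairs of consecutive fractions of order \<open>T\<close>, in the coordinates of \<open>fraction_sum\<close>, between
  which \<open>k0 1 T\<close> reaches values above \<open>1 - eps\<close>.
\<close>

definition gap_pairs :: "nat => nat => real => real => ((nat \<times> nat) \<times> (nat \<times> nat)) set" where
  "gap_pairs q1 q2 T eps = {((a, b), (a', b')). a * b' = a' * b + 1 \<and>
     real (a * q1 + b * q2) <= T \<and> real (a' * q1 + b' * q2) <= T \<and>
     T < real ((a * q1 + b * q2) + (a' * q1 + b' * q2)) \<and>
     (1 - eps) * real ((a * q1 + b * q2) + (a' * q1 + b' * q2)) < T}"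

text \<open>
  The length of the set of \<open>\<alpha>\<close> between \<open>p / q\<close> and \<open>p' / q'\<close> for which \<open>q \<alpha> - p\<close> and \<open>p' - q' \<alpha>\<close>
  are both at least \<open>(1 - eps) / T\<close>.
\<close>

definition gap_length :: "real => real => nat => nat => real" where
  "gap_length T eps q q' = (T - (1 - eps) * real (q + q')) / (T * real q * real q')"

definition gap_sum :: "nat => nat => real => real => real" where
  "gap_sum q1 q2 T eps = (\<Sum>((a, b), (a', b')) \<in> gap_pairs q1 q2 T eps.
     gap_length T eps (a * q1 + b * q2) (a' * q1 + b' * q2))"

lemma finite_gap_pairs:
  assumes "q1 >= 1" "q2 >= 1"
  shows "finite (gap_pairs q1 q2 T eps)"
proof (rule finite_subset[of _ "({..nat \<lfloor>T\<rfloor>} \<times> {..nat \<lfloor>T\<rfloor>}) \<times> ({..nat \<lfloor>T\<rfloor>} \<times> {..nat \<lfloor>T\<rfloor>})"])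
  have b: "a <= nat \<lfloor>T\<rfloor>" "b <= nat \<lfloor>T\<rfloor>" if "real (a * q1 + b * q2) <= T" for a b
  proof -
    have "a * q1 + b * q2 <= nat \<lfloor>T\<rfloor>" using that by (rule le_nat_floor)
    moreover have "a <= a * q1" "b <= b * q2" using assms by auto
    ultimately show "a <= nat \<lfloor>T\<rfloor>" "b <= nat \<lfloor>T\<rfloor>" by linarith+
  qed
  show "gap_pairs q1 q2 T eps \<subseteq> ({..nat \<lfloor>T\<rfloor>} \<times> {..nat \<lfloor>T\<rfloor>}) \<times> ({..nat \<lfloor>T\<rfloor>} \<times> {..nat \<lfloor>T\<rfloor>})"
    using b unfolding gap_pairs_def by blast
qed auto

lemma gap_pairs_pos:
  assumes "((a, b), (a', b')) \<in> gap_pairs q1 q2 T eps"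
  shows "a >= 1" "b' >= 1"
proof -
  have "a * b' = a' * b + 1" using assms by (simp add: gap_pairs_def)
  then show "a >= 1" by (cases a) auto
  show "b' >= 1" using \<open>a * b' = a' * b + 1\<close> by (cases b') auto
qed

lemma gap_pairs_swap:
  "((b', a'), (b, a)) \<in> gap_pairs q2 q1 T eps \<longleftrightarrow> ((a, b), (a', b')) \<in> gap_pairs q1 q2 T eps"
proof -
  define q where "q = a * q1 + b * q2"
  define q' where "q' = a' * q1 + b' * q2"
  have e: "b' * q2 + a' * q1 = q'" "b * q2 + a * q1 = q" "q' + q = q + q'" "b' * a = a * b'" "b * a' = a' * b"
    by (simp_all add: q_def q'_def)
  show ?thesis
    unfolding gap_pairs_def mem_Collect_eq case_prod_conv e q_def[symmetric] q'_def[symmetric] by blast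
qed

lemma gap_length_commute: "gap_length T eps q q' = gap_length T eps q' q"
proof -
  have "T * real q * real q' = T * real q' * real q" by simp
  then show ?thesis unfolding gap_length_def add.commute[of q q'] by (simp only:)
qed

lemma gap_sum_commute: "gap_sum q1 q2 T eps = gap_sum q2 q1 T eps"
  unfolding gap_sum_def
proof (rule sum.reindex_bij_witness[where i = "\<lambda>((a, b), (a', b')). ((b', a'), (b, a))"
        and j = "\<lambda>((a, b), (a', b')). ((b', a'), (b, a))"])
  fix x assume x: "x \<in> gap_pairs q1 q2 T eps"
  obtain a b a' b' where xe: "x = ((a, b), (a', b'))" by (metis surj_pair)
  show "(case case x of (x, xa) => (case x of (a, b) => \<lambda>(a', b'). ((b', a'), b, a)) xa of
           (x, xa) => (case x of (a, b) => \<lambda>(a', b'). ((b', a'), b, a)) xa) = x" by (simp add: xe)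
  show "(case x of (x, xa) => (case x of (a, b) => \<lambda>(a', b'). ((b', a'), b, a)) xa) \<in> gap_pairs q2 q1 T eps"
    using x by (simp add: xe gap_pairs_swap)
  have "gap_length T eps (b' * q2 + a' * q1) (b * q2 + a * q1) = gap_length T eps (a * q1 + b * q2) (a' * q1 + b' * q2)"
    unfolding add.commute[of "b' * q2"] add.commute[of "b * q2"] by (rule gap_length_commute)
  then show "(case case x of (x, xa) => (case x of (a, b) => \<lambda>(a', b'). ((b', a'), b, a)) xa of
           (x, xa) => (case x of (a, b) => \<lambda>(a', b'). gap_length T eps (a * q2 + b * q1) (a' * q2 + b' * q1)) xa) =
        (case x of (x, xa) => (case x of (a, b) => \<lambda>(a', b'). gap_length T eps (a * q1 + b * q2) (a' * q1 + b' * q2)) xa)"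
    by (simp add: xe)
next
  fix x assume x: "x \<in> gap_pairs q2 q1 T eps"
  obtain a b a' b' where xe: "x = ((a, b), (a', b'))" by (metis surj_pair)
  show "(case case x of (x, xa) => (case x of (a, b) => \<lambda>(a', b'). ((b', a'), b, a)) xa of
           (x, xa) => (case x of (a, b) => \<lambda>(a', b'). ((b', a'), b, a)) xa) = x" by (simp add: xe)
  show "(case x of (x, xa) => (case x of (a, b) => \<lambda>(a', b'). ((b', a'), b, a)) xa) \<in> gap_pairs q1 q2 T eps"
    using x by (simp add: xe gap_pairs_swap)
qed

text \<open>
  \<open>modular_box_count\<close> for moduli with a large simple prime factor, as a double sum to which
  two-dimensional summation by parts applies.
\<close>

lemma box_count_sum:
  assumes B: "has_large_prime P B" "B > 0" and \<sigma>: "coprime \<sigma> (int B)" and P: "P >= 1"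
  shows "(\<Sum>i=1..s. \<Sum>j=1..t. if [int (A0 + i) * int (b0 + j) = \<sigma>] (mod int B) then 1 else 0)
     >= totient_ratio B / real B * real s * real t - 4096 * real P powr (- 1/8) * (real B + real s + real t)"
proof -
  obtain p where p: "prime p" "P <= p" "p dvd B" "\<not> p ^ 2 dvd B" using B by (auto simp: has_large_prime_def)
  then obtain d where d: "B = p * d" by blast
  have pd: "\<not> p dvd d"
  proof
    assume "p dvd d"
    then have "p * p dvd p * d" by simp
    then show False using p d by (simp add: power2_eq_square)
  qed
  have d0: "d > 0" using B d by (cases d) auto
  let ?S = "{(x, y) \<in> {int A0<..int A0 + int s} \<times> {int b0<..int b0 + int t}. [x * y = \<sigma>] (mod int (p * d))}"
  have "real (card ?S) >= totient_ratio (p * d) / real (p * d) * real s * real t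
       - 4096 * real p powr (- 1/8) * (real (p * d) + real s + real t)"
    using \<sigma> d by (intro modular_box_count[OF p(1) pd d0]) auto
  moreover have "4096 * real p powr (- 1/8) * (real (p * d) + real s + real t) <= 4096 * real P powr (- 1/8) * (real (p * d) + real s + real t)"
    using p P by (intro mult_right_mono mult_left_mono powr_mono2') auto
  moreover have "(\<Sum>i=1..s. \<Sum>j=1..t. if [int (A0 + i) * int (b0 + j) = \<sigma>] (mod int B) then 1 else 0) = real (card ?S)"
  proof -
    let ?R = "{z \<in> {1..s} \<times> {1..t}. [int (A0 + fst z) * int (b0 + snd z) = \<sigma>] (mod int B)}"
    have "(\<Sum>i=1..s. \<Sum>j=1..t. if [int (A0 + i) * int (b0 + j) = \<sigma>] (mod int B) then 1 else (0::real)) = real (card ?R)"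
      unfolding sum.cartesian_product case_prod_beta by (simp add: sum.If_cases Int_def)
    also have "card ?R = card ?S"
    proof (rule bij_betw_same_card[of "\<lambda>z. (int (A0 + fst z), int (b0 + snd z))"], rule bij_betwI')
      fix x y assume "x \<in> ?R" "y \<in> ?R"
      show "(int (A0 + fst x), int (b0 + snd x)) = (int (A0 + fst y), int (b0 + snd y)) \<longleftrightarrow> x = y"
        by (auto simp: prod_eq_iff)
    next
      fix x assume "x \<in> ?R"
      then show "(int (A0 + fst x), int (b0 + snd x)) \<in> ?S" by (auto simp: d)
    next
      fix z assume z: "z \<in> ?S"
      obtain x y where xy: "z = (x, y)" by (cases z)
      have r: "int A0 < x" "x <= int A0 + int s" "int b0 < y" "y <= int b0 + int t" "[x * y = \<sigma>] (mod int B)"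
        using z xy d by auto
      define i where "i = nat (x - int A0)"
      define j where "j = nat (y - int b0)"
      have ij: "x = int (A0 + i)" "y = int (b0 + j)" using r by (auto simp: i_def j_def)
      have "(i, j) \<in> ?R" using r ij by auto
      then show "\<exists>x\<in>?R. z = (int (A0 + fst x), int (b0 + snd x))" using ij xy by (intro bexI[of _ "(i, j)"]) auto
    qed
    finally show ?thesis .
  qed
  ultimately show ?thesis unfolding d by linarith
qed

lemma scale_pos:
  assumes "1 <= q" "real q <= eps\<^sup>2 * T" shows "0 < T"
proof (rule ccontr)
  assume "\<not> 0 < T"
  then have "eps\<^sup>2 * T <= 0" by (simp add: mult_nonneg_nonpos)
  then show False using assms by simp
qed

text \<open>
  A pair of \<open>gap_pairs\<close> is recovered from its mediant \<open>(A, B)\<close> and the second coordinate \<open>b\<close> of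
  one of the two fractions. Only \<open>b\<close> between \<open>2 eps B\<close> and \<open>B / 4\<close> are used: this costs a bounded
  factor inside the logarithm, makes \<open>b\<close> the smaller second coordinate, and guarantees that both
  denominators are at most \<open>T\<close>.
\<close>

definition split_ok :: "nat => nat => real => real => nat => nat => nat => bool" where
  "split_ok q1 q2 T eps A B b \<longleftrightarrow> T < real (A * q1 + B * q2) \<and> (1 - eps) * real (A * q1 + B * q2) < T \<and>
     1 <= A \<and> 2 * eps * real B <= real b \<and> 4 * b <= B \<and> 1 <= b"

text \<open>
  As \<open>a / A\<close> is close to \<open>b / B\<close>, the denominators of the two fractions are about \<open>b / B\<close> and
  \<open>1 - b / B\<close> times that of the mediant. The latter may exceed \<open>T\<close> by the factor \<open>1 / (1 - eps)\<close>,
  which \<open>b >= 2 eps B\<close> compensates.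
\<close>

lemma split_sizes:
  fixes q1 q2 A B b a :: nat and \<tau> :: int
  assumes ok: "split_ok q1 q2 T eps A B b" and eps: "0 < eps" "eps <= 1 / 16"
    and q1: "1 <= q1" "real q1 <= eps\<^sup>2 * T" and \<tau>: "\<bar>\<tau>\<bar> = 1" and a: "int a * int B = int A * int b + \<tau>"
  shows "a <= A" "b <= B" "real (a * q1 + b * q2) <= T" "real ((A - a) * q1 + (B - b) * q2) <= T"
    "real (a * q1 + b * q2) <= real b / real B * (T * (1 + 3 * eps))"
    "real ((A - a) * q1 + (B - b) * q2) <= T * (1 + 2 * eps)"
proof -
  define c where "c = real (A * q1 + B * q2)"
  have c: "T < c" "(1 - eps) * c < T" and A: "1 <= A" and b: "2 * eps * real B <= real b" "4 * b <= B" "1 <= b"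
    using ok by (auto simp: split_ok_def c_def)
  have B: "B >= 4" "real B > 0" using b by auto
  have T0: "T > 0" using q1 eps by (metis less_le_trans mult_pos_pos of_nat_0_less_iff zero_less_power zero_less_mult_pos less_eq_Suc_le One_nat_def)
  have cT: "c <= T * (1 + 2 * eps)"
  proof -
    have "T <= T * ((1 + 2 * eps) * (1 - eps))"
    proof -
      have "1 <= (1 + 2 * eps) * (1 - eps)" using eps by (simp add: algebra_simps)
      then show ?thesis using T0 by simp
    qed
    then have "(1 - eps) * c <= (1 - eps) * (T * (1 + 2 * eps))" using c by (simp add: mult_ac)
    then show ?thesis using eps by (subst (asm) mult_le_cancel_left_pos) auto
  qed
  have tau: "\<tau> = 1 \<or> \<tau> = -1" using \<tau> by linarith
  have ra: "real a * real B = real A * real b + of_int \<tau>"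
    using arg_cong[OF a, of real_of_int] by simp
  have q: "real (a * q1 + b * q2) = real b / real B * c + of_int \<tau> * real q1 / real B"
  proof -
    have "real (a * q1 + b * q2) * real B = real b * c + of_int \<tau> * real q1"
    proof -
      have "real (a * q1 + b * q2) * real B = (real a * real B) * real q1 + real b * real B * real q2" by (simp add: algebra_simps)
      also have "... = real b * c + of_int \<tau> * real q1" unfolding ra by (simp add: c_def algebra_simps)
      finally show ?thesis .
    qed
    then have "real (a * q1 + b * q2) = (real b * c + of_int \<tau> * real q1) / real B" using B by (simp add: field_simps)
    then show ?thesis by (simp add: add_divide_distrib)
  qed
  have e2: "eps\<^sup>2 <= eps / 16" using eps by (simp add: power2_eq_square mult_left_mono)
  have qe: "real q1 <= eps * T / 16" using order_trans[OF q1(2) mult_right_mono[OF e2, of T]] T0 by simp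
  have t1: "of_int \<tau> * real q1 / real B <= real b / real B * (eps * T)"
  proof -
    have "of_int \<tau> * real q1 <= real q1" using tau by auto
    also have "... <= 1 * (eps * T)" using qe mult_pos_pos[OF eps(1) T0] by linarith
    also have "... <= real b * (eps * T)" using b eps T0 by (intro mult_right_mono) auto
    finally have "of_int \<tau> * real q1 / real B <= real b * (eps * T) / real B" by (intro divide_right_mono) auto
    then show ?thesis by simp
  qed
  show up: "real (a * q1 + b * q2) <= real b / real B * (T * (1 + 3 * eps))"
  proof -
    have "real b / real B * c <= real b / real B * (T * (1 + 2 * eps))" using cT by (intro mult_left_mono) auto
    then have "real (a * q1 + b * q2) <= real b / real B * (T * (1 + 2 * eps)) + real b / real B * (eps * T)" unfolding q using t1 by linarith
    also have "... = real b / real B * (T * (1 + 3 * eps))" by (simp only: distrib_left[symmetric]) (simp add: algebra_simps)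
    finally show ?thesis .
  qed
  also have "... <= (1 / 4) * (T * 2)"
    using b B eps T0 by (intro mult_mono mult_left_mono) (auto simp: field_simps)
  finally show "real (a * q1 + b * q2) <= T" using T0 by simp
  show bB: "b <= B" using b by simp
  show aA: "a <= A"
  proof (rule ccontr)
    assume "\<not> a <= A"
    then have "(A + 1) * B <= a * B" by (intro mult_right_mono) auto
    then have "int A * int B + int B <= int A * int b + \<tau>" using a by (metis (mono_tags, opaque_lifting) add_mult_distrib mult_1 of_nat_add of_nat_le_iff of_nat_mult)
    moreover have "int A * int b <= int A * int B" using bB by (intro mult_left_mono) auto
    ultimately show False using tau B by auto
  qed
  have other: "real ((A - a) * q1 + (B - b) * q2) = c - real (a * q1 + b * q2)"
    by (simp only: of_nat_add of_nat_mult of_nat_diff[OF aA] of_nat_diff[OF bB] c_def) (simp add: algebra_simps)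
  show "real ((A - a) * q1 + (B - b) * q2) <= T * (1 + 2 * eps)" unfolding other using cT by linarith
  have "real b / real B * c >= 2 * eps * T"
  proof -
    have "2 * eps <= real b / real B" using b B by (simp add: field_simps)
    then show ?thesis using c T0 eps by (intro mult_mono) auto
  qed
  moreover have "of_int \<tau> * real q1 / real B >= - (eps * T / 16)"
  proof -
    have "real q1 * 1 <= real q1 * real B" using B by (intro mult_left_mono) auto
    then have "real q1 / real B <= real q1" using B by (simp add: divide_le_eq)
    moreover have "- (real q1 / real B) <= of_int \<tau> * real q1 / real B" using tau by (elim disjE) auto
    ultimately show ?thesis using qe by linarith
  qed
  moreover have "c - T <= (3 / 2) * (eps * T)"
  proof -
    have "T <= T * ((1 + 3 / 2 * eps) * (1 - eps))"
    proof -
      have "0 <= eps * (1 / 2 - 3 / 2 * eps)" using eps by (intro mult_nonneg_nonneg) auto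
      then have "1 <= (1 + 3 / 2 * eps) * (1 - eps)" by (simp add: algebra_simps)
      then show ?thesis using T0 by simp
    qed
    then have "(1 - eps) * c <= (1 - eps) * (T * (1 + 3 / 2 * eps))" using c by (simp add: mult_ac)
    then have "c <= T * (1 + 3 / 2 * eps)" using eps by (subst (asm) mult_le_cancel_left_pos) auto
    then show ?thesis by (simp add: algebra_simps)
  qed
  moreover have "0 < eps * T" using eps T0 by simp
  ultimately show "real ((A - a) * q1 + (B - b) * q2) <= T" unfolding other q by linarith
qed

text \<open>The sign \<open>\<tau>\<close> says whether the fraction with second coordinate \<open>b\<close> is the left or the right one.\<close>

definition split_set :: "nat => nat => real => real => nat set => int => (nat \<times> nat \<times> nat) set" where
  "split_set q1 q2 T eps G \<tau> = {(B, A, b). B \<in> G \<and> split_ok q1 q2 T eps A B b \<and> [int A * int b = - \<tau>] (mod int B)}"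

text \<open>
  A lower bound for \<open>gap_length\<close> that for given \<open>B\<close> is a function of \<open>A\<close> times a function of \<open>b\<close>;
  the product of the two denominators is replaced by its upper bound \<open>(b / B) T\<^sup>2 (1 + 8 eps)\<close>.
\<close>

definition split_weight :: "nat => nat => real => real => nat => nat => nat => real" where
  "split_weight q1 q2 T eps B A b = real B / (T\<^sup>2 * (1 + 8 * eps)) * ((1 - (1 - eps) * real (A * q1 + B * q2) / T) * (1 / real b))"

definition split_map :: "int => nat \<times> nat \<times> nat => (nat \<times> nat) \<times> (nat \<times> nat)" where
  "split_map \<tau> = (\<lambda>(B, A, b). let a = nat ((int A * int b + \<tau>) div int B) in
     if \<tau> = 1 then ((a, b), (A - a, B - b)) else ((A - a, B - b), (a, b)))"

lemma split_map_properties: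
  assumes x: "(B, A, b) \<in> split_set q1 q2 T eps G \<tau>" and eps: "0 < eps" "eps <= 1 / 16"
    and q1: "1 <= q1" "real q1 <= eps\<^sup>2 * T" "1 <= q2" and \<tau>: "\<tau> = 1 \<or> \<tau> = - 1"
  obtains a b' a' where
    "split_map \<tau> (B, A, b) = (if \<tau> = 1 then ((a, b), (a', b')) else ((a', b'), (a, b)))"
    "a + a' = A" "b + b' = B" "b < b'"
    "split_map \<tau> (B, A, b) \<in> gap_pairs q1 q2 T eps"
    "split_weight q1 q2 T eps B A b <= gap_length T eps (a * q1 + b * q2) (a' * q1 + b' * q2)"
proof -
  have ok: "split_ok q1 q2 T eps A B b" and cong: "[int A * int b = - \<tau>] (mod int B)"
    using x by (auto simp: split_set_def)
  have A: "1 <= A" and b: "4 * b <= B" "1 <= b" using ok by (auto simp: split_ok_def)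
  have B: "B >= 4" using b by simp
  have T0: "T > 0" by (rule scale_pos[OF q1(1,2)])
  define a where "a = nat ((int A * int b + \<tau>) div int B)"
  have "int B dvd int A * int b + \<tau>" using cong by (simp add: cong_iff_dvd_diff)
  moreover have nn: "0 <= int A * int b + \<tau>"
  proof -
    have "int A * int b >= 1 * 1" using A b by (intro mult_mono) auto
    then show ?thesis using \<tau> by auto
  qed
  ultimately have a: "int a * int B = int A * int b + \<tau>"
    using B by (simp add: a_def pos_imp_zdiv_nonneg_iff)
  have abs\<tau>: "\<bar>\<tau>\<bar> = 1" using \<tau> by auto
  note sz = split_sizes[OF ok eps q1(1,2) abs\<tau> a]
  define a' where "a' = A - a"
  define b' where "b' = B - b"
  have sum: "a + a' = A" "b + b' = B" using sz by (auto simp: a'_def b'_def)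
  have lt: "b < b'" using b by (simp add: b'_def)
  have m: "split_map \<tau> (B, A, b) = (if \<tau> = 1 then ((a, b), (a', b')) else ((a', b'), (a, b)))"
    by (simp add: split_map_def a_def a'_def b'_def Let_def)
  have AA: "int A = int a + int a'" "int B = int b + int b'" using sum by auto
  have det: "int a * int b' - int a' * int b = \<tau>"
    using a unfolding AA by (simp add: algebra_simps)
  have tot: "(a * q1 + b * q2) + (a' * q1 + b' * q2) = A * q1 + B * q2"
    unfolding sum[symmetric] by (simp add: algebra_simps)
  have tot': "(a' * q1 + b' * q2) + (a * q1 + b * q2) = A * q1 + B * q2" using tot by simp
  have lim: "T < real ((a * q1 + b * q2) + (a' * q1 + b' * q2))" "(1 - eps) * real ((a * q1 + b * q2) + (a' * q1 + b' * q2)) < T"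
    unfolding tot using ok by (simp_all only: split_ok_def)
  have lim': "T < real ((a' * q1 + b' * q2) + (a * q1 + b * q2))" "(1 - eps) * real ((a' * q1 + b' * q2) + (a * q1 + b * q2)) < T"
    unfolding tot' using ok by (simp_all only: split_ok_def)
  have mem: "split_map \<tau> (B, A, b) \<in> gap_pairs q1 q2 T eps"
  proof (cases "\<tau> = 1")
    case True
    then have "int (a * b') = int (a' * b + 1)" using det by simp
    then have "a * b' = a' * b + 1" by (simp only: of_nat_eq_iff)
    then show ?thesis using sz(3,4) lim unfolding m a'_def[symmetric] b'_def[symmetric] gap_pairs_def
      using True by (simp only: simp_thms if_True mem_Collect_eq case_prod_conv)
  next
    case False
    then have "int (a' * b) = int (a * b' + 1)" using det \<tau> by simp
    then have "a' * b = a * b' + 1" by (simp only: of_nat_eq_iff)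
    then show ?thesis using sz(3,4) lim' unfolding m a'_def[symmetric] b'_def[symmetric] gap_pairs_def
      using False by (simp only: simp_thms if_False mem_Collect_eq case_prod_conv)
  qed
  define q where "q = real (a * q1 + b * q2)"
  define q' where "q' = real (a' * q1 + b' * q2)"
  define c where "c = real (A * q1 + B * q2)"
  have qpos: "q > 0" "q' > 0" using b lt q1 by (auto simp: q_def q'_def add_nonneg_pos)
  have qc: "q + q' = c" unfolding q_def q'_def c_def tot[symmetric] by simp
  have "q * q' <= (real b / real B * (T * (1 + 3 * eps))) * (T * (1 + 2 * eps))"
    using sz qpos by (intro mult_mono) (auto simp: q_def q'_def a'_def b'_def)
  also have "... = real b / real B * T\<^sup>2 * ((1 + 3 * eps) * (1 + 2 * eps))" by (simp add: power2_eq_square mult_ac)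
  also have "... <= real b / real B * T\<^sup>2 * (1 + 8 * eps)"
  proof (intro mult_left_mono)
    have "6 * eps * eps <= 3 * eps" using eps by simp
    then show "(1 + 3 * eps) * (1 + 2 * eps) <= 1 + 8 * eps" by (simp add: algebra_simps)
  qed auto
  finally have qq: "q * q' <= real b / real B * T\<^sup>2 * (1 + 8 * eps)" .
  have w: "0 <= 1 - (1 - eps) * c / T" using ok T0 by (simp add: split_ok_def c_def divide_le_eq)
  have "split_weight q1 q2 T eps B A b = (1 - (1 - eps) * c / T) / (real b / real B * T\<^sup>2 * (1 + 8 * eps))"
    using B b by (simp add: split_weight_def c_def mult_ac)
  also have "... <= (1 - (1 - eps) * c / T) / (q * q')"
    using w qq qpos b B T0 eps by (intro divide_left_mono mult_pos_pos) auto
  also have "... = gap_length T eps (a * q1 + b * q2) (a' * q1 + b' * q2)"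
  proof -
    have g: "gap_length T eps (a * q1 + b * q2) (a' * q1 + b' * q2) = (T - (1 - eps) * c) / (T * q * q')"
      unfolding gap_length_def tot by (simp only: q_def q'_def c_def)
    have "1 - (1 - eps) * c / T = (T - (1 - eps) * c) / T" using T0 by (simp add: diff_divide_distrib)
    then show ?thesis unfolding g by (simp add: mult.assoc)
  qed
  finally have fin: "split_weight q1 q2 T eps B A b <= gap_length T eps (a * q1 + b * q2) (a' * q1 + b' * q2)" .
  show ?thesis by (rule that[OF m sum lt mem fin])
qed

text \<open>
  The two signs give disjoint families of pairs: \<open>b\<close> is the smaller second coordinate, and it
  belongs to the left fraction for one sign and to the right fraction for the other.
\<close>

lemma gap_sum_ge_splits:
  assumes eps: "0 < eps" "eps <= 1 / 16" and q1: "1 <= q1" "real q1 <= eps\<^sup>2 * T" "1 <= q2"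
  shows "finite (split_set q1 q2 T eps G 1)" "finite (split_set q1 q2 T eps G (- 1))"
    "(\<Sum>(B, A, b)\<in>split_set q1 q2 T eps G 1. split_weight q1 q2 T eps B A b)
     + (\<Sum>(B, A, b)\<in>split_set q1 q2 T eps G (- 1). split_weight q1 q2 T eps B A b) <= gap_sum q1 q2 T eps"
proof -
  define D where "D \<tau> = split_set q1 q2 T eps G \<tau>" for \<tau>
  define len where "len = (\<lambda>((a, b), (a', b')). gap_length T eps (a * q1 + b * q2) (a' * q1 + b' * q2))"
  have fin: "finite (gap_pairs q1 q2 T eps)" using q1 by (intro finite_gap_pairs) auto
  have into: "split_map \<tau> ` D \<tau> \<subseteq> gap_pairs q1 q2 T eps" if \<tau>: "\<tau> = 1 \<or> \<tau> = - 1" for \<tau>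
  proof (rule image_subsetI)
    fix x assume x: "x \<in> D \<tau>"
    obtain B A b where xe: "x = (B, A, b)" by (cases x)
    show "split_map \<tau> x \<in> gap_pairs q1 q2 T eps"
      using x unfolding D_def xe by (rule split_map_properties[OF _ eps q1 \<tau>])
  qed
  have inj: "inj_on (split_map \<tau>) (D \<tau>)" if \<tau>: "\<tau> = 1 \<or> \<tau> = - 1" for \<tau>
  proof (rule inj_onI)
    fix x y assume xy: "x \<in> D \<tau>" "y \<in> D \<tau>" "split_map \<tau> x = split_map \<tau> y"
    obtain B1 A1 b1 where xe: "x = (B1, A1, b1)" by (cases x)
    obtain B2 A2 b2 where ye: "y = (B2, A2, b2)" by (cases y)
    have 1: "(B1, A1, b1) \<in> D \<tau>" and 2: "(B2, A2, b2) \<in> D \<tau>" and eq: "split_map \<tau> (B1, A1, b1) = split_map \<tau> (B2, A2, b2)"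
      using xy xe ye by auto
    obtain a a' b' where p1: "split_map \<tau> (B1, A1, b1) = (if \<tau> = 1 then ((a, b1), (a', b')) else ((a', b'), (a, b1)))" "a + a' = A1" "b1 + b' = B1"
      using 1 unfolding D_def by (rule split_map_properties[OF _ eps q1 \<tau>])
    obtain c c' d' where p2: "split_map \<tau> (B2, A2, b2) = (if \<tau> = 1 then ((c, b2), (c', d')) else ((c', d'), (c, b2)))" "c + c' = A2" "b2 + d' = B2"
      using 2 unfolding D_def by (rule split_map_properties[OF _ eps q1 \<tau>])
    show "x = y" unfolding xe ye using eq p1 p2 by (auto split: if_splits)
  qed
  have finD: "finite (D \<tau>)" if "\<tau> = 1 \<or> \<tau> = - 1" for \<tau>
    using finite_subset[OF into[OF that] fin] inj[OF that] by (rule finite_imageD)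
  then show "finite (split_set q1 q2 T eps G 1)" "finite (split_set q1 q2 T eps G (- 1))" by (auto simp: D_def)
  have wt: "(\<Sum>(B, A, b)\<in>D \<tau>. split_weight q1 q2 T eps B A b) <= (\<Sum>x\<in>split_map \<tau> ` D \<tau>. len x)" if \<tau>: "\<tau> = 1 \<or> \<tau> = - 1" for \<tau>
  proof -
    have "(\<Sum>(B, A, b)\<in>D \<tau>. split_weight q1 q2 T eps B A b) <= (\<Sum>x\<in>D \<tau>. len (split_map \<tau> x))"
    proof (rule sum_mono)
      fix x assume x: "x \<in> D \<tau>"
      obtain B A b where xe: "x = (B, A, b)" by (cases x)
      have 1: "(B, A, b) \<in> D \<tau>" using x xe by simp
      obtain a a' b' where p1: "split_map \<tau> (B, A, b) = (if \<tau> = 1 then ((a, b), (a', b')) else ((a', b'), (a, b)))"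
        "split_weight q1 q2 T eps B A b <= gap_length T eps (a * q1 + b * q2) (a' * q1 + b' * q2)"
        using 1 unfolding D_def by (rule split_map_properties[OF _ eps q1 \<tau>])
      have "len (split_map \<tau> (B, A, b)) = gap_length T eps (a * q1 + b * q2) (a' * q1 + b' * q2)"
        unfolding p1 len_def by (simp add: gap_length_def add.commute mult_ac)
      then show "(case x of (B, A, b) => split_weight q1 q2 T eps B A b) <= len (split_map \<tau> x)" using p1 xe by simp
    qed
    then show ?thesis using inj[OF \<tau>] by (simp add: sum.reindex)
  qed
  have order: "if \<tau> = 1 then snd (fst x) < snd (snd x) else snd (snd x) < snd (fst x)"
    if \<tau>: "\<tau> = 1 \<or> \<tau> = - 1" and x: "x \<in> split_map \<tau> ` D \<tau>" for \<tau> x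
  proof -
    obtain B A b where 1: "(B, A, b) \<in> D \<tau>" "x = split_map \<tau> (B, A, b)" using x by (metis imageE prod_cases3)
    obtain a a' b' where "split_map \<tau> (B, A, b) = (if \<tau> = 1 then ((a, b), (a', b')) else ((a', b'), (a, b)))" "b < b'"
      using 1(1) unfolding D_def by (rule split_map_properties[OF _ eps q1 \<tau>])
    then show ?thesis using 1 by simp
  qed
  have disj: "split_map 1 ` D 1 \<inter> split_map (- 1) ` D (- 1) = {}"
  proof (rule ccontr)
    assume "split_map 1 ` D 1 \<inter> split_map (- 1) ` D (- 1) ~= {}"
    then obtain x where "x \<in> split_map 1 ` D 1" "x \<in> split_map (- 1) ` D (- 1)" by blast
    then show False using order[of 1 x] order[of "- 1" x] by simp
  qed
  have "(\<Sum>(B, A, b)\<in>D 1. split_weight q1 q2 T eps B A b) + (\<Sum>(B, A, b)\<in>D (- 1). split_weight q1 q2 T eps B A b)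
     <= (\<Sum>x\<in>split_map 1 ` D 1. len x) + (\<Sum>x\<in>split_map (- 1) ` D (- 1). len x)"
    by (intro add_mono wt) auto
  also have "... = (\<Sum>x\<in>split_map 1 ` D 1 \<union> split_map (- 1) ` D (- 1). len x)"
    using disj finD by (subst sum.union_disjoint) auto
  also have "... <= (\<Sum>x\<in>gap_pairs q1 q2 T eps. len x)"
  proof (rule sum_mono2[OF fin])
    show "split_map 1 ` D 1 \<union> split_map (- 1) ` D (- 1) \<subseteq> gap_pairs q1 q2 T eps" using into by auto
    fix x assume x: "x \<in> gap_pairs q1 q2 T eps - (split_map 1 ` D 1 \<union> split_map (- 1) ` D (- 1))"
    obtain a b a' b' where x': "x = ((a, b), (a', b'))" by (metis surj_pair)
    have "real (a * q1 + b * q2) <= T" using x x' by (auto simp: gap_pairs_def)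
    then have "0 <= T" by (meson of_nat_0_le_iff order_trans)
    then show "0 <= len x" using x x' by (auto simp: gap_pairs_def len_def gap_length_def intro!: divide_nonneg_nonneg)
  qed
  also have "... = gap_sum q1 q2 T eps" by (simp add: gap_sum_def len_def case_prod_beta)
  finally show "(\<Sum>(B, A, b)\<in>split_set q1 q2 T eps G 1. split_weight q1 q2 T eps B A b)
     + (\<Sum>(B, A, b)\<in>split_set q1 q2 T eps G (- 1). split_weight q1 q2 T eps B A b) <= gap_sum q1 q2 T eps"
    by (simp add: D_def)
qed

text \<open>
  One modulus \<open>B\<close>. The solutions of the congruence are equidistributed in all boxes
  \<open>A0 < A <= A0 + s\<close>, \<open>b0 < b <= b0 + t\<close>, so the weights may be summed independently: the weights
  of \<open>A\<close> form a triangle of height about \<open>eps\<close>, and the weights \<open>1 / b\<close> add up to a logarithm. The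
  error \<open>P\<^bsup>-1/8\<^esup> <= eps ^ 3\<close> of equidistribution stays below the main term \<open>eps\<^sup>2 ln (1 / eps)\<close>.
\<close>

lemma row_estimate:
  fixes q1 q2 B P :: nat and T eps :: real and \<sigma> :: int
  assumes eps: "0 < eps" "eps <= 1 / 16" and q: "1 <= q1" "q1 <= q2" "real q1 <= eps\<^sup>2 * T"
    and B: "has_large_prime P B" "real B * real q2 <= T" "2 <= eps * real B"
    and P: "P >= 1" "real P powr (- 1/8) <= eps ^ 3" and \<sigma>: "coprime \<sigma> (int B)"
  defines "A0 \<equiv> nat \<lfloor>(T - real B * real q2) / real q1\<rfloor>" and "H1 \<equiv> nat \<lfloor>2 * eps * T / real q1\<rfloor>"
    and "b0 \<equiv> nat \<lceil>2 * eps * real B\<rceil>" and "H2 \<equiv> B div 4 - nat \<lceil>2 * eps * real B\<rceil>"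
  defines "v \<equiv> (\<lambda>i. max 0 (1 - (1 - eps) * real ((A0 + i) * q1 + B * q2) / T))"
  shows "real B * (\<Sum>i=1..H1. \<Sum>j=1..H2. (if [int (A0 + i) * int (b0 + j) = \<sigma>] (mod int B) then 1 else 0) * v i * (1 / real (b0 + j)))
     >= T / real q1 * (totient_ratio B * (eps\<^sup>2 / 2) * (1 - eps)\<^sup>2 * ln (1 / (16 * eps)) - 6144 * eps ^ 3)"
    "\<And>i. T < real ((A0 + i + 1) * q1 + B * q2)"
proof -
  have T0: "T > 0" by (rule scale_pos[OF q(1,3)])
  have q0: "real q1 > 0" "real q2 > 0" using q by auto
  have rB: "real B >= 32" "real B > 0"
  proof -
    have "eps * real B <= (1 / 16) * real B" using eps by (intro mult_right_mono) auto
    then show "real B >= 32" "real B > 0" using B by linarith+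
  qed
  define F where "F = (T - real B * real q2) / real q1"
  have F: "F >= 0" "F * real q1 = T - real B * real q2" using B q0 by (auto simp: F_def)
  have A0: "real A0 <= F" "F < real A0 + 1" using F(1) by (auto simp: A0_def F_def[symmetric])
  have Ac: "T < real ((A0 + i + 1) * q1 + B * q2)" for i
  proof -
    have "F * real q1 < (real A0 + 1) * real q1" using A0 q0 by (intro mult_strict_right_mono) auto
    also have "... <= (real A0 + real i + 1) * real q1" using q0 by (intro mult_right_mono) auto
    finally show ?thesis using F by (simp add: algebra_simps)
  qed
  then show "\<And>i. T < real ((A0 + i + 1) * q1 + B * q2)" .
  \<comment> \<open>The weights v decrease linearly with slope d from w0 to 0, and H1 terms suffice to reach 0.\<close>
  define d where "d = (1 - eps) * real q1 / T"
  define w0 where "w0 = 1 - (1 - eps) * real ((A0 + 1) * q1 + B * q2) / T"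
  have qT: "real q1 / T <= eps\<^sup>2" using q T0 by (simp add: divide_le_eq)
  have e2: "eps\<^sup>2 <= eps" using eps by (simp add: power2_eq_square)
  have d0: "d > 0" using eps q0 T0 by (simp add: d_def)
  have v: "v i = max 0 (w0 - (real i - 1) * d)" for i
    unfolding v_def w0_def d_def by (simp add: algebra_simps add_divide_distrib diff_divide_distrib)
  have w0u: "w0 <= eps"
  proof -
    have "(1 - eps) * T <= (1 - eps) * real ((A0 + 1) * q1 + B * q2)"
      using Ac[of 0] eps by (intro mult_left_mono) auto
    then have "(1 - eps) <= (1 - eps) * real ((A0 + 1) * q1 + B * q2) / T" using T0 by (simp add: le_divide_eq)
    then show ?thesis by (simp add: w0_def)
  qed
  have w0l: "w0 >= eps * (1 - eps)"
  proof -
    have "real ((A0 + 1) * q1 + B * q2) <= T + real q1"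
      using mult_right_mono[OF A0(1), of "real q1"] F by (simp add: algebra_simps)
    then have "(1 - eps) * real ((A0 + 1) * q1 + B * q2) / T <= (1 - eps) * (T + real q1) / T"
      using eps T0 by (intro divide_right_mono mult_left_mono) auto
    also have "... = (1 - eps) * (1 + real q1 / T)" using T0 by (simp add: field_simps)
    also have "... <= (1 - eps) + real q1 / T"
    proof -
      have "(1 - eps) * (real q1 / T) <= 1 * (real q1 / T)" using eps T0 by (intro mult_right_mono) auto
      then show ?thesis by (simp only: distrib_left mult_1_left mult_1_right add_le_cancel_left)
    qed
    finally show ?thesis using qT by (simp add: w0_def power2_eq_square algebra_simps)
  qed
  have "0 <= eps * (1 - eps)" using eps by (intro mult_nonneg_nonneg) auto
  then have w00: "w0 >= 0" using w0l by linarith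
  have H1: "real H1 <= 2 * eps * T / real q1" "real H1 > 2 * eps * T / real q1 - 1"
  proof -
    have "2 * eps * T / real q1 >= 0" using eps T0 by simp
    then show "real H1 <= 2 * eps * T / real q1" "real H1 > 2 * eps * T / real q1 - 1" unfolding H1_def by linarith+
  qed
  have Tq: "T / real q1 >= 256"
  proof -
    have "eps\<^sup>2 <= (1 / 16)\<^sup>2" using eps by (intro power_mono) auto
    then have "eps\<^sup>2 * T <= (1 / 256) * T" using T0 by (intro mult_right_mono) (auto simp: power2_eq_square)
    then have "real q1 <= T / 256" using q by simp
    then show ?thesis using q0 by (simp add: field_simps)
  qed
  have eTq: "eps * (T / real q1) >= 16"
  proof -
    have "1 / eps >= 16" using eps by (simp add: field_simps)
    moreover have "eps * (T / real q1) >= 1 / eps" using q q0 eps by (simp add: field_simps power2_eq_square)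
    ultimately show ?thesis by linarith
  qed
  have H11: "H1 >= 1" using H1 eTq by (simp add: mult.assoc)
  have H1d: "real H1 * d >= w0"
  proof -
    have "(2 * eps * T / real q1 - 1) * d <= real H1 * d" using H1 d0 by (intro mult_right_mono) auto
    moreover have "(2 * eps * T / real q1 - 1) * d = (1 - eps) * (2 * eps - real q1 / T)"
      using q0 T0 by (simp add: d_def field_simps)
    moreover have "(1 - eps) * (2 * eps - real q1 / T) >= (15 / 16) * (eps * (31 / 16))"
    proof (intro mult_mono)
      have "eps\<^sup>2 <= eps / 16" using eps by (simp add: power2_eq_square mult_left_mono)
      then show "eps * (31 / 16) <= 2 * eps - real q1 / T" using qT by linarith
    qed (use eps in auto)
    ultimately show ?thesis using w0u eps by linarith
  qed
  have sv: "(\<Sum>i=1..H1. v i) >= T / real q1 * (eps\<^sup>2 / 2) * (1 - eps)\<^sup>2"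
  proof -
    have "T / real q1 * (eps\<^sup>2 / 2) * (1 - eps)\<^sup>2 = (eps * (1 - eps))\<^sup>2 / (2 * (real q1 / T))"
      using q0 T0 by (simp add: field_simps power2_eq_square)
    also have "... <= w0\<^sup>2 / (2 * d)"
    proof (rule frac_le)
      show "(eps * (1 - eps))\<^sup>2 <= w0\<^sup>2" using w0l eps by (intro power_mono) auto
      have "(1 - eps) * (real q1 / T) <= 1 * (real q1 / T)" using eps T0 by (intro mult_right_mono) auto
      then show "2 * d <= 2 * (real q1 / T)" by (simp add: d_def)
    qed (use d0 in auto)
    also have "... <= (\<Sum>i=1..H1. v i)" unfolding v by (rule linear_ramp_sum[OF d0 w00 H1d])
    finally show ?thesis .
  qed
  have b0: "real b0 >= 2 * eps * real B" "real b0 < 2 * eps * real B + 1" unfolding b0_def using eps by (auto simp: ceiling_less_iff) (linarith | simp)+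
  have eB: "2 * eps * real B <= real B / 8" using mult_right_mono[of "2 * eps" "1 / 8" "real B"] eps by simp
  have H2e: "b0 + H2 = B div 4" "H2 >= 1"
  proof -
    have "real (B div 4) >= real B / 4 - 1" using nat_div_lower[of B 4] by simp
    then have "real b0 + 1 <= real (B div 4)" using b0 eB rB by linarith
    then have "b0 + 1 <= B div 4" by linarith
    then show "b0 + H2 = B div 4" "H2 >= 1" unfolding H2_def b0_def by auto
  qed
  have sw: "(\<Sum>j=1..H2. 1 / real (b0 + j)) >= ln (1 / (16 * eps))"
  proof -
    have "ln (1 / (16 * eps)) <= ln ((real (Suc H2) * 1 + real b0) / (1 + real b0))"
    proof (rule ln_mono)
      have "real (Suc H2) * 1 + real b0 = real (B div 4) + 1" using H2e by (simp flip: H2e(1))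
      also have "... >= real B / 4" using nat_div_lower[of B 4] by simp
      finally have n: "real B / 4 <= real (Suc H2) * 1 + real b0" .
      have "1 / (16 * eps) = (real B / 4) / (4 * eps * real B)" using rB eps by simp
      also have "... <= (real (Suc H2) * 1 + real b0) / (1 + real b0)"
        using n b0 B eps by (intro frac_le) (auto simp: algebra_simps)
      finally show "1 / (16 * eps) <= (real (Suc H2) * 1 + real b0) / (1 + real b0)" .
      show "0 < 1 / (16 * eps)" using eps by simp
    qed
    also have "... <= (\<Sum>j=1..H2. 1 / (real j * 1 + real b0))"
      using harmonic_progression_lower[of "real b0" 1 H2] by simp
    finally show ?thesis by (simp add: add.commute)
  qed
  \<comment> \<open>4096 is the constant of box_count_sum, and each of B, s and t is at most T / q1.\<close>
  define Er where "Er = 12288 * eps ^ 3 * (T / real q1)"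
  have BT: "real B <= T / real q1"
  proof -
    have "real B * real q1 <= real B * real q2" using q by (intro mult_left_mono) auto
    then show ?thesis using B q0 by (simp add: le_divide_eq)
  qed
  have B0: "B > 0" using rB by simp
  have v1: "v 1 <= eps" "0 <= v 1" using w0u eps by (auto simp: v)
  have main: "(\<Sum>i=1..H1. \<Sum>j=1..H2. (if [int (A0 + i) * int (b0 + j) = \<sigma>] (mod int B) then 1 else 0) * v i * (1 / real (b0 + j)))
     >= totient_ratio B / real B * (\<Sum>i=1..H1. v i) * (\<Sum>j=1..H2. 1 / real (b0 + j)) - Er * v 1 * (1 / real (b0 + 1))"
  proof (rule abel_lower_2d[where w = "\<lambda>j. 1 / real (b0 + j)" and v = v])
    fix s t assume st: "s <= H1" "t <= H2"
    have H1u: "real s <= T / real q1"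
    proof -
      have "(2 * eps) * (T / real q1) <= 1 * (T / real q1)" using eps T0 by (intro mult_right_mono) auto
      then show ?thesis using H1(1) st by simp
    qed
    have tB: "real t <= real B" using st H2e by simp
    have "4096 * real P powr (- 1/8) * (real B + real s + real t) <= 4096 * eps ^ 3 * (3 * (T / real q1))"
      using P H1u tB BT T0 q0 eps(1) by (intro mult_mono) auto
    then have "4096 * real P powr (- 1/8) * (real B + real s + real t) <= Er" by (simp add: Er_def)
    then show "totient_ratio B / real B * real s * real t - Er <= (\<Sum>i=1..s. \<Sum>j=1..t. if [int (A0 + i) * int (b0 + j) = \<sigma>] (mod int B) then 1 else 0)"
      using box_count_sum[OF B(1) B0 \<sigma> P(1), of s t A0 b0] by linarith
  next
    fix k show "0 <= v k" by (simp add: v)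
    show "v (Suc k) <= v k" unfolding v using d0 by (intro max.mono) (auto simp: algebra_simps)
    show "1 / real (b0 + Suc k) <= 1 / real (b0 + k)" if "1 <= k" using that by (intro divide_left_mono) auto
  qed (use H11 H2e in auto)
  have lnn: "0 <= ln (1 / (16 * eps))" using eps by simp
  have "Er * v 1 * (1 / real (b0 + 1)) <= Er * eps * (1 / (2 * eps * real B))"
  proof (intro mult_mono)
    show "1 / real (b0 + 1) <= 1 / (2 * eps * real B)" using b0 eps rB by (intro divide_left_mono) auto
  qed (use v1 eps T0 q0 in \<open>auto simp: Er_def\<close>)
  also have "... = 6144 * eps ^ 3 * (T / real q1) / real B" using eps by (simp add: Er_def mult_ac)
  finally have er: "Er * v 1 * (1 / real (b0 + 1)) <= 6144 * eps ^ 3 * (T / real q1) / real B" .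
  have "totient_ratio B / real B * (T / real q1 * (eps\<^sup>2 / 2) * (1 - eps)\<^sup>2) * ln (1 / (16 * eps))
     <= totient_ratio B / real B * (\<Sum>i=1..H1. v i) * (\<Sum>j=1..H2. 1 / real (b0 + j))"
  proof -
    have nv: "0 <= (\<Sum>i=1..H1. v i)" by (intro sum_nonneg) (simp add: v)
    have tb: "0 <= totient_ratio B / real B" by (intro divide_nonneg_nonneg totient_ratio_bounds) auto
    have "totient_ratio B / real B * (T / real q1 * (eps\<^sup>2 / 2) * (1 - eps)\<^sup>2) * ln (1 / (16 * eps))
      <= totient_ratio B / real B * (\<Sum>i=1..H1. v i) * ln (1 / (16 * eps))"
      by (intro mult_right_mono mult_left_mono sv tb lnn)
    also have "... <= totient_ratio B / real B * (\<Sum>i=1..H1. v i) * (\<Sum>j=1..H2. 1 / real (b0 + j))"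
      by (intro mult_left_mono sw mult_nonneg_nonneg tb nv)
    finally show ?thesis .
  qed
  then have "totient_ratio B / real B * (T / real q1 * (eps\<^sup>2 / 2) * (1 - eps)\<^sup>2) * ln (1 / (16 * eps)) - 6144 * eps ^ 3 * (T / real q1) / real B
     <= (\<Sum>i=1..H1. \<Sum>j=1..H2. (if [int (A0 + i) * int (b0 + j) = \<sigma>] (mod int B) then 1 else 0) * v i * (1 / real (b0 + j)))"
    using main er by linarith
  then have "real B * (totient_ratio B / real B * (T / real q1 * (eps\<^sup>2 / 2) * (1 - eps)\<^sup>2) * ln (1 / (16 * eps)) - 6144 * eps ^ 3 * (T / real q1) / real B)
     <= real B * (\<Sum>i=1..H1. \<Sum>j=1..H2. (if [int (A0 + i) * int (b0 + j) = \<sigma>] (mod int B) then 1 else 0) * v i * (1 / real (b0 + j)))"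
    by (intro mult_left_mono) auto
  moreover have "real B * (totient_ratio B / real B * (T / real q1 * (eps\<^sup>2 / 2) * (1 - eps)\<^sup>2) * ln (1 / (16 * eps)) - 6144 * eps ^ 3 * (T / real q1) / real B)
     = T / real q1 * (totient_ratio B * (eps\<^sup>2 / 2) * (1 - eps)\<^sup>2 * ln (1 / (16 * eps)) - 6144 * eps ^ 3)"
  proof -
    have "x * (r / x * (u * (e / 2) * f) * l - g * u / x) = u * (r * (e / 2) * f * l - g)" if "x > 0" for x r u e f l g :: real
      using that by (simp add: field_simps)
    from this[OF rB(2)] show ?thesis .
  qed
  ultimately show "real B * (\<Sum>i=1..H1. \<Sum>j=1..H2. (if [int (A0 + i) * int (b0 + j) = \<sigma>] (mod int B) then 1 else 0) * v i * (1 / real (b0 + j)))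
     >= T / real q1 * (totient_ratio B * (eps\<^sup>2 / 2) * (1 - eps)\<^sup>2 * ln (1 / (16 * eps)) - 6144 * eps ^ 3)"
    by linarith
qed

text \<open>The rows of the previous lemma, added over \<open>B\<close>, reindexed as part of \<open>split_set\<close>.\<close>

lemma split_sum_ge_row:
  fixes q1 q2 P :: nat and T eps :: real and \<tau> :: int
  assumes eps: "0 < eps" "eps <= 1 / 16" and q: "1 <= q1" "q1 <= q2" "real q1 <= eps\<^sup>2 * T"
    and G: "finite G" "\<And>B. B \<in> G ==> has_large_prime P B \<and> real B * real q2 <= T \<and> 2 <= eps * real B"
    and P: "P >= 1" "real P powr (- 1/8) <= eps ^ 3" and \<tau>: "\<tau> = 1 \<or> \<tau> = - 1"
  shows "(\<Sum>(B, A, b)\<in>split_set q1 q2 T eps G \<tau>. split_weight q1 q2 T eps B A b)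
     >= (\<Sum>B\<in>G. T / real q1 * (totient_ratio B * (eps\<^sup>2 / 2) * (1 - eps)\<^sup>2 * ln (1 / (16 * eps)) - 6144 * eps ^ 3)) / (T\<^sup>2 * (1 + 8 * eps))"
proof -
  define A0 where "A0 B = nat \<lfloor>(T - real B * real q2) / real q1\<rfloor>" for B
  define H1 where "H1 = nat \<lfloor>2 * eps * T / real q1\<rfloor>"
  define b0 where "b0 B = nat \<lceil>2 * eps * real B\<rceil>" for B :: nat
  define H2 where "H2 B = B div 4 - nat \<lceil>2 * eps * real B\<rceil>" for B
  define v where "v B i = max 0 (1 - (1 - eps) * real ((A0 B + i) * q1 + B * q2) / T)" for B i
  define g where "g B i j \<longleftrightarrow> [int (A0 B + i) * int (b0 B + j) = - \<tau>] (mod int B)" for B i j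
  have T0: "T > 0" by (rule scale_pos[OF q(1,3)])
  have cop: "coprime (- \<tau>) (int B)" for B using \<tau> by auto
  have row: "real B * (\<Sum>i=1..H1. \<Sum>j=1..H2 B. (if g B i j then 1 else 0) * v B i * (1 / real (b0 B + j)))
     >= T / real q1 * (totient_ratio B * (eps\<^sup>2 / 2) * (1 - eps)\<^sup>2 * ln (1 / (16 * eps)) - 6144 * eps ^ 3)" if "B \<in> G" for B
    unfolding g_def v_def A0_def H1_def b0_def H2_def
    using G(2)[OF that] by (intro row_estimate(1)[OF eps q _ _ _ P cop]) auto
  have big: "T < real ((A0 B + i + 1) * q1 + B * q2)" if "B \<in> G" for B i
    unfolding A0_def using G(2)[OF that] by (intro row_estimate(2)[OF eps q _ _ _ P cop[of B]]) auto
  define X where "X = (SIGMA B:G. {1..H1} \<times> {1..H2 B})"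
  define X' where "X' = {(B, i, j) \<in> X. g B i j \<and> v B i > 0}"
  define \<phi> where "\<phi> = (\<lambda>(B, i, j). (B, A0 B + i, b0 B + j))"
  have finX: "finite X" using G by (auto simp: X_def)
  have q2: "1 <= q2" using q by simp
  have into: "\<phi> ` X' \<subseteq> split_set q1 q2 T eps G \<tau>"
  proof (rule image_subsetI)
    fix x assume x: "x \<in> X'"
    obtain B i j where xe: "x = (B, i, j)" by (cases x)
    have BG: "B \<in> G" and ij: "i \<in> {1..H1}" "j \<in> {1..H2 B}" and gv: "g B i j" "v B i > 0" using x by (auto simp: xe X'_def X_def)
    have "T < real ((A0 B + (i - 1) + 1) * q1 + B * q2)" by (rule big[OF BG])
    moreover have "A0 B + (i - 1) + 1 = A0 B + i" using ij by simp
    ultimately have t1: "T < real ((A0 B + i) * q1 + B * q2)" by simp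
    have t2: "(1 - eps) * real ((A0 B + i) * q1 + B * q2) < T"
      using gv(2) T0 by (simp add: v_def less_divide_eq max_def split: if_splits)
    have "2 * eps * real B <= real (b0 B)" unfolding b0_def by linarith
    then have t3: "2 * eps * real B <= real (b0 B + j)" by simp
    have "b0 B + j <= B div 4" using ij by (auto simp: H2_def b0_def)
    then have t4: "4 * (b0 B + j) <= B" by simp
    show "\<phi> x \<in> split_set q1 q2 T eps G \<tau>"
      using BG ij gv t1 t2 t3 t4 by (simp add: xe \<phi>_def split_set_def split_ok_def g_def)
  qed
  have inj: "inj_on \<phi> X'" by (auto simp: \<phi>_def inj_on_def)
  have finS: "finite (split_set q1 q2 T eps G \<tau>)" using gap_sum_ge_splits[OF eps q(1,3) q2, of G] \<tau> by auto
  have "(\<Sum>B\<in>G. T / real q1 * (totient_ratio B * (eps\<^sup>2 / 2) * (1 - eps)\<^sup>2 * ln (1 / (16 * eps)) - 6144 * eps ^ 3))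
    <= (\<Sum>B\<in>G. real B * (\<Sum>i=1..H1. \<Sum>j=1..H2 B. (if g B i j then 1 else 0) * v B i * (1 / real (b0 B + j))))"
    by (intro sum_mono row)
  also have "... = (\<Sum>B\<in>G. \<Sum>x\<in>{1..H1} \<times> {1..H2 B}. real B * ((if g B (fst x) (snd x) then 1 else 0) * v B (fst x) * (1 / real (b0 B + snd x))))"
    unfolding sum.cartesian_product sum_distrib_left case_prod_beta ..
  also have "... = (\<Sum>(B, x)\<in>X. real B * ((if g B (fst x) (snd x) then 1 else 0) * v B (fst x) * (1 / real (b0 B + snd x))))"
    unfolding X_def using G by (subst sum.Sigma) auto
  also have "... = (\<Sum>(B, x)\<in>X'. real B * (v B (fst x) * (1 / real (b0 B + snd x))))"
  proof (rule sum.mono_neutral_cong_right[OF finX])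
    show "X' \<subseteq> X" by (auto simp: X'_def)
    have v0: "v B i >= 0" for B i by (simp add: v_def)
    show "\<forall>x\<in>X - X'. (case x of (B, x) => real B * ((if g B (fst x) (snd x) then 1 else 0) * v B (fst x) * (1 / real (b0 B + snd x)))) = 0"
    proof
      fix x assume x: "x \<in> X - X'"
      obtain B i j where xe: "x = (B, i, j)" by (cases x)
      have "\<not> g B i j \<or> v B i = 0" using x v0[of B i] by (auto simp: xe X'_def)
      then show "(case x of (B, x) => real B * ((if g B (fst x) (snd x) then 1 else 0) * v B (fst x) * (1 / real (b0 B + snd x)))) = 0"
        by (auto simp: xe)
    qed
    fix x assume x: "x \<in> X'"
    then show "(case x of (B, x) => real B * ((if g B (fst x) (snd x) then 1 else 0) * v B (fst x) * (1 / real (b0 B + snd x))))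
       = (case x of (B, x) => real B * (v B (fst x) * (1 / real (b0 B + snd x))))"
      by (auto simp: X'_def)
  qed
  also have "... = (\<Sum>x\<in>X'. (T\<^sup>2 * (1 + 8 * eps)) * (case \<phi> x of (B, A, b) => split_weight q1 q2 T eps B A b))"
  proof (rule sum.cong[OF refl])
    fix x assume x: "x \<in> X'"
    obtain B i j where xe: "x = (B, i, j)" by (cases x)
    have "v B i > 0" using x by (auto simp: xe X'_def)
    then have "v B i = 1 - (1 - eps) * real ((A0 B + i) * q1 + B * q2) / T" by (auto simp: v_def max_def split: if_splits)
    then show "(case x of (B, x) => real B * (v B (fst x) * (1 / real (b0 B + snd x))))
      = (T\<^sup>2 * (1 + 8 * eps)) * (case \<phi> x of (B, A, b) => split_weight q1 q2 T eps B A b)"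
      using T0 eps by (simp add: xe \<phi>_def split_weight_def)
  qed
  also have "... = (T\<^sup>2 * (1 + 8 * eps)) * (\<Sum>x\<in>\<phi> ` X'. case x of (B, A, b) => split_weight q1 q2 T eps B A b)"
    using inj by (simp add: sum.reindex sum_distrib_left)
  also have "... <= (T\<^sup>2 * (1 + 8 * eps)) * (\<Sum>x\<in>split_set q1 q2 T eps G \<tau>. case x of (B, A, b) => split_weight q1 q2 T eps B A b)"
  proof (intro mult_left_mono sum_mono2[OF finS into])
    fix x assume x: "x \<in> split_set q1 q2 T eps G \<tau> - \<phi> ` X'"
    obtain B A b where xe: "x = (B, A, b)" by (cases x)
    have "split_ok q1 q2 T eps A B b" using x by (simp add: xe split_set_def)
    then have "(1 - eps) * real (A * q1 + B * q2) / T <= 1" using T0 by (simp add: split_ok_def divide_le_eq)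
    then have "0 <= 1 - (1 - eps) * real (A * q1 + B * q2) / T" by linarith
    then show "0 <= (case x of (B, A, b) => split_weight q1 q2 T eps B A b)"
      using eps unfolding xe split_weight_def case_prod_conv by (intro mult_nonneg_nonneg divide_nonneg_nonneg) auto
  qed (use eps in auto)
  finally show ?thesis using T0 eps by (subst divide_le_eq) (auto simp: mult.commute add_pos_pos)
qed

text \<open>Both signs contribute equally; this turns the factor \<open>eps\<^sup>2 / 2\<close> of a row into \<open>eps\<^sup>2\<close>.\<close>

lemma gap_sum_lower_ordered:
  fixes q1 q2 P :: nat and T eps :: real
  assumes eps: "0 < eps" "eps <= 1 / 16" and q: "1 <= q1" "q1 <= q2" "real q1 <= eps\<^sup>2 * T"
    and G: "finite G" "\<And>B. B \<in> G ==> has_large_prime P B \<and> real B * real q2 <= T \<and> 2 <= eps * real B"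
    and P: "P >= 1" "real P powr (- 1/8) <= eps ^ 3"
    and cG: "real (card G) <= Y" and sG: "(\<Sum>B\<in>G. totient_ratio B) >= \<rho> * Y" and Y: "Y = T / real q2"
  shows "gap_sum q1 q2 T eps >= (eps\<^sup>2 * (1 - eps)\<^sup>2 * ln (1 / (16 * eps)) * \<rho> - 12288 * eps ^ 3) / ((1 + 8 * eps) * (real q1 * real q2))"
proof -
  define c where "c = (eps\<^sup>2 / 2) * (1 - eps)\<^sup>2 * ln (1 / (16 * eps))"
  have T0: "T > 0" by (rule scale_pos[OF q(1,3)])
  have c: "c >= 0" using eps by (simp add: c_def)
  define S where "S = (\<Sum>B\<in>G. T / real q1 * (totient_ratio B * (eps\<^sup>2 / 2) * (1 - eps)\<^sup>2 * ln (1 / (16 * eps)) - 6144 * eps ^ 3))"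
  have "S = (\<Sum>B\<in>G. T / real q1 * (c * totient_ratio B - 6144 * eps ^ 3))"
    unfolding S_def c_def by (intro sum.cong refl) (simp add: mult_ac)
  also have "... = T / real q1 * (c * (\<Sum>B\<in>G. totient_ratio B) - 6144 * eps ^ 3 * real (card G))"
    unfolding sum_distrib_left[symmetric] sum_subtractf sum_constant mult.commute[of "real (card G)"] by (simp only: mult.assoc)
  also have "... >= T / real q1 * (c * (\<rho> * Y) - 6144 * eps ^ 3 * Y)"
    using sG cG c eps T0 by (intro mult_left_mono diff_mono mult_left_mono) auto
  finally have S: "S >= T / real q1 * (c * (\<rho> * Y) - 6144 * eps ^ 3 * Y)" .
  have q2: "1 <= q2" using q by simp
  have "S / (T\<^sup>2 * (1 + 8 * eps)) + S / (T\<^sup>2 * (1 + 8 * eps)) <= gap_sum q1 q2 T eps"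
    using split_sum_ge_row[OF eps q G P, of 1] split_sum_ge_row[OF eps q G P, of "- 1"] gap_sum_ge_splits(3)[OF eps q(1,3) q2, of G]
    unfolding S_def by linarith
  moreover have "(T / real q1 * (c * (\<rho> * Y) - 6144 * eps ^ 3 * Y)) / (T\<^sup>2 * (1 + 8 * eps)) <= S / (T\<^sup>2 * (1 + 8 * eps))"
    using S eps by (intro divide_right_mono) auto
  moreover have "(T / real q1 * (c * (\<rho> * Y) - 6144 * eps ^ 3 * Y)) / (T\<^sup>2 * (1 + 8 * eps))
      = (c * \<rho> - 6144 * eps ^ 3) / ((1 + 8 * eps) * (real q1 * real q2))"
  proof -
    have "(T / a * (c * (r * (T / b)) - e * (T / b))) / (T\<^sup>2 * h) = (c * r - e) / (h * (a * b))"
      if "a > 0" "b > 0" "h > 0" for a b r e h :: real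
      using that T0 by (simp add: field_simps power2_eq_square)
    from this[of "real q1" "real q2" "1 + 8 * eps" \<rho> "6144 * eps ^ 3"] show ?thesis using q eps unfolding Y by simp
  qed
  moreover have "(eps\<^sup>2 * (1 - eps)\<^sup>2 * ln (1 / (16 * eps)) * \<rho> - 12288 * eps ^ 3) / ((1 + 8 * eps) * (real q1 * real q2))
     = (c * \<rho> - 6144 * eps ^ 3) / ((1 + 8 * eps) * (real q1 * real q2)) + (c * \<rho> - 6144 * eps ^ 3) / ((1 + 8 * eps) * (real q1 * real q2))"
    unfolding c_def add_divide_distrib[symmetric] by simp
  moreover have "z <= g" if "s + s <= g" "r <= s" "r = u" "z = u + u" for z g s r u :: real
    using that by linarith
  ultimately show ?thesis by blast
qed

text \<open>
  The choice \<open>P = eps\<^bsup>-24\<^esup>\<close> makes \<open>P\<^bsup>-1/8\<^esup>\<close> at most the required \<open>eps ^ 3\<close>. The discarded moduli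
  have small density as soon as \<open>ln P\<close> is small compared to \<open>ln Y\<close>, that is, if \<open>Y\<close> is a large
  power of \<open>1 / eps\<close>.
\<close>

lemma good_moduli_sum:
  assumes \<kappa>: "0 < \<kappa>"
  shows "\<exists>C::nat. \<exists>eps0>0. \<forall>eps Y P. 0 < eps --> eps <= eps0 --> (1 / eps) ^ C <= Y --> P = nat \<lceil>(1 / eps) ^ 24\<rceil> -->
    (\<Sum>B\<in>{B\<in>{1..nat \<lfloor>Y\<rfloor>}. has_large_prime P B}. totient_ratio B) >= (6 / pi\<^sup>2 - \<kappa>) * Y"
proof -
  obtain E where E: "E >= 0" "\<And>s. ratio_sum s >= (6 / pi\<^sup>2 - \<kappa> / 8) * real s - E"
    using ratio_sum_lower[of "\<kappa> / 8"] \<kappa> by auto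
  \<comment> \<open>ln P is at most 25 ln (1 / eps), and the density 8 ln P / ln M of the smooth moduli has to be at most kappa / 8: 8 * 25 * 8 = 1600.\<close>
  define C where "C = nat \<lceil>1600 / \<kappa>\<rceil> + 2"
  have C: "real C - 1 >= 1600 / \<kappa>" "C >= 2" unfolding C_def using \<kappa> by (auto intro: order_trans[OF real_nat_ceiling_ge])
  define K where "K = max 4 (max (2 * (E + 1) * 8 / \<kappa>) (2 * (8 / \<kappa>)\<^sup>2))"
  define eps0 where "eps0 = min (1 / 4) (min (1 / K) (\<kappa> / 16))"
  have K4: "K >= 4" by (simp add: K_def)
  show ?thesis
  proof (intro exI[of _ C] exI[of _ eps0] conjI allI impI)
    show "eps0 > 0" using K4 \<kappa> by (simp add: eps0_def)
    fix eps Y :: real and P :: nat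
    assume eps: "0 < eps" "eps <= eps0" and Y: "(1 / eps) ^ C <= Y" and P: "P = nat \<lceil>(1 / eps) ^ 24\<rceil>"
    define z where "z = 1 / eps"
    have z: "z >= 4" "z >= K" "z >= 16 / \<kappa>"
      using eps K4 \<kappa> by (auto simp: z_def eps0_def field_simps)
    have zC: "z ^ C <= Y" using Y by (simp add: z_def)
    have "z ^ 1 <= z ^ C" using z C by (intro power_increasing) auto
    then have Yz: "Y >= z" using zC by simp
    define M where "M = nat \<lfloor>Y\<rfloor>"
    have M: "real M <= Y" "Y - 1 <= real M" "real M >= Y / 2" "M >= 2"
    proof -
      show 1: "real M <= Y" "Y - 1 <= real M" using Yz z by (auto simp: M_def)
      show "real M >= Y / 2" using 1 Yz z by linarith
      show "M >= 2" using 1 Yz z by linarith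
    qed
    have P24: "z ^ 24 <= real P" "real P <= z ^ 25"
    proof -
      have a: "z ^ 24 >= 1" using z by (intro one_le_power) auto
      show "z ^ 24 <= real P" unfolding P z_def[symmetric] by (rule real_nat_ceiling_ge)
      have "real P <= z ^ 24 + 1" unfolding P z_def[symmetric] using a by linarith
      also have "... <= z ^ 24 * 2" using a by simp
      also have "... <= z ^ 24 * z" using z a by (intro mult_left_mono) auto
      finally show "real P <= z ^ 25" by (simp add: power_add[symmetric] flip: power_Suc2)
    qed
    have Pz: "real P >= z"
    proof -
      have "z ^ 1 <= z ^ 24" using z by (intro power_increasing) auto
      then show ?thesis using P24 by simp
    qed
    have P2: "P >= 2" using Pz z by linarith
    have lz: "ln z > 0" using z by simp
    have lP: "ln (real P) <= 25 * ln z"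
    proof -
      have "ln (real P) <= ln (z ^ 25)" using P24 P2 by (intro ln_mono) auto
      then show ?thesis using z by (simp add: ln_realpow)
    qed
    have lM: "ln (real M) >= (real C - 1) * ln z"
    proof -
      have "z ^ (C - 1) <= z ^ C / 2"
      proof -
        have "z ^ C = z * z ^ (C - 1)" using C by (metis power_eq_if not_numeral_le_zero)
        moreover have "2 * z ^ (C - 1) <= z * z ^ (C - 1)" using z by (intro mult_right_mono) auto
        ultimately show ?thesis by simp
      qed
      then have "z ^ (C - 1) <= real M" using zC M by linarith
      then have "ln (z ^ (C - 1)) <= ln (real M)" using z by (intro ln_mono) auto
      then show ?thesis using z C by (simp add: ln_realpow of_nat_diff)
    qed
    have lM0: "ln (real M) > 0" using M(4) by simp
    have t1: "sqrt (real M) <= \<kappa> / 8 * real M"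
    proof -
      have "(8 / \<kappa>)\<^sup>2 <= real M" using M(3) Yz z(2) unfolding K_def by linarith
      then have "8 / \<kappa> <= sqrt (real M)" using \<kappa> by (simp add: real_le_rsqrt)
      then have "8 / \<kappa> * sqrt (real M) <= sqrt (real M) * sqrt (real M)" by (intro mult_right_mono) auto
      then show ?thesis using \<kappa> by (simp add: field_simps)
    qed
    have t2: "2 / real P <= \<kappa> / 8"
    proof -
      have "16 / \<kappa> <= real P" using Pz z(3) by linarith
      then show ?thesis using \<kappa> P2 by (simp add: field_simps)
    qed
    have t3: "8 * ln (real P) / ln (real M) <= \<kappa> / 8"
    proof -
      have "1600 / \<kappa> * ln z <= (real C - 1) * ln z" using C lz by (intro mult_right_mono) auto
      then have "1600 / \<kappa> * ln z <= ln (real M)" using lM by linarith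
      then have "1600 * ln z <= \<kappa> * ln (real M)" using \<kappa> by (simp add: field_simps)
      then have "64 * ln (real P) <= \<kappa> * ln (real M)" using lP by linarith
      then show ?thesis using lM0 by (simp add: field_simps)
    qed
    have bad: "real (card {B\<in>{1..M}. \<not> has_large_prime P B}) <= 3 * \<kappa> / 8 * real M"
    proof -
      have "real (card {B\<in>{1..M}. \<not> has_large_prime P B}) <= sqrt (real M) + real M * (2 / real P + 8 * ln (real P) / ln (real M))"
        by (rule card_no_large_prime[OF P2 M(4)])
      also have "... <= \<kappa> / 8 * real M + real M * (\<kappa> / 8 + \<kappa> / 8)"
        using t1 t2 t3 by (intro add_mono mult_left_mono) auto
      finally show ?thesis by (simp add: algebra_simps)
    qed
    have "ratio_sum M = (\<Sum>B\<in>{B\<in>{1..M}. has_large_prime P B}. totient_ratio B) + (\<Sum>B\<in>{B\<in>{1..M}. \<not> has_large_prime P B}. totient_ratio B)"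
      unfolding ratio_sum_def by (subst sum.union_disjoint[symmetric]) (auto intro: sum.cong)
    moreover have "(\<Sum>B\<in>{B\<in>{1..M}. \<not> has_large_prime P B}. totient_ratio B) <= (\<Sum>B\<in>{B\<in>{1..M}. \<not> has_large_prime P B}. 1)"
      by (intro sum_mono totient_ratio_bounds)
    ultimately have "(\<Sum>B\<in>{B\<in>{1..M}. has_large_prime P B}. totient_ratio B) >= (6 / pi\<^sup>2 - \<kappa> / 8) * real M - E - 3 * \<kappa> / 8 * real M"
      using E(2)[of M] bad by simp
    also have "(6 / pi\<^sup>2 - \<kappa> / 8) * real M - E - 3 * \<kappa> / 8 * real M = (6 / pi\<^sup>2) * real M - \<kappa> / 2 * real M - E"
      by (simp add: algebra_simps)
    finally have "(\<Sum>B\<in>{B\<in>{1..M}. has_large_prime P B}. totient_ratio B) >= (6 / pi\<^sup>2) * real M - \<kappa> / 2 * real M - E" .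
    moreover have "(6 / pi\<^sup>2) * real M >= (6 / pi\<^sup>2) * Y - 1"
    proof -
      have "6 / pi\<^sup>2 <= 1"
      proof -
        have "3\<^sup>2 <= pi\<^sup>2" using pi_gt3 by (intro power_mono) auto
        then show ?thesis by (simp add: divide_le_eq)
      qed
      then have "(6 / pi\<^sup>2) * (Y - real M) <= 1 * 1" using M by (intro mult_mono) auto
      then show ?thesis unfolding right_diff_distrib by linarith
    qed
    moreover have "\<kappa> / 2 * real M <= \<kappa> / 2 * Y" using M \<kappa> by (intro mult_left_mono) auto
    moreover have "E + 1 <= \<kappa> / 2 * Y"
    proof -
      have "2 * (E + 1) * 8 / \<kappa> <= Y" using Yz z(2) unfolding K_def by linarith
      then have "16 * (E + 1) <= \<kappa> * Y" using \<kappa> by (simp add: field_simps)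
      moreover have "2 * (E + 1) <= 16 * (E + 1)" using E(1) by simp
      ultimately have "2 * (E + 1) <= \<kappa> * Y" by (rule order_trans[rotated])
      then show ?thesis by simp
    qed
    ultimately show "(6 / pi\<^sup>2 - \<kappa>) * Y <= (\<Sum>B\<in>{B\<in>{1..nat \<lfloor>Y\<rfloor>}. has_large_prime P B}. totient_ratio B)"
      unfolding M_def[symmetric] left_diff_distrib by linarith
  qed
qed

lemma gap_sum_lower:
  assumes \<kappa>: "0 < \<kappa>" "\<kappa> < 1 / 2"
  shows "\<exists>C::nat. \<exists>eps0>0. \<forall>eps q1 q2 T. 0 < eps --> eps <= eps0 --> 1 <= q1 --> 1 <= q2 -->
     (1 / eps) ^ C * real q1 <= T --> (1 / eps) ^ C * real q2 <= T -->
     gap_sum q1 q2 T eps >= (6 / pi\<^sup>2 - \<kappa>) * (eps\<^sup>2 * ln (1 / eps)) / (real q1 * real q2)"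
proof -
  obtain C0 eps1 where C0: "eps1 > 0" "\<And>eps Y P. 0 < eps ==> eps <= eps1 ==> (1 / eps) ^ C0 <= Y ==> P = nat \<lceil>(1 / eps) ^ 24\<rceil> ==>
    (\<Sum>B\<in>{B\<in>{1..nat \<lfloor>Y\<rfloor>}. has_large_prime P B}. totient_ratio B) >= (6 / pi\<^sup>2 - \<kappa> / 2) * Y"
    using good_moduli_sum[of "\<kappa> / 2"] \<kappa> by auto
  define \<rho> where "\<rho> = 6 / pi\<^sup>2 - \<kappa> / 2"
  have rho: "\<rho> > 0"
  proof -
    have "pi < 3.15" using pi_approx by simp
    then have "pi\<^sup>2 < 3.15\<^sup>2" by (intro power_strict_mono) auto
    then have "pi\<^sup>2 < 12" by (simp add: power2_eq_square)
    then have "6 / pi\<^sup>2 > 6 / 12" by (intro divide_strict_left_mono) auto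
    then show ?thesis using \<kappa> unfolding \<rho>_def by linarith
  qed
  have "((\<lambda>eps::real. ((1 - eps)\<^sup>2 * ln (1 / (16 * eps)) * \<rho> - 12288 * eps) / ((1 + 8 * eps) * ln (1 / eps))) \<longlongrightarrow> \<rho>) (at_right 0)"
    using rho by real_asymp
  then have "\<forall>\<^sub>F eps in at_right 0. ((1 - eps)\<^sup>2 * ln (1 / (16 * eps)) * \<rho> - 12288 * eps) / ((1 + 8 * eps) * ln (1 / eps)) > \<rho> - \<kappa> / 2"
    using \<kappa> by (intro order_tendstoD(1)) auto
  then obtain eps2 where "eps2 > 0" "\<forall>eps>0. eps < eps2 -->
      ((1 - eps)\<^sup>2 * ln (1 / (16 * eps)) * \<rho> - 12288 * eps) / ((1 + 8 * eps) * ln (1 / eps)) > \<rho> - \<kappa> / 2"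
    unfolding eventually_at_right_field by blast
  then have e2: "eps2 > 0" "\<And>eps. 0 < eps ==> eps < eps2 ==>
      ((1 - eps)\<^sup>2 * ln (1 / (16 * eps)) * \<rho> - 12288 * eps) / ((1 + 8 * eps) * ln (1 / eps)) > \<rho> - \<kappa> / 2"
    by blast+
  define eps0 where "eps0 = min (1 / 16) (min eps1 (eps2 / 2))"
  define C where "C = max C0 2"
  have ord: "gap_sum q1 q2 T eps >= (6 / pi\<^sup>2 - \<kappa>) * (eps\<^sup>2 * ln (1 / eps)) / (real q1 * real q2)"
    if eps: "0 < eps" "eps <= eps0" and q: "1 <= q1" "q1 <= q2" and T: "(1 / eps) ^ C * real q2 <= T" for eps q1 q2 T
  proof -
    have eps16: "eps <= 1 / 16" "eps <= eps1" "eps < eps2" using eps e2 by (auto simp: eps0_def)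
    have z: "1 / eps >= 16" using eps16 eps by (simp add: field_simps)
    define Y where "Y = T / real q2"
    have Yl: "(1 / eps) ^ C <= Y" using T q by (simp add: Y_def le_divide_eq)
    have Yl0: "(1 / eps) ^ C0 <= Y"
    proof -
      have "(1 / eps) ^ C0 <= (1 / eps) ^ C" using z by (intro power_increasing) (auto simp: C_def)
      then show ?thesis using Yl by linarith
    qed
    have Yl2: "(1 / eps) ^ 2 <= Y"
    proof -
      have "(1 / eps) ^ 2 <= (1 / eps) ^ C" using z by (intro power_increasing) (auto simp: C_def)
      then show ?thesis using Yl by linarith
    qed
    define P where "P = nat \<lceil>(1 / eps) ^ 24\<rceil>"
    define G where "G = {B\<in>{1..nat \<lfloor>Y\<rfloor>}. has_large_prime P B}"
    have P24: "(1 / eps) ^ 24 <= real P" unfolding P_def by (rule real_nat_ceiling_ge)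
    have "(1 / eps) ^ 24 >= (1 / eps) ^ 2" using z by (intro power_increasing) auto
    then have P2: "(1 / eps) ^ 2 <= real P" using P24 by linarith
    have "(1 / eps) ^ 2 >= 1" using z by (intro one_le_power) auto
    then have P1: "P >= 1" using P2 by linarith
    have Ppow: "real P powr (- 1/8) <= eps ^ 3"
    proof -
      have "real P powr (- 1/8) <= ((1 / eps) ^ 24) powr (- 1/8)"
        using P24 eps by (intro powr_mono2') auto
      also have "(1 / eps) ^ 24 = eps powr (- 24)" using eps by (simp add: powr_minus powr_numeral power_one_over field_simps)
      also have "(eps powr (- 24)) powr (- 1/8) = eps powr 3" by (simp add: powr_powr)
      also have "... = eps ^ 3" using eps by (simp add: powr_numeral)
      finally show ?thesis .
    qed
    have q1T: "real q1 <= eps\<^sup>2 * T"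
    proof -
      have "(1 / eps) ^ 2 * real q2 <= T" using Yl2 q by (simp add: Y_def le_divide_eq)
      then have "real q2 <= eps\<^sup>2 * T" using eps by (simp add: power_one_over field_simps)
      then show ?thesis using q by linarith
    qed
    have Y0: "Y >= 0" using Yl2 \<open>(1 / eps) ^ 2 >= 1\<close> by linarith
    have GB: "has_large_prime P B \<and> real B * real q2 <= T \<and> 2 <= eps * real B" if "B \<in> G" for B
    proof -
      have B: "B >= 1" "B <= nat \<lfloor>Y\<rfloor>" "has_large_prime P B" using that by (auto simp: G_def)
      then have "real B <= Y" using Y0 by linarith
      then have "real B * real q2 <= T" using q by (simp add: Y_def le_divide_eq)
      moreover obtain p where "P <= p" "p dvd B" using B(3) by (auto simp: has_large_prime_def)
      then have "P <= B" using B(1) dvd_imp_le[of p B] by linarith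
      then have "(1 / eps) ^ 2 <= real B" using P2 by linarith
      then have "eps * (1 / eps) ^ 2 <= eps * real B" using eps by (intro mult_left_mono) auto
      then have "1 / eps <= eps * real B" using eps by (simp add: power2_eq_square)
      ultimately show ?thesis using B(3) z by linarith
    qed
    have cG: "real (card G) <= Y"
    proof -
      have "card G <= card {1..nat \<lfloor>Y\<rfloor>}" unfolding G_def by (intro card_mono) auto
      then have "card G <= nat \<lfloor>Y\<rfloor>" by simp
      then show ?thesis using Y0 by linarith
    qed
    have sG: "(\<Sum>B\<in>G. totient_ratio B) >= \<rho> * Y"
      unfolding G_def \<rho>_def by (rule C0(2)[OF eps(1) eps16(2) Yl0 P_def])
    have fin: "finite G" by (simp add: G_def)
    have main: "gap_sum q1 q2 T eps >= (eps\<^sup>2 * (1 - eps)\<^sup>2 * ln (1 / (16 * eps)) * \<rho> - 12288 * eps ^ 3) / ((1 + 8 * eps) * (real q1 * real q2))"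
      by (rule gap_sum_lower_ordered[OF eps(1) eps16(1) q q1T fin GB P1 Ppow cG sG Y_def])
    have lz: "ln (1 / eps) > 0" using z by (intro ln_gt_zero) auto
    have "(\<rho> - \<kappa> / 2) * ((1 + 8 * eps) * ln (1 / eps)) <= (1 - eps)\<^sup>2 * ln (1 / (16 * eps)) * \<rho> - 12288 * eps"
      using e2(2)[OF eps(1) eps16(3)] lz eps by (simp add: less_divide_eq)
    then have "eps\<^sup>2 * ((\<rho> - \<kappa> / 2) * ((1 + 8 * eps) * ln (1 / eps))) <= eps\<^sup>2 * ((1 - eps)\<^sup>2 * ln (1 / (16 * eps)) * \<rho> - 12288 * eps)"
      by (intro mult_left_mono) auto
    then have "eps\<^sup>2 * ((\<rho> - \<kappa> / 2) * ((1 + 8 * eps) * ln (1 / eps))) / ((1 + 8 * eps) * (real q1 * real q2))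
       <= eps\<^sup>2 * ((1 - eps)\<^sup>2 * ln (1 / (16 * eps)) * \<rho> - 12288 * eps) / ((1 + 8 * eps) * (real q1 * real q2))"
      using eps by (intro divide_right_mono) auto
    also have "eps\<^sup>2 * ((1 - eps)\<^sup>2 * ln (1 / (16 * eps)) * \<rho> - 12288 * eps) = eps\<^sup>2 * (1 - eps)\<^sup>2 * ln (1 / (16 * eps)) * \<rho> - 12288 * eps ^ 3"
    proof -
      have "e\<^sup>2 * (x * l * r - 12288 * e) = e\<^sup>2 * x * l * r - 12288 * e ^ 3" for e x l r :: real
        by (simp add: algebra_simps power2_eq_square power3_eq_cube)
      then show ?thesis .
    qed
    also have "eps\<^sup>2 * ((\<rho> - \<kappa> / 2) * ((1 + 8 * eps) * ln (1 / eps))) / ((1 + 8 * eps) * (real q1 * real q2))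
        = (6 / pi\<^sup>2 - \<kappa>) * (eps\<^sup>2 * ln (1 / eps)) / (real q1 * real q2)"
    proof -
      have "e * (r * (h * l)) / (h * d) = r * (e * l) / d" if "h > 0" for e r h l d :: real
        using that by simp
      from this[of "1 + 8 * eps" "eps\<^sup>2" "\<rho> - \<kappa> / 2" "ln (1 / eps)" "real q1 * real q2"] show ?thesis using eps by (simp add: \<rho>_def)
    qed
    finally show ?thesis using main by linarith
  qed
  show ?thesis
  proof (intro exI[of _ C] exI[of _ eps0] conjI allI impI)
    show "eps0 > 0" using C0 e2 by (simp add: eps0_def)
    fix eps T :: real and q1 q2 :: nat
    assume a: "0 < eps" "eps <= eps0" "1 <= q1" "1 <= q2" "(1 / eps) ^ C * real q1 <= T" "(1 / eps) ^ C * real q2 <= T"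
    show "(6 / pi\<^sup>2 - \<kappa>) * (eps\<^sup>2 * ln (1 / eps)) / (real q1 * real q2) <= gap_sum q1 q2 T eps"
    proof (cases "q1 <= q2")
      case True then show ?thesis using ord a by blast
    next
      case False
      then have "(6 / pi\<^sup>2 - \<kappa>) * (eps\<^sup>2 * ln (1 / eps)) / (real q2 * real q1) <= gap_sum q2 q1 T eps"
        using a by (intro ord) auto
      then show ?thesis unfolding gap_sum_commute[of q1 q2] mult.commute[of "real q1" "real q2"] .
    qed
  qed
qed

section \<open>Order statistics of the distances\<close>

lemma sorted_nth_le_iff:
  fixes l :: "'a :: linorder list"
  assumes "sorted l" "k < length l"
  shows "l ! k <= x \<longleftrightarrow> k < length (filter (\<lambda>y. y <= x) l)"
  using assms
proof (induction l arbitrary: k)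
  case (Cons a l)
  show ?case
  proof (cases "a <= x")
    case True
    then show ?thesis using Cons by (cases k) auto
  next
    case False
    then have "\<forall>y\<in>set (a # l). \<not> y <= x" using Cons by auto
    then have "filter (\<lambda>y. y <= x) (a # l) = []" unfolding filter_empty_conv .
    moreover have "(a # l) ! k \<in> set (a # l)" using Cons by (intro nth_mem) auto
    ultimately show ?thesis using \<open>\<forall>y\<in>set (a # l). \<not> y <= x\<close> by auto
  qed
qed simp

definition denoms :: "real => nat set" where "denoms T = {q. 1 <= q \<and> real q <= T}"

lemma denoms_eq: "0 <= T ==> denoms T = {1..nat \<lfloor>T\<rfloor>}"
  by (auto simp: denoms_def le_nat_floor) linarith

lemma finite_denoms [simp]: "finite (denoms T)"
  by (rule finite_subset[of _ "{1..nat \<lfloor>T\<rfloor>}"]) (auto simp: denoms_def le_nat_floor)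

lemma card_denoms: "0 <= T ==> card (denoms T) = nat \<lfloor>T\<rfloor>"
  by (simp add: denoms_eq)

abbreviation nint_dist :: "real => real" where "nint_dist x \<equiv> circle_dist x 0"

lemma rth_min_le_iff:
  assumes r: "1 <= r" "real r <= T"
  shows "rth_min_dist r T \<alpha> <= x \<longleftrightarrow> r <= card {q\<in>denoms T. nint_dist (real q * \<alpha>) <= x}"
proof -
  define M where "M = {# nint_dist (real q * \<alpha>). q \<in># mset_set (denoms T) #}"
  define l where "l = sorted_list_of_multiset M"
  have len: "length l = card (denoms T)" unfolding l_def M_def by (metis mset_sorted_list_of_multiset size_image_mset size_mset size_mset_set)
  have "r <= card (denoms T)" using r by (simp add: card_denoms le_nat_floor)
  then have k: "r - 1 < length l" using r len by simp
  have "rth_min_dist r T \<alpha> <= x \<longleftrightarrow> r - 1 < length (filter (\<lambda>y. y <= x) l)"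
    unfolding rth_min_dist_def denoms_def[symmetric] M_def[symmetric] l_def[symmetric]
    using k by (intro sorted_nth_le_iff) (auto simp: l_def sorted_sorted_list_of_multiset)
  also have "length (filter (\<lambda>y. y <= x) l) = size (filter_mset (\<lambda>y. y <= x) M)"
    unfolding l_def by (metis mset_filter mset_sorted_list_of_multiset size_mset)
  also have "filter_mset (\<lambda>y. y <= x) M = image_mset (\<lambda>q. nint_dist (real q * \<alpha>)) (mset_set {q\<in>denoms T. nint_dist (real q * \<alpha>) <= x})"
    unfolding M_def by (simp add: filter_mset_image_mset)
  also have "size ... = card {q\<in>denoms T. nint_dist (real q * \<alpha>) <= x}" by simp
  finally show ?thesis using r by linarith
qed

lemma k0_le_iff:
  assumes r: "1 <= r" "real r <= T"
  shows "k0 r T \<alpha> <= s \<longleftrightarrow> r <= card {q\<in>denoms T. nint_dist (real q * \<alpha>) <= s / T}"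
proof -
  have "T > 0" using r by linarith
  then have "k0 r T \<alpha> <= s \<longleftrightarrow> rth_min_dist r T \<alpha> <= s / T" by (simp add: k0_def le_divide_eq mult.commute)
  then show ?thesis using rth_min_le_iff[OF r] by simp
qed

lemma nint_dist_le: "nint_dist x <= \<bar>x - of_int p\<bar>"
  using circle_dist_le[of x 0 "- p"] by simp

lemma nint_dist_obtain: obtains p :: int where "nint_dist x = \<bar>x - of_int p\<bar>"
proof -
  obtain p where "nint_dist x = \<bar>x - 0 + of_int p\<bar>" using circle_dist_attained by blast
  then show ?thesis using that[of "- p"] by simp
qed

lemma nint_dist_diff_le: "nint_dist x <= nint_dist y + \<bar>x - y\<bar>"
proof -
  obtain p where "nint_dist y = \<bar>y - of_int p\<bar>" by (rule nint_dist_obtain)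
  then show ?thesis using nint_dist_le[of x p] by linarith
qed

text \<open>
  Each \<open>q \<alpha>\<close> with \<open>q <= T\<close> moves by at most \<open>T \<bar>\<alpha> - \<beta>\<bar>\<close>, and \<open>k0\<close> has a further factor \<open>T\<close>.
\<close>

lemma k0_lipschitz_one_sided:
  assumes "1 <= r" "real r <= T"
  shows "k0 r T \<alpha> <= k0 r T \<beta> + T\<^sup>2 * \<bar>\<alpha> - \<beta>\<bar>"
proof -
  have T: "T > 0" using assms by linarith
  have "r <= card {q\<in>denoms T. nint_dist (real q * \<beta>) <= k0 r T \<beta> / T}" using k0_le_iff[OF assms, of \<beta> "k0 r T \<beta>"] by simp
  also have "... <= card {q\<in>denoms T. nint_dist (real q * \<alpha>) <= (k0 r T \<beta> + T\<^sup>2 * \<bar>\<alpha> - \<beta>\<bar>) / T}"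
  proof (rule card_mono, force, rule subsetI, clarify)
    fix q assume q: "q \<in> denoms T" "nint_dist (real q * \<beta>) <= k0 r T \<beta> / T"
    have "nint_dist (real q * \<alpha>) <= nint_dist (real q * \<beta>) + \<bar>real q * \<alpha> - real q * \<beta>\<bar>" by (rule nint_dist_diff_le)
    also have "\<bar>real q * \<alpha> - real q * \<beta>\<bar> = real q * \<bar>\<alpha> - \<beta>\<bar>" by (simp add: right_diff_distrib[symmetric] abs_mult)
    also have "... <= T * \<bar>\<alpha> - \<beta>\<bar>" using q by (intro mult_right_mono) (auto simp: denoms_def)
    finally show "nint_dist (real q * \<alpha>) <= (k0 r T \<beta> + T\<^sup>2 * \<bar>\<alpha> - \<beta>\<bar>) / T"
      using q T by (simp add: add_divide_distrib power2_eq_square)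
  qed
  finally show ?thesis using k0_le_iff[OF assms] by simp
qed

lemma k0_lipschitz:
  assumes "1 <= r" "real r <= T"
  shows "\<bar>k0 r T \<alpha> - k0 r T \<beta>\<bar> <= T\<^sup>2 * \<bar>\<alpha> - \<beta>\<bar>"
  using k0_lipschitz_one_sided[OF assms, of \<alpha> \<beta>] k0_lipschitz_one_sided[OF assms, of \<beta> \<alpha>]
  by (simp add: abs_le_iff abs_minus_commute)

lemma k0_continuous:
  assumes "1 <= r" "real r <= T"
  shows "continuous_on UNIV (k0 r T)"
proof (rule lipschitz_on_continuous_on[of "T\<^sup>2"], rule lipschitz_onI)
  fix x y show "dist (k0 r T x) (k0 r T y) <= T\<^sup>2 * dist x y"
    using k0_lipschitz[OF assms] by (simp add: dist_real_def)
qed simp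

lemma k0_measurable:
  assumes "1 <= r" "real r <= T"
  shows "k0 r T \<in> borel_measurable borel"
  using k0_continuous[OF assms] by (rule borel_measurable_continuous_onI)

section \<open>Small values and close fractions\<close>

text \<open>The multiples \<open>q, 2 q, ..., r q\<close> are \<open>r\<close> denominators with small distances.\<close>

lemma k0_le_if_close:
  assumes r: "1 <= r" and q: "1 <= q" "real r * real q <= T" and s: "0 <= s" and close: "\<bar>real q * \<alpha> - of_int p\<bar> <= s / (real r * T)"
  shows "k0 r T \<alpha> <= s"
proof -
  have rT: "real r <= T" using q mult_left_mono[of 1 "real q" "real r"] by simp
  then have T: "T > 0" using r by linarith
  have "(\<lambda>j. j * q) ` {1..r} \<subseteq> {j\<in>denoms T. nint_dist (real j * \<alpha>) <= s / T}"
  proof clarify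
    fix j assume j: "j \<in> {1..r}"
    have "real j * real q <= real r * real q" using j by (intro mult_right_mono) auto
    then have "real (j * q) <= T" unfolding of_nat_mult using q(2) by (rule order_trans)
    moreover have "1 <= j * q" using j q by simp
    moreover have "nint_dist (real (j * q) * \<alpha>) <= s / T"
    proof -
      have "nint_dist (real (j * q) * \<alpha>) <= \<bar>real (j * q) * \<alpha> - of_int (int j * p)\<bar>" by (rule nint_dist_le)
      also have "... = real j * \<bar>real q * \<alpha> - of_int p\<bar>"
      proof -
        have "real (j * q) * \<alpha> - of_int (int j * p) = real j * (real q * \<alpha> - of_int p)" by (simp add: algebra_simps)
        then show ?thesis by (simp add: abs_mult)
      qed
      also have "... <= real r * (s / (real r * T))" using j close by (intro mult_mono) auto
      also have "... = s / T" using r by simp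
      finally show ?thesis .
    qed
    ultimately show "j * q \<in> denoms T \<and> nint_dist (real (j * q) * \<alpha>) <= s / T" by (simp add: denoms_def)
  qed
  then have "card ((\<lambda>j. j * q) ` {1..r}) <= card {j\<in>denoms T. nint_dist (real j * \<alpha>) <= s / T}"
    by (intro card_mono) auto
  moreover have "card ((\<lambda>j. j * q) ` {1..r}) = r" using q by (subst card_image) (auto simp: inj_on_def)
  ultimately show ?thesis using k0_le_iff[OF r rT] by simp
qed

text \<open>
  Two denominators \<open>q, q' <= T\<close> with distances at most \<open>s / T\<close>, attained at \<open>p, p'\<close>, have
  \<open>\<bar>q p' - q' p\<bar> <= 2 s < 1\<close>, so \<open>(q, p)\<close> and \<open>(q', p')\<close> are parallel. Hence all of them are
  multiples of one primitive vector, and the largest of \<open>r\<close> multiples is at least the \<open>r\<close>-th.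
\<close>

lemma close_if_k0_le:
  assumes r: "1 <= r" "real r <= T" and s: "2 * s < 1" and k: "k0 r T \<alpha> <= s"
  obtains p :: int and q :: nat where "coprime p (int q)" "1 <= q" "real r * real q <= T" "\<bar>real q * \<alpha> - of_int p\<bar> <= s / (real r * T)"
proof -
  have T: "T > 0" using r by linarith
  define W where "W = {q\<in>denoms T. nint_dist (real q * \<alpha>) <= s / T}"
  have cW: "r <= card W" using k k0_le_iff[OF r] by (simp add: W_def)
  have finW: "finite W" by (simp add: W_def)
  have "\<exists>p::int. nint_dist (real q * \<alpha>) = \<bar>real q * \<alpha> - of_int p\<bar>" for q :: nat by (meson nint_dist_obtain)
  then obtain pp where pp: "\<And>q::nat. nint_dist (real q * \<alpha>) = \<bar>real q * \<alpha> - of_int (pp q)\<bar>" by metis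
  have near: "\<bar>real q * \<alpha> - of_int (pp q)\<bar> <= s / T" "1 <= q" "real q <= T" if "q \<in> W" for q
    using that pp by (auto simp: W_def denoms_def)
  have s0: "s >= 0"
  proof -
    have "W ~= {}" using cW r by auto
    then obtain q where "q \<in> W" by auto
    then have "0 <= s / T" using near(1) by (meson abs_ge_zero order_trans)
    then show ?thesis using T by (simp add: zero_le_divide_iff)
  qed
  have par: "int q * pp q' = int q' * pp q" if "q \<in> W" "q' \<in> W" for q q'
  proof -
    have "\<bar>real q * of_int (pp q') - real q' * of_int (pp q)\<bar> = \<bar>real q' * (real q * \<alpha> - of_int (pp q)) - real q * (real q' * \<alpha> - of_int (pp q'))\<bar>"
      by (simp add: algebra_simps)
    also have "... <= real q' * \<bar>real q * \<alpha> - of_int (pp q)\<bar> + real q * \<bar>real q' * \<alpha> - of_int (pp q')\<bar>"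
      using abs_triangle_ineq4[of "real q' * (real q * \<alpha> - of_int (pp q))" "real q * (real q' * \<alpha> - of_int (pp q'))"] by (simp add: abs_mult)
    also have "... <= T * (s / T) + T * (s / T)"
      using near[OF that(1)] near[OF that(2)] T s0 by (intro add_mono mult_mono) auto
    also have "... < 1" using T s by simp
    finally have "\<bar>real_of_int (int q * pp q' - int q' * pp q)\<bar> < 1" by simp
    then have "int q * pp q' - int q' * pp q = 0" by linarith
    then show ?thesis by simp
  qed
  have "W ~= {}" using cW r by auto
  then obtain q0 where q0: "q0 \<in> W" by auto
  \<comment> \<open>Reduce one of the vectors to a primitive one; all others are multiples of it.\<close>
  define g where "g = gcd (int q0) (pp q0)"
  have g0: "g > 0" using near(2)[OF q0] by (simp add: g_def)
  obtain q1 p where q1: "int q0 = g * q1" "pp q0 = g * p" by (metis g_def gcd_dvd1 gcd_dvd2 dvdE)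
  have cop: "coprime q1 p"
    using gcd_coprime_exists[of "int q0" "pp q0"] g0 q1 unfolding g_def[symmetric]
    by (metis g_def gcd_coprime[of "int q0" "pp q0" q1 p] less_numeral_extra(3) mult.commute)
  have q1pos: "q1 > 0" using q1(1) g0 near(2)[OF q0] by (metis of_nat_0_less_iff zero_less_mult_pos less_le_trans zero_less_one)
  define q where "q = nat q1"
  have q: "int q = q1" "1 <= q" using q1pos by (auto simp: q_def)
  have mult: "\<exists>m. q' = m * q \<and> pp q' = int m * p" if "q' \<in> W" for q'
  proof -
    have "g * (q1 * pp q') = g * (int q' * p)" using par[OF q0 that] q1 by (simp add: mult_ac)
    then have e: "q1 * pp q' = int q' * p" using g0 by simp
    then have "q1 dvd int q' * p" by (metis dvd_triv_left)
    then have "q1 dvd int q'" using cop coprime_dvd_mult_left_iff by blast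
    then have "q dvd q'" using q by (metis int_dvd_int_iff)
    then obtain m where m: "q' = m * q" by (metis dvd_def mult.commute)
    then have "q1 * pp q' = q1 * (int m * p)" using e q by (simp add: mult_ac)
    then have "pp q' = int m * p" using q1pos by simp
    then show ?thesis using m by blast
  qed
  have "\<exists>q'\<in>W. r * q <= q'"
  proof (rule ccontr)
    assume neg: "\<not> (\<exists>q'\<in>W. r * q <= q')"
    have "W \<subseteq> (\<lambda>m. m * q) ` {1..<r}"
    proof
      fix q' assume q': "q' \<in> W"
      obtain m where m: "q' = m * q" using mult[OF q'] by blast
      have "m < r" using neg q' m q by (metis mult_le_mono1 not_less)
      moreover have "m >= 1" using near(2)[OF q'] m by (cases m) auto
      ultimately show "q' \<in> (\<lambda>m. m * q) ` {1..<r}" using m by auto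
    qed
    then have "card W <= card ((\<lambda>m. m * q) ` {1..<r})" by (intro card_mono) auto
    also have "... <= card {1..<r}" by (rule card_image_le) auto
    finally show False using cW r by simp
  qed
  then obtain q' where q': "q' \<in> W" "r * q <= q'" by blast
  obtain m where m: "q' = m * q" "pp q' = int m * p" using mult[OF q'(1)] by blast
  have mr: "r <= m" using q' m q by simp
  have "real r * real q <= real q'" using q'(2) by (metis of_nat_le_iff of_nat_mult)
  then have "real r * real q <= T" using near(3)[OF q'(1)] by linarith
  moreover have "\<bar>real q * \<alpha> - of_int p\<bar> <= s / (real r * T)"
  proof -
    have "real q' = real m * real q" "real_of_int (pp q') = real m * of_int p" using m by simp_all
    then have "real q' * \<alpha> - of_int (pp q') = real m * (real q * \<alpha> - of_int p)" by (simp add: algebra_simps)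
    then have "real m * \<bar>real q * \<alpha> - of_int p\<bar> <= s / T" using near(1)[OF q'(1)] by (simp add: abs_mult)
    moreover have "real r * \<bar>real q * \<alpha> - of_int p\<bar> <= real m * \<bar>real q * \<alpha> - of_int p\<bar>" using mr by (intro mult_right_mono) auto
    ultimately have "real r * \<bar>real q * \<alpha> - of_int p\<bar> <= s / T" by linarith
    then show ?thesis using r T by (simp add: field_simps)
  qed
  moreover have "coprime p (int q)" using cop q by (simp add: coprime_commute)
  ultimately show ?thesis using that q by blast
qed

section \<open>Farey intervals\<close>

type_synonym farey = "(int \<times> nat) \<times> (int \<times> nat)"

text \<open>Half-open, so that the intervals of one order partition \<open>[0, 1)\<close>.\<close>

definition farey_interval :: "farey => real set" where
  "farey_interval = (\<lambda>((p1, q1), (p2, q2)). {of_int p1 / real q1 ..< of_int p2 / real q2})"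

definition farey_adjacent :: "farey => bool" where
  "farey_adjacent = (\<lambda>((p1, q1), (p2, q2)). 0 <= p1 \<and> p2 <= int q2 \<and> 1 <= q1 \<and> 1 <= q2 \<and> p2 * int q1 - p1 * int q2 = 1)"

text \<open>Neighbours in the Farey sequence of order \<open>Q\<close>: their mediant no longer belongs to it.\<close>

definition farey_pairs :: "nat => farey set" where
  "farey_pairs Q = {x. farey_adjacent x \<and> snd (fst x) <= Q \<and> snd (snd x) <= Q \<and> Q < snd (fst x) + snd (snd x)}"

definition farey_length :: "farey => real" where
  "farey_length = (\<lambda>((p1, q1), (p2, q2)). 1 / (real q1 * real q2))"

lemma farey_adjacent_diff:
  assumes "farey_adjacent ((p1, q1), (p2, q2))"
  shows "of_int p2 / real q2 - of_int p1 / real q1 = 1 / (real q1 * real q2)"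
proof -
  have q: "real q1 > 0" "real q2 > 0" and d: "p2 * int q1 - p1 * int q2 = 1" using assms by (auto simp: farey_adjacent_def)
  have "real_of_int p2 * real q1 - real_of_int p1 * real q2 = 1" using arg_cong[OF d, of real_of_int] by simp
  then show ?thesis using q by (simp add: field_simps)
qed

lemma farey_adjacent_bounds:
  assumes "farey_adjacent ((p1, q1), (p2, q2))"
  shows "0 < p2" "p1 < int q1"
proof -
  have adj: "0 <= p1" "p2 <= int q2" "1 <= q1" "1 <= q2" "p2 * int q1 - p1 * int q2 = 1"
    using assms by (auto simp: farey_adjacent_def)
  have "0 <= p1 * int q2" using adj by simp
  then have "0 < p2 * int q1" using adj(5) by linarith
  then show "0 < p2" using adj(3) by (simp add: zero_less_mult_iff)
  show "p1 < int q1"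
  proof (rule ccontr)
    assume "\<not> p1 < int q1"
    then have "int q1 * int q2 <= p1 * int q2" by (intro mult_right_mono) auto
    moreover have "p2 * int q1 <= int q2 * int q1" using adj by (intro mult_right_mono) auto
    ultimately show False using adj(5) by (simp add: mult.commute)
  qed
qed

lemma farey_interval_subset:
  assumes "farey_adjacent x" shows "farey_interval x \<subseteq> {0..<1}"
proof -
  obtain p1 q1 p2 q2 where x: "x = ((p1, q1), (p2, q2))" by (metis surj_pair)
  have "0 <= of_int p1 / real q1" "of_int p2 / real q2 <= 1" using assms by (auto simp: x farey_adjacent_def divide_le_eq)
  then show ?thesis by (auto simp: x farey_interval_def)
qed

lemma farey_interval_iff:
  assumes "1 <= q1" "1 <= q2"
  shows "\<alpha> \<in> farey_interval ((p1, q1), (p2, q2)) \<longleftrightarrow> 0 <= real q1 * \<alpha> - of_int p1 \<and> 0 < of_int p2 - real q2 * \<alpha>"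
  using assms by (auto simp: farey_interval_def field_simps)

text \<open>Passing from order \<open>Q\<close> to \<open>Q + 1\<close> cuts the intervals with \<open>q1 + q2 = Q + 1\<close> at their mediants.\<close>

lemma farey_cover:
  assumes "1 <= Q" "0 <= \<alpha>" "\<alpha> < 1"
  shows "\<exists>x\<in>farey_pairs Q. \<alpha> \<in> farey_interval x"
  using assms(1)
proof (induction Q rule: nat_induct_at_least)
  case base
  have "((0, 1), (1, 1)) \<in> farey_pairs 1" by (simp add: farey_pairs_def farey_adjacent_def)
  moreover have "\<alpha> \<in> farey_interval ((0, 1), (1, 1))" using assms by (simp add: farey_interval_def)
  ultimately show ?case by blast
next
  case (Suc Q)
  then obtain p1 q1 p2 q2 where x: "((p1, q1), (p2, q2)) \<in> farey_pairs Q" and \<alpha>: "\<alpha> \<in> farey_interval ((p1, q1), (p2, q2))"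
    by (metis surj_pair)
  have adj: "farey_adjacent ((p1, q1), (p2, q2))" and q: "q1 <= Q" "q2 <= Q" "Q < q1 + q2" using x by (auto simp: farey_pairs_def)
  have q1: "1 <= q1" "1 <= q2" using adj by (auto simp: farey_adjacent_def)
  show ?case
  proof (cases "Suc Q < q1 + q2")
    case True
    then have "((p1, q1), (p2, q2)) \<in> farey_pairs (Suc Q)" using adj q by (simp add: farey_pairs_def)
    then show ?thesis using \<alpha> by blast
  next
    case False
    then have e: "q1 + q2 = Suc Q" using q by simp
    define p where "p = p1 + p2"
    have a1: "farey_adjacent ((p1, q1), (p, q1 + q2))" and a2: "farey_adjacent ((p, q1 + q2), (p2, q2))"
      using adj farey_adjacent_bounds[OF adj] by (auto simp: farey_adjacent_def p_def algebra_simps)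
    have m: "((p1, q1), (p, q1 + q2)) \<in> farey_pairs (Suc Q)" "((p, q1 + q2), (p2, q2)) \<in> farey_pairs (Suc Q)"
      using a1 a2 e q q1 by (auto simp: farey_pairs_def)
    show ?thesis
    proof (cases "0 < of_int p - real (q1 + q2) * \<alpha>")
      case True
      then have "\<alpha> \<in> farey_interval ((p1, q1), (p, q1 + q2))"
        using \<alpha> q1 by (simp add: farey_interval_iff)
      then show ?thesis using m by blast
    next
      case False
      then have "\<alpha> \<in> farey_interval ((p, q1 + q2), (p2, q2))"
        using \<alpha> q1 by (simp add: farey_interval_iff)
      then show ?thesis using m by blast
    qed
  qed
qed

lemma between_farey_denominator:
  assumes adj: "farey_adjacent ((p1, q1), (p2, q2))"
    and b: "of_int p1 * real q < of_int p * real q1" "of_int p * real q2 < of_int p2 * real q"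
  shows "q1 + q2 <= q"
proof -
  have "p1 * int q < p * int q1" using b(1) by (metis of_int_less_iff of_int_mult of_int_of_nat_eq)
  moreover have "p * int q2 < p2 * int q" using b(2) by (metis of_int_less_iff of_int_mult of_int_of_nat_eq)
  ultimately have "1 <= p * int q1 - p1 * int q" "1 <= p2 * int q - p * int q2" by linarith+
  then have "int q2 * 1 <= int q2 * (p * int q1 - p1 * int q)" "int q1 * 1 <= int q1 * (p2 * int q - p * int q2)"
    by (intro mult_left_mono; simp)+
  then have "int q1 + int q2 <= int q2 * (p * int q1 - p1 * int q) + int q1 * (p2 * int q - p * int q2)" by linarith
  also have "... = int q * (p2 * int q1 - p1 * int q2)" by (simp add: algebra_simps)
  also have "... = int q" using adj by (simp add: farey_adjacent_def)
  finally show ?thesis by linarith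
qed

lemma coprime_fraction_eq:
  assumes "coprime p (int q)" "coprime p' (int q')" "1 <= q" "1 <= q'" "p * int q' = p' * int q"
  shows "p = p' \<and> q = q'"
proof -
  have "int q dvd p * int q'" using assms(5) by simp
  then have "int q dvd int q'" using assms(1) by (simp add: coprime_dvd_mult_right_iff coprime_commute)
  moreover have "int q' dvd p' * int q" using assms(5) by (metis dvd_triv_right)
  then have "int q' dvd int q" using assms(2) by (simp add: coprime_dvd_mult_right_iff coprime_commute)
  ultimately have "q = q'" by (simp add: dvd_antisym)
  then show ?thesis using assms by simp
qed

lemma farey_adjacent_coprime:
  assumes "farey_adjacent ((p1, q1), (p2, q2))"
  shows "coprime p1 (int q1)" "coprime p2 (int q2)"
proof -
  have d: "p2 * int q1 - p1 * int q2 = 1" using assms by (simp add: farey_adjacent_def)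
  show "coprime p1 (int q1)"
  proof (rule coprimeI)
    fix c assume "c dvd p1" "c dvd int q1"
    then have "c dvd p2 * int q1 - p1 * int q2" by simp
    then show "c dvd 1" using d by simp
  qed
  show "coprime p2 (int q2)"
  proof (rule coprimeI)
    fix c assume "c dvd p2" "c dvd int q2"
    then have "c dvd p2 * int q1 - p1 * int q2" by simp
    then show "c dvd 1" using d by simp
  qed
qed

text \<open>An end point of one interval inside another one would have a denominator exceeding \<open>Q\<close>.\<close>

lemma farey_disjoint:
  assumes x: "x \<in> farey_pairs Q" and y: "y \<in> farey_pairs Q" and \<alpha>: "\<alpha> \<in> farey_interval x" "\<alpha> \<in> farey_interval y"
  shows "x = y"
proof -
  obtain p1 q1 p2 q2 where xe: "x = ((p1, q1), (p2, q2))" by (metis surj_pair)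
  obtain a1 b1 a2 b2 where ye: "y = ((a1, b1), (a2, b2))" by (metis surj_pair)
  have ax: "farey_adjacent ((p1, q1), (p2, q2))" and Qx: "q1 <= Q" "q2 <= Q" "Q < q1 + q2" using x by (auto simp: farey_pairs_def xe)
  have ay: "farey_adjacent ((a1, b1), (a2, b2))" and Qy: "b1 <= Q" "b2 <= Q" "Q < b1 + b2" using y by (auto simp: farey_pairs_def ye)
  have q: "1 <= q1" "1 <= q2" "1 <= b1" "1 <= b2" using ax ay by (auto simp: farey_adjacent_def)
  have i: "of_int p1 / real q1 <= \<alpha>" "\<alpha> < of_int p2 / real q2" "of_int a1 / real b1 <= \<alpha>" "\<alpha> < of_int a2 / real b2"
    using \<alpha> by (auto simp: xe ye farey_interval_def)
  have left: "\<not> of_int p1 / real q1 < of_int a1 / real b1"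
    if ax: "farey_adjacent ((p1, q1), (p2, q2))" and Q: "Q < q1 + q2" "b1 <= Q" and lt: "of_int a1 / real b1 < of_int p2 / real q2"
      and q: "1 <= q1" "1 <= q2" "1 <= b1" for p1 q1 p2 q2 a1 b1
  proof
    assume "of_int p1 / real q1 < of_int a1 / real b1"
    then have "q1 + q2 <= b1" using lt q by (intro between_farey_denominator[OF ax, of b1 a1]) (auto simp: field_simps)
    then show False using Q by simp
  qed
  have right: "\<not> of_int a2 / real b2 < of_int p2 / real q2"
    if ax: "farey_adjacent ((p1, q1), (p2, q2))" and Q: "Q < q1 + q2" "b2 <= Q" and lt: "of_int p1 / real q1 < of_int a2 / real b2"
      and q: "1 <= q1" "1 <= q2" "1 <= b2" for p1 q1 p2 q2 a2 b2
  proof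
    assume "of_int a2 / real b2 < of_int p2 / real q2"
    then have "q1 + q2 <= b2" using lt q by (intro between_farey_denominator[OF ax, of b2 a2]) (auto simp: field_simps)
    then show False using Q by simp
  qed
  have "\<not> of_int p1 / real q1 < of_int a1 / real b1"
    by (rule left[OF ax Qx(3) Qy(1) _ q(1,2,3)]) (use i in linarith)
  moreover have "\<not> of_int a1 / real b1 < of_int p1 / real q1"
    by (rule left[OF ay Qy(3) Qx(1) _ q(3,4,1)]) (use i in linarith)
  ultimately have "of_int p1 / real q1 = of_int a1 / real b1" by linarith
  then have "real_of_int (p1 * int b1) = real_of_int (a1 * int q1)" using q by (simp add: field_simps)
  then have "p1 * int b1 = a1 * int q1" by linarith
  then have l: "p1 = a1 \<and> q1 = b1" using farey_adjacent_coprime(1)[OF ax] farey_adjacent_coprime(1)[OF ay] q by (intro coprime_fraction_eq) auto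
  have "\<not> of_int a2 / real b2 < of_int p2 / real q2"
    by (rule right[OF ax Qx(3) Qy(2) _ q(1,2,4)]) (use i in linarith)
  moreover have "\<not> of_int p2 / real q2 < of_int a2 / real b2"
    by (rule right[OF ay Qy(3) Qx(2) _ q(3,4,2)]) (use i in linarith)
  ultimately have "of_int p2 / real q2 = of_int a2 / real b2" by linarith
  then have "real_of_int (p2 * int b2) = real_of_int (a2 * int q2)" using q by (simp add: field_simps)
  then have "p2 * int b2 = a2 * int q2" by linarith
  then have r: "p2 = a2 \<and> q2 = b2" using farey_adjacent_coprime(2)[OF ax] farey_adjacent_coprime(2)[OF ay] q by (intro coprime_fraction_eq) auto
  show ?thesis using l r by (simp add: xe ye)
qed

lemma finite_farey_pairs: "finite (farey_pairs Q)"
proof (rule finite_subset[of _ "({0..int Q} \<times> {0..Q}) \<times> ({0..int Q} \<times> {0..Q})"])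
  show "farey_pairs Q \<subseteq> ({0..int Q} \<times> {0..Q}) \<times> ({0..int Q} \<times> {0..Q})"
  proof
    fix x assume x: "x \<in> farey_pairs Q"
    obtain p1 q1 p2 q2 where xe: "x = ((p1, q1), (p2, q2))" by (metis surj_pair)
    have adj: "farey_adjacent ((p1, q1), (p2, q2))" and q: "q1 <= Q" "q2 <= Q" using x by (auto simp: xe farey_pairs_def)
    have "0 <= p1" "p2 <= int q2" "0 < p2" "p1 < int q1" using adj farey_adjacent_bounds[OF adj] by (auto simp: farey_adjacent_def)
    then show "x \<in> ({0..int Q} \<times> {0..Q}) \<times> ({0..int Q} \<times> {0..Q})" using q by (auto simp: xe)
  qed
qed auto

section \<open>The first minimum on a Farey interval\<close>

text \<open>
  The vectors \<open>(q1, p1)\<close> and \<open>(q2, p2)\<close> form a basis of the integer lattice. A vector \<open>(j, i)\<close>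
  with two positive coordinates has \<open>j >= q1 + q2 > T\<close>; for one with coordinates of different
  signs the contributions to \<open>j \<alpha> - i\<close> do not cancel.
\<close>

lemma k0_first_ge:
  assumes adj: "farey_adjacent ((p1, q1), (p2, q2))" and T: "1 <= T" "T < real (q1 + q2)"
    and x: "real q1 * \<alpha> - of_int p1 >= \<delta>" and y: "of_int p2 - real q2 * \<alpha> >= \<delta>" and \<delta>: "\<delta> > 0"
  shows "k0 1 T \<alpha> >= T * \<delta>"
proof (rule ccontr)
  assume "\<not> T * \<delta> <= k0 1 T \<alpha>"
  then have lt: "k0 1 T \<alpha> < T * \<delta>" by simp
  have "1 <= card {q\<in>denoms T. nint_dist (real q * \<alpha>) <= k0 1 T \<alpha> / T}" using k0_le_iff[of 1 T \<alpha> "k0 1 T \<alpha>"] T by simp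
  then have "{q\<in>denoms T. nint_dist (real q * \<alpha>) <= k0 1 T \<alpha> / T} ~= {}" by (metis card.empty not_one_le_zero)
  then obtain j where j: "1 <= j" "real j <= T" "nint_dist (real j * \<alpha>) <= k0 1 T \<alpha> / T" by (auto simp: denoms_def)
  have "k0 1 T \<alpha> / T < \<delta>" using lt T by (simp add: divide_less_eq mult.commute)
  then have nd: "nint_dist (real j * \<alpha>) < \<delta>" using j by linarith
  obtain i where i: "nint_dist (real j * \<alpha>) = \<bar>real j * \<alpha> - of_int i\<bar>" by (rule nint_dist_obtain)
  have d: "p2 * int q1 - p1 * int q2 = 1" using adj by (simp add: farey_adjacent_def)
  \<comment> \<open>coordinates of the vector (j, i) in the basis\<close>
  define m where "m = int j * p2 - i * int q2"
  define m' where "m' = i * int q1 - int j * p1"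
  have jj: "int j = m * int q1 + m' * int q2"
  proof -
    have "m * int q1 + m' * int q2 = int j * (p2 * int q1 - p1 * int q2)" by (simp add: m_def m'_def algebra_simps)
    then show ?thesis using d by simp
  qed
  have ii: "i = m * p1 + m' * p2"
  proof -
    have "m * p1 + m' * p2 = i * (p2 * int q1 - p1 * int q2)" by (simp add: m_def m'_def algebra_simps)
    then show ?thesis using d by simp
  qed
  define X where "X = real q1 * \<alpha> - of_int p1"
  define Y where "Y = of_int p2 - real q2 * \<alpha>"
  have XY: "X >= \<delta>" "Y >= \<delta>" using x y by (auto simp: X_def Y_def)
  have "real j = of_int m * real q1 + of_int m' * real q2" using arg_cong[OF jj, of real_of_int] by simp
  moreover have "real_of_int i = of_int m * of_int p1 + of_int m' * of_int p2" using arg_cong[OF ii, of real_of_int] by simp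
  ultimately have lin: "real j * \<alpha> - of_int i = of_int m * X - of_int m' * Y" by (simp add: X_def Y_def algebra_simps)
  have jT: "int j < int q1 + int q2" using j(2) T(2) by linarith
  consider "m >= 1 \<and> m' >= 1" | "m >= 1 \<and> m' <= 0" | "m <= 0 \<and> m' >= 1" | "m <= 0 \<and> m' <= 0" by linarith
  then show False
  proof cases
    case 1
    then have "1 * int q1 <= m * int q1" "1 * int q2 <= m' * int q2" by (intro mult_right_mono; simp)+
    then show False using jj jT by linarith
  next
    case 2
    have "1 * X <= of_int m * X" using 2 XY \<delta> by (intro mult_right_mono) auto
    moreover have "of_int m' * Y <= 0" using 2 XY \<delta> by (intro mult_nonpos_nonneg) auto
    ultimately show False using lin nd i XY by linarith
  next
    case 3
    have "1 * Y <= of_int m' * Y" using 3 XY \<delta> by (intro mult_right_mono) auto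
    moreover have "of_int m * X <= 0" using 3 XY \<delta> by (intro mult_nonpos_nonneg) auto
    ultimately show False using lin nd i XY by linarith
  next
    case 4
    then have "m * int q1 <= 0" "m' * int q2 <= 0" by (auto intro: mult_nonpos_nonneg)
    then show False using jj j(1) by linarith
  qed
qed

lemma k0_first_le:
  assumes "1 <= q" "real q <= T" shows "k0 1 T \<alpha> <= T * \<bar>real q * \<alpha> - of_int p\<bar>"
proof -
  have T: "1 <= T" using assms by linarith
  have "{q\<in>denoms T. nint_dist (real q * \<alpha>) <= (T * \<bar>real q * \<alpha> - of_int p\<bar>) / T} \<supseteq> {}" by simp
  have "q \<in> {j\<in>denoms T. nint_dist (real j * \<alpha>) <= (T * \<bar>real q * \<alpha> - of_int p\<bar>) / T}"
    using assms T nint_dist_le[of "real q * \<alpha>" p] by (simp add: denoms_def)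
  then have "1 <= card {j\<in>denoms T. nint_dist (real j * \<alpha>) <= (T * \<bar>real q * \<alpha> - of_int p\<bar>) / T}"
    by (metis (no_types, lifting) One_nat_def Suc_leI card_gt_0_iff empty_iff finite_denoms finite_subset mem_Collect_eq subsetI)
  then show ?thesis using k0_le_iff[of 1 T \<alpha> "T * \<bar>real q * \<alpha> - of_int p\<bar>"] T by simp
qed

lemma k0_first_farey:
  assumes T: "1 <= T" and \<alpha>: "0 <= \<alpha>" "\<alpha> < 1"
  obtains p1 q1 p2 q2 where "((p1, q1), (p2, q2)) \<in> farey_pairs (nat \<lfloor>T\<rfloor>)"
    "\<alpha> \<in> farey_interval ((p1, q1), (p2, q2))"
    "k0 1 T \<alpha> <= T * (real q1 * \<alpha> - of_int p1)" "k0 1 T \<alpha> <= T * (of_int p2 - real q2 * \<alpha>)"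
proof -
  have "1 <= nat \<lfloor>T\<rfloor>" using T by linarith
  then obtain p1 q1 p2 q2 where x: "((p1, q1), (p2, q2)) \<in> farey_pairs (nat \<lfloor>T\<rfloor>)" "\<alpha> \<in> farey_interval ((p1, q1), (p2, q2))"
    using farey_cover[OF _ \<alpha>] by (metis surj_pair)
  have q: "1 <= q1" "1 <= q2" "q1 <= nat \<lfloor>T\<rfloor>" "q2 <= nat \<lfloor>T\<rfloor>" using x(1) by (auto simp: farey_pairs_def farey_adjacent_def)
  have qT: "real q1 <= T" "real q2 <= T" using q T by linarith+
  have s: "0 <= real q1 * \<alpha> - of_int p1" "0 < of_int p2 - real q2 * \<alpha>" using x(2) q by (simp_all add: farey_interval_iff)
  have "k0 1 T \<alpha> <= T * (real q1 * \<alpha> - of_int p1)" using k0_first_le[OF q(1) qT(1), of \<alpha> p1] s by simp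
  moreover have "k0 1 T \<alpha> <= T * (of_int p2 - real q2 * \<alpha>)" using k0_first_le[OF q(2) qT(2), of \<alpha> p2] s by simp
  ultimately show ?thesis using that x by blast
qed

section \<open>Lower bounds on a Farey interval\<close>

lemma measure_disjoint_intervals:
  fixes l u :: "'i => real"
  assumes I: "finite I" and lu: "\<And>i. i \<in> I ==> l i <= u i"
    and disj: "\<And>i j x. i \<in> I ==> j \<in> I ==> x \<in> {l i..u i} ==> x \<in> {l j..u j} ==> i = j"
    and sub: "\<And>i. i \<in> I ==> {l i..u i} \<subseteq> S" and S: "S \<in> sets lborel" "S \<subseteq> {0..1}"
  shows "(\<Sum>i\<in>I. u i - l i) <= measure lborel S"
proof -
  have fm: "{a..b} \<in> fmeasurable lborel" for a b :: real
    by (simp add: fmeasurable_def emeasure_lborel_Icc_eq)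
  have "(\<Sum>i\<in>I. u i - l i) = (\<Sum>i\<in>I. measure lborel {l i..u i})" using lu by simp
  also have "... = measure lborel (\<Union>i\<in>I. {l i..u i})"
  proof (rule measure_UNION'[symmetric, OF I])
    show "pairwise (\<lambda>i j. disjnt {l i..u i} {l j..u j}) I"
      using disj unfolding pairwise_def disjnt_iff by blast
  qed (rule fm)
  also have "... <= measure lborel S"
  proof (rule measure_mono_fmeasurable)
    show "S \<in> fmeasurable lborel"
      by (rule fmeasurableI2[OF fm S(2,1)])
  qed (use sub I in auto)
  finally show ?thesis .
qed

lemma mediant_coprime:
  assumes adj: "farey_adjacent ((p1, q1), (p2, q2))" and c: "coprime a b"
  shows "coprime (int a * p1 + int b * p2) (int (a * q1 + b * q2))"
proof (rule coprimeI)
  fix d assume d: "d dvd int a * p1 + int b * p2" "d dvd int (a * q1 + b * q2)"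
  have u: "p2 * int q1 - p1 * int q2 = 1" using adj by (simp add: farey_adjacent_def)
  have "d dvd int (a * q1 + b * q2) * p2 - (int a * p1 + int b * p2) * int q2" using d by simp
  also have "int (a * q1 + b * q2) * p2 - (int a * p1 + int b * p2) * int q2 = int a * (p2 * int q1 - p1 * int q2)" by (simp add: algebra_simps)
  finally have "d dvd int a" using u by simp
  moreover have "d dvd (int a * p1 + int b * p2) * int q1 - int (a * q1 + b * q2) * p1" using d by simp
  moreover have "(int a * p1 + int b * p2) * int q1 - int (a * q1 + b * q2) * p1 = int b * (p2 * int q1 - p1 * int q2)" by (simp add: algebra_simps)
  ultimately have "d dvd int a" "d dvd int b" using u by simp_all
  then show "d dvd 1" using c by (metis coprime_common_divisor coprime_int_iff)
qed

lemma mediant_inj: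
  assumes adj: "farey_adjacent ((p1, q1), (p2, q2))"
    and e: "int a * p1 + int b * p2 = int a' * p1 + int b' * p2" "a * q1 + b * q2 = a' * q1 + b' * q2"
  shows "a = a' \<and> b = b'"
proof -
  have u: "p2 * int q1 - p1 * int q2 = 1" using adj by (simp add: farey_adjacent_def)
  have e2: "int (a * q1 + b * q2) = int (a' * q1 + b' * q2)" using e(2) by simp
  have A: "int a = int (a * q1 + b * q2) * p2 - (int a * p1 + int b * p2) * int q2" for a b
  proof -
    have "int (a * q1 + b * q2) * p2 - (int a * p1 + int b * p2) * int q2 = int a * (p2 * int q1 - p1 * int q2)" by (simp add: algebra_simps)
    then show ?thesis using u by simp
  qed
  have B: "int b = (int a * p1 + int b * p2) * int q1 - int (a * q1 + b * q2) * p1" for a b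
  proof -
    have "(int a * p1 + int b * p2) * int q1 - int (a * q1 + b * q2) * p1 = int b * (p2 * int q1 - p1 * int q2)" by (simp add: algebra_simps)
    then show ?thesis using u by simp
  qed
  have "int a = int a'" using A[of a b] A[of a' b'] e(1) e2 by metis
  moreover have "int b = int b'" using B[of b a] B[of b' a'] e(1) e2 by metis
  ultimately show ?thesis by simp
qed

text \<open>The distance of two different fractions is at least the inverse product of the denominators.\<close>

lemma mediant_between:
  assumes adj: "farey_adjacent ((p1, q1), (p2, q2))" and ab: "a >= 1" "b >= 1"
  defines "p \<equiv> int a * p1 + int b * p2" and "q \<equiv> a * q1 + b * q2"
  shows "1 / (real q1 * real q) <= of_int p / real q - of_int p1 / real q1"
    "1 / (real q2 * real q) <= of_int p2 / real q2 - of_int p / real q"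
proof -
  have u: "p2 * int q1 - p1 * int q2 = 1" and q1: "1 <= q1" "1 <= q2" using adj by (auto simp: farey_adjacent_def)
  have u': "real_of_int p2 * real q1 - real_of_int p1 * real q2 = 1" using arg_cong[OF u, of real_of_int] by simp
  have "0 < a * q1" using ab q1 by simp
  then have "0 < q" unfolding q_def by (rule trans_less_add1)
  then have q: "q >= 1" by simp
  have "of_int p * real q1 - of_int p1 * real q = real b * (real_of_int p2 * real q1 - real_of_int p1 * real q2)"
    by (simp add: p_def q_def algebra_simps)
  then have "of_int p * real q1 - of_int p1 * real q >= 1" using u' ab by simp
  then show "1 / (real q1 * real q) <= of_int p / real q - of_int p1 / real q1" using q q1 by (simp add: field_simps)
  have "of_int p2 * real q - of_int p * real q2 = real a * (real_of_int p2 * real q1 - real_of_int p1 * real q2)"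
    by (simp add: p_def q_def algebra_simps)
  then have "of_int p2 * real q - of_int p * real q2 >= 1" using u' ab by simp
  then show "1 / (real q2 * real q) <= of_int p2 / real q2 - of_int p / real q" using q q1 by (simp add: field_simps)
qed

lemma farey_interval_sets [measurable]: "farey_interval x \<in> sets lborel"
  unfolding farey_interval_def by (auto split: prod.splits)

text \<open>
  By \<open>k0_le_if_close\<close>, \<open>k0 r T \<alpha> <= s\<close> holds within \<open>s / (r T q)\<close> of every reduced fraction of
  denominator \<open>q <= T / r\<close> inside the interval, and because of \<open>2 s < 1\<close> these neighbourhoods are
  disjoint and do not leave the interval.
\<close>

lemma small_value_measure_ge:
  assumes adj: "farey_adjacent ((p1, q1), (p2, q2))" and r: "1 <= r" and T: "real r * real q1 <= T" "real r * real q2 <= T"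
    and s: "0 <= s" "2 * s < 1"
  shows "measure lborel {\<alpha> \<in> farey_interval ((p1, q1), (p2, q2)). k0 r T \<alpha> <= s}
     >= 2 * s / (real r * T) * fraction_sum q1 q2 (T / real r)"
proof -
  have q: "1 <= q1" "1 <= q2" using adj by (auto simp: farey_adjacent_def)
  have rr: "real r > 0" using r by simp
  have rq: "real r * 1 <= real r * real q1" using q rr by (intro mult_left_mono) auto
  have rT: "real r <= T" using rq T(1) by linarith
  have T0: "T > 0" using rT rr by linarith
  define \<eta> where "\<eta> = s / (real r * T)"
  have \<eta>: "0 <= \<eta>" using s rr T0 by (simp add: \<eta>_def)
  define I where "I = {(a, b). a >= 1 \<and> b >= 1 \<and> coprime a b \<and> real (a * q1 + b * q2) <= T / real r}"
  have finI: "finite I" unfolding I_def using q by (intro finite_fraction_set) auto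
  define qq where "qq = (\<lambda>(a, b). a * q1 + b * q2)"
  define pp where "pp = (\<lambda>(a, b). int a * p1 + int b * p2)"
  define l where "l x = (of_int (pp x) - \<eta>) / real (qq x)" for x
  define u where "u x = (of_int (pp x) + \<eta>) / real (qq x)" for x
  define S where "S = {\<alpha> \<in> farey_interval ((p1, q1), (p2, q2)). k0 r T \<alpha> <= s}"
  have qpos: "1 <= qq x" "real r * real (qq x) <= T" if "x \<in> I" for x
  proof -
    obtain a b where x: "x = (a, b)" by (cases x)
    have "0 < a * q1" using that q by (auto simp: I_def x)
    then have "0 < qq x" unfolding x qq_def case_prod_conv by (rule trans_less_add1)
    then show "1 <= qq x" by simp
    have "real (qq x) <= T / real r" using that by (simp add: I_def x qq_def)
    then show "real r * real (qq x) <= T" using rr by (simp add: field_simps)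
  qed
  have close: "\<bar>real (qq x) * \<alpha> - of_int (pp x)\<bar> <= \<eta>" if "x \<in> I" "\<alpha> \<in> {l x..u x}" for x \<alpha>
    using that qpos(1)[OF that(1)] by (auto simp: l_def u_def abs_le_iff field_simps)
  have "(\<Sum>x\<in>I. u x - l x) <= measure lborel S"
  proof (rule measure_disjoint_intervals[OF finI])
    show "l x <= u x" if "x \<in> I" for x using \<eta> by (auto simp: l_def u_def intro!: divide_right_mono)
  next
    fix x y \<alpha> assume x: "x \<in> I" and y: "y \<in> I" and ax: "\<alpha> \<in> {l x..u x}" and ay: "\<alpha> \<in> {l y..u y}"
    have "\<bar>of_int (pp x) * real (qq y) - of_int (pp y) * real (qq x)\<bar>
       = \<bar>real (qq x) * (real (qq y) * \<alpha> - of_int (pp y)) - real (qq y) * (real (qq x) * \<alpha> - of_int (pp x))\<bar>" by (simp add: algebra_simps)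
    also have "... <= real (qq x) * \<bar>real (qq y) * \<alpha> - of_int (pp y)\<bar> + real (qq y) * \<bar>real (qq x) * \<alpha> - of_int (pp x)\<bar>"
      using abs_triangle_ineq4[of "real (qq x) * (real (qq y) * \<alpha> - of_int (pp y))" "real (qq y) * (real (qq x) * \<alpha> - of_int (pp x))"] by (simp add: abs_mult)
    also have "... <= T * \<eta> + T * \<eta>"
    proof (intro add_mono mult_mono close x y ax ay)
      have "real (qq z) <= T" if "z \<in> I" for z
      proof -
        have "1 * real (qq z) <= real r * real (qq z)" using r by (intro mult_right_mono) auto
        then show ?thesis using qpos(2)[OF that] by linarith
      qed
      then show "real (qq x) <= T" "real (qq y) <= T" using x y by auto
    qed (use T0 in auto)
    also have "... = 2 * s / real r" using T0 rr by (simp add: \<eta>_def)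
    also have "... <= 2 * s" using s r mult_left_mono[of 1 "real r" s] by (simp add: divide_le_eq)
    also have "... < 1" by (rule s)
    finally have "\<bar>real_of_int (pp x * int (qq y) - pp y * int (qq x))\<bar> < 1" by simp
    then have "pp x * int (qq y) - pp y * int (qq x) = 0" by linarith
    then have e: "pp x * int (qq y) = pp y * int (qq x)" by simp
    obtain a b where xe: "x = (a, b)" by (cases x)
    obtain a' b' where ye: "y = (a', b')" by (cases y)
    have "coprime (pp x) (int (qq x))" "coprime (pp y) (int (qq y))"
      using mediant_coprime[OF adj, of a b] mediant_coprime[OF adj, of a' b'] x y by (auto simp: xe ye pp_def qq_def I_def)
    then have "pp x = pp y \<and> qq x = qq y" using qpos x y e by (intro coprime_fraction_eq) auto
    then show "x = y" using mediant_inj[OF adj, of a b a' b'] by (simp add: xe ye pp_def qq_def)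
  next
    fix x assume x: "x \<in> I"
    obtain a b where xe: "x = (a, b)" by (cases x)
    have ab: "a >= 1" "b >= 1" using x by (auto simp: xe I_def)
    have Q: "real (qq x) > 0" using qpos(1)[OF x] by simp
    show "{l x..u x} \<subseteq> S"
    proof
      fix \<alpha> assume \<alpha>: "\<alpha> \<in> {l x..u x}"
      have "k0 r T \<alpha> <= s"
        using close[OF x \<alpha>] unfolding \<eta>_def by (intro k0_le_if_close[OF r qpos(1)[OF x] qpos(2)[OF x] s(1)])
      moreover have "\<alpha> \<in> farey_interval ((p1, q1), (p2, q2))"
      proof -
        have e: "\<eta> < 1 / real z" if "1 <= z" "real r * real z <= T" for z :: nat
        proof -
          have "s * real z < 1 * (real r * T)"
          proof -
            have "1 * real z <= real r * real z" using r by (intro mult_right_mono) auto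
            then have "real z <= T" using that by linarith
            then have "s * real z <= s * T" using s by (intro mult_left_mono) auto
            also have "... < 1 * T" using s T0 by (intro mult_strict_right_mono) auto
            also have "... <= real r * T" using r T0 by (intro mult_right_mono) auto
            finally show ?thesis by simp
          qed
          then show ?thesis using that rr T0 by (simp add: \<eta>_def field_simps)
        qed
        have "\<eta> / real (qq x) < 1 / (real q1 * real (qq x))"
          using divide_strict_right_mono[OF e[OF q(1) T(1)] Q] by simp
        moreover have "\<eta> / real (qq x) < 1 / (real q2 * real (qq x))"
          using divide_strict_right_mono[OF e[OF q(2) T(2)] Q] by simp
        moreover have "of_int (pp x) / real (qq x) - \<eta> / real (qq x) <= \<alpha>" "\<alpha> <= of_int (pp x) / real (qq x) + \<eta> / real (qq x)"
          using \<alpha> by (auto simp: l_def u_def diff_divide_distrib add_divide_distrib)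
        moreover note mediant_between[OF adj ab]
        ultimately have "of_int p1 / real q1 <= \<alpha>" "\<alpha> < of_int p2 / real q2"
          unfolding xe pp_def qq_def case_prod_conv by linarith+
        then show ?thesis by (simp add: farey_interval_def)
      qed
      ultimately show "\<alpha> \<in> S" by (simp add: S_def)
    qed
  next
    have "S = farey_interval ((p1, q1), (p2, q2)) \<inter> (k0 r T -` {..s} \<inter> space lborel)" by (auto simp: S_def)
    moreover have "k0 r T -` {..s} \<inter> space lborel \<in> sets lborel"
      using k0_measurable[OF r rT] by (intro measurable_sets[of _ lborel borel]) auto
    ultimately show "S \<in> sets lborel" by (metis farey_interval_sets sets.Int)
    show "S \<subseteq> {0..1}" using farey_interval_subset[OF adj] by (auto simp: S_def)
  qed
  moreover have "(\<Sum>x\<in>I. u x - l x) = 2 * s / (real r * T) * fraction_sum q1 q2 (T / real r)"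
  proof -
    have "u x - l x = 2 * s / (real r * T) * (case x of (a, b) => 1 / real (a * q1 + b * q2))" for x
    proof -
      have "u x - l x = 2 * \<eta> * (1 / real (qq x))" by (simp add: u_def l_def diff_divide_distrib[symmetric])
      then show ?thesis by (simp add: \<eta>_def qq_def case_prod_beta)
    qed
    then show ?thesis unfolding fraction_sum_def I_def[symmetric] by (simp add: sum_distrib_left)
  qed
  ultimately show ?thesis by (simp add: S_def)
qed

lemma gap_farey:
  assumes adj: "farey_adjacent ((p1, q1), (p2, q2))" and x: "((a, b), (a', b')) \<in> gap_pairs q1 q2 T eps"
  shows "((int a * p1 + int b * p2, a * q1 + b * q2), (int a' * p1 + int b' * p2, a' * q1 + b' * q2)) \<in> farey_pairs (nat \<lfloor>T\<rfloor>)"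
    "farey_interval ((int a * p1 + int b * p2, a * q1 + b * q2), (int a' * p1 + int b' * p2, a' * q1 + b' * q2)) \<subseteq> farey_interval ((p1, q1), (p2, q2))"
proof -
  have A: "0 <= p1" "p2 <= int q2" "1 <= q1" "1 <= q2" and u: "p2 * int q1 - p1 * int q2 = 1" using adj by (auto simp: farey_adjacent_def)
  have B: "0 < p2" "p1 < int q1" using farey_adjacent_bounds[OF adj] by auto
  have d: "a * b' = a' * b + 1" and s: "real (a * q1 + b * q2) <= T" "real (a' * q1 + b' * q2) <= T" "T < real ((a * q1 + b * q2) + (a' * q1 + b' * q2))"
    using x unfolding gap_pairs_def by blast+
  have ab: "1 <= a" "1 <= b'" using gap_pairs_pos[OF x] by auto
  have d': "int a * int b' - int a' * int b = 1" using arg_cong[OF d, of int] by simp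
  define p where "p = int a * p1 + int b * p2"
  define q where "q = a * q1 + b * q2"
  define p' where "p' = int a' * p1 + int b' * p2"
  define q' where "q' = a' * q1 + b' * q2"
  have q0: "1 <= q" "1 <= q'"
  proof -
    have "1 * 1 <= a * q1" "1 * 1 <= b' * q2" using ab A by (intro mult_le_mono; simp)+
    then show "1 <= q" "1 <= q'" unfolding q_def q'_def by linarith+
  qed
  have det: "p' * int q - p * int q' = 1"
  proof -
    have "p' * int q - p * int q' = (int a * int b' - int a' * int b) * (p2 * int q1 - p1 * int q2)" by (simp add: p_def q_def p'_def q'_def algebra_simps)
    then show ?thesis using d' u by simp
  qed
  have "p' <= int q'"
  proof -
    have "int a' * p1 <= int a' * int q1" "int b' * p2 <= int b' * int q2" using A B by (intro mult_left_mono; simp)+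
    then show ?thesis by (simp add: p'_def q'_def)
  qed
  moreover have "0 <= p" using A B by (simp add: p_def)
  moreover have "q <= nat \<lfloor>T\<rfloor>" "q' <= nat \<lfloor>T\<rfloor>" using s unfolding q_def q'_def by (intro le_nat_floor; simp)+
  moreover have "nat \<lfloor>T\<rfloor> < q + q'"
  proof -
    have "0 <= T" using s(1) by (meson of_nat_0_le_iff order_trans)
    then have "real (nat \<lfloor>T\<rfloor>) <= T" by simp
    then have "real (nat \<lfloor>T\<rfloor>) < real (q + q')" using s(3) unfolding q_def q'_def by linarith
    then show ?thesis by (simp only: of_nat_less_iff)
  qed
  ultimately have "((p, q), (p', q')) \<in> farey_pairs (nat \<lfloor>T\<rfloor>)" using q0 det by (simp add: farey_pairs_def farey_adjacent_def)
  then show "((int a * p1 + int b * p2, a * q1 + b * q2), (int a' * p1 + int b' * p2, a' * q1 + b' * q2)) \<in> farey_pairs (nat \<lfloor>T\<rfloor>)"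
    by (simp only: p_def q_def p'_def q'_def)
  have u': "real_of_int p2 * real q1 - real_of_int p1 * real q2 = 1" using arg_cong[OF u, of real_of_int] by simp
  have "of_int p * real q1 - of_int p1 * real q = real b * (real_of_int p2 * real q1 - real_of_int p1 * real q2)"
    by (simp add: p_def q_def algebra_simps)
  then have "of_int p1 * real q <= of_int p * real q1" using u' by simp
  then have l: "of_int p1 / real q1 <= of_int p / real q" using q0 A by (simp add: field_simps)
  have "of_int p2 * real q' - of_int p' * real q2 = real a' * (real_of_int p2 * real q1 - real_of_int p1 * real q2)"
    by (simp add: p'_def q'_def algebra_simps)
  then have "of_int p' * real q2 <= of_int p2 * real q'" using u' by simp
  then have "of_int p' / real q' <= of_int p2 / real q2" using q0 A by (simp add: field_simps)
  then have "farey_interval ((p, q), (p', q')) \<subseteq> farey_interval ((p1, q1), (p2, q2))" using l by (auto simp: farey_interval_def)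
  then show "farey_interval ((int a * p1 + int b * p2, a * q1 + b * q2), (int a' * p1 + int b' * p2, a' * q1 + b' * q2)) \<subseteq> farey_interval ((p1, q1), (p2, q2))"
    by (simp only: p_def q_def p'_def q'_def)
qed

lemma middle_length:
  assumes adj: "farey_adjacent ((p, n), (p', n'))" and T: "0 < T" and \<delta>: "\<delta> = (1 - eps) / T"
  shows "(of_int p' - \<delta>) / real n' - (of_int p + \<delta>) / real n = gap_length T eps n n'"
proof -
  have n: "real n > 0" "real n' > 0" using adj by (auto simp: farey_adjacent_def)
  have "(of_int p' - \<delta>) / real n' - (of_int p + \<delta>) / real n = (of_int p' / real n' - of_int p / real n) - (\<delta> / real n' + \<delta> / real n)"
    by (simp add: diff_divide_distrib add_divide_distrib)
  also have "... = 1 / (real n * real n') - (\<delta> / real n' + \<delta> / real n)" using farey_adjacent_diff[OF adj] by simp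
  also have "... = gap_length T eps n n'" using n T by (simp add: gap_length_def \<delta> field_simps)
  finally show ?thesis .
qed

text \<open>
  A pair in \<open>gap_pairs\<close> yields a Farey interval of order \<open>T\<close> inside the given interval, and on its
  middle part of length \<open>gap_length\<close> the bound of \<open>k0_first_ge\<close> is at least \<open>1 - eps\<close>.
\<close>

lemma large_value_measure_ge:
  assumes adj: "farey_adjacent ((p1, q1), (p2, q2))" and T: "1 <= T" and eps: "0 < eps" "eps < 1"
  shows "measure lborel {\<alpha> \<in> farey_interval ((p1, q1), (p2, q2)). k0 1 T \<alpha> >= 1 - eps} >= gap_sum q1 q2 T eps"
proof -
  have q: "1 <= q1" "1 <= q2" using adj by (auto simp: farey_adjacent_def)
  define \<delta> where "\<delta> = (1 - eps) / T"
  have \<delta>: "\<delta> > 0" "T * \<delta> = 1 - eps" using eps T by (auto simp: \<delta>_def)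
  define I where "I = gap_pairs q1 q2 T eps"
  have finI: "finite I" unfolding I_def using q by (intro finite_gap_pairs) auto
  define \<Phi> :: "(nat \<times> nat) \<times> (nat \<times> nat) => farey" where "\<Phi> = (\<lambda>((a, b), (a', b')). ((int a * p1 + int b * p2, a * q1 + b * q2), (int a' * p1 + int b' * p2, a' * q1 + b' * q2)))"
  define l :: "farey => real" where "l = (\<lambda>((p, q), (p', q')). (of_int p + \<delta>) / real q)"
  define u :: "farey => real" where "u = (\<lambda>((p, q), (p', q')). (of_int p' - \<delta>) / real q')"
  define S where "S = {\<alpha> \<in> farey_interval ((p1, q1), (p2, q2)). k0 1 T \<alpha> >= 1 - eps}"
  have F: "\<Phi> x \<in> farey_pairs (nat \<lfloor>T\<rfloor>)" "farey_interval (\<Phi> x) \<subseteq> farey_interval ((p1, q1), (p2, q2))" if "x \<in> I" for x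
  proof -
    obtain a b a' b' where x: "x = ((a, b), (a', b'))" by (metis surj_pair)
    show "\<Phi> x \<in> farey_pairs (nat \<lfloor>T\<rfloor>)" "farey_interval (\<Phi> x) \<subseteq> farey_interval ((p1, q1), (p2, q2))"
      using gap_farey[OF adj, of a b a' b' T eps] that by (simp_all add: I_def x \<Phi>_def)
  qed
  have inj: "x = y" if "\<Phi> x = \<Phi> y" for x y
  proof -
    obtain a b a' b' where x: "x = ((a, b), (a', b'))" by (metis surj_pair)
    obtain c d c' d' where y: "y = ((c, d), (c', d'))" by (metis surj_pair)
    show ?thesis using that mediant_inj[OF adj, of a b c d] mediant_inj[OF adj, of a' b' c' d'] by (simp add: x y \<Phi>_def)
  qed
  have len: "u (\<Phi> x) - l (\<Phi> x) = (\<lambda>((a, b), (a', b')). gap_length T eps (a * q1 + b * q2) (a' * q1 + b' * q2)) x" "l (\<Phi> x) <= u (\<Phi> x)" if x: "x \<in> I" for x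
  proof -
    obtain a b a' b' where xe: "x = ((a, b), (a', b'))" by (metis surj_pair)
    define p where "p = int a * p1 + int b * p2"
    define n where "n = a * q1 + b * q2"
    define p' where "p' = int a' * p1 + int b' * p2"
    define n' where "n' = a' * q1 + b' * q2"
    have \<Phi>: "\<Phi> x = ((p, n), (p', n'))" by (simp add: \<Phi>_def xe p_def n_def p'_def n'_def)
    have fa: "farey_adjacent ((p, n), (p', n'))" using F(1)[OF x] by (simp add: \<Phi> farey_pairs_def)
    have e: "u (\<Phi> x) - l (\<Phi> x) = gap_length T eps n n'"
      using middle_length[OF fa _ \<delta>_def] T by (simp add: \<Phi> u_def l_def)
    then show "u (\<Phi> x) - l (\<Phi> x) = (\<lambda>((a, b), (a', b')). gap_length T eps (a * q1 + b * q2) (a' * q1 + b' * q2)) x"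
      by (simp add: xe n_def n'_def)
    have "(1 - eps) * real (n + n') < T" using x unfolding I_def xe gap_pairs_def n_def n'_def by blast
    then have "0 <= gap_length T eps n n'" using T by (simp add: gap_length_def)
    then show "l (\<Phi> x) <= u (\<Phi> x)" using e by linarith
  qed
  have inside: "\<alpha> \<in> farey_interval (\<Phi> x) \<and> k0 1 T \<alpha> >= 1 - eps" if x: "x \<in> I" and \<alpha>: "\<alpha> \<in> {l (\<Phi> x)..u (\<Phi> x)}" for x \<alpha>
  proof -
    obtain p n p' n' where \<Phi>: "\<Phi> x = ((p, n), (p', n'))" by (metis surj_pair)
    have fp: "((p, n), (p', n')) \<in> farey_pairs (nat \<lfloor>T\<rfloor>)" using F(1)[OF x] by (simp add: \<Phi>)
    then have fa: "farey_adjacent ((p, n), (p', n'))" by (simp add: farey_pairs_def)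
    have n: "1 <= n" "1 <= n'" using fa by (auto simp: farey_adjacent_def)
    have c: "\<delta> <= real n * \<alpha> - of_int p" "\<delta> <= of_int p' - real n' * \<alpha>"
      using \<alpha> n by (auto simp: \<Phi> l_def u_def field_simps)
    have "nat \<lfloor>T\<rfloor> < n + n'" using fp by (simp add: farey_pairs_def)
    then have "T < real (n + n')" using T by linarith
    then have "T * \<delta> <= k0 1 T \<alpha>" by (rule k0_first_ge[OF fa T _ c \<delta>(1)])
    moreover have "\<alpha> \<in> farey_interval ((p, n), (p', n'))" using c \<delta> n by (simp add: farey_interval_iff)
    ultimately show ?thesis using \<delta> by (simp add: \<Phi>)
  qed
  have "(\<Sum>x\<in>I. u (\<Phi> x) - l (\<Phi> x)) <= measure lborel S"
  proof (rule measure_disjoint_intervals[OF finI len(2)])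
    fix x y \<alpha> assume "x \<in> I" "y \<in> I" "\<alpha> \<in> {l (\<Phi> x)..u (\<Phi> x)}" "\<alpha> \<in> {l (\<Phi> y)..u (\<Phi> y)}"
    then have "\<Phi> x = \<Phi> y" using inside F(1) by (intro farey_disjoint[of _ "nat \<lfloor>T\<rfloor>" _ \<alpha>]) auto
    then show "x = y" by (rule inj)
  next
    fix x assume x: "x \<in> I"
    show "{l (\<Phi> x)..u (\<Phi> x)} \<subseteq> S" using inside[OF x] F(2)[OF x] by (auto simp: S_def)
  next
    have "S = farey_interval ((p1, q1), (p2, q2)) \<inter> (k0 1 T -` {1 - eps..} \<inter> space lborel)" by (auto simp: S_def)
    moreover have "k0 1 T -` {1 - eps..} \<inter> space lborel \<in> sets lborel"
      using k0_measurable[of 1 T] T by (intro measurable_sets[of _ lborel borel]) auto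
    ultimately show "S \<in> sets lborel" by (metis farey_interval_sets sets.Int)
    show "S \<subseteq> {0..1}" using farey_interval_subset[OF adj] by (auto simp: S_def)
  qed
  moreover have "(\<Sum>x\<in>I. u (\<Phi> x) - l (\<Phi> x)) = gap_sum q1 q2 T eps"
    unfolding gap_sum_def I_def[symmetric] by (rule sum.cong[OF refl], rule len(1))
  ultimately show ?thesis by (simp add: S_def)
qed

section \<open>Upper bounds on the whole circle\<close>

lemma fmeasurable_Icc: "{a..b::real} \<in> fmeasurable lborel"
  by (simp add: fmeasurable_def emeasure_lborel_Icc_eq)

lemma measure_le_sum_intervals:
  fixes l u :: "'i => real"
  assumes I: "finite I" and lu: "\<And>i. i \<in> I ==> l i <= u i" and S: "S \<in> sets lborel" "S \<subseteq> (\<Union>i\<in>I. {l i..u i})"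
  shows "measure lborel S <= (\<Sum>i\<in>I. u i - l i)"
proof -
  have "measure lborel S <= measure lborel (\<Union>i\<in>I. {l i..u i})"
    by (rule measure_mono_fmeasurable[OF S(2,1)]) (intro fmeasurable.finite_UN I fmeasurable_Icc)
  also have "... <= (\<Sum>i\<in>I. measure lborel {l i..u i})"
    using I by (rule measure_UNION_le) auto
  also have "... = (\<Sum>i\<in>I. u i - l i)" using lu by simp
  finally show ?thesis .
qed

text \<open>
  For \<open>q = 1\<close> the two ends of \<open>[0, 1)\<close> carry one half of the neighbourhood of an integer each, so
  this case is treated separately.
\<close>

lemma near_fraction_measure_le:
  assumes q: "1 <= q" and \<eta>: "0 <= \<eta>" "\<eta> < 1" and S: "S \<in> sets lborel" "S \<subseteq> {0..<1}"
    and close: "\<And>\<alpha>. \<alpha> \<in> S ==> \<exists>p::int. coprime p (int q) \<and> \<bar>real q * \<alpha> - of_int p\<bar> <= \<eta>"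
  shows "measure lborel S <= 2 * \<eta> * totient_ratio q"
proof (cases "q = 1")
  case True
  have "S \<subseteq> (\<Union>i\<in>{False, True}. {(if i then 1 - \<eta> else 0)..(if i then 1 else \<eta>)})"
  proof
    fix \<alpha> assume \<alpha>: "\<alpha> \<in> S"
    then have r: "0 <= \<alpha>" "\<alpha> < 1" using S by auto
    obtain p :: int where p: "\<bar>\<alpha> - of_int p\<bar> <= \<eta>" using close[OF \<alpha>] True by auto
    have "-1 < p" "p < 2" using p r \<eta> by linarith+
    then have "p = 0 \<or> p = 1" by auto
    then show "\<alpha> \<in> (\<Union>i\<in>{False, True}. {(if i then 1 - \<eta> else 0)..(if i then 1 else \<eta>)})" using p r by auto
  qed
  then have "measure lborel S <= (\<Sum>i\<in>{False, True}. (if i then 1 else \<eta>) - (if i then 1 - \<eta> else 0))"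
    using \<eta> S by (intro measure_le_sum_intervals) auto
  then show ?thesis using True by (simp add: totient_ratio_def)
next
  case False
  have "S \<subseteq> (\<Union>p\<in>totatives q. {(real p - \<eta>) / real q..(real p + \<eta>) / real q})"
  proof
    fix \<alpha> assume \<alpha>: "\<alpha> \<in> S"
    then have r: "0 <= \<alpha>" "\<alpha> < 1" using S by auto
    obtain p :: int where p: "coprime p (int q)" "\<bar>real q * \<alpha> - of_int p\<bar> <= \<eta>" using close[OF \<alpha>] by auto
    have "0 <= real q * \<alpha>" "real q * \<alpha> <= real q * 1" using r by (simp, intro mult_left_mono) auto
    then have "-1 < p" "p < int q + 1" using p \<eta> by linarith+
    then have b: "0 <= p" "p <= int q" by auto
    have "p ~= 0" using p(1) False q by auto
    define n where "n = nat p"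
    have n: "p = int n" "n > 0" "n <= q" using b \<open>p ~= 0\<close> by (auto simp: n_def)
    have "coprime n q" using p(1) n by simp
    then have "n \<in> totatives q" using n by (simp add: in_totatives_iff)
    moreover have "\<alpha> \<in> {(real n - \<eta>) / real q..(real n + \<eta>) / real q}"
      using p(2) n q by (auto simp: field_simps abs_le_iff)
    ultimately show "\<alpha> \<in> (\<Union>p\<in>totatives q. {(real p - \<eta>) / real q..(real p + \<eta>) / real q})" by blast
  qed
  then have "measure lborel S <= (\<Sum>p\<in>totatives q. (real p + \<eta>) / real q - (real p - \<eta>) / real q)"
    using \<eta> S by (intro measure_le_sum_intervals) (auto intro!: divide_right_mono)
  also have "... = (\<Sum>p\<in>totatives q. 2 * \<eta> / real q)" by (intro sum.cong refl) (simp add: diff_divide_distrib[symmetric])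
  also have "... = 2 * \<eta> * totient_ratio q" by (simp add: totient_ratio_def totient_def)
  finally show ?thesis .
qed

lemma k0_sublevel_sets:
  assumes "1 <= r" "real r <= T" "A \<in> sets lborel"
  shows "{\<alpha> \<in> A. k0 r T \<alpha> <= s} \<in> sets lborel" "{\<alpha> \<in> A. s <= k0 r T \<alpha>} \<in> sets lborel"
proof -
  have "k0 r T -` {..s} \<inter> space lborel \<in> sets lborel" "k0 r T -` {s..} \<inter> space lborel \<in> sets lborel"
  proof -
    have "k0 r T -` {..s} \<inter> space borel \<in> sets borel" "k0 r T -` {s..} \<inter> space borel \<in> sets borel"
      by (rule measurable_sets[OF k0_measurable[OF assms(1,2)]]; simp)+
    then show "k0 r T -` {..s} \<inter> space lborel \<in> sets lborel" "k0 r T -` {s..} \<inter> space lborel \<in> sets lborel" by simp_all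
  qed
  then have "A \<inter> (k0 r T -` {..s} \<inter> space lborel) \<in> sets lborel" "A \<inter> (k0 r T -` {s..} \<inter> space lborel) \<in> sets lborel"
    using assms(3) by auto
  moreover have "A \<inter> (k0 r T -` {..s} \<inter> space lborel) = {\<alpha> \<in> A. k0 r T \<alpha> <= s}" "A \<inter> (k0 r T -` {s..} \<inter> space lborel) = {\<alpha> \<in> A. s <= k0 r T \<alpha>}" by auto
  ultimately show "{\<alpha> \<in> A. k0 r T \<alpha> <= s} \<in> sets lborel" "{\<alpha> \<in> A. s <= k0 r T \<alpha>} \<in> sets lborel" by simp_all
qed

text \<open>\<open>close_if_k0_le\<close> covers the set by neighbourhoods of reduced fractions.\<close>

lemma small_value_measure_le:
  assumes r: "1 <= r" "real r <= T" and s: "0 <= s" "2 * s < 1"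
  shows "measure lborel {\<alpha> \<in> {0..<1}. k0 r T \<alpha> <= s} <= 2 * s / (real r * T) * ratio_sum (nat \<lfloor>T / real r\<rfloor>)"
proof -
  have T: "T >= 1" using r by linarith
  define \<eta> where "\<eta> = s / (real r * T)"
  have rT: "real r * T >= 1" using r T mult_mono[of 1 "real r" 1 T] by simp
  have "s * 1 < 1 * (real r * T)" using s rT by linarith
  then have \<eta>: "0 <= \<eta>" "\<eta> < 1" using s rT by (auto simp: \<eta>_def divide_less_eq)
  define S where "S = {\<alpha> \<in> {0..<1}. k0 r T \<alpha> <= s}"
  define A where "A q = S \<inter> (\<Union>p\<in>{p. coprime p (int q)}. {(of_int p - \<eta>) / real q..(of_int p + \<eta>) / real q})" for q :: nat
  have Ss: "S \<in> sets lborel" unfolding S_def using r by (intro k0_sublevel_sets) auto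
  have As: "A q \<in> sets lborel" for q
    unfolding A_def using Ss by (intro sets.Int sets.countable_UN'') auto
  have Af: "A q \<in> fmeasurable lborel" for q
    by (rule fmeasurableI2[OF fmeasurable_Icc[of 0 1] _ As]) (auto simp: A_def S_def)
  have mA: "measure lborel (A q) <= 2 * \<eta> * totient_ratio q" if q: "q \<in> {1..nat \<lfloor>T / real r\<rfloor>}" for q
  proof (rule near_fraction_measure_le[OF _ \<eta> As])
    show "1 <= q" using q by simp
    show "A q \<subseteq> {0..<1}" by (auto simp: A_def S_def)
    fix \<alpha> assume "\<alpha> \<in> A q"
    then obtain p where "coprime p (int q)" "(of_int p - \<eta>) / real q <= \<alpha>" "\<alpha> <= (of_int p + \<eta>) / real q" by (auto simp: A_def)
    then show "\<exists>p. coprime p (int q) \<and> \<bar>real q * \<alpha> - of_int p\<bar> <= \<eta>"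
      using q by (intro exI[of _ p]) (auto simp: field_simps abs_le_iff)
  qed
  have "S \<subseteq> (\<Union>q\<in>{1..nat \<lfloor>T / real r\<rfloor>}. A q)"
  proof
    fix \<alpha> assume \<alpha>: "\<alpha> \<in> S"
    then obtain p :: int and q :: nat where pq: "coprime p (int q)" "1 <= q" "real r * real q <= T" "\<bar>real q * \<alpha> - of_int p\<bar> <= s / (real r * T)"
      using close_if_k0_le[OF r s(2), of \<alpha>] by (auto simp: S_def)
    have "real q <= T / real r" using pq(3) r by (simp add: field_simps)
    then have "q <= nat \<lfloor>T / real r\<rfloor>" by (rule le_nat_floor)
    moreover have "\<alpha> \<in> {(of_int p - \<eta>) / real q..(of_int p + \<eta>) / real q}"
      using pq(4,2) unfolding \<eta>_def[symmetric] by (auto simp: field_simps abs_le_iff)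
    ultimately show "\<alpha> \<in> (\<Union>q\<in>{1..nat \<lfloor>T / real r\<rfloor>}. A q)" using \<alpha> pq by (auto simp: A_def)
  qed
  then have "measure lborel S <= measure lborel (\<Union>q\<in>{1..nat \<lfloor>T / real r\<rfloor>}. A q)"
    by (rule measure_mono_fmeasurable[OF _ Ss]) (intro fmeasurable.finite_UN Af finite_atLeastAtMost)
  also have "... <= (\<Sum>q\<in>{1..nat \<lfloor>T / real r\<rfloor>}. measure lborel (A q))"
    by (rule measure_UNION_le[OF _ As]) simp
  also have "... <= (\<Sum>q\<in>{1..nat \<lfloor>T / real r\<rfloor>}. 2 * \<eta> * totient_ratio q)"
    by (intro sum_mono mA)
  also have "... = 2 * s / (real r * T) * ratio_sum (nat \<lfloor>T / real r\<rfloor>)"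
    by (simp add: ratio_sum_def sum_distrib_left \<eta>_def)
  finally show ?thesis by (simp add: S_def)
qed

text \<open>The sum exceeds the area of the triangle by at most its first term.\<close>

lemma linear_ramp_sum_upper:
  fixes w0 d :: real
  assumes d: "d > 0" and w0: "w0 >= 0"
  shows "(\<Sum>i=1..n. max 0 (w0 - (real i - 1) * d)) <= w0 ^ 2 / (2 * d) + w0"
proof -
  define F where "F x = (max 0 x) ^ 2 / 2" for x :: real
  have step: "d * max 0 x <= F (x + d) - F x" for x
  proof (cases "x >= 0")
    case True
    have "0 <= d * d" by simp
    moreover have "max 0 x = x" "max 0 (x + d) = x + d" using True d by auto
    ultimately show ?thesis by (simp add: F_def power2_eq_square field_simps)
  qed (auto simp: F_def)
  have "(\<Sum>i=1..n. d * max 0 (w0 - (real i - 1) * d)) <= d * w0 + F w0 - F (w0 - (real n - 1) * d)" if "n >= 1"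
    using that
  proof (induction n rule: nat_induct_at_least)
    case base then show ?case using w0 by simp
  next
    case (Suc n)
    have eq: "w0 - (real n - 1) * d = (w0 - real n * d) + d" by (simp add: algebra_simps)
    have "(\<Sum>i=1..n. d * max 0 (w0 - (real i - 1) * d)) <= d * w0 + F w0 - F ((w0 - real n * d) + d)"
      using Suc.IH unfolding eq .
    moreover have "(\<Sum>i=1..Suc n. d * max 0 (w0 - (real i - 1) * d)) = (\<Sum>i=1..n. d * max 0 (w0 - (real i - 1) * d)) + d * max 0 (w0 - real n * d)"
      by simp
    ultimately have "(\<Sum>i=1..Suc n. d * max 0 (w0 - (real i - 1) * d)) <= d * w0 + F w0 - F (w0 - real n * d)"
      using step[of "w0 - real n * d"] by linarith
    then show ?case by simp
  qed
  moreover have "0 <= F x" for x by (simp add: F_def)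
  ultimately have "(\<Sum>i=1..n. d * max 0 (w0 - (real i - 1) * d)) <= d * w0 + F w0"
  proof (cases "n >= 1")
    case True
    then show ?thesis using \<open>n >= 1 ==> _\<close> \<open>\<And>x. 0 <= F x\<close>[of "w0 - (real n - 1) * d"] by linarith
  qed (use d w0 \<open>\<And>x. 0 <= F x\<close>[of w0] in auto)
  moreover have "F w0 = w0 ^ 2 / 2" using w0 by (simp add: F_def)
  ultimately have "d * (\<Sum>i=1..n. max 0 (w0 - (real i - 1) * d)) <= d * w0 + w0 ^ 2 / 2"
    by (simp only: sum_distrib_left)
  then have "(\<Sum>i=1..n. max 0 (w0 - (real i - 1) * d)) <= (d * w0 + w0 ^ 2 / 2) / d"
    using d by (simp only: le_divide_eq mult.commute if_True)
  also have "... = w0 ^ 2 / (2 * d) + w0" using d by (simp add: add_divide_distrib mult.commute)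
  finally show ?thesis .
qed

lemma totient_ratio_log_sum_le:
  assumes up: "\<And>s. ratio_sum s <= (\<rho> + k) * real s + E" and lo: "\<And>s. ratio_sum s >= (\<rho> - k) * real s - E"
    and k: "0 <= k" "0 <= E" "0 <= \<rho>" and q0: "1 <= q0" "q0 <= n"
  shows "(\<Sum>q\<in>{q0<..n}. totient_ratio q / real q) <= (\<rho> + k) * ln (real n / real q0) + 2 * k + 2 * E"
proof (cases "q0 = n")
  case True then show ?thesis using k q0 by simp
next
  case False
  define m where "m = n - q0"
  have m: "m >= 1" "n = q0 + m" using False q0 by (auto simp: m_def)
  have sh: "(\<Sum>q\<in>{q0<..q0 + s}. f q) = (\<Sum>i=1..s. f (q0 + i))" for f :: "nat => real" and s
    by (rule sum.reindex_bij_witness[where i = "\<lambda>i. q0 + i" and j = "\<lambda>q. q - q0"]) auto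
  have rs: "(\<Sum>i=1..s. totient_ratio (q0 + i)) = ratio_sum (q0 + s) - ratio_sum q0" for s
  proof -
    have "{1..q0 + s} = {1..q0} \<union> {q0<..q0 + s}" using q0 by auto
    then have "ratio_sum (q0 + s) = ratio_sum q0 + (\<Sum>q\<in>{q0<..q0 + s}. totient_ratio q)"
      unfolding ratio_sum_def by (simp only:) (subst sum.union_disjoint, auto)
    then show ?thesis by (simp add: sh)
  qed
  have "(\<Sum>i=1..m. totient_ratio (q0 + i) * (1 / real (q0 + i))) <= (\<rho> + k) * (\<Sum>i=1..m. 1 / real (q0 + i)) + (2 * k * real q0 + 2 * E) * (1 / real (q0 + 1))"
  proof (rule abel_upper[where w = "\<lambda>i. 1 / real (q0 + i)" and n = m])
    fix s show "(\<Sum>i=1..s. totient_ratio (q0 + i)) <= (\<rho> + k) * real s + (2 * k * real q0 + 2 * E)"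
      unfolding rs using up[of "q0 + s"] lo[of q0] by (simp add: algebra_simps)
  next
    fix i :: nat assume "1 <= i"
    then show "1 / real (q0 + Suc i) <= 1 / real (q0 + i)" by (intro divide_left_mono) auto
  qed (use m in auto)
  moreover have "(2 * k * real q0 + 2 * E) * (1 / real (q0 + 1)) <= 2 * k + 2 * E"
  proof -
    have "(2 * k * real q0 + 2 * E) <= (2 * k + 2 * E) * real (q0 + 1)"
    proof -
      have "0 <= E * real q0" using k by simp
      then show ?thesis using k by (simp add: algebra_simps)
    qed
    then show ?thesis by (simp add: divide_le_eq)
  qed
  moreover have "(\<Sum>i=1..m. 1 / real (q0 + i)) <= ln (real n / real q0)"
  proof -
    have "(\<Sum>i=1..s. 1 / real (q0 + i)) <= ln (real (q0 + s) / real q0)" for s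
    proof (induction s)
      case 0 then show ?case using q0 by simp
    next
      case (Suc s)
      define x where "x = real (q0 + s)"
      have x: "x > 0" using q0 by (simp add: x_def)
      have "ln (x / (x + 1)) <= x / (x + 1) - 1" using x by (intro ln_le_minus_one) auto
      also have "... = - (1 / (x + 1))" using x by (simp add: field_simps)
      finally have "1 / (x + 1) <= ln (x + 1) - ln x" using x by (simp add: ln_div)
      moreover have "ln (real (q0 + Suc s) / real q0) = ln (x + 1) - ln (real q0)" "ln (real (q0 + s) / real q0) = ln x - ln (real q0)"
        using q0 x by (simp_all add: ln_div x_def add_ac)
      moreover have "1 / real (q0 + Suc s) = 1 / (x + 1)" by (simp add: x_def add_ac)
      moreover have "(\<Sum>i=1..Suc s. 1 / real (q0 + i)) = (\<Sum>i=1..s. 1 / real (q0 + i)) + 1 / real (q0 + Suc s)" by simp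
      ultimately show ?case using Suc by linarith
    qed
    then show ?thesis using m by simp
  qed
  then have "(\<rho> + k) * (\<Sum>i=1..m. 1 / real (q0 + i)) <= (\<rho> + k) * ln (real n / real q0)"
    using k by (intro mult_left_mono) auto
  moreover have "(\<Sum>q\<in>{q0<..n}. totient_ratio q / real q) = (\<Sum>i=1..m. totient_ratio (q0 + i) * (1 / real (q0 + i)))"
    unfolding m(2) sh by simp
  ultimately show ?thesis by linarith
qed

lemma farey_pairs_denominators_inj:
  "inj_on (\<lambda>((p1, q1), (p2, q2)). (q1, q2)) {x. farey_adjacent x}"
proof (rule inj_onI)
  fix x y assume x: "x \<in> {x. farey_adjacent x}" and y: "y \<in> {x. farey_adjacent x}"
    and e: "(\<lambda>((p1, q1), (p2, q2)). (q1, q2)) x = (\<lambda>((p1, q1), (p2, q2)). (q1, q2)) y"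
  obtain p1 q1 p2 q2 where xe: "x = ((p1, q1), (p2, q2))" by (metis surj_pair)
  obtain a1 b1 a2 b2 where ye: "y = ((a1, b1), (a2, b2))" by (metis surj_pair)
  have b: "b1 = q1" "b2 = q2" using e by (simp_all add: xe ye)
  have ax: "farey_adjacent ((p1, q1), (p2, q2))" and ay: "farey_adjacent ((a1, q1), (a2, q2))" using x y by (simp_all add: xe ye b)
  have dx: "p2 * int q1 - p1 * int q2 = 1" and dy: "a2 * int q1 - a1 * int q2 = 1" and q: "1 <= q1" "1 <= q2" and nn: "0 <= p1" "0 <= a1"
    using ax ay by (auto simp: farey_adjacent_def)
  have eq: "(p2 - a2) * int q1 = (p1 - a1) * int q2" using dx dy by (simp add: algebra_simps)
  have "coprime (int q1) (int q2)"
  proof (rule coprimeI)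
    fix c assume "c dvd int q1" "c dvd int q2"
    then have "c dvd p2 * int q1 - p1 * int q2" by simp
    then show "c dvd 1" using dx by simp
  qed
  moreover have "int q1 dvd (p1 - a1) * int q2" using eq by (metis dvd_triv_right)
  ultimately have "int q1 dvd p1 - a1" by (simp add: coprime_dvd_mult_left_iff)
  moreover have "\<bar>p1 - a1\<bar> < int q1" using farey_adjacent_bounds[OF ax] farey_adjacent_bounds[OF ay] nn by linarith
  ultimately have "p1 - a1 = 0" by (metis dvd_imp_le_int abs_of_nat not_less)
  then have p: "p1 = a1" by simp
  then have "p2 = a2" using eq q by simp
  then show "x = y" using p by (simp add: xe ye b)
qed

text \<open>
  On a Farey interval of order \<open>T\<close>, \<open>k0 1 T >= 1 - eps\<close> forces \<open>\<alpha>\<close> into the middle part of length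
  \<open>gap_length\<close>. From \<open>1 / (q q') = (1 / q + 1 / q') / (q + q')\<close> and \<open>q + q' > T\<close> one gets, by
  symmetry, a sum of \<open>2 / (T q)\<close>, in which \<open>q + q' = n0 + i\<close> is the new variable; it is coprime to
  \<open>q\<close>.
\<close>

lemma large_value_measure_le_sum:
  assumes T: "1 <= T" and eps: "0 < eps" "eps < 1"
  defines "n0 \<equiv> nat \<lfloor>T\<rfloor>"
  shows "measure lborel {\<alpha> \<in> {0..<1}. k0 1 T \<alpha> >= 1 - eps}
    <= 2 / T * (\<Sum>q=1..n0. (\<Sum>i=1..q. (if coprime (n0 + i) q then 1 else 0) * max 0 (eps - (real i - 1) * ((1 - eps) / T))) / real q)"
proof -
  define \<delta> where "\<delta> = (1 - eps) / T"
  have \<delta>: "\<delta> > 0" "T * \<delta> = 1 - eps" using eps T by (auto simp: \<delta>_def)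
  define S where "S = {\<alpha> \<in> {0..<1}. k0 1 T \<alpha> >= 1 - eps}"
  define l :: "farey => real" where "l = (\<lambda>((p, q), (p', q')). (of_int p + \<delta>) / real q)"
  define u :: "farey => real" where "u = (\<lambda>((p, q), (p', q')). (of_int p' - \<delta>) / real q')"
  define F where "F = {y \<in> farey_pairs n0. l y <= u y}"
  define den :: "farey => nat \<times> nat" where "den = (\<lambda>((p1, q1), (p2, q2)). (q1, q2))"
  define D where "D = {(q, q'). coprime q q' \<and> 1 <= q \<and> 1 <= q' \<and> q <= n0 \<and> q' <= n0 \<and> n0 < q + q' \<and> (1 - eps) * real (q + q') <= T}"
  have finF: "finite F" unfolding F_def using finite_farey_pairs by simp
  have finD: "finite D" by (rule finite_subset[of _ "{1..n0} \<times> {1..n0}"]) (auto simp: D_def)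
  have n0: "real n0 <= T" "T < real n0 + 1" using T by (auto simp: n0_def)
  have Ss: "S \<in> sets lborel" unfolding S_def using T by (intro k0_sublevel_sets) auto
  have "S \<subseteq> (\<Union>y\<in>F. {l y..u y})"
  proof
    fix \<alpha> assume \<alpha>: "\<alpha> \<in> S"
    then have r: "0 <= \<alpha>" "\<alpha> < 1" and k: "k0 1 T \<alpha> >= 1 - eps" by (auto simp: S_def)
    obtain p1 q1 p2 q2 where x: "((p1, q1), (p2, q2)) \<in> farey_pairs n0"
      and kk: "k0 1 T \<alpha> <= T * (real q1 * \<alpha> - of_int p1)" "k0 1 T \<alpha> <= T * (of_int p2 - real q2 * \<alpha>)"
      unfolding n0_def using k0_first_farey[OF T r] by metis
    have q: "1 <= q1" "1 <= q2" using x by (auto simp: farey_pairs_def farey_adjacent_def)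
    have "T * \<delta> <= T * (real q1 * \<alpha> - of_int p1)" "T * \<delta> <= T * (of_int p2 - real q2 * \<alpha>)" using k kk \<delta> by linarith+
    then have "\<delta> <= real q1 * \<alpha> - of_int p1" "\<delta> <= of_int p2 - real q2 * \<alpha>" using T by simp_all
    then have "\<alpha> \<in> {l ((p1, q1), (p2, q2))..u ((p1, q1), (p2, q2))}" using q by (auto simp: l_def u_def field_simps)
    moreover from this have "((p1, q1), (p2, q2)) \<in> F" using x by (auto simp: F_def)
    ultimately show "\<alpha> \<in> (\<Union>y\<in>F. {l y..u y})" by blast
  qed
  then have "measure lborel S <= (\<Sum>y\<in>F. u y - l y)"
    using finF Ss by (intro measure_le_sum_intervals) (auto simp: F_def)
  also have "... = (\<Sum>y\<in>F. gap_length T eps (fst (den y)) (snd (den y)))"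
  proof (rule sum.cong[OF refl])
    fix y assume y: "y \<in> F"
    obtain p n p' n' where ye: "y = ((p, n), (p', n'))" by (metis surj_pair)
    have fa: "farey_adjacent ((p, n), (p', n'))" using y by (simp add: F_def ye farey_pairs_def)
    show "u y - l y = gap_length T eps (fst (den y)) (snd (den y))"
      using middle_length[OF fa _ \<delta>_def] T by (simp add: ye den_def u_def l_def)
  qed
  also have "... = (\<Sum>z\<in>den ` F. gap_length T eps (fst z) (snd z))"
  proof -
    have "inj_on den F" unfolding den_def by (rule inj_on_subset[OF farey_pairs_denominators_inj]) (auto simp: F_def farey_pairs_def)
    then show ?thesis by (simp add: sum.reindex)
  qed
  also have "... <= (\<Sum>z\<in>D. gap_length T eps (fst z) (snd z))"
  proof (rule sum_mono2[OF finD])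
    show "den ` F \<subseteq> D"
    proof (rule image_subsetI)
      fix y assume y: "y \<in> F"
      obtain p n p' n' where ye: "y = ((p, n), (p', n'))" by (metis surj_pair)
      have fa: "farey_adjacent ((p, n), (p', n'))" and nn: "n <= n0" "n' <= n0" "n0 < n + n'" using y by (simp_all add: F_def ye farey_pairs_def)
      have n: "1 <= n" "1 <= n'" and d: "p' * int n - p * int n' = 1" using fa by (auto simp: farey_adjacent_def)
      have "coprime n n'"
      proof (rule coprimeI)
        fix c assume "c dvd n" "c dvd n'"
        then have "int c dvd int n" "int c dvd int n'" by simp_all
        then have "int c dvd p' * int n - p * int n'" by simp
        then show "c dvd 1" using d by simp
      qed
      moreover have "(1 - eps) * real (n + n') <= T"
      proof -
        have "(of_int p + \<delta>) / real n <= (of_int p' - \<delta>) / real n'" using y by (simp add: F_def ye l_def u_def)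
        then have "\<delta> / real n' + \<delta> / real n <= of_int p' / real n' - of_int p / real n" by (simp add: diff_divide_distrib add_divide_distrib)
        also have "... = 1 / (real n * real n')" by (rule farey_adjacent_diff[OF fa])
        finally have "(\<delta> / real n' + \<delta> / real n) * (real n * real n') <= 1 / (real n * real n') * (real n * real n')"
          by (intro mult_right_mono) auto
        then have "\<delta> * real (n + n') <= 1" using n by (simp add: distrib_right distrib_left)
        then have "T * (\<delta> * real (n + n')) <= T * 1" using T by (intro mult_left_mono) auto
        then show ?thesis using \<delta>(2) by (simp only: mult.assoc[symmetric] mult_1_right)
      qed
      ultimately show "den y \<in> D" using n nn by (simp add: ye den_def D_def)
    qed
    fix z assume "z \<in> D - den ` F"
    then show "0 <= gap_length T eps (fst z) (snd z)" using T by (auto simp: D_def gap_length_def)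
  qed
  also have "... <= 2 / T * (\<Sum>z\<in>D. (1 - (1 - eps) * real (fst z + snd z) / T) / real (fst z))"
  proof -
    define w where "w z = (1 - (1 - eps) * real (fst z + snd z) / T)" for z :: "nat \<times> nat"
    have w0: "0 <= w z" if "z \<in> D" for z using that T by (auto simp: D_def w_def divide_le_eq)
    have "gap_length T eps (fst z) (snd z) <= 1 / T * (w z / real (fst z) + w z / real (snd z))" if z: "z \<in> D" for z
    proof -
      have q: "real (fst z) > 0" "real (snd z) > 0" and c: "T <= real (fst z + snd z)" using z n0 by (auto simp: D_def)
      have "gap_length T eps (fst z) (snd z) = w z * (1 / (real (fst z) * real (snd z)))"
        using T by (simp add: gap_length_def w_def field_simps)
      also have "1 / (real (fst z) * real (snd z)) = 1 / real (fst z + snd z) * (1 / real (fst z) + 1 / real (snd z))"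
        using q by (simp add: field_simps)
      also have "w z * (1 / real (fst z + snd z) * (1 / real (fst z) + 1 / real (snd z))) <= w z * (1 / T * (1 / real (fst z) + 1 / real (snd z)))"
        using w0[OF z] c T q by (intro mult_left_mono mult_right_mono divide_left_mono) auto
      finally show ?thesis by (simp add: field_simps)
    qed
    then have "(\<Sum>z\<in>D. gap_length T eps (fst z) (snd z)) <= (\<Sum>z\<in>D. 1 / T * (w z / real (fst z) + w z / real (snd z)))"
      by (rule sum_mono)
    also have "... = 1 / T * ((\<Sum>z\<in>D. w z / real (fst z)) + (\<Sum>z\<in>D. w z / real (snd z)))"
      by (simp only: sum_distrib_left[symmetric] sum.distrib)
    also have "(\<Sum>z\<in>D. w z / real (snd z)) = (\<Sum>z\<in>D. w z / real (fst z))"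
      by (rule sum.reindex_bij_witness[where i = "\<lambda>z. (snd z, fst z)" and j = "\<lambda>z. (snd z, fst z)"])
         (auto simp: D_def w_def coprime_commute add.commute)
    finally show ?thesis by (simp add: w_def)
  qed
  also have "(\<Sum>z\<in>D. (1 - (1 - eps) * real (fst z + snd z) / T) / real (fst z))
     <= (\<Sum>q=1..n0. (\<Sum>i=1..q. (if coprime (n0 + i) q then 1 else 0) * max 0 (eps - (real i - 1) * ((1 - eps) / T))) / real q)"
  proof -
    define h where "h = (\<lambda>(q, i). (if coprime (n0 + i) q then 1 else 0) * max 0 (eps - (real i - 1) * ((1 - eps) / T)) / real q)"
    define \<psi> where "\<psi> = (\<lambda>z::nat \<times> nat. (fst z, fst z + snd z - n0))"
    have "(\<Sum>z\<in>D. (1 - (1 - eps) * real (fst z + snd z) / T) / real (fst z)) <= (\<Sum>z\<in>D. h (\<psi> z))"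
    proof (rule sum_mono)
      fix z assume z: "z \<in> D"
      define i where "i = fst z + snd z - n0"
      have i: "fst z + snd z = n0 + i" "1 <= i" and cop: "coprime (fst z) (snd z)" using z by (auto simp: D_def i_def)
      have "coprime (n0 + i) (fst z)"
        unfolding i(1)[symmetric]
      proof (rule coprimeI)
        fix c assume c: "c dvd fst z + snd z" "c dvd fst z"
        then have "c dvd snd z" by (simp add: dvd_add_right_iff)
        then show "c dvd 1" using coprime_common_divisor[OF cop c(2)] by simp
      qed
      moreover have "1 - (1 - eps) * real (fst z + snd z) / T <= eps - (real i - 1) * ((1 - eps) / T)"
      proof -
        have "T + (real i - 1) <= real (fst z + snd z)" unfolding i(1) using n0 by simp
        then have "(1 - eps) * (T + (real i - 1)) / T <= (1 - eps) * real (fst z + snd z) / T"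
          using eps T by (intro divide_right_mono mult_left_mono) auto
        moreover have "(1 - eps) * (T + (real i - 1)) / T = (1 - eps) + (real i - 1) * ((1 - eps) / T)" using T by (simp add: field_simps)
        ultimately show ?thesis by linarith
      qed
      ultimately show "(1 - (1 - eps) * real (fst z + snd z) / T) / real (fst z) <= h (\<psi> z)"
        by (auto simp: \<psi>_def h_def i_def[symmetric] intro!: divide_right_mono)
    qed
    also have "... = (\<Sum>z\<in>\<psi> ` D. h z)"
    proof -
      have "inj_on \<psi> D" by (auto simp: inj_on_def \<psi>_def D_def)
      then show ?thesis by (simp add: sum.reindex)
    qed
    also have "... <= (\<Sum>z\<in>(SIGMA q:{1..n0}. {1..q}). h z)"
      by (rule sum_mono2) (auto simp: \<psi>_def D_def h_def)
    also have "... = (\<Sum>q=1..n0. \<Sum>i=1..q. h (q, i))" by (simp add: sum.Sigma)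
    also have "... = (\<Sum>q=1..n0. (\<Sum>i=1..q. (if coprime (n0 + i) q then 1 else 0) * max 0 (eps - (real i - 1) * ((1 - eps) / T))) / real q)"
      by (simp add: h_def sum_divide_distrib)
    finally show ?thesis .
  qed
  finally show ?thesis using T by (simp add: S_def mult_left_mono divide_right_mono)
qed

text \<open>
  For \<open>q <= eps T\<close> the inner sum is estimated trivially. For larger \<open>q\<close>, counting coprime integers
  turns it into \<open>\<phi>(q) / q\<close> times the area of a triangle, about \<open>eps\<^sup>2 T / 2\<close>, and summing
  \<open>\<phi>(q) / q\<^sup>2\<close> over \<open>eps T < q <= T\<close> gives about \<open>6 / \<pi>\<^sup>2\<close> times \<open>ln (1 / eps)\<close>.
\<close>

lemma large_value_measure_le:
  assumes \<kappa>: "0 < \<kappa>"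
  shows "\<exists>eps0>0. \<forall>eps T. 0 < eps --> eps <= eps0 --> (1 / eps) ^ 4 <= T -->
     measure lborel {\<alpha> \<in> {0..<1}. k0 1 T \<alpha> >= 1 - eps} <= (6 / pi\<^sup>2 + \<kappa>) * (eps\<^sup>2 * ln (1 / eps))"
proof -
  define \<rho> where "\<rho> = 6 / pi\<^sup>2"
  define k where "k = \<kappa> / 2"
  have k: "k > 0" "\<rho> >= 0" using \<kappa> by (auto simp: k_def \<rho>_def)
  obtain E1 where E1: "E1 >= 0" "\<And>s. ratio_sum s >= (\<rho> - k) * real s - E1" using ratio_sum_lower[OF k(1)] unfolding \<rho>_def by blast
  obtain E2 where E2: "E2 >= 0" "\<And>s. ratio_sum s <= (\<rho> + k) * real s + E2" using ratio_sum_upper[OF k(1)] unfolding \<rho>_def by blast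
  define E where "E = max E1 E2"
  have E: "E >= 0" "\<And>s. ratio_sum s <= (\<rho> + k) * real s + E" "\<And>s. ratio_sum s >= (\<rho> - k) * real s - E"
  proof -
    show "E >= 0" using E1(1) by (simp add: E_def)
    show "ratio_sum s <= (\<rho> + k) * real s + E" for s using E2(2)[of s] by (simp add: E_def)
    show "ratio_sum s >= (\<rho> - k) * real s - E" for s using E1(2)[of s] by (simp add: E_def)
  qed
  define R where "R eps = 2 * eps\<^sup>2 + (eps\<^sup>2 / (1 - eps) + 2 * eps ^ 5) * ((\<rho> + k) * ln (2 / eps) + 2 * k + 2 * E) + 8 * eps ^ 3" for eps :: real
  have rk: "\<rho> + k > 0" using k by simp
  have "((\<lambda>eps::real. R eps / (eps\<^sup>2 * ln (1 / eps))) \<longlongrightarrow> \<rho> + k) (at_right 0)"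
    unfolding R_def using rk E(1) k by real_asymp
  then have "\<forall>\<^sub>F eps in at_right 0. R eps / (eps\<^sup>2 * ln (1 / eps)) < \<rho> + 2 * k"
    using k by (intro order_tendstoD(2)) auto
  then obtain eps1 where e1: "eps1 > 0" "\<forall>eps>0. eps < eps1 --> R eps / (eps\<^sup>2 * ln (1 / eps)) < \<rho> + 2 * k"
    unfolding eventually_at_right_field by blast
  define eps0 where "eps0 = min (1 / 2) (eps1 / 2)"
  show ?thesis
  proof (intro exI[of _ eps0] conjI allI impI)
    show "eps0 > 0" using e1 by (simp add: eps0_def)
    fix eps T :: real assume eps: "0 < eps" "eps <= eps0" and T: "(1 / eps) ^ 4 <= T"
    have e2: "eps <= 1 / 2" "eps < eps1" using eps e1 by (auto simp: eps0_def)
    define z where "z = 1 / eps"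
    have z: "z >= 2" "z * eps = 1" using e2 eps by (auto simp: z_def field_simps)
    have z4: "z ^ 4 <= T" using T by (simp add: z_def)
    have "2 ^ 3 <= z ^ 3" using z by (intro power_mono) auto
    moreover have "z ^ 4 * eps = z ^ 3" using z by (simp add: power4_eq_xxxx power3_eq_cube mult.assoc)
    ultimately have eT: "eps * T >= 8" using mult_right_mono[OF z4, of eps] eps by (simp add: mult.commute)
    have T1: "T >= 1"
    proof -
      have "1 <= z ^ 4" using z by (intro one_le_power) auto
      then show ?thesis using z4 by linarith
    qed
    define n0 where "n0 = nat \<lfloor>T\<rfloor>"
    define q0 where "q0 = nat \<lfloor>eps * T\<rfloor>"
    have n0: "real n0 <= T" using T1 by (simp add: n0_def)
    have q0: "real q0 <= eps * T" "real q0 >= eps * T / 2" "1 <= q0" "q0 <= n0"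
    proof -
      show 1: "real q0 <= eps * T" using eT by (simp add: q0_def)
      have "eps * T < real q0 + 1" using eT by (simp add: q0_def)
      then show "real q0 >= eps * T / 2" "1 <= q0" using eT by linarith+
      have "eps * T <= 1 * T" using e2 T1 by (intro mult_right_mono) auto
      then show "q0 <= n0" unfolding q0_def n0_def by (intro nat_mono floor_mono) simp
    qed
    define d where "d = (1 - eps) / T"
    have d: "d > 0" using e2 T1 by (simp add: d_def)
    define v where "v i = max 0 (eps - (real i - 1) * d)" for i :: nat
    define V where "V = eps\<^sup>2 * T / (2 * (1 - eps)) + eps"
    define inner where "inner q = (\<Sum>i=1..q. (if coprime (n0 + i) q then 1 else 0) * v i)" for q
    have vV: "(\<Sum>i=1..q. v i) <= V" for q
      using linear_ramp_sum_upper[OF d, of eps q] eps e2 T1 by (simp add: v_def V_def d_def)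
    have v: "0 <= v i" "i >= 1 ==> v i <= eps" for i using eps d by (auto simp: v_def)
    have in1: "inner q <= real q * eps" for q
    proof -
      have "inner q <= (\<Sum>i=1..q. eps)" unfolding inner_def using v eps by (intro sum_mono) auto
      then show ?thesis by simp
    qed
    have in2: "inner q <= totient_ratio q * V + 2 * sqrt (real q) * eps" if "q >= 1" for q
    proof -
      have "inner q <= totient_ratio q * (\<Sum>i=1..q. v i) + 2 * sqrt (real q) * v 1"
        unfolding inner_def
      proof (rule abel_upper)
        fix s show "(\<Sum>i=1..s. if coprime (n0 + i) q then 1 else 0) <= totient_ratio q * real s + 2 * sqrt (real q)"
          using coprime_count_nat[of q n0 s] that by (simp add: abs_le_iff)
      next
        fix i show "v (Suc i) <= v i" unfolding v_def using d by (intro max.mono) (auto simp: algebra_simps)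
      qed (use that v in auto)
      also have "... <= totient_ratio q * V + 2 * sqrt (real q) * eps"
        using vV v(2)[of 1] by (intro add_mono mult_left_mono totient_ratio_bounds) auto
      finally show ?thesis .
    qed
    have low: "(\<Sum>q\<in>{1..q0}. inner q / real q) <= eps\<^sup>2 * T"
    proof -
      have "(\<Sum>q\<in>{1..q0}. inner q / real q) <= (\<Sum>q\<in>{1..q0}. eps)"
        using in1 by (intro sum_mono) (auto simp: divide_le_eq mult.commute)
      also have "... <= (eps * T) * eps" using q0 eps by (simp add: mult_right_mono)
      finally show ?thesis by (simp add: power2_eq_square mult_ac)
    qed
    have high: "(\<Sum>q\<in>{q0<..n0}. inner q / real q) <= V * ((\<rho> + k) * ln (2 / eps) + 2 * k + 2 * E) + 4 * eps * sqrt T"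
    proof -
      have "(\<Sum>q\<in>{q0<..n0}. inner q / real q) <= (\<Sum>q\<in>{q0<..n0}. V * (totient_ratio q / real q) + 2 * eps * (1 / sqrt (real q)))"
      proof (rule sum_mono)
        fix q assume q: "q \<in> {q0<..n0}"
        then have qp: "real q > 0" by auto
        have "inner q / real q <= (totient_ratio q * V + 2 * sqrt (real q) * eps) / real q" using q by (intro divide_right_mono in2) auto
        also have "... = V * (totient_ratio q / real q) + 2 * eps * (sqrt (real q) / real q)" by (simp add: add_divide_distrib mult_ac)
        also have "sqrt (real q) / real q = 1 / sqrt (real q)" using qp by (simp add: field_simps)
        finally show "inner q / real q <= V * (totient_ratio q / real q) + 2 * eps * (1 / sqrt (real q))" .
      qed
      also have "... = V * (\<Sum>q\<in>{q0<..n0}. totient_ratio q / real q) + 2 * eps * (\<Sum>q\<in>{q0<..n0}. 1 / sqrt (real q))"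
        by (simp only: sum.distrib sum_distrib_left)
      also have "... <= V * ((\<rho> + k) * ln (2 / eps) + 2 * k + 2 * E) + 2 * eps * (2 * sqrt T)"
      proof (intro add_mono mult_left_mono)
        have "(\<Sum>q\<in>{q0<..n0}. totient_ratio q / real q) <= (\<rho> + k) * ln (real n0 / real q0) + 2 * k + 2 * E"
          using E k q0 by (intro totient_ratio_log_sum_le) auto
        also have "ln (real n0 / real q0) <= ln (2 / eps)"
        proof (rule ln_mono)
          have "real n0 / real q0 <= T / (eps * T / 2)" using n0 q0 eT T1 by (intro frac_le) auto
          then show "real n0 / real q0 <= 2 / eps" using T1 by simp
          show "0 < real n0 / real q0" using q0 by auto
        qed
        finally show "(\<Sum>q\<in>{q0<..n0}. totient_ratio q / real q) <= (\<rho> + k) * ln (2 / eps) + 2 * k + 2 * E" using rk by (simp add: mult_left_mono)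
        have "(\<Sum>q\<in>{q0<..n0}. 1 / sqrt (real q)) <= (\<Sum>q=1..n0. 1 / sqrt (real q))" by (intro sum_mono2) auto
        also have "... <= 2 * sqrt (real n0)" by (rule sum_inverse_sqrt_le)
        also have "... <= 2 * sqrt T" using n0 by simp
        finally show "(\<Sum>q\<in>{q0<..n0}. 1 / sqrt (real q)) <= 2 * sqrt T" .
        show "0 <= V" using eps e2 T1 by (simp add: V_def)
      qed (use eps in auto)
      finally show ?thesis by simp
    qed
    have split: "{1..n0} = {1..q0} \<union> {q0<..n0}" using q0 by auto
    have "measure lborel {\<alpha> \<in> {0..<1}. k0 1 T \<alpha> >= 1 - eps} <= 2 / T * (\<Sum>q=1..n0. inner q / real q)"
      unfolding inner_def v_def d_def n0_def using T1 eps e2 by (intro large_value_measure_le_sum) auto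
    also have "(\<Sum>q=1..n0. inner q / real q) = (\<Sum>q\<in>{1..q0}. inner q / real q) + (\<Sum>q\<in>{q0<..n0}. inner q / real q)"
      unfolding split by (rule sum.union_disjoint) auto
    also have "2 / T * ... <= 2 / T * (eps\<^sup>2 * T + (V * ((\<rho> + k) * ln (2 / eps) + 2 * k + 2 * E) + 4 * eps * sqrt T))"
      using low high T1 by (intro mult_left_mono add_mono) auto
    also have "... = 2 * eps\<^sup>2 + (2 / T * V) * ((\<rho> + k) * ln (2 / eps) + 2 * k + 2 * E) + 8 * eps * (sqrt T / T)"
      using T1 by (simp add: distrib_left field_simps)
    also have "... <= R eps"
    proof -
      have iT: "1 / T <= eps ^ 4"
      proof -
        have "1 / T <= 1 / z ^ 4" using z4 z T1 by (intro divide_left_mono) auto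
        then show ?thesis using eps by (simp add: z_def power_one_over)
      qed
      have "2 / T * V = eps\<^sup>2 / (1 - eps) + 2 * eps * (1 / T)" using T1 e2 by (simp add: V_def field_simps)
      also have "... <= eps\<^sup>2 / (1 - eps) + 2 * eps * eps ^ 4" using iT eps by (intro add_mono mult_left_mono) auto
      finally have a: "2 / T * V <= eps\<^sup>2 / (1 - eps) + 2 * eps ^ 5" by (simp add: power_Suc[symmetric] eval_nat_numeral)
      have L: "0 <= (\<rho> + k) * ln (2 / eps) + 2 * k + 2 * E"
      proof -
        have "0 <= ln (2 / eps)" using e2 eps by (intro ln_ge_zero) (simp add: le_divide_eq)
        then show ?thesis using rk k E by simp
      qed
      have "sqrt T / T = sqrt (1 / T)" using T1 by (simp add: real_sqrt_divide field_simps)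
      also have "... <= sqrt (eps ^ 4)" using iT by simp
      also have "... = eps\<^sup>2" by (rule real_sqrt_unique) (auto simp: power_mult[symmetric])
      finally have "8 * eps * (sqrt T / T) <= 8 * eps * eps\<^sup>2" using eps by (intro mult_left_mono) auto
      then have b: "8 * eps * (sqrt T / T) <= 8 * eps ^ 3" by (simp add: power3_eq_cube power2_eq_square)
      show ?thesis unfolding R_def using mult_right_mono[OF a L] b by linarith
    qed
    also have "... <= (6 / pi\<^sup>2 + \<kappa>) * (eps\<^sup>2 * ln (1 / eps))"
    proof -
      have "ln (1 / eps) > 0" using e2 eps by (intro ln_gt_zero) (simp add: less_divide_eq)
      then have "0 < eps\<^sup>2 * ln (1 / eps)" using eps by simp
      moreover have "R eps / (eps\<^sup>2 * ln (1 / eps)) < \<rho> + 2 * k" using e1(2) eps e2 by simp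
      ultimately have "R eps <= (\<rho> + 2 * k) * (eps\<^sup>2 * ln (1 / eps))" by (simp add: divide_less_eq)
      then show ?thesis by (simp add: \<rho>_def k_def)
    qed
    finally show "measure lborel {\<alpha> \<in> {0..<1}. k0 1 T \<alpha> >= 1 - eps} <= (6 / pi\<^sup>2 + \<kappa>) * (eps\<^sup>2 * ln (1 / eps))" .
  qed
qed

section \<open>Asymptotic independence\<close>

lemma farey_interval_borel [simp]: "farey_interval x \<in> sets borel"
  using farey_interval_sets by simp

definition cut_by :: "real set => real set => bool" where
  "cut_by J E \<longleftrightarrow> J \<inter> E ~= {} \<and> \<not> J \<subseteq> E"

lemma fmeasurable_sub_circle:
  assumes "A \<in> sets lborel" "A \<subseteq> {0..<1::real}" shows "A \<in> fmeasurable lborel"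
  by (rule fmeasurableI2[OF fmeasurable_Icc[of 0 1] _ assms(1)]) (use assms(2) in auto)

lemma farey_measure_union:
  assumes A: "A \<in> sets lborel" and X: "X \<subseteq> farey_pairs Q"
  shows "measure lborel (A \<inter> (\<Union>x\<in>X. farey_interval x)) = (\<Sum>x\<in>X. measure lborel (A \<inter> farey_interval x))"
proof -
  have fin: "finite X" using X finite_farey_pairs finite_subset by blast
  have "A \<inter> (\<Union>x\<in>X. farey_interval x) = (\<Union>x\<in>X. A \<inter> farey_interval x)" by blast
  moreover have "measure lborel (\<Union>x\<in>X. A \<inter> farey_interval x) = (\<Sum>x\<in>X. measure lborel (A \<inter> farey_interval x))"
  proof (rule measure_UNION'[OF fin])
    fix x assume x: "x \<in> X"
    have "farey_interval x \<subseteq> {0..<1}" using x X by (intro farey_interval_subset) (auto simp: farey_pairs_def)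
    then show "A \<inter> farey_interval x \<in> fmeasurable lborel"
      using A by (intro fmeasurable_sub_circle) (auto intro: sets.Int)
  next
    show "pairwise (\<lambda>x y. disjnt (A \<inter> farey_interval x) (A \<inter> farey_interval y)) X"
      unfolding pairwise_def disjnt_iff using farey_disjoint X by (meson IntD2 subsetD)
  qed
  ultimately show ?thesis by simp
qed

lemma farey_union_eq: "1 <= Q ==> (\<Union>x\<in>farey_pairs Q. farey_interval x) = {0..<1}"

proof (intro equalityI subsetI)
  fix \<alpha> :: real assume Q: "1 <= Q" and "\<alpha> \<in> {0..<1}"
  then show "\<alpha> \<in> (\<Union>x\<in>farey_pairs Q. farey_interval x)" using farey_cover[OF Q, of \<alpha>] by simp
next
  fix \<alpha> assume "\<alpha> \<in> (\<Union>x\<in>farey_pairs Q. farey_interval x)"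
  then obtain x where "x \<in> farey_pairs Q" "\<alpha> \<in> farey_interval x" by blast
  then show "\<alpha> \<in> {0..<1}" using farey_interval_subset unfolding farey_pairs_def by blast
qed

lemma measure_farey_interval:
  assumes "farey_adjacent x" shows "measure lborel (farey_interval x) = farey_length x"
proof -
  obtain p1 q1 p2 q2 where x: "x = ((p1, q1), (p2, q2))" by (metis surj_pair)
  have d: "of_int p2 / real q2 - of_int p1 / real q1 = 1 / (real q1 * real q2)" using assms unfolding x by (rule farey_adjacent_diff)
  moreover have "0 <= 1 / (real q1 * real q2)" by simp
  ultimately have "of_int p1 / real q1 <= of_int p2 / real q2" by linarith
  then show ?thesis using d by (simp add: x farey_interval_def farey_length_def)
qed

lemma sum_union_le:
  fixes f :: "'a => real"
  assumes "finite A" "finite B" "\<And>x. 0 <= f x"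
  shows "sum f (A \<union> B) <= sum f A + sum f B"
proof -
  have "0 <= sum f (A \<inter> B)" using assms by (simp add: sum_nonneg)
  then show ?thesis using sum.union_inter[OF assms(1,2), of f] by linarith
qed

lemma sum_UN_le:
  fixes f :: "'a => real" and X :: "nat => 'a set"
  assumes "\<And>j. finite (X j)" "\<And>x. 0 <= f x"
  shows "sum f (\<Union>j<i. X j) <= (\<Sum>j<i. sum f (X j))"
proof (induction i)
  case (Suc i)
  have "sum f (\<Union>j<Suc i. X j) = sum f ((\<Union>j<i. X j) \<union> X i)" by (simp add: lessThan_Suc Un_commute)
  also have "... <= sum f (\<Union>j<i. X j) + sum f (X i)" using assms by (intro sum_union_le) auto
  finally show ?case using Suc by simp
qed simp

lemma measure_Un_disjoint_circle:
  assumes "A \<in> fmeasurable lborel" "B \<in> fmeasurable lborel" "A \<inter> B = {}"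
  shows "measure lborel (A \<union> B) = measure lborel A + measure lborel (B :: real set)"
  using measure_Union[of lborel A B] assms by (auto simp: fmeasurable_def)

text \<open>
  Let \<open>B i\<close> be the set where none of the first \<open>i\<close> events occurs. Up to measure \<open>\<beta>\<close> it is the
  union of the Farey intervals of order \<open>Q i\<close> that it contains, and its complement is the union of
  those that it avoids. The event \<open>E i\<close> takes its share of both unions by the local lower bound;
  subtracting the share of the complement from the global upper bound yields an upper bound for
  the share of \<open>B i\<close>. Hence the measure of \<open>B i\<close> satisfies a linear recursion up to the error \<open>c\<close>,
  and \<open>N\<close> such errors add up to the claimed bound.
\<close>

lemma void_probability:
  fixes E :: "nat => real set" and Q :: "nat => nat"
  assumes N: "N >= 1" and lam: "0 <= \<kappa>" "\<kappa> <= \<mu>" "\<mu> <= real N" and \<beta>: "0 <= \<beta>"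
    and Es: "\<And>i. i < N ==> E i \<in> sets lborel" and Q: "\<And>i. i < N ==> 1 <= Q i"
    and up: "\<And>i. i < N ==> measure lborel ({0..<1} \<inter> E i) <= (\<mu> + \<kappa>) / real N"
    and lo: "\<And>i x. i < N ==> x \<in> farey_pairs (Q i) ==> measure lborel (E i \<inter> farey_interval x) >= (\<mu> - \<kappa>) / real N * farey_length x"
    and cut: "\<And>i j. i < N ==> j < i ==> (\<Sum>x\<in>{x\<in>farey_pairs (Q i). cut_by (farey_interval x) (E j)}. farey_length x) <= \<beta> / real N"
  shows "\<bar>measure lborel ({0..<1} - (\<Union>i<N. E i)) - (1 - \<mu> / real N) ^ N\<bar> <= 2 * \<kappa> + \<mu> * \<beta>"
proof -
  define \<Omega> where "\<Omega> = {0..<1::real}"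
  define B where "B i = \<Omega> - (\<Union>j<i. E j)" for i
  define b where "b i = measure lborel (B i)" for i
  define c where "c = (2 * \<kappa> + \<mu> * \<beta>) / real N"
  have Bs: "B i \<in> sets lborel" if "i <= N" for i
    unfolding B_def \<Omega>_def using Es that by (intro sets.Diff sets.finite_UN) auto
  have m\<Omega>: "measure lborel \<Omega> = 1" by (simp add: \<Omega>_def)
  have Bf: "B i \<in> fmeasurable lborel" if "i <= N" for i
    using Bs[OF that] by (rule fmeasurable_sub_circle) (auto simp: B_def \<Omega>_def)
  have b01: "0 <= b i" for i by (simp add: b_def)
  have step: "\<bar>b (Suc i) - (1 - \<mu> / real N) * b i\<bar> <= c" if i: "i < N" for i
  proof -
    define F where "F = farey_pairs (Q i)"
    define G where "G = {x \<in> F. farey_interval x \<subseteq> B i}"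
    define H where "H = {x \<in> F. farey_interval x \<inter> B i = {}}"
    \<comment> \<open>The intervals in K meet both B i and its complement, so each of them is cut by an earlier event.\<close>
    define K where "K = F - G - H"
    have finF: "finite F" unfolding F_def by (rule finite_farey_pairs)
    have adj: "farey_adjacent x" if "x \<in> F" for x using that by (simp add: F_def farey_pairs_def)
    have ne: "farey_interval x ~= {}" if "x \<in> F" for x
    proof -
      have "0 < farey_length x" using adj[OF that] by (auto simp: farey_length_def farey_adjacent_def split: prod.splits)
      then show ?thesis using measure_farey_interval[OF adj[OF that]] by auto
    qed
    have FGH: "F = G \<union> (H \<union> K)" "G \<inter> (H \<union> K) = {}" "H \<inter> K = {}"
    proof -
      have "G \<inter> H = {}"
      proof (rule ccontr)
        assume "G \<inter> H ~= {}"
        then obtain x where x: "x \<in> F" "farey_interval x \<subseteq> B i" "farey_interval x \<inter> B i = {}" unfolding G_def H_def by blast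
        then show False using ne[OF x(1)] by blast
      qed
      then show "F = G \<union> (H \<union> K)" "G \<inter> (H \<union> K) = {}" "H \<inter> K = {}" by (auto simp: K_def G_def H_def)
    qed
    have fin: "finite G" "finite H" "finite K" using finF by (auto simp: G_def H_def K_def)
    have len0: "0 <= farey_length x" for x by (auto simp: farey_length_def split: prod.splits)
    have sum1: "(\<Sum>x\<in>F. farey_length x) = 1"
    proof -
      have "(\<Sum>x\<in>F. farey_length x) = (\<Sum>x\<in>F. measure lborel (UNIV \<inter> farey_interval x))" using adj by (intro sum.cong refl) (simp add: measure_farey_interval)
      also have "... = measure lborel (UNIV \<inter> (\<Union>x\<in>F. farey_interval x))" by (rule farey_measure_union[symmetric, of _ _ "Q i"]) (auto simp: F_def)
      also have "... = 1" using farey_union_eq[OF Q[OF i]] by (simp add: F_def)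
      finally show ?thesis .
    qed
    have Km: "(\<Sum>x\<in>K. farey_length x) <= \<beta>"
    proof -
      have "K \<subseteq> (\<Union>j<i. {x\<in>F. cut_by (farey_interval x) (E j)})"
      proof
        fix x assume x: "x \<in> K"
        then have xF: "x \<in> F" and "\<not> farey_interval x \<subseteq> B i" "farey_interval x \<inter> B i ~= {}" by (auto simp: K_def G_def H_def)
        then obtain u w where u: "u \<in> farey_interval x" "u \<notin> B i" and w: "w \<in> farey_interval x" "w \<in> B i" by blast
        have "u \<in> \<Omega>" using u farey_interval_subset[OF adj[OF xF]] by (auto simp: \<Omega>_def)
        then obtain j where j: "j < i" "u \<in> E j" using u by (auto simp: B_def)
        then have "w \<notin> E j" using w by (auto simp: B_def)
        then have "cut_by (farey_interval x) (E j)" using u w j by (auto simp: cut_by_def)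
        then show "x \<in> (\<Union>j<i. {x\<in>F. cut_by (farey_interval x) (E j)})" using xF j by auto
      qed
      then have "(\<Sum>x\<in>K. farey_length x) <= (\<Sum>x\<in>(\<Union>j<i. {x\<in>F. cut_by (farey_interval x) (E j)}). farey_length x)"
        using finF len0 by (intro sum_mono2) auto
      also have "... <= (\<Sum>j<i. \<Sum>x\<in>{x\<in>F. cut_by (farey_interval x) (E j)}. farey_length x)"
        using finF len0 by (intro sum_UN_le) auto
      also have "... <= (\<Sum>j<i. \<beta> / real N)" unfolding F_def using cut[OF i] by (intro sum_mono) auto
      also have "... <= real N * (\<beta> / real N)" using mult_right_mono[of "real i" "real N" "\<beta> / real N"] i \<beta> by simp
      also have "... = \<beta>" using N by simp
      finally show ?thesis .
    qed
    have split: "measure lborel A = (\<Sum>x\<in>F. measure lborel (A \<inter> farey_interval x))" if "A \<in> sets lborel" "A \<subseteq> \<Omega>" for A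
    proof -
      have "A = A \<inter> (\<Union>x\<in>F. farey_interval x)" using farey_union_eq[OF Q[OF i]] that by (auto simp: F_def \<Omega>_def)
      then show ?thesis using farey_measure_union[OF that(1), of F "Q i"] by (simp add: F_def)
    qed
    have le_len: "measure lborel (A \<inter> farey_interval x) <= farey_length x" if "A \<in> sets lborel" "x \<in> F" for A x
    proof -
      have "farey_interval x \<in> fmeasurable lborel" using farey_interval_subset[OF adj[OF that(2)]] by (intro fmeasurable_sub_circle) auto
      then have "measure lborel (A \<inter> farey_interval x) <= measure lborel (farey_interval x)"
        using that by (intro measure_mono_fmeasurable) (auto intro: sets.Int)
      then show ?thesis using measure_farey_interval[OF adj[OF that(2)]] by simp
    qed
    have iN: "i <= N" using i by simp
    have G_ge: "(\<Sum>x\<in>G. farey_length x) >= b i - \<beta>"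
    proof -
      have "b i = (\<Sum>x\<in>F. measure lborel (B i \<inter> farey_interval x))" unfolding b_def by (rule split[OF Bs[OF iN]]) (auto simp: B_def)
      also have "... = (\<Sum>x\<in>G. measure lborel (B i \<inter> farey_interval x)) + ((\<Sum>x\<in>H. measure lborel (B i \<inter> farey_interval x)) + (\<Sum>x\<in>K. measure lborel (B i \<inter> farey_interval x)))"
        using FGH fin by (simp add: sum.union_disjoint)
      also have "... <= (\<Sum>x\<in>G. farey_length x) + ((\<Sum>x\<in>H. 0) + (\<Sum>x\<in>K. farey_length x))"
      proof (intro add_mono sum_mono)
        fix x assume "x \<in> H"
        then have "B i \<inter> farey_interval x = {}" by (auto simp: H_def)
        then show "measure lborel (B i \<inter> farey_interval x) <= 0" by simp
      qed (use le_len[OF Bs[OF iN]] in \<open>auto simp: G_def K_def\<close>)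
      finally show ?thesis using Km by simp
    qed
    have H_ge: "(\<Sum>x\<in>H. farey_length x) >= 1 - b i - \<beta>"
    proof -
      have "(\<Sum>x\<in>G. farey_length x) <= b i"
      proof -
        have "(\<Sum>x\<in>G. farey_length x) = (\<Sum>x\<in>G. measure lborel (B i \<inter> farey_interval x))"
          using adj by (intro sum.cong refl) (auto simp: G_def measure_farey_interval Int_absorb1)
        also have "... <= (\<Sum>x\<in>F. measure lborel (B i \<inter> farey_interval x))" using finF by (intro sum_mono2) (auto simp: G_def)
        also have "... = b i" unfolding b_def by (rule split[OF Bs[OF iN], symmetric]) (auto simp: B_def)
        finally show ?thesis .
      qed
      moreover have "1 = (\<Sum>x\<in>G. farey_length x) + ((\<Sum>x\<in>H. farey_length x) + (\<Sum>x\<in>K. farey_length x))"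
        using FGH fin by (simp add: sum.union_disjoint flip: sum1)
      ultimately show ?thesis using Km by linarith
    qed
    have lk: "0 <= (\<mu> - \<kappa>) / real N" using lam by simp
    have low: "measure lborel (E i \<inter> A) >= (\<mu> - \<kappa>) / real N * (\<Sum>x\<in>X. farey_length x)"
      if X: "X \<subseteq> F" "\<And>x. x \<in> X ==> farey_interval x \<subseteq> A" and A: "A \<in> sets lborel" "A \<subseteq> \<Omega>" for X A
    proof -
      have "(\<mu> - \<kappa>) / real N * (\<Sum>x\<in>X. farey_length x) <= (\<Sum>x\<in>X. measure lborel (E i \<inter> farey_interval x))"
        unfolding sum_distrib_left using lo[OF i] X by (intro sum_mono) (auto simp: F_def)
      also have "... = measure lborel (E i \<inter> (\<Union>x\<in>X. farey_interval x))"
        using X by (intro farey_measure_union[symmetric, of _ _ "Q i"] Es i) (auto simp: F_def)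
      also have "... <= measure lborel (E i \<inter> A)"
      proof (rule measure_mono_fmeasurable)
        show "E i \<inter> (\<Union>x\<in>X. farey_interval x) \<in> sets lborel"
          using Es[OF i] finite_subset[OF X(1) finF] by (intro sets.Int sets.finite_UN) auto
        show "E i \<inter> A \<in> fmeasurable lborel" using Es[OF i] A by (intro fmeasurable_sub_circle) (auto simp: \<Omega>_def intro: sets.Int)
      qed (use X(2) in blast)
      finally show ?thesis .
    qed
    define e where "e = measure lborel (E i \<inter> B i)"
    have e1: "e >= (\<mu> - \<kappa>) / real N * (b i - \<beta>)"
    proof -
      have "e >= (\<mu> - \<kappa>) / real N * (\<Sum>x\<in>G. farey_length x)"
        unfolding e_def using Bs[OF iN]
      proof (intro low)
        show "B i \<subseteq> \<Omega>" by (auto simp: B_def)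
      qed (simp_all add: G_def)
      then show ?thesis using mult_left_mono[OF G_ge lk] by linarith
    qed
    have e2: "e <= (\<mu> + \<kappa>) / real N - (\<mu> - \<kappa>) / real N * (1 - b i - \<beta>)"
    proof -
      have s: "\<Omega> - B i \<in> sets lborel" using Bs[OF iN] by (auto simp: \<Omega>_def)
      have "measure lborel (E i \<inter> (\<Omega> - B i)) >= (\<mu> - \<kappa>) / real N * (\<Sum>x\<in>H. farey_length x)"

      proof (intro low s)
        fix x assume x: "x \<in> H"
        then have "farey_interval x \<subseteq> \<Omega>" using farey_interval_subset[OF adj] unfolding H_def \<Omega>_def by blast
        then show "farey_interval x \<subseteq> \<Omega> - B i" using x unfolding H_def by blast
      qed (auto simp: H_def)
      then have "measure lborel (E i \<inter> (\<Omega> - B i)) >= (\<mu> - \<kappa>) / real N * (1 - b i - \<beta>)" using mult_left_mono[OF H_ge lk] by linarith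
      moreover have "measure lborel (\<Omega> \<inter> E i) = e + measure lborel (E i \<inter> (\<Omega> - B i))"
      proof -
        have eq: "\<Omega> \<inter> E i = (E i \<inter> B i) \<union> (E i \<inter> (\<Omega> - B i))" by (auto simp: B_def)
        have "measure lborel ((E i \<inter> B i) \<union> (E i \<inter> (\<Omega> - B i))) = measure lborel (E i \<inter> B i) + measure lborel (E i \<inter> (\<Omega> - B i))"
          using Es[OF i] Bs[OF iN] s by (intro measure_Un_disjoint_circle) (auto simp: B_def \<Omega>_def intro!: fmeasurable_sub_circle intro: sets.Int)
        then show ?thesis using eq by (simp add: e_def)
      qed
      ultimately show ?thesis using up[OF i] unfolding \<Omega>_def by linarith
    qed
    have bS: "b (Suc i) = b i - e"
    proof -
      have eq: "B (Suc i) = B i - E i \<inter> B i" by (auto simp: B_def less_Suc_eq)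
      have "measure lborel (B i - E i \<inter> B i) = measure lborel (B i) - measure lborel (E i \<inter> B i)"
      proof (rule measurable_measure_Diff[OF Bf[OF iN]])
        show "E i \<inter> B i \<in> sets lborel" using Es[OF i] Bs[OF iN] by (rule sets.Int)
      qed auto
      then show ?thesis by (simp only: b_def eq e_def)
    qed
    have b1: "b i <= 1"
    proof -
      have "b i <= measure lborel \<Omega>" unfolding b_def using Bs[OF iN] by (intro measure_mono_fmeasurable) (auto simp: B_def \<Omega>_def intro!: fmeasurable_sub_circle)
      then show ?thesis using m\<Omega> by simp
    qed
    have rN: "real N > 0" using N by simp
    have E1: "e * real N >= (\<mu> - \<kappa>) * (b i - \<beta>)" using mult_right_mono[OF e1, of "real N"] rN by simp
    have E2: "e * real N <= (\<mu> + \<kappa>) - (\<mu> - \<kappa>) * (1 - b i - \<beta>)"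
    proof -
      have "(\<mu> + \<kappa>) / real N - (\<mu> - \<kappa>) / real N * (1 - b i - \<beta>) = ((\<mu> + \<kappa>) - (\<mu> - \<kappa>) * (1 - b i - \<beta>)) / real N"
        by (simp only: diff_divide_distrib[of "\<mu> + \<kappa>"] times_divide_eq_left)
      then show ?thesis using e2 rN by (simp add: le_divide_eq)
    qed
    have kb: "\<kappa> * b i <= \<kappa> * 1" "0 <= \<kappa> * b i" "0 <= \<kappa> * \<beta>" using lam(1) b1 b01[of i] \<beta> by (intro mult_left_mono mult_nonneg_nonneg; simp)+
    have "\<mu> * b i - e * real N <= 2 * \<kappa> + \<mu> * \<beta>" using E1 kb lam(1) by (simp add: algebra_simps)
    moreover have "e * real N - \<mu> * b i <= 2 * \<kappa> + \<mu> * \<beta>" using E2 kb lam(1) by (simp add: algebra_simps)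
    ultimately have "\<bar>\<mu> * b i - e * real N\<bar> <= 2 * \<kappa> + \<mu> * \<beta>" by linarith
    then have "\<bar>\<mu> * b i - e * real N\<bar> / real N <= c" unfolding c_def by (intro divide_right_mono) auto
    moreover have "b (Suc i) - (1 - \<mu> / real N) * b i = (\<mu> * b i - e * real N) / real N"
      unfolding bS using rN by (simp add: field_simps)
    ultimately show ?thesis by simp
  qed
  have c0: "c >= 0" using lam \<beta> by (simp add: c_def)
  have "\<bar>b i - (1 - \<mu> / real N) ^ i\<bar> <= real i * c" if "i <= N" for i
    using that
  proof (induction i)
    case 0
    then show ?case using m\<Omega> by (simp add: b_def B_def)
  next
    case (Suc i)
    define y where "y = 1 - \<mu> / real N"
    have y: "0 <= y" "y <= 1" using lam N by (auto simp: y_def)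
    have "b (Suc i) - y ^ Suc i = (b (Suc i) - y * b i) + y * (b i - y ^ i)" by (simp add: algebra_simps)
    then have "\<bar>b (Suc i) - y ^ Suc i\<bar> <= \<bar>b (Suc i) - y * b i\<bar> + y * \<bar>b i - y ^ i\<bar>"
      using y abs_triangle_ineq[of "b (Suc i) - y * b i" "y * (b i - y ^ i)"] by (simp add: abs_mult)
    also have "... <= c + 1 * (real i * c)"
      using step[of i] Suc y c0 unfolding y_def[symmetric] by (intro add_mono mult_mono) auto
    finally show ?case by (simp add: y_def algebra_simps)
  qed
  from this[of N] have "\<bar>b N - (1 - \<mu> / real N) ^ N\<bar> <= real N * c" by simp
  moreover have "real N * c = 2 * \<kappa> + \<mu> * \<beta>" using N by (simp add: c_def)
  ultimately show ?thesis by (simp add: b_def B_def \<Omega>_def)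
qed

text \<open>
  An interval longer than \<open>h\<close> has one end denominator above \<open>Q / 2\<close>, hence the other is at most
  \<open>2 / (h Q)\<close>, and the interval lies within \<open>2 / (q Q)\<close> of the fraction with this small
  denominator \<open>q\<close>.
\<close>

lemma long_farey_measure:
  assumes Q: "1 <= Q" and h: "0 < h"
  shows "(\<Sum>x\<in>{x\<in>farey_pairs Q. farey_length x > h}. farey_length x) <= 16 / (h * real Q ^ 2)"
proof -
  define R where "R = nat \<lfloor>2 / (h * real Q)\<rfloor>"
  define F where "F = {x\<in>farey_pairs Q. farey_length x > h}"
  define I where "I = (SIGMA q:{1..R}. {0..int q})"
  define l where "l = (\<lambda>(q::nat, p::int). of_int p / real q - 2 / (real q * real Q))"
  define u where "u = (\<lambda>(q::nat, p::int). of_int p / real q + 2 / (real q * real Q))"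
  define S where "S = (\<Union>x\<in>F. farey_interval x)"
  have finF: "finite F" unfolding F_def using finite_farey_pairs by simp
  have Qp: "real Q > 0" using Q by simp
  have "S \<subseteq> (\<Union>i\<in>I. {l i..u i})"
  proof
    fix \<alpha> assume "\<alpha> \<in> S"
    then obtain x where x: "x \<in> F" "\<alpha> \<in> farey_interval x" by (auto simp: S_def)
    obtain p1 q1 p2 q2 where xe: "x = ((p1, q1), (p2, q2))" by (metis surj_pair)
    have fa: "farey_adjacent ((p1, q1), (p2, q2))" and len: "h < 1 / (real q1 * real q2)" and Qq: "Q < q1 + q2"
      using x by (auto simp: F_def xe farey_pairs_def farey_length_def)
    have A: "0 <= p1" "p2 <= int q2" "1 <= q1" "1 <= q2" using fa by (auto simp: farey_adjacent_def)
    have B: "0 < p2" "p1 < int q1" using farey_adjacent_bounds[OF fa] by auto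
    have i: "of_int p1 / real q1 <= \<alpha>" "\<alpha> < of_int p2 / real q2" using x by (auto simp: xe farey_interval_def)
    have d: "of_int p2 / real q2 - of_int p1 / real q1 = 1 / (real q1 * real q2)" by (rule farey_adjacent_diff[OF fa])
    have small: "q <= R \<and> 1 / (real q * real q') <= 2 / (real q * real Q)"
      if "1 <= q" "1 <= q'" "h < 1 / (real q * real q')" "real Q <= 2 * real q'" for q q' :: nat
    proof
      have q: "real q > 0" "real q' > 0" using that by auto
      have "real q * (h * real q') < 1" using that(3) q by (simp add: less_divide_eq mult_ac)
      moreover have "real q * (h * real Q) <= real q * (h * (2 * real q'))" using that(4) h by (intro mult_left_mono) auto
      ultimately have "real q * (h * real Q) <= 2" by simp
      then have "real q <= 2 / (h * real Q)" using h Qp by (simp add: le_divide_eq)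
      then show "q <= R" unfolding R_def by (rule le_nat_floor)
      have "1 / real q' <= 2 / real Q" using that(4) q Qp by (simp add: field_simps)
      then show "1 / (real q * real q') <= 2 / (real q * real Q)" using divide_right_mono[of "1 / real q'" "2 / real Q" "real q"] q by (simp add: mult.commute)
    qed
    show "\<alpha> \<in> (\<Union>i\<in>I. {l i..u i})"
    proof (cases "q1 <= q2")
      case True
      then have "real Q <= 2 * real q2" using Qq by linarith
      then have "q1 <= R" "1 / (real q1 * real q2) <= 2 / (real q1 * real Q)" using small[OF A(3,4) len] by auto
      moreover have "0 <= 2 / (real q1 * real Q)" by simp
      ultimately have "(q1, p1) \<in> I" "\<alpha> \<in> {l (q1, p1)..u (q1, p1)}" using A B i d by (auto simp: I_def l_def u_def)
      then show ?thesis by blast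
    next
      case False
      then have "real Q <= 2 * real q1" using Qq by linarith
      moreover have "h < 1 / (real q2 * real q1)" using len by (simp add: mult.commute)
      ultimately have "q2 <= R" "1 / (real q2 * real q1) <= 2 / (real q2 * real Q)" using small[OF A(4,3)] by auto
      moreover have "0 <= 2 / (real q2 * real Q)" by simp
      moreover have "1 / (real q2 * real q1) = 1 / (real q1 * real q2)" by (simp add: mult.commute)
      ultimately have "(q2, p2) \<in> I" "\<alpha> \<in> {l (q2, p2)..u (q2, p2)}" using A B i d by (auto simp: I_def l_def u_def)
      then show ?thesis by blast
    qed
  qed
  moreover have "S \<in> sets lborel" unfolding S_def using finF by (intro sets.finite_UN farey_interval_sets)
  ultimately have "measure lborel S <= (\<Sum>i\<in>I. u i - l i)"
    by (intro measure_le_sum_intervals) (auto simp: I_def l_def u_def intro: order_trans[of _ 0])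
  also have "... = (\<Sum>q=1..R. \<Sum>p\<in>{0..int q}. 4 / (real q * real Q))"
    unfolding I_def by (subst sum.Sigma) (auto intro!: sum.cong simp: l_def u_def)
  also have "... <= (\<Sum>q=1..R. 8 / real Q)"
  proof (rule sum_mono)
    fix q assume q: "q \<in> {1..R}"
    have "(\<Sum>p\<in>{0..int q}. 4 / (real q * real Q)) = (real q + 1) * (4 / (real q * real Q))" by simp
    also have "... <= (2 * real q) * (4 / (real q * real Q))" using q by (intro mult_right_mono) auto
    also have "... = 8 / real Q" using q by simp
    finally show "(\<Sum>p\<in>{0..int q}. 4 / (real q * real Q)) <= 8 / real Q" .
  qed
  also have "... = real R * (8 / real Q)" by simp
  also have "... <= (2 / (h * real Q)) * (8 / real Q)"
  proof (rule mult_right_mono)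
    have "0 <= 2 / (h * real Q)" using h by simp
    then show "real R <= 2 / (h * real Q)" unfolding R_def by linarith
  qed simp
  also have "... = 16 / (h * real Q ^ 2)" by (simp add: power2_eq_square)
  finally have "measure lborel S <= 16 / (h * real Q ^ 2)" .
  moreover have "measure lborel S = (\<Sum>x\<in>F. farey_length x)"
  proof -
    have "measure lborel (UNIV \<inter> S) = (\<Sum>x\<in>F. measure lborel (UNIV \<inter> farey_interval x))"
      unfolding S_def by (rule farey_measure_union[of _ _ Q]) (auto simp: F_def)
    also have "... = (\<Sum>x\<in>F. farey_length x)" by (intro sum.cong refl) (auto simp: measure_farey_interval F_def farey_pairs_def)
    finally show ?thesis by simp
  qed
  ultimately show ?thesis by (simp add: F_def)
qed

text \<open>
  On an interval shorter than \<open>h / T\<^sup>2\<close> the function \<open>f\<close> varies by less than \<open>h\<close>. If such an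
  interval is cut by the sublevel set of \<open>s\<close>, the values of \<open>f\<close> on it lie between \<open>s1\<close> and \<open>s2\<close>;
  the other intervals are long.
\<close>

lemma cut_measure:
  fixes f :: "real => real"
  assumes Q: "1 <= Q" and h: "0 < h" and T: "0 < T"
    and lip: "\<And>\<alpha> \<beta>. \<bar>f \<alpha> - f \<beta>\<bar> <= T\<^sup>2 * \<bar>\<alpha> - \<beta>\<bar>"
    and s: "s1 <= s - h" "s + h <= s2"
    and S: "{\<alpha>\<in>{0..<1}. f \<alpha> <= s1} \<in> sets lborel" "{\<alpha>\<in>{0..<1}. f \<alpha> <= s2} \<in> sets lborel"
  shows "(\<Sum>x\<in>{x\<in>farey_pairs Q. cut_by (farey_interval x) {\<alpha>. f \<alpha> <= s}}. farey_length x)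
    <= measure lborel {\<alpha>\<in>{0..<1}. f \<alpha> <= s2} - measure lborel {\<alpha>\<in>{0..<1}. f \<alpha> <= s1} + 16 * T\<^sup>2 / (h * real Q ^ 2)"
proof -
  define F where "F = {x\<in>farey_pairs Q. cut_by (farey_interval x) {\<alpha>. f \<alpha> <= s}}"
  define F1 where "F1 = {x\<in>F. farey_length x <= h / T\<^sup>2}"
  define F2 where "F2 = {x\<in>farey_pairs Q. farey_length x > h / T\<^sup>2}"
  have fin: "finite F1" "finite F2" using finite_farey_pairs by (auto simp: F1_def F2_def F_def)
  have len0: "0 <= farey_length x" for x by (auto simp: farey_length_def split: prod.splits)
  have T2: "T\<^sup>2 > 0" using T by simp
  have "(\<Sum>x\<in>F. farey_length x) <= (\<Sum>x\<in>F1 \<union> F2. farey_length x)"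
    using fin len0 by (intro sum_mono2) (auto simp: F1_def F2_def F_def)
  also have "... <= (\<Sum>x\<in>F1. farey_length x) + (\<Sum>x\<in>F2. farey_length x)"
    using fin len0 by (intro sum_union_le) auto
  also have "(\<Sum>x\<in>F2. farey_length x) <= 16 / (h / T\<^sup>2 * real Q ^ 2)"
    unfolding F2_def using h T by (intro long_farey_measure[OF Q]) auto
  also have "16 / (h / T\<^sup>2 * real Q ^ 2) = 16 * T\<^sup>2 / (h * real Q ^ 2)" by simp
  finally have sum: "(\<Sum>x\<in>F. farey_length x) <= (\<Sum>x\<in>F1. farey_length x) + 16 * T\<^sup>2 / (h * real Q ^ 2)" by simp
  define U where "U = (\<Union>x\<in>F1. farey_interval x)"
  have "(\<Sum>x\<in>F1. farey_length x) = measure lborel U"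
  proof -
    have "measure lborel (UNIV \<inter> U) = (\<Sum>x\<in>F1. measure lborel (UNIV \<inter> farey_interval x))"
      unfolding U_def by (rule farey_measure_union[of _ _ Q]) (auto simp: F1_def F_def)
    also have "... = (\<Sum>x\<in>F1. farey_length x)" by (intro sum.cong refl) (auto simp: measure_farey_interval F1_def F_def farey_pairs_def)
    finally show ?thesis by simp
  qed
  also have "... <= measure lborel ({\<alpha>\<in>{0..<1}. f \<alpha> <= s2} - {\<alpha>\<in>{0..<1}. f \<alpha> <= s1})"
  proof (rule measure_mono_fmeasurable)
    show "U \<subseteq> {\<alpha>\<in>{0..<1}. f \<alpha> <= s2} - {\<alpha>\<in>{0..<1}. f \<alpha> <= s1}"
    proof
      fix \<alpha> assume "\<alpha> \<in> U"
      then obtain x where x: "x \<in> F1" "\<alpha> \<in> farey_interval x" by (auto simp: U_def)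
      have adj: "farey_adjacent x" and len: "farey_length x <= h / T\<^sup>2" using x by (auto simp: F1_def F_def farey_pairs_def)
      obtain a0 a1 where a: "a0 \<in> farey_interval x" "f a0 <= s" "a1 \<in> farey_interval x" "f a1 > s"
        using x by (auto simp: F1_def F_def cut_by_def not_le)
      have near: "T\<^sup>2 * \<bar>\<alpha> - b\<bar> < h" if "b \<in> farey_interval x" for b
      proof -
        obtain p1 q1 p2 q2 where xe: "x = ((p1, q1), (p2, q2))" by (metis surj_pair)
        have "of_int p2 / real q2 - of_int p1 / real q1 = farey_length x"
          using adj unfolding xe farey_length_def by (simp add: farey_adjacent_diff)
        then have "\<bar>\<alpha> - b\<bar> < farey_length x" using that x(2) by (auto simp: xe farey_interval_def)
        then have "\<bar>\<alpha> - b\<bar> < h / T\<^sup>2" using len by linarith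
        then show ?thesis using T2 by (simp add: less_divide_eq mult.commute)
      qed
      have "f \<alpha> <= s + h" using lip[of \<alpha> a0] near[OF a(1)] a(2) by linarith
      moreover have "f \<alpha> > s - h" using lip[of \<alpha> a1] near[OF a(3)] a(4) by linarith
      ultimately show "\<alpha> \<in> {\<alpha>\<in>{0..<1}. f \<alpha> <= s2} - {\<alpha>\<in>{0..<1}. f \<alpha> <= s1}"
        using s farey_interval_subset[OF adj] x(2) by auto
    qed
    show "U \<in> sets lborel" unfolding U_def using fin by (intro sets.finite_UN farey_interval_sets)
    show "{\<alpha>\<in>{0..<1}. f \<alpha> <= s2} - {\<alpha>\<in>{0..<1}. f \<alpha> <= s1} \<in> fmeasurable lborel"
      by (intro fmeasurable_sub_circle sets.Diff S) blast
  qed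
  also have "... = measure lborel {\<alpha>\<in>{0..<1}. f \<alpha> <= s2} - measure lborel {\<alpha>\<in>{0..<1}. f \<alpha> <= s1}"

  proof (rule measurable_measure_Diff)
    show "{\<alpha>\<in>{0..<1}. f \<alpha> <= s2} \<in> fmeasurable lborel" using S(2) by (rule fmeasurable_sub_circle) blast
    have "s1 <= s2" using s h by linarith
    then show "{\<alpha>\<in>{0..<1}. f \<alpha> <= s1} \<subseteq> {\<alpha>\<in>{0..<1}. f \<alpha> <= s2}" by auto
  qed (rule S(1))
  finally show ?thesis using sum by (simp add: F_def)
qed

text \<open>
  The orders are \<open>T / N ^ C\<close>. The two extra powers of \<open>N\<close> in the spacing make the long intervals
  of \<open>cut_measure\<close> negligible compared to \<open>\<kappa> / N\<close>, and the values between \<open>s1\<close> and \<open>s2\<close> have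
  measure at most \<open>4 \<kappa> / N\<close>.
\<close>

lemma void_probability_spaced:
  fixes f :: "real => real => real" and D :: "real set"
  assumes D: "finite D" and N: "N = card D" "N >= 1"
    and L: "0 <= \<kappa>" "\<kappa> <= L" "L <= real N" and h: "0 < h" "64 <= h * \<kappa> * real N"
    and meas: "\<And>T. T \<in> D ==> f T \<in> borel_measurable borel"
    and lip: "\<And>T \<alpha> \<beta>. T \<in> D ==> \<bar>f T \<alpha> - f T \<beta>\<bar> <= T\<^sup>2 * \<bar>\<alpha> - \<beta>\<bar>"
    and large: "\<And>T. T \<in> D ==> real N ^ (C + 2) <= T"
    and spaced: "\<And>T T'. T \<in> D ==> T' \<in> D ==> T < T' ==> real N ^ (C + 2) * T <= T'"
    and up: "\<And>T. T \<in> D ==> measure lborel {\<alpha>\<in>{0..<1}. f T \<alpha> <= s} <= (L + \<kappa>) / real N"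
    and lo: "\<And>T p1 q1 p2 q2. T \<in> D ==> farey_adjacent ((p1, q1), (p2, q2)) ==> real N ^ C * real q1 <= T ==> real N ^ C * real q2 <= T ==>
      (L - \<kappa>) / real N * farey_length ((p1, q1), (p2, q2)) <= measure lborel {\<alpha>\<in>farey_interval ((p1, q1), (p2, q2)). f T \<alpha> <= s}"
    and up2: "\<And>T. T \<in> D ==> measure lborel {\<alpha>\<in>{0..<1}. f T \<alpha> <= s2} <= (L + 2 * \<kappa>) / real N"
    and lo1: "\<And>T. T \<in> D ==> (L - 2 * \<kappa>) / real N <= measure lborel {\<alpha>\<in>{0..<1}. f T \<alpha> <= s1}"
    and s: "s1 <= s - h / real N" "s + h / real N <= s2"
  shows "\<bar>measure lborel {\<alpha>\<in>{0..<1}. \<forall>T\<in>D. s < f T \<alpha>} - (1 - L / real N) ^ N\<bar> <= 2 * \<kappa> + L * (5 * \<kappa>)"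
proof -
  define ts where "ts = sorted_list_of_set D"
  define t where "t i = ts ! i" for i
  have ts: "set ts = D" "length ts = N" "sorted_wrt (<) ts" using D N by (auto simp: ts_def)
  have tD: "t i \<in> D" if "i < N" for i using ts that by (auto simp: t_def)
  have tlt: "t j < t i" if "j < i" "i < N" for i j using sorted_wrt_nth_less[OF ts(3), of j i] that ts by (simp add: t_def)
  have img: "t ` {..<N} = D"
  proof -
    have "t ` {..<N} = set ts" by (auto simp: t_def set_conv_nth ts(2))
    then show ?thesis using ts by simp
  qed
  define E where "E i = {\<alpha>. f (t i) \<alpha> <= s}" for i
  define Q where "Q i = nat \<lfloor>t i / real N ^ C\<rfloor>" for i
  define y where "y = real N"
  have y1: "y >= 1" using N by (simp add: y_def)
  have pC: "y ^ C > 0" using y1 by simp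
  have QC: "y\<^sup>2 <= t i / y ^ C" "real (Q i) <= t i / y ^ C" "t i / y ^ C <= 2 * real (Q i)" "1 <= Q i" if i: "i < N" for i
  proof -
    have "y ^ C * y\<^sup>2 <= t i" using large[OF tD[OF i]] by (simp only: y_def power_add)
    then show a: "y\<^sup>2 <= t i / y ^ C" using pC by (simp add: le_divide_eq mult.commute)
    moreover have "1 <= y\<^sup>2" using y1 by simp
    ultimately have "1 <= t i / y ^ C" by linarith
    moreover have "Q i = nat \<lfloor>t i / y ^ C\<rfloor>" by (simp add: Q_def y_def)
    moreover from calculation have "1 <= \<lfloor>t i / y ^ C\<rfloor>" by simp
    ultimately show "real (Q i) <= t i / y ^ C" "t i / y ^ C <= 2 * real (Q i)" "1 <= Q i" by linarith+
  qed
  have set_eq: "{\<alpha>\<in>{0..<1}. \<forall>T\<in>D. s < f T \<alpha>} = {0..<1} - (\<Union>i<N. E i)"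
    unfolding img[symmetric] by (auto simp: E_def not_le) (meson lessThan_iff not_le)
  have ms: "{\<alpha>\<in>{0..<1}. f T \<alpha> <= a} \<in> sets lborel" if "T \<in> D" for T a using meas[OF that] by measurable
  have "\<bar>measure lborel ({0..<1} - (\<Union>i<N. E i)) - (1 - L / real N) ^ N\<bar> <= 2 * \<kappa> + L * (5 * \<kappa>)"
  proof (rule void_probability[where Q = Q])
    show "1 <= N" "0 <= \<kappa>" "\<kappa> <= L" "L <= real N" "0 <= 5 * \<kappa>" using N L by auto
  next
    fix i assume i: "i < N"
    show "E i \<in> sets lborel" unfolding E_def using meas[OF tD[OF i]] by measurable
    show "1 <= Q i" using QC[OF i] by simp
    have "{0..<1} \<inter> E i = {\<alpha>\<in>{0..<1}. f (t i) \<alpha> <= s}" by (auto simp: E_def)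
    then show "measure lborel ({0..<1} \<inter> E i) <= (L + \<kappa>) / real N" using up[OF tD[OF i]] by simp
  next
    fix i x assume i: "i < N" and x: "x \<in> farey_pairs (Q i)"
    obtain p1 q1 p2 q2 where xe: "x = ((p1, q1), (p2, q2))" by (metis surj_pair)
    have adj: "farey_adjacent ((p1, q1), (p2, q2))" and q: "q1 <= Q i" "q2 <= Q i" using x by (auto simp: farey_pairs_def xe)
    have "real N ^ C * real q <= t i" if "q <= Q i" for q
    proof -
      have "real q <= t i / y ^ C" using QC(2)[OF i] that by linarith
      then show ?thesis using pC by (simp add: le_divide_eq mult.commute y_def)
    qed
    moreover have "E i \<inter> farey_interval x = {\<alpha>\<in>farey_interval x. f (t i) \<alpha> <= s}" by (auto simp: E_def)
    ultimately show "(L - \<kappa>) / real N * farey_length x <= measure lborel (E i \<inter> farey_interval x)"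
      using lo[OF tD[OF i] adj] q by (simp add: xe)
  next
    fix i j assume i: "i < N" and j: "j < i"
    have jN: "j < N" using i j by simp
    have tj: "0 < t j"
    proof -
      have "0 < y ^ (C + 2)" using y1 by simp
      then show ?thesis using large[OF tD[OF jN]] unfolding y_def by linarith
    qed
    have "(\<Sum>x\<in>{x\<in>farey_pairs (Q i). cut_by (farey_interval x) {\<alpha>. f (t j) \<alpha> <= s}}. farey_length x)
      <= measure lborel {\<alpha>\<in>{0..<1}. f (t j) \<alpha> <= s2} - measure lborel {\<alpha>\<in>{0..<1}. f (t j) \<alpha> <= s1} + 16 * (t j)\<^sup>2 / (h / real N * real (Q i) ^ 2)"
      using N by (intro cut_measure QC i tj lip tD jN s ms) (use h in auto)
    also have "... <= (L + 2 * \<kappa>) / real N - (L - 2 * \<kappa>) / real N + \<kappa> / real N"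
    proof (intro add_mono diff_mono up2 lo1 tD jN)
      have q: "t j * y\<^sup>2 <= 2 * real (Q i)"
      proof -
        have "y ^ C * (t j * y\<^sup>2) <= t i" using spaced[OF tD[OF jN] tD[OF i] tlt[OF j i]] by (simp add: y_def power_add power2_eq_square mult_ac)
        then have "t j * y\<^sup>2 <= t i / y ^ C" using pC by (simp add: le_divide_eq mult.commute)
        then show ?thesis using QC(3)[OF i] by linarith
      qed
      have "(t j * y\<^sup>2)\<^sup>2 <= (2 * real (Q i))\<^sup>2" using tj y1 by (intro power_mono[OF q]) auto
      then have "(t j)\<^sup>2 * y ^ 4 <= 4 * (real (Q i))\<^sup>2" by (simp add: power_mult_distrib power_mult[symmetric])
      moreover have "y ^ 3 <= y ^ 4" using y1 by (intro power_increasing) auto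
      then have "(t j)\<^sup>2 * y ^ 3 <= (t j)\<^sup>2 * y ^ 4" by (intro mult_left_mono) auto
      ultimately have a: "(t j)\<^sup>2 * y ^ 3 <= 4 * (real (Q i))\<^sup>2" by linarith
      have "16 * (t j)\<^sup>2 * y\<^sup>2 <= h * \<kappa> * (real (Q i))\<^sup>2"
      proof -
        have "64 * ((t j)\<^sup>2 * y\<^sup>2) <= (h * \<kappa> * y) * ((t j)\<^sup>2 * y\<^sup>2)" using h by (intro mult_right_mono) (auto simp: y_def)
        also have "... = (h * \<kappa>) * ((t j)\<^sup>2 * y ^ 3)" by (simp add: power2_eq_square power3_eq_cube mult_ac)
        also have "... <= (h * \<kappa>) * (4 * (real (Q i))\<^sup>2)" using h L by (intro mult_left_mono[OF a]) auto
        finally show ?thesis by (simp add: mult_ac)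
      qed
      moreover have "0 < real (Q i)" using QC[OF i] by simp
      ultimately have pos: "0 < h / y * (real (Q i))\<^sup>2" and le: "16 * (t j)\<^sup>2 * y\<^sup>2 <= h * \<kappa> * (real (Q i))\<^sup>2"
        using h y1 by simp_all
      have "16 * (t j)\<^sup>2 = 16 * (t j)\<^sup>2 * y\<^sup>2 / y\<^sup>2" using y1 by simp
      also have "... <= h * \<kappa> * (real (Q i))\<^sup>2 / y\<^sup>2" using le by (rule divide_right_mono) simp
      also have "... = \<kappa> / y * (h / y * (real (Q i))\<^sup>2)" by (simp add: power2_eq_square mult_ac)
      finally show "16 * (t j)\<^sup>2 / (h / real N * (real (Q i))\<^sup>2) <= \<kappa> / real N" using pos by (simp only: divide_le_eq y_def[symmetric] if_True)
    qed
    also have "... = 5 * \<kappa> / real N" by (simp add: add_divide_distrib diff_divide_distrib)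
    finally show "(\<Sum>x\<in>{x\<in>farey_pairs (Q i). cut_by (farey_interval x) (E j)}. farey_length x) <= 5 * \<kappa> / real N"
      by (simp add: E_def)
  qed
  then show ?thesis unfolding set_eq .
qed

text \<open>
  The thresholds \<open>s1, s2\<close> of the previous lemma are those of \<open>t - h\<close> and \<open>t + h\<close>, with \<open>h\<close> so
  small that \<open>\<Lambda>\<close> varies by less than \<open>\<kappa>\<close>. The lower bound for \<open>s1\<close> on the whole circle is the
  local one for the Farey interval from 0 to 1.
\<close>

lemma poisson_void:
  fixes \<Delta> :: "nat => real set" and f :: "real => real => real" and s :: "nat => real => real" and \<Lambda> :: "real => real"
  assumes fin: "\<And>n. finite (\<Delta> n)" and card: "filterlim (\<lambda>n. card (\<Delta> n)) at_top sequentially"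
    and spacing: "\<And>D. \<forall>\<^sub>F n in sequentially. (\<forall>T\<in>\<Delta> n. real (card (\<Delta> n)) ^ D <= T) \<and>
      (\<forall>T\<in>\<Delta> n. \<forall>T'\<in>\<Delta> n. T < T' --> real (card (\<Delta> n)) ^ D * T <= T')"
    and meas: "\<And>T. T0 <= T ==> f T \<in> borel_measurable borel"
    and lip: "\<And>T \<alpha> \<beta>. T0 <= T ==> \<bar>f T \<alpha> - f T \<beta>\<bar> <= T\<^sup>2 * \<bar>\<alpha> - \<beta>\<bar>"
    and up: "\<And>t \<kappa>. 0 < t ==> 0 < \<kappa> ==> \<exists>C. \<forall>\<^sub>F n in sequentially. \<forall>T. real (card (\<Delta> n)) ^ C <= T -->
      measure lborel {\<alpha>\<in>{0..<1}. f T \<alpha> <= s n t} <= (\<Lambda> t + \<kappa>) / real (card (\<Delta> n))"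
    and lo: "\<And>t \<kappa>. 0 < t ==> 0 < \<kappa> ==> \<exists>C. \<forall>\<^sub>F n in sequentially. \<forall>T p1 q1 p2 q2. farey_adjacent ((p1, q1), (p2, q2)) -->
      real (card (\<Delta> n)) ^ C * real q1 <= T --> real (card (\<Delta> n)) ^ C * real q2 <= T -->
      (\<Lambda> t - \<kappa>) / real (card (\<Delta> n)) * farey_length ((p1, q1), (p2, q2)) <= measure lborel {\<alpha>\<in>farey_interval ((p1, q1), (p2, q2)). f T \<alpha> <= s n t}"
    and gap: "\<And>t t'. 0 < t ==> t < t' ==> \<forall>\<^sub>F n in sequentially. (t' - t) / real (card (\<Delta> n)) <= s n t' - s n t"
    and \<Lambda>: "\<And>t. 0 < t ==> isCont \<Lambda> t" "\<And>t. 0 < t ==> 0 < \<Lambda> t" and t: "0 < t"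
  shows "(\<lambda>n. measure lborel {\<alpha>\<in>{0..<1}. \<forall>T\<in>\<Delta> n. s n t < f T \<alpha>}) \<longlonglongrightarrow> exp (- \<Lambda> t)"
proof -
  define L where "L = \<Lambda> t"
  have L0: "0 < L" using \<Lambda>(2)[OF t] by (simp add: L_def)
  define m where "m n = measure lborel {\<alpha>\<in>{0..<1}. \<forall>T\<in>\<Delta> n. s n t < f T \<alpha>}" for n
  define M where "M n = card (\<Delta> n)" for n
  have rM: "filterlim (\<lambda>n. real (M n)) at_top sequentially"
    unfolding M_def by (rule filterlim_compose[OF filterlim_real_sequentially card])
  have "(\<lambda>n. m n - (1 - L / real (M n)) ^ M n) \<longlonglongrightarrow> 0"
  proof (rule LIMSEQ_I)
    fix \<delta> :: real assume \<delta>: "0 < \<delta>"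
    define \<kappa> where "\<kappa> = min L (\<delta> / (2 * (2 + 5 * L)))"
    have \<kappa>: "0 < \<kappa>" "\<kappa> <= L" using L0 \<delta> by (auto simp: \<kappa>_def)
    have k\<delta>: "2 * \<kappa> + L * (5 * \<kappa>) < \<delta>"
    proof -
      have "\<kappa> * (2 * (2 + 5 * L)) <= \<delta>"
        using L0 pos_le_divide_eq[of "2 * (2 + 5 * L)" \<kappa> \<delta>] by (simp add: \<kappa>_def)
      moreover have "\<kappa> * (2 * (2 + 5 * L)) = 2 * (2 * \<kappa> + L * (5 * \<kappa>))" by (simp add: algebra_simps)
      moreover have "0 < 2 * \<kappa> + L * (5 * \<kappa>)" using \<kappa> L0 by (intro add_pos_pos) auto
      ultimately have "2 * (2 * \<kappa> + L * (5 * \<kappa>)) <= \<delta>" "0 < 2 * \<kappa> + L * (5 * \<kappa>)" by metis+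
      moreover have "x < d" if "2 * x <= d" "0 < x" for x d :: real using that by linarith
      ultimately show ?thesis by blast
    qed
    have "\<exists>d>0. \<forall>x. dist x t < d --> dist (\<Lambda> x) (\<Lambda> t) < \<kappa>"
      using \<Lambda>(1)[OF t] \<kappa>(1) unfolding continuous_at by (auto simp: tendsto_iff eventually_at dist_commute) (metis dist_self)
    then obtain d where d: "d > 0" "\<And>x. dist x t < d ==> \<bar>\<Lambda> x - L\<bar> < \<kappa>" by (auto simp: dist_real_def L_def)
    define h where "h = min d t / 2"
    have h: "0 < h" "h < t" "h < d" using d t by (auto simp: h_def min_def)
    have \<Lambda>1: "\<bar>\<Lambda> (t - h) - L\<bar> < \<kappa>" and \<Lambda>2: "\<bar>\<Lambda> (t + h) - L\<bar> < \<kappa>" using h by (auto intro!: d(2) simp: dist_real_def)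
    obtain C1 where C1: "\<forall>\<^sub>F n in sequentially. \<forall>T. real (M n) ^ C1 <= T --> measure lborel {\<alpha>\<in>{0..<1}. f T \<alpha> <= s n t} <= (L + \<kappa>) / real (M n)"
      using up[OF t \<kappa>(1)] unfolding M_def L_def by blast
    obtain C2 where C2: "\<forall>\<^sub>F n in sequentially. \<forall>T. real (M n) ^ C2 <= T --> measure lborel {\<alpha>\<in>{0..<1}. f T \<alpha> <= s n (t + h)} <= (\<Lambda> (t + h) + \<kappa>) / real (M n)"
      using up[of "t + h", OF _ \<kappa>(1)] t h unfolding M_def by auto
    obtain C3 where C3: "\<forall>\<^sub>F n in sequentially. \<forall>T p1 q1 p2 q2. farey_adjacent ((p1, q1), (p2, q2)) -->
      real (M n) ^ C3 * real q1 <= T --> real (M n) ^ C3 * real q2 <= T -->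
      (L - \<kappa>) / real (M n) * farey_length ((p1, q1), (p2, q2)) <= measure lborel {\<alpha>\<in>farey_interval ((p1, q1), (p2, q2)). f T \<alpha> <= s n t}"
      using lo[OF t \<kappa>(1)] unfolding M_def L_def by blast
    obtain C4 where C4: "\<forall>\<^sub>F n in sequentially. \<forall>T p1 q1 p2 q2. farey_adjacent ((p1, q1), (p2, q2)) -->
      real (M n) ^ C4 * real q1 <= T --> real (M n) ^ C4 * real q2 <= T -->
      (\<Lambda> (t - h) - \<kappa>) / real (M n) * farey_length ((p1, q1), (p2, q2)) <= measure lborel {\<alpha>\<in>farey_interval ((p1, q1), (p2, q2)). f T \<alpha> <= s n (t - h)}"
      using lo[of "t - h", OF _ \<kappa>(1)] h unfolding M_def by auto
    have gt: "t < t + h" "0 < t - h" "t - h < t" using t h by auto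
    define C where "C = C1 + C2 + C3 + C4"
    \<comment> \<open>The bound 64 / (h kappa) on N is what void_probability_spaced requires of the long intervals.\<close>
    define b where "b = 1 + \<bar>T0\<bar> + L + 64 / (h * \<kappa>)"
    have "\<forall>\<^sub>F n in sequentially. real (M n) >= b" using rM by (simp add: filterlim_at_top)
    then have "\<forall>\<^sub>F n in sequentially. norm (m n - (1 - L / real (M n)) ^ M n - 0) < \<delta>"
      using C1 C2 C3 C4 spacing[of "C + 2"] gap[of t "t + h", OF t gt(1)] gap[of "t - h" t, OF gt(2,3)]
    proof (eventually_elim)
      case (elim n)
      have hk: "0 <= 64 / (h * \<kappa>)" using h \<kappa> by simp
      have N: "1 <= real (M n)" "T0 <= real (M n)" "L <= real (M n)" "64 / (h * \<kappa>) <= real (M n)"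
        using elim(1) hk L0 unfolding b_def by linarith+
      have pw: "real (M n) ^ c <= real (M n) ^ C" if "c <= C" for c using N(1) that by (rule power_increasing[rotated])
      have big: "real (M n) ^ (C + 2) <= T" "real (M n) ^ C <= T" "T0 <= T" if "T \<in> \<Delta> n" for T
      proof -
        show 1: "real (M n) ^ (C + 2) <= T" using elim(6) that by (simp add: M_def)
        have "real (M n) ^ C <= real (M n) ^ (C + 2)" "real (M n) ^ 1 <= real (M n) ^ (C + 2)" using N(1) by (intro power_increasing; simp)+
        then show "real (M n) ^ C <= T" "T0 <= T" using 1 N(2) by simp_all
      qed
      have pq: "real (M n) ^ c * real q <= T" if "real (M n) ^ C * real q <= T" "c <= C" for c q T
      proof -
        have "real (M n) ^ c * real q <= real (M n) ^ C * real q" using pw[OF that(2)] by (rule mult_right_mono) simp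
        then show ?thesis using that(1) by linarith
      qed
      have "\<bar>m n - (1 - L / real (M n)) ^ M n\<bar> <= 2 * \<kappa> + L * (5 * \<kappa>)"
        unfolding m_def
      proof (rule void_probability_spaced[where C = C and h = h and ?s1.0 = "s n (t - h)" and ?s2.0 = "s n (t + h)"])
        show "finite (\<Delta> n)" by (rule fin)
        show "M n = card (\<Delta> n)" by (simp add: M_def)
        show "1 <= M n" using N(1) by simp
        show "0 <= \<kappa>" "\<kappa> <= L" "L <= real (M n)" "0 < h" using \<kappa> N h by auto
        show "64 <= h * \<kappa> * real (M n)" using N(4) h \<kappa> by (simp add: divide_le_eq mult.commute)
        show "s n (t - h) <= s n t - h / real (M n)" "s n t + h / real (M n) <= s n (t + h)"
          using elim(7,8) h by (simp_all add: M_def)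
      next
        fix T assume T: "T \<in> \<Delta> n"
        show "f T \<in> borel_measurable borel" using big[OF T] by (intro meas)
        show "real (M n) ^ (C + 2) <= T" by (rule big[OF T])
        have "real (M n) ^ C1 <= T" "real (M n) ^ C2 <= T" using pw[of C1] pw[of C2] big(2)[OF T] by (auto simp: C_def)
        then have a: "measure lborel {\<alpha>\<in>{0..<1}. f T \<alpha> <= s n (t + h)} <= (\<Lambda> (t + h) + \<kappa>) / real (M n)"
          and "measure lborel {\<alpha>\<in>{0..<1}. f T \<alpha> <= s n t} <= (L + \<kappa>) / real (M n)" using elim(2,3) by blast+
        then show "measure lborel {\<alpha>\<in>{0..<1}. f T \<alpha> <= s n t} <= (L + \<kappa>) / real (M n)" by blast
        have "(\<Lambda> (t + h) + \<kappa>) / real (M n) <= (L + 2 * \<kappa>) / real (M n)" using \<Lambda>2 by (intro divide_right_mono) auto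
        then show "measure lborel {\<alpha>\<in>{0..<1}. f T \<alpha> <= s n (t + h)} <= (L + 2 * \<kappa>) / real (M n)" using a by linarith
        have "farey_adjacent ((0, 1), (1, 1))" by (simp add: farey_adjacent_def)
        moreover have "real (M n) ^ C4 * real 1 <= T" using pw[of C4] big(2)[OF T] by (auto simp: C_def)
        ultimately have "(\<Lambda> (t - h) - \<kappa>) / real (M n) * farey_length ((0, 1), (1, 1)) <= measure lborel {\<alpha>\<in>farey_interval ((0, 1), (1, 1)). f T \<alpha> <= s n (t - h)}"
          using elim(5) by blast
        then have "(\<Lambda> (t - h) - \<kappa>) / real (M n) <= measure lborel {\<alpha>\<in>{0..<1}. f T \<alpha> <= s n (t - h)}"
          by (simp add: farey_length_def farey_interval_def)
        moreover have "(L - 2 * \<kappa>) / real (M n) <= (\<Lambda> (t - h) - \<kappa>) / real (M n)" using \<Lambda>1 by (intro divide_right_mono) auto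
        ultimately show "(L - 2 * \<kappa>) / real (M n) <= measure lborel {\<alpha>\<in>{0..<1}. f T \<alpha> <= s n (t - h)}" by linarith
      next
        fix T \<alpha> \<beta> assume "T \<in> \<Delta> n"
        then show "\<bar>f T \<alpha> - f T \<beta>\<bar> <= T\<^sup>2 * \<bar>\<alpha> - \<beta>\<bar>" using big by (intro lip)
      next
        fix T T' assume "T \<in> \<Delta> n" "T' \<in> \<Delta> n" "T < T'"
        then show "real (M n) ^ (C + 2) * T <= T'" using elim(6) by (simp add: M_def)
      next
        fix T p1 q1 p2 q2 assume adj: "farey_adjacent ((p1, q1), (p2, q2))" and Tq: "real (M n) ^ C * real q1 <= T" "real (M n) ^ C * real q2 <= T"
        have "C3 <= C" by (simp add: C_def)
        then have "real (M n) ^ C3 * real q1 <= T" "real (M n) ^ C3 * real q2 <= T" using pq[OF Tq(1)] pq[OF Tq(2)] by auto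
        with adj show "(L - \<kappa>) / real (M n) * farey_length ((p1, q1), (p2, q2)) <= measure lborel {\<alpha>\<in>farey_interval ((p1, q1), (p2, q2)). f T \<alpha> <= s n t}"
          using elim(4) by blast
      qed
      then show ?case using k\<delta> by simp
    qed
    then show "\<exists>no. \<forall>n\<ge>no. norm (m n - (1 - L / real (M n)) ^ M n - 0) < \<delta>" by (simp add: eventually_sequentially)
  qed
  moreover have "(\<lambda>n. (1 + (- L) / real (M n)) ^ M n) \<longlonglongrightarrow> exp (- L)"
    unfolding M_def by (rule filterlim_compose[OF tendsto_exp_limit_sequentially card])
  ultimately have "(\<lambda>n. (m n - (1 - L / real (M n)) ^ M n) + (1 + (- L) / real (M n)) ^ M n) \<longlonglongrightarrow> 0 + exp (- L)" by (rule tendsto_add)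
  then show ?thesis by (simp add: m_def L_def)
qed

section \<open>One-scale estimates at the two normalisations\<close>

text \<open>
  With \<open>s = t / N\<close>, the product of \<open>2 s / (r T)\<close> and \<open>(6 / \<pi>\<^sup>2) (T / r)\<close> is \<open>12 t / (\<pi>\<^sup>2 r\<^sup>2 N)\<close>.
\<close>

lemma small_values_upper:
  fixes M :: "nat => nat"
  assumes M: "filterlim (\<lambda>n. real (M n)) at_top sequentially" and r: "1 <= r" and t: "0 < t" and \<kappa>: "0 < \<kappa>"
  shows "\<forall>\<^sub>F n in sequentially. \<forall>T. real (M n) ^ 2 <= T -->
    measure lborel {\<alpha>\<in>{0..<1}. k0 r T \<alpha> <= t / real (M n)} <= (12 * t / (pi\<^sup>2 * (real r)\<^sup>2) + \<kappa>) / real (M n)"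
proof -
  define k where "k = \<kappa> / (4 * t)"
  have k: "0 < k" using t \<kappa> by (simp add: k_def)
  obtain E where E: "0 <= E" "\<And>s. ratio_sum s <= (6 / pi\<^sup>2 + k) * real s + E" using ratio_sum_upper[OF k] by blast
  define b where "b = 1 + 4 * t + real r + real r * (E / k)"
  have "\<forall>\<^sub>F n in sequentially. b <= real (M n)" using M by (simp add: filterlim_at_top)
  then show ?thesis
  proof eventually_elim
    case (elim n)
    have rE: "0 <= real r * (E / k)" using E k by simp
    have N: "1 <= real (M n)" "4 * t <= real (M n)" "real r <= real (M n)" "real r * (E / k) <= real (M n)"
      using elim rE t unfolding b_def by linarith+
    show ?case
    proof (intro allI impI)
      fix T assume "real (M n) ^ 2 <= T"
      moreover have "real (M n) <= real (M n) ^ 2" using N(1) self_le_power[of "real (M n)" 2] by simp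
      ultimately have TM: "real (M n) <= T" by linarith
      have T: "real r <= T" "real r * (E / k) <= T" "0 < T" using TM N by linarith+
      have r0: "0 < real r" using r by simp
      define x where "x = T / real r"
      have x: "0 < x" using T r0 by (simp add: x_def)
      have "2 * (t / real (M n)) < 1" using N t by (simp add: divide_less_eq)
      then have "measure lborel {\<alpha>\<in>{0..<1}. k0 r T \<alpha> <= t / real (M n)} <= 2 * (t / real (M n)) / (real r * T) * ratio_sum (nat \<lfloor>T / real r\<rfloor>)"
        using t by (intro small_value_measure_le r T) auto
      also have "... <= 2 * (t / real (M n)) / (real r * T) * ((6 / pi\<^sup>2 + 2 * k) * x)"
      proof (rule mult_left_mono)
        have "ratio_sum (nat \<lfloor>x\<rfloor>) <= (6 / pi\<^sup>2 + k) * real (nat \<lfloor>x\<rfloor>) + E" by (rule E)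
        also have "... <= (6 / pi\<^sup>2 + k) * x + k * x"
        proof (rule add_mono)
          show "(6 / pi\<^sup>2 + k) * real (nat \<lfloor>x\<rfloor>) <= (6 / pi\<^sup>2 + k) * x" using k x by (intro mult_left_mono add_nonneg_nonneg) auto
          have "E / k <= x" using T(2) r0 by (simp add: x_def le_divide_eq mult.commute)
          then show "E <= k * x" using k by (simp add: divide_le_eq mult.commute)
        qed
        also have "... = (6 / pi\<^sup>2 + 2 * k) * x" by (simp add: algebra_simps)
        finally show "ratio_sum (nat \<lfloor>T / real r\<rfloor>) <= (6 / pi\<^sup>2 + 2 * k) * x" by (simp add: x_def)
      qed (use t T in auto)
      also have "... = 2 * t * (6 / pi\<^sup>2 + 2 * k) / (real r)\<^sup>2 / real (M n)"
        using T r0 N unfolding x_def by (simp add: power2_eq_square mult_ac)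
      also have "... <= (12 * t / (pi\<^sup>2 * (real r)\<^sup>2) + \<kappa>) / real (M n)"
      proof (rule divide_right_mono)
        have tk: "2 * t * (2 * k) = \<kappa>" using t by (simp add: k_def)
        have "2 * t * (6 / pi\<^sup>2 + 2 * k) / (real r)\<^sup>2 = 12 * t / (pi\<^sup>2 * (real r)\<^sup>2) + \<kappa> / (real r)\<^sup>2"
          unfolding distrib_left tk by (simp add: add_divide_distrib)
        moreover have "\<kappa> / (real r)\<^sup>2 <= \<kappa> / 1" using r \<kappa> by (intro divide_left_mono) auto
        ultimately show "2 * t * (6 / pi\<^sup>2 + 2 * k) / (real r)\<^sup>2 <= 12 * t / (pi\<^sup>2 * (real r)\<^sup>2) + \<kappa>" by simp
      qed simp
      finally show "measure lborel {\<alpha>\<in>{0..<1}. k0 r T \<alpha> <= t / real (M n)} <= (12 * t / (pi\<^sup>2 * (real r)\<^sup>2) + \<kappa>) / real (M n)" .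
    qed
  qed
qed

lemma small_values_lower:
  fixes M :: "nat => nat"
  assumes M: "filterlim (\<lambda>n. real (M n)) at_top sequentially" and r: "1 <= r" and t: "0 < t" and \<kappa>: "0 < \<kappa>"
  shows "\<forall>\<^sub>F n in sequentially. \<forall>T p1 q1 p2 q2. farey_adjacent ((p1, q1), (p2, q2)) -->
      real (M n) ^ 1 * real q1 <= T --> real (M n) ^ 1 * real q2 <= T -->
      (12 * t / (pi\<^sup>2 * (real r)\<^sup>2) - \<kappa>) / real (M n) * farey_length ((p1, q1), (p2, q2))
        <= measure lborel {\<alpha>\<in>farey_interval ((p1, q1), (p2, q2)). k0 r T \<alpha> <= t / real (M n)}"
proof -
  define k where "k = min (1 / 4) (\<kappa> / (2 * t))"
  have k: "0 < k" "k < 1 / 2" using t \<kappa> by (auto simp: k_def)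
  obtain X where X: "0 < X" "\<And>q1 q2 Z. 1 <= q1 ==> 1 <= q2 ==> X * real q1 <= Z ==> X * real q2 <= Z ==>
           fraction_sum q1 q2 Z >= (6 / pi\<^sup>2 - k) * Z / (real q1 * real q2)" using fraction_sum_lower[OF k] by blast
  define b where "b = 1 + 4 * t + real r + real r * X"
  have "\<forall>\<^sub>F n in sequentially. b <= real (M n)" using M by (simp add: filterlim_at_top)
  then show ?thesis
  proof eventually_elim
    case (elim n)
    have rX: "0 <= real r * X" using X by simp
    have N: "1 <= real (M n)" "4 * t <= real (M n)" "real r <= real (M n)" "real r * X <= real (M n)"
      using elim rX t unfolding b_def by linarith+
    show ?case
    proof (intro allI impI)
      fix T p1 q1 p2 q2 assume adj: "farey_adjacent ((p1, q1), (p2, q2))" and "real (M n) ^ 1 * real q1 <= T" "real (M n) ^ 1 * real q2 <= T"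
      then have Tq: "real (M n) * real q1 <= T" "real (M n) * real q2 <= T" by auto
      have q: "1 <= q1" "1 <= q2" using adj by (auto simp: farey_adjacent_def)
      have le: "c * real q1 <= T" "c * real q2 <= T" if "c <= real (M n)" for c
        using Tq mult_right_mono[OF that, of "real q1"] mult_right_mono[OF that, of "real q2"] by auto
      have r0: "0 < real r" using r by simp
      have T0: "0 < T" using le(1)[OF N(1)] q by linarith
      have "(6 / pi\<^sup>2 - k) * (T / real r) / (real q1 * real q2) <= fraction_sum q1 q2 (T / real r)"
        using le[OF N(4)] r0 by (intro X q) (simp_all add: le_divide_eq mult_ac)
      then have "2 * (t / real (M n)) / (real r * T) * ((6 / pi\<^sup>2 - k) * (T / real r) / (real q1 * real q2))
        <= 2 * (t / real (M n)) / (real r * T) * fraction_sum q1 q2 (T / real r)" using t T0 by (intro mult_left_mono) auto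
      also have "... <= measure lborel {\<alpha>\<in>farey_interval ((p1, q1), (p2, q2)). k0 r T \<alpha> <= t / real (M n)}"
        using adj r le[OF N(3)] t N by (intro small_value_measure_ge) (auto simp: divide_less_eq)
      also have "2 * (t / real (M n)) / (real r * T) * ((6 / pi\<^sup>2 - k) * (T / real r) / (real q1 * real q2))
        = 2 * t * (6 / pi\<^sup>2 - k) / (real r)\<^sup>2 / real (M n) * farey_length ((p1, q1), (p2, q2))"
        using T0 by (simp add: farey_length_def power2_eq_square mult_ac)
      finally have A: "2 * t * (6 / pi\<^sup>2 - k) / (real r)\<^sup>2 / real (M n) * farey_length ((p1, q1), (p2, q2))
        <= measure lborel {\<alpha>\<in>farey_interval ((p1, q1), (p2, q2)). k0 r T \<alpha> <= t / real (M n)}" .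
      have B: "12 * t / (pi\<^sup>2 * (real r)\<^sup>2) - \<kappa> <= 2 * t * (6 / pi\<^sup>2 - k) / (real r)\<^sup>2"
      proof -
        have "2 * t * k <= \<kappa>"
        proof -
          have "k <= \<kappa> / (2 * t)" by (simp add: k_def)
          then show ?thesis using t by (simp add: le_divide_eq mult_ac)
        qed
        then have "2 * t * k / (real r)\<^sup>2 <= \<kappa> / (real r)\<^sup>2" by (intro divide_right_mono) auto
        also have "... <= \<kappa> / 1" using r \<kappa> by (intro divide_left_mono) auto
        finally have "2 * t * k / (real r)\<^sup>2 <= \<kappa>" by simp
        moreover have "2 * t * (6 / pi\<^sup>2 - k) / (real r)\<^sup>2 = 12 * t / (pi\<^sup>2 * (real r)\<^sup>2) - 2 * t * k / (real r)\<^sup>2"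
          unfolding right_diff_distrib by (simp add: diff_divide_distrib)
        ultimately show ?thesis by (simp only: diff_left_mono)
      qed
      have "(12 * t / (pi\<^sup>2 * (real r)\<^sup>2) - \<kappa>) / real (M n) * farey_length ((p1, q1), (p2, q2))
        <= 2 * t * (6 / pi\<^sup>2 - k) / (real r)\<^sup>2 / real (M n) * farey_length ((p1, q1), (p2, q2))"
        by (intro mult_right_mono divide_right_mono B) (simp_all add: farey_length_def)
      then show "(12 * t / (pi\<^sup>2 * (real r)\<^sup>2) - \<kappa>) / real (M n) * farey_length ((p1, q1), (p2, q2))
        <= measure lborel {\<alpha>\<in>farey_interval ((p1, q1), (p2, q2)). k0 r T \<alpha> <= t / real (M n)}" using A by linarith
    qed
  qed
qed

text \<open>
  The normalisation: \<open>eps\<^sup>2 = t\<^sup>2 / (N ln N)\<close> and \<open>ln (1 / eps)\<close> is asymptotically \<open>ln N / 2\<close>.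
\<close>

lemma large_value_scale:
  fixes M :: "nat => nat"
  assumes M: "filterlim (\<lambda>n. real (M n)) at_top sequentially" and t: "0 < t"
  defines "eps \<equiv> \<lambda>n. t / sqrt (real (M n) * ln (real (M n)))"
  shows "(\<lambda>n. real (M n) * ((eps n)\<^sup>2 * ln (1 / eps n))) \<longlonglongrightarrow> t\<^sup>2 / 2"
    and "eps \<longlonglongrightarrow> 0" and "\<forall>\<^sub>F n in sequentially. 0 < eps n \<and> 1 / eps n <= real (M n)"
proof -
  define e where "e y = t / sqrt (y * ln y)" for y :: real
  have e: "eps = (\<lambda>n. e (real (M n)))" by (simp add: eps_def e_def)
  have "((\<lambda>y. y * ((e y)\<^sup>2 * ln (1 / e y))) \<longlongrightarrow> t\<^sup>2 / 2) at_top" unfolding e_def using t by real_asymp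
  then show "(\<lambda>n. real (M n) * ((eps n)\<^sup>2 * ln (1 / eps n))) \<longlonglongrightarrow> t\<^sup>2 / 2" unfolding e by (rule filterlim_compose[OF _ M])
  have "(e \<longlongrightarrow> 0) at_top" unfolding e_def using t by real_asymp
  then show "eps \<longlonglongrightarrow> 0" unfolding e by (rule filterlim_compose[OF _ M])
  have "\<forall>\<^sub>F y in at_top. 0 < e y \<and> 1 / e y <= y" unfolding e_def using t by (intro eventually_conj) real_asymp+
  then show "\<forall>\<^sub>F n in sequentially. 0 < eps n \<and> 1 / eps n <= real (M n)" unfolding e by (rule eventually_compose_filterlim[OF _ M])
qed

lemma large_values_upper:
  fixes M :: "nat => nat"
  assumes M: "filterlim (\<lambda>n. real (M n)) at_top sequentially" and t: "0 < t" and \<kappa>: "0 < \<kappa>"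
  shows "\<forall>\<^sub>F n in sequentially. \<forall>T. real (M n) ^ 4 <= T -->
    measure lborel {\<alpha>\<in>{0..<1}. 1 - t / sqrt (real (M n) * ln (real (M n))) <= k0 1 T \<alpha>} <= (3 * t\<^sup>2 / pi\<^sup>2 + \<kappa>) / real (M n)"
proof -
  define eps where "eps n = t / sqrt (real (M n) * ln (real (M n)))" for n
  define k where "k = \<kappa> / t\<^sup>2"
  have k: "0 < k" "(6 / pi\<^sup>2 + k) * (t\<^sup>2 / 2) = 3 * t\<^sup>2 / pi\<^sup>2 + \<kappa> / 2" using t \<kappa> by (auto simp: k_def field_simps)
  obtain eps0 where eps0: "0 < eps0" "\<And>eps T. 0 < eps ==> eps <= eps0 ==> (1 / eps) ^ 4 <= T ==>
     measure lborel {\<alpha> \<in> {0..<1}. k0 1 T \<alpha> >= 1 - eps} <= (6 / pi\<^sup>2 + k) * (eps\<^sup>2 * ln (1 / eps))"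
    using large_value_measure_le[OF k(1)] by blast
  have "(\<lambda>n. (6 / pi\<^sup>2 + k) * (real (M n) * ((eps n)\<^sup>2 * ln (1 / eps n)))) \<longlonglongrightarrow> (6 / pi\<^sup>2 + k) * (t\<^sup>2 / 2)"
    unfolding eps_def by (intro tendsto_mult tendsto_const large_value_scale[OF M t])
  moreover have "(6 / pi\<^sup>2 + k) * (t\<^sup>2 / 2) < 3 * t\<^sup>2 / pi\<^sup>2 + \<kappa>" using k \<kappa> by simp
  ultimately have "\<forall>\<^sub>F n in sequentially. (6 / pi\<^sup>2 + k) * (real (M n) * ((eps n)\<^sup>2 * ln (1 / eps n))) < 3 * t\<^sup>2 / pi\<^sup>2 + \<kappa>"
    by (rule order_tendstoD(2))
  moreover have "\<forall>\<^sub>F n in sequentially. eps n < eps0" using large_value_scale(2)[OF M t] eps0(1) unfolding eps_def by (rule order_tendstoD(2))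
  moreover have "\<forall>\<^sub>F n in sequentially. 0 < eps n \<and> 1 / eps n <= real (M n)" unfolding eps_def by (rule large_value_scale(3)[OF M t])
  moreover have "\<forall>\<^sub>F n in sequentially. 1 <= real (M n)" using M unfolding filterlim_at_top by blast
  ultimately show ?thesis
  proof eventually_elim
    case (elim n)
    show ?case
    proof (intro allI impI)
      fix T assume T: "real (M n) ^ 4 <= T"
      have "(1 / eps n) ^ 4 <= real (M n) ^ 4" using elim by (intro power_mono) auto
      then have "(1 / eps n) ^ 4 <= T" using T by linarith
      then have "measure lborel {\<alpha> \<in> {0..<1}. k0 1 T \<alpha> >= 1 - eps n} <= (6 / pi\<^sup>2 + k) * ((eps n)\<^sup>2 * ln (1 / eps n))"
        using elim by (intro eps0) (blast, linarith, blast)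
      also have "... <= (3 * t\<^sup>2 / pi\<^sup>2 + \<kappa>) / real (M n)" using elim by (simp add: le_divide_eq mult_ac)
      finally show "measure lborel {\<alpha>\<in>{0..<1}. 1 - t / sqrt (real (M n) * ln (real (M n))) <= k0 1 T \<alpha>} <= (3 * t\<^sup>2 / pi\<^sup>2 + \<kappa>) / real (M n)"
        by (simp add: eps_def)
    qed
  qed
qed

lemma large_values_lower:
  fixes M :: "nat => nat"
  assumes M: "filterlim (\<lambda>n. real (M n)) at_top sequentially" and t: "0 < t" and \<kappa>: "0 < \<kappa>"
  shows "\<exists>C. \<forall>\<^sub>F n in sequentially. \<forall>T p1 q1 p2 q2. farey_adjacent ((p1, q1), (p2, q2)) -->
      real (M n) ^ C * real q1 <= T --> real (M n) ^ C * real q2 <= T -->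
      (3 * t\<^sup>2 / pi\<^sup>2 - \<kappa>) / real (M n) * farey_length ((p1, q1), (p2, q2))
        <= measure lborel {\<alpha>\<in>farey_interval ((p1, q1), (p2, q2)). 1 - t / sqrt (real (M n) * ln (real (M n))) <= k0 1 T \<alpha>}"
proof -
  define eps where "eps n = t / sqrt (real (M n) * ln (real (M n)))" for n
  define k where "k = min (1 / 4) (\<kappa> / t\<^sup>2)"
  have k: "0 < k" "k < 1 / 2" using t \<kappa> by (auto simp: k_def)
  have lt: "3 * t\<^sup>2 / pi\<^sup>2 - \<kappa> < (6 / pi\<^sup>2 - k) * (t\<^sup>2 / 2)"
  proof -
    have "k <= \<kappa> / t\<^sup>2" by (simp add: k_def)
    then have "k * t\<^sup>2 <= \<kappa>" using t by (simp add: le_divide_eq)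
    moreover have "(6 / pi\<^sup>2 - k) * (t\<^sup>2 / 2) = 3 * t\<^sup>2 / pi\<^sup>2 - k * t\<^sup>2 / 2" by (simp add: algebra_simps)
    ultimately show ?thesis using \<kappa> by linarith
  qed
  obtain C eps0 where eps0: "0 < eps0" "\<And>eps q1 q2 T. 0 < eps ==> eps <= eps0 ==> 1 <= q1 ==> 1 <= q2 ==>
     (1 / eps) ^ C * real q1 <= T ==> (1 / eps) ^ C * real q2 <= T ==>
     gap_sum q1 q2 T eps >= (6 / pi\<^sup>2 - k) * (eps\<^sup>2 * ln (1 / eps)) / (real q1 * real q2)"
    using gap_sum_lower[OF k] by blast
  have "(\<lambda>n. (6 / pi\<^sup>2 - k) * (real (M n) * ((eps n)\<^sup>2 * ln (1 / eps n)))) \<longlonglongrightarrow> (6 / pi\<^sup>2 - k) * (t\<^sup>2 / 2)"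
    unfolding eps_def by (intro tendsto_mult tendsto_const large_value_scale[OF M t])
  then have "\<forall>\<^sub>F n in sequentially. 3 * t\<^sup>2 / pi\<^sup>2 - \<kappa> < (6 / pi\<^sup>2 - k) * (real (M n) * ((eps n)\<^sup>2 * ln (1 / eps n)))"
    using lt by (rule order_tendstoD(1))
  moreover have "\<forall>\<^sub>F n in sequentially. eps n < min eps0 1"
    using large_value_scale(2)[OF M t] unfolding eps_def by (rule order_tendstoD(2)) (use eps0(1) in simp)
  moreover have "\<forall>\<^sub>F n in sequentially. 0 < eps n \<and> 1 / eps n <= real (M n)" unfolding eps_def by (rule large_value_scale(3)[OF M t])
  moreover have "\<forall>\<^sub>F n in sequentially. 1 <= real (M n)" using M unfolding filterlim_at_top by blast
  ultimately have "\<forall>\<^sub>F n in sequentially. \<forall>T p1 q1 p2 q2. farey_adjacent ((p1, q1), (p2, q2)) -->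
      real (M n) ^ C * real q1 <= T --> real (M n) ^ C * real q2 <= T -->
      (3 * t\<^sup>2 / pi\<^sup>2 - \<kappa>) / real (M n) * farey_length ((p1, q1), (p2, q2))
        <= measure lborel {\<alpha>\<in>farey_interval ((p1, q1), (p2, q2)). 1 - eps n <= k0 1 T \<alpha>}"
  proof eventually_elim
    case (elim n)
    show ?case
    proof (intro allI impI)
      fix T p1 q1 p2 q2 assume adj: "farey_adjacent ((p1, q1), (p2, q2))" and T: "real (M n) ^ C * real q1 <= T" "real (M n) ^ C * real q2 <= T"
      have q: "1 <= q1" "1 <= q2" using adj by (auto simp: farey_adjacent_def)
      have "(1 / eps n) ^ C <= real (M n) ^ C" using elim by (intro power_mono) auto
      then have eT: "(1 / eps n) ^ C * real q <= real (M n) ^ C * real q" for q by (rule mult_right_mono) simp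
      have "real (M n) ^ C * real q1 >= 1 * 1" using elim q by (intro mult_mono) auto
      then have T1: "1 <= T" using T by linarith
      have "(3 * t\<^sup>2 / pi\<^sup>2 - \<kappa>) / real (M n) * farey_length ((p1, q1), (p2, q2)) <= (6 / pi\<^sup>2 - k) * ((eps n)\<^sup>2 * ln (1 / eps n)) * farey_length ((p1, q1), (p2, q2))"
      proof (rule mult_right_mono)
        show "(3 * t\<^sup>2 / pi\<^sup>2 - \<kappa>) / real (M n) <= (6 / pi\<^sup>2 - k) * ((eps n)\<^sup>2 * ln (1 / eps n))"
          using elim by (simp add: divide_le_eq mult_ac)
      qed (simp add: farey_length_def)
      also have "... = (6 / pi\<^sup>2 - k) * ((eps n)\<^sup>2 * ln (1 / eps n)) / (real q1 * real q2)" by (simp add: farey_length_def)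
      also have "... <= gap_sum q1 q2 T (eps n)" using elim q order_trans[OF eT T(1)] order_trans[OF eT T(2)] by (intro eps0) auto
      also have "... <= measure lborel {\<alpha>\<in>farey_interval ((p1, q1), (p2, q2)). 1 - eps n <= k0 1 T \<alpha>}"
        using adj T1 elim by (intro large_value_measure_ge) auto
      finally show "(3 * t\<^sup>2 / pi\<^sup>2 - \<kappa>) / real (M n) * farey_length ((p1, q1), (p2, q2))
        <= measure lborel {\<alpha>\<in>farey_interval ((p1, q1), (p2, q2)). 1 - eps n <= k0 1 T \<alpha>}" .
    qed
  qed
  then show ?thesis unfolding eps_def by blast
qed

section \<open>Convergence in distribution\<close>

text \<open>The two growth hypotheses, exponentiated.\<close>

lemma spacing_eventually:
  fixes \<Delta> :: "nat => real set"
  assumes fin: "\<And>n. finite (\<Delta> n)" and ge1: "\<And>n. \<Delta> n \<subseteq> {1..}"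
    and card: "filterlim (\<lambda>n. card (\<Delta> n)) at_top sequentially"
    and diff: "filterlim (\<lambda>n. Min {\<bar>ln T - ln T'\<bar> | T T'. T \<in> \<Delta> n \<and> T' \<in> \<Delta> n \<and> T ~= T'}
           / ln (real (card (\<Delta> n)))) at_top sequentially"
    and low: "filterlim (\<lambda>n. (MIN T\<in>\<Delta> n. ln T) / ln (real (card (\<Delta> n)))) at_top sequentially"
  shows "\<forall>\<^sub>F n in sequentially. (\<forall>T\<in>\<Delta> n. real (card (\<Delta> n)) ^ D <= T) \<and>
      (\<forall>T\<in>\<Delta> n. \<forall>T'\<in>\<Delta> n. T < T' --> real (card (\<Delta> n)) ^ D * T <= T')"
proof -
  define S where "S n = {\<bar>ln T - ln T'\<bar> | T T'. T \<in> \<Delta> n \<and> T' \<in> \<Delta> n \<and> T ~= T'}" for n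
  have "\<forall>\<^sub>F n in sequentially. real D <= Min (S n) / ln (real (card (\<Delta> n)))"
    using diff unfolding filterlim_at_top S_def by blast
  moreover have "\<forall>\<^sub>F n in sequentially. real D <= (MIN T\<in>\<Delta> n. ln T) / ln (real (card (\<Delta> n)))"
    using low unfolding filterlim_at_top by blast
  moreover have "\<forall>\<^sub>F n in sequentially. 2 <= card (\<Delta> n)" using card unfolding filterlim_at_top by blast
  ultimately show ?thesis
  proof eventually_elim
    case (elim n)
    have l: "0 < ln (real (card (\<Delta> n)))" using elim(3) by simp
    have pos: "0 < real (card (\<Delta> n)) ^ D" using elim(3) by simp
    have lnp: "ln (real (card (\<Delta> n)) ^ D) = real D * ln (real (card (\<Delta> n)))" by (rule ln_realpow)
    have a: "real D * ln (real (card (\<Delta> n))) <= Min (S n)" "real D * ln (real (card (\<Delta> n))) <= (MIN T\<in>\<Delta> n. ln T)"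
      using elim(1,2) l by (simp_all add: le_divide_eq)
    have T1: "1 <= T" if "T \<in> \<Delta> n" for T using ge1 that by auto
    show ?case
    proof (intro conjI ballI impI)
      fix T assume T: "T \<in> \<Delta> n"
      have "(MIN T\<in>\<Delta> n. ln T) <= ln T" using T fin[of n] by (intro Min_le) auto
      then have "ln (real (card (\<Delta> n)) ^ D) <= ln T" using a lnp by linarith
      then show "real (card (\<Delta> n)) ^ D <= T" using pos T1[OF T] ln_le_cancel_iff[of "real (card (\<Delta> n)) ^ D" T] by linarith
    next
      fix T T' assume T: "T \<in> \<Delta> n" "T' \<in> \<Delta> n" "T < T'"
      have "S n \<subseteq> (\<lambda>(T, T'). \<bar>ln T - ln T'\<bar>) ` (\<Delta> n \<times> \<Delta> n)" by (auto simp: S_def)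
      then have "finite (S n)" by (rule finite_subset) (use fin in auto)
      moreover have "\<bar>ln T - ln T'\<bar> \<in> S n" using T by (auto simp: S_def)
      ultimately have "Min (S n) <= \<bar>ln T - ln T'\<bar>" by (rule Min_le)
      moreover have "ln T < ln T'" using T T1[OF T(1)] by simp
      ultimately have "ln (real (card (\<Delta> n)) ^ D) + ln T <= ln T'" using a lnp by linarith
      moreover have "ln (real (card (\<Delta> n)) ^ D * T) = ln (real (card (\<Delta> n)) ^ D) + ln T" using pos T1[OF T(1)] by (subst ln_mult) auto
      ultimately have "ln (real (card (\<Delta> n)) ^ D * T) <= ln T'" by simp
      moreover have "0 < real (card (\<Delta> n)) ^ D * T" "0 < T'" using pos T1[OF T(1)] T1[OF T(2)] by (auto intro: mult_pos_pos)
      ultimately show "real (card (\<Delta> n)) ^ D * T <= T'" by simp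
    qed
  qed
qed

text \<open>
  Only the limits at \<open>t > 0\<close> have to be known: the limit distribution function tends to 0 at \<open>0\<close>
  from the right, and by monotonicity this controls the values at all \<open>x <= 0\<close>.
\<close>

lemma weak_conv_weibull:
  fixes X :: "nat => real => real"
  assumes c: "0 < c" and a: "0 < a"
    and meas: "\<forall>\<^sub>F n in sequentially. X n \<in> borel_measurable borel"
    and lim: "\<And>t. 0 < t ==> (\<lambda>n. measure lborel {\<alpha>\<in>{0..<1}. t < X n \<alpha>}) \<longlonglongrightarrow> exp (- c * t powr a)"
  shows "weak_conv_m (\<lambda>n. distr circle_measure borel (X n)) (weibull c a)"
  unfolding weak_conv_m_def weak_conv_def cdf_weibull[OF c a]
proof (intro allI impI)
  fix x
  define p where "p n = cdf (distr circle_measure borel (X n))" for n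
  have p: "\<forall>\<^sub>F n in sequentially. \<forall>y. p n y = 1 - measure lborel {\<alpha>\<in>{0..<1}. y < X n \<alpha>}"
    using meas
  proof eventually_elim
    case (elim n)
    show ?case
    proof
      fix y
      have sp: "space circle_measure = {0..<1}" by (simp add: circle_measure_def space_restrict_space)
      have X: "X n \<in> borel_measurable circle_measure" unfolding circle_measure_def by (rule measurable_restrict_space1) (use elim in simp)
      have "p n y = measure circle_measure (X n -` {..y} \<inter> space circle_measure)"
        unfolding p_def cdf_def by (rule measure_distr[OF X]) simp
      also have "X n -` {..y} \<inter> space circle_measure = {\<alpha>\<in>{0..<1}. X n \<alpha> <= y}" by (auto simp: sp)
      also have "measure circle_measure ... = measure lborel {\<alpha>\<in>{0..<1}. X n \<alpha> <= y}"
        unfolding circle_measure_def by (rule measure_restrict_space) auto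
      also have "{\<alpha>\<in>{0..<1}. X n \<alpha> <= y} = {0..<1} - {\<alpha>\<in>{0..<1}. y < X n \<alpha>}" by auto
      also have "measure lborel ... = measure lborel {0..<1::real} - measure lborel {\<alpha>\<in>{0..<1}. y < X n \<alpha>}"
      proof (rule measurable_measure_Diff)
        show "{0..<1::real} \<in> fmeasurable lborel" by (rule fmeasurable_sub_circle) auto
        show "{\<alpha>\<in>{0..<1}. y < X n \<alpha>} \<in> sets lborel" using elim by measurable
      qed auto
      finally show "p n y = 1 - measure lborel {\<alpha>\<in>{0..<1}. y < X n \<alpha>}" by simp
    qed
  qed
  have pos: "(\<lambda>n. p n t) \<longlonglongrightarrow> 1 - exp (- c * t powr a)" if "0 < t" for t
  proof (rule Lim_transform_eventually)
    show "(\<lambda>n. 1 - measure lborel {\<alpha>\<in>{0..<1}. t < X n \<alpha>}) \<longlonglongrightarrow> 1 - exp (- c * t powr a)"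
      by (intro tendsto_diff tendsto_const lim that)
    show "\<forall>\<^sub>F n in sequentially. 1 - measure lborel {\<alpha>\<in>{0..<1}. t < X n \<alpha>} = p n t"
      using p by eventually_elim simp
  qed
  have "(\<lambda>n. p n x) \<longlonglongrightarrow> weibull_cdf c a x"
  proof (cases "0 < x")
    case True
    then show ?thesis using pos by (simp add: weibull_cdf_def)
  next
    case False
    have "(\<lambda>n. p n x) \<longlonglongrightarrow> 0"
    proof (rule order_tendstoI)
      fix \<delta> :: real assume "\<delta> < 0"
      moreover have "0 <= p n x" for n by (simp add: p_def cdf_def)
      ultimately show "\<forall>\<^sub>F n in sequentially. \<delta> < p n x" by (intro always_eventually allI) (meson less_le_trans)
    next
      fix \<delta> :: real assume \<delta>: "0 < \<delta>"
      have "((\<lambda>t. 1 - exp (- c * t powr a)) \<longlongrightarrow> 0) (at_right 0)" using c a by real_asymp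
      then have "\<forall>\<^sub>F t in at_right 0. 1 - exp (- c * t powr a) < \<delta>" using \<delta> by (rule order_tendstoD(2))
      then have "\<forall>\<^sub>F t in at_right 0. 0 < t \<and> 1 - exp (- c * t powr a) < \<delta>" by (intro eventually_conj eventually_at_right_less)
      then obtain t where t: "0 < t" "1 - exp (- c * t powr a) < \<delta>" using eventually_happens[of _ "at_right (0::real)"] by auto
      have "\<forall>\<^sub>F n in sequentially. p n t < \<delta>" using pos[OF t(1)] t(2) by (rule order_tendstoD(2))
      then show "\<forall>\<^sub>F n in sequentially. p n x < \<delta>"
        using meas p
      proof eventually_elim
        case (elim n)
        have "measure lborel {\<alpha>\<in>{0..<1}. t < X n \<alpha>} <= measure lborel {\<alpha>\<in>{0..<1}. x < X n \<alpha>}"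
        proof (rule measure_mono_fmeasurable)
          show "{\<alpha>\<in>{0..<1}. t < X n \<alpha>} \<in> sets lborel" using elim(2) by measurable
          have "{\<alpha>\<in>{0..<1}. x < X n \<alpha>} \<in> sets lborel" using elim(2) by measurable
          then show "{\<alpha>\<in>{0..<1}. x < X n \<alpha>} \<in> fmeasurable lborel" by (rule fmeasurable_sub_circle) auto
        qed (use t False in auto)
        then show ?case using elim by simp
      qed
    qed
    then show ?thesis using False by (simp add: weibull_cdf_def)
  qed
  then show "(\<lambda>n. cdf (distr circle_measure borel (X n)) x) \<longlonglongrightarrow> weibull_cdf c a x" by (simp add: p_def)
qed

theorem theorem1p2:
  fixes \<Delta> :: "nat \<Rightarrow> real set"
  assumes "\<And>n. finite (\<Delta> n)"
    and "\<And>n. \<Delta> n \<subseteq> {1..}"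
    and "filterlim (\<lambda>n. card (\<Delta> n)) at_top sequentially"
    and "filterlim (\<lambda>n. Min {\<bar>ln T - ln T'\<bar> | T T'. T \<in> \<Delta> n \<and> T' \<in> \<Delta> n \<and> T \<noteq> T'}
           / ln (real (card (\<Delta> n)))) at_top sequentially"
    and "filterlim (\<lambda>n. (MIN T\<in>\<Delta> n. ln T) / ln (real (card (\<Delta> n)))) at_top sequentially"
  shows "(\<forall>r::nat. r \<ge> 1 \<longrightarrow>
            weak_conv_m
              (\<lambda>n. distr circle_measure borel (\<lambda>\<alpha>. real (card (\<Delta> n)) * min_k0 r (\<Delta> n) \<alpha>))
              (weibull (12 / (pi\<^sup>2 * (real r)\<^sup>2)) 1)) \<and>
         weak_conv_m
           (\<lambda>n. distr circle_measure borel
              (\<lambda>\<alpha>. sqrt (real (card (\<Delta> n))) * sqrt (ln (real (card (\<Delta> n))))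
                     * (1 - max_k0 1 (\<Delta> n) \<alpha>)))
           (weibull (3 / pi\<^sup>2) 2)"
proof -
  define M where "M n = card (\<Delta> n)" for n
  have rM: "filterlim (\<lambda>n. real (M n)) at_top sequentially"
    unfolding M_def by (rule filterlim_compose[OF filterlim_real_sequentially assms(3)])
  note spacing = spacing_eventually[OF assms]
  have ne: "\<Delta> n ~= {}" if "1 <= M n" for n using that by (auto simp: M_def)
  have Mge: "\<forall>\<^sub>F n in sequentially. c <= real (M n)" for c using rM unfolding filterlim_at_top by blast
  have large: "\<forall>\<^sub>F n in sequentially. \<forall>T\<in>\<Delta> n. c <= T" for c
    using Mge[of c] spacing[of 1] by eventually_elim (auto simp: M_def)
  have part1: "weak_conv_m (\<lambda>n. distr circle_measure borel (\<lambda>\<alpha>. real (M n) * min_k0 r (\<Delta> n) \<alpha>)) (weibull (12 / (pi\<^sup>2 * (real r)\<^sup>2)) 1)"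
    if r: "1 <= r" for r
  proof (rule weak_conv_weibull)
    show "0 < 12 / (pi\<^sup>2 * (real r)\<^sup>2)" using r by simp
    show "\<forall>\<^sub>F n in sequentially. (\<lambda>\<alpha>. real (M n) * min_k0 r (\<Delta> n) \<alpha>) \<in> borel_measurable borel"
      using large[of "real r"]
    proof eventually_elim
      case (elim n)
      have "(\<lambda>\<alpha>. Min ((\<lambda>T. k0 r T \<alpha>) ` \<Delta> n)) \<in> borel_measurable borel"
        using elim r by (intro borel_measurable_Min assms(1) k0_measurable) auto
      then show ?case unfolding min_k0_def by measurable
    qed
    fix t :: real assume t: "0 < t"
    have "(\<lambda>n. measure lborel {\<alpha>\<in>{0..<1}. \<forall>T\<in>\<Delta> n. t / real (M n) < k0 r T \<alpha>}) \<longlonglongrightarrow> exp (- (12 * t / (pi\<^sup>2 * (real r)\<^sup>2)))"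
    proof (rule poisson_void[where \<Lambda> = "\<lambda>t. 12 * t / (pi\<^sup>2 * (real r)\<^sup>2)" and s = "\<lambda>n t. t / real (M n)" and f = "k0 r" and ?T0.0 = "real r", OF assms(1,3) spacing])
      fix t :: real assume t: "0 < t"
      show "isCont (\<lambda>t. 12 * t / (pi\<^sup>2 * (real r)\<^sup>2)) t" using r by (intro continuous_intros) auto
      show "0 < 12 * t / (pi\<^sup>2 * (real r)\<^sup>2)" using t r by simp
      fix \<kappa> :: real assume "0 < \<kappa>"
      note lu = small_values_upper[OF rM r t this] small_values_lower[OF rM r t this]
      show "\<exists>C. \<forall>\<^sub>F n in sequentially. \<forall>T. real (card (\<Delta> n)) ^ C <= T -->
          measure lborel {\<alpha>\<in>{0..<1}. k0 r T \<alpha> <= t / real (M n)} <= (12 * t / (pi\<^sup>2 * (real r)\<^sup>2) + \<kappa>) / real (card (\<Delta> n))"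
        using lu(1) unfolding M_def by blast
      show "\<exists>C. \<forall>\<^sub>F n in sequentially. \<forall>T p1 q1 p2 q2. farey_adjacent ((p1, q1), (p2, q2)) -->
          real (card (\<Delta> n)) ^ C * real q1 <= T --> real (card (\<Delta> n)) ^ C * real q2 <= T -->
          (12 * t / (pi\<^sup>2 * (real r)\<^sup>2) - \<kappa>) / real (card (\<Delta> n)) * farey_length ((p1, q1), (p2, q2))
            <= measure lborel {\<alpha>\<in>farey_interval ((p1, q1), (p2, q2)). k0 r T \<alpha> <= t / real (M n)}"
        using lu(2) unfolding M_def by blast
    qed (use r t in \<open>simp_all add: k0_measurable k0_lipschitz M_def diff_divide_distrib\<close>)
    then show "(\<lambda>n. measure lborel {\<alpha>\<in>{0..<1}. t < real (M n) * min_k0 r (\<Delta> n) \<alpha>}) \<longlonglongrightarrow> exp (- (12 / (pi\<^sup>2 * (real r)\<^sup>2)) * t powr 1)"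
    proof (rule Lim_transform_eventually[THEN tendsto_eq_rhs])
      show "\<forall>\<^sub>F n in sequentially. measure lborel {\<alpha>\<in>{0..<1}. \<forall>T\<in>\<Delta> n. t / real (M n) < k0 r T \<alpha>}
          = measure lborel {\<alpha>\<in>{0..<1}. t < real (M n) * min_k0 r (\<Delta> n) \<alpha>}"
        using Mge[of 1]
      proof eventually_elim
        case (elim n)
        have "(t < real (M n) * min_k0 r (\<Delta> n) \<alpha>) \<longleftrightarrow> (\<forall>T\<in>\<Delta> n. t / real (M n) < k0 r T \<alpha>)" for \<alpha>
        proof -
          have "(t < real (M n) * min_k0 r (\<Delta> n) \<alpha>) \<longleftrightarrow> t / real (M n) < min_k0 r (\<Delta> n) \<alpha>"
            using elim by (simp add: divide_less_eq mult.commute)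
          also have "... \<longleftrightarrow> (\<forall>T\<in>\<Delta> n. t / real (M n) < k0 r T \<alpha>)"
            unfolding min_k0_def using elim ne[of n] assms(1)[of n] by (subst Min_gr_iff) auto
          finally show ?thesis .
        qed
        then show ?case by simp
      qed
      show "exp (- (12 * t / (pi\<^sup>2 * (real r)\<^sup>2))) = exp (- (12 / (pi\<^sup>2 * (real r)\<^sup>2)) * t powr 1)" using t by simp
    qed
  qed simp
  have part2: "weak_conv_m (\<lambda>n. distr circle_measure borel (\<lambda>\<alpha>. sqrt (real (M n)) * sqrt (ln (real (M n))) * (1 - max_k0 1 (\<Delta> n) \<alpha>))) (weibull (3 / pi\<^sup>2) 2)"
  proof (rule weak_conv_weibull)
    show "\<forall>\<^sub>F n in sequentially. (\<lambda>\<alpha>. sqrt (real (M n)) * sqrt (ln (real (M n))) * (1 - max_k0 1 (\<Delta> n) \<alpha>)) \<in> borel_measurable borel"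
      using large[of 1]
    proof eventually_elim
      case (elim n)
      have "(\<lambda>\<alpha>. Max ((\<lambda>T. k0 1 T \<alpha>) ` \<Delta> n)) \<in> borel_measurable borel"
        using elim by (intro borel_measurable_Max assms(1) k0_measurable) auto
      then show ?case unfolding max_k0_def by measurable
    qed
    fix t :: real assume t: "0 < t"
    define eps where "eps n t = t / sqrt (real (M n) * ln (real (M n)))" for n t
    \<comment> \<open>Large values of k0 become small values after a change of sign.\<close>
    have "(\<lambda>n. measure lborel {\<alpha>\<in>{0..<1}. \<forall>T\<in>\<Delta> n. - (1 - eps n t) < - k0 1 T \<alpha>}) \<longlonglongrightarrow> exp (- (3 * t\<^sup>2 / pi\<^sup>2))"
    proof (rule poisson_void[where \<Lambda> = "\<lambda>t. 3 * t\<^sup>2 / pi\<^sup>2" and s = "\<lambda>n t. - (1 - eps n t)" and f = "\<lambda>T \<alpha>. - k0 1 T \<alpha>" and ?T0.0 = 1, OF assms(1,3) spacing])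
      fix t :: real assume t: "0 < t"
      show "isCont (\<lambda>t. 3 * t\<^sup>2 / pi\<^sup>2) t" by (intro continuous_intros) auto
      show "0 < 3 * t\<^sup>2 / pi\<^sup>2" using t by simp
      fix \<kappa> :: real assume "0 < \<kappa>"
      note lu = large_values_upper[OF rM t this] large_values_lower[OF rM t this]
      show "\<exists>C. \<forall>\<^sub>F n in sequentially. \<forall>T. real (card (\<Delta> n)) ^ C <= T -->
          measure lborel {\<alpha>\<in>{0..<1}. - k0 1 T \<alpha> <= - (1 - eps n t)} <= (3 * t\<^sup>2 / pi\<^sup>2 + \<kappa>) / real (card (\<Delta> n))"
        using lu(1) unfolding M_def eps_def neg_le_iff_le by blast
      show "\<exists>C. \<forall>\<^sub>F n in sequentially. \<forall>T p1 q1 p2 q2. farey_adjacent ((p1, q1), (p2, q2)) -->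
          real (card (\<Delta> n)) ^ C * real q1 <= T --> real (card (\<Delta> n)) ^ C * real q2 <= T -->
          (3 * t\<^sup>2 / pi\<^sup>2 - \<kappa>) / real (card (\<Delta> n)) * farey_length ((p1, q1), (p2, q2))
            <= measure lborel {\<alpha>\<in>farey_interval ((p1, q1), (p2, q2)). - k0 1 T \<alpha> <= - (1 - eps n t)}"
        using lu(2) unfolding M_def eps_def neg_le_iff_le by blast
    next
      fix T :: real assume T: "1 <= T"
      have "k0 1 T \<in> borel_measurable borel" using T by (intro k0_measurable) auto
      then show "(\<lambda>\<alpha>. - k0 1 T \<alpha>) \<in> borel_measurable borel" by measurable
      fix \<alpha> \<beta>
      show "\<bar>- k0 1 T \<alpha> - - k0 1 T \<beta>\<bar> <= T\<^sup>2 * \<bar>\<alpha> - \<beta>\<bar>" using k0_lipschitz[of 1 T \<alpha> \<beta>] T by simp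
    next
      fix t t' :: real assume t: "0 < t" "t < t'"
      show "\<forall>\<^sub>F n in sequentially. (t' - t) / real (card (\<Delta> n)) <= - (1 - eps n t') - - (1 - eps n t)"
        using Mge[of 2]
      proof eventually_elim
        case (elim n)
        have l: "0 < ln (real (M n))" "ln (real (M n)) <= real (M n)" using elim ln_le_minus_one[of "real (M n)"] by auto
        have "sqrt (real (M n) * ln (real (M n))) <= sqrt (real (M n) * real (M n))" using l by (intro real_sqrt_le_mono mult_left_mono) auto
        then have "sqrt (real (M n) * ln (real (M n))) <= real (M n)" by simp
        moreover have "0 < sqrt (real (M n) * ln (real (M n)))" using l elim by simp
        ultimately have "(t' - t) / real (M n) <= (t' - t) / sqrt (real (M n) * ln (real (M n)))" using t elim by (intro divide_left_mono mult_pos_pos) auto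
        then show ?case by (simp add: eps_def M_def diff_divide_distrib)
      qed
    qed (rule t)
    then show "(\<lambda>n. measure lborel {\<alpha>\<in>{0..<1}. t < sqrt (real (M n)) * sqrt (ln (real (M n))) * (1 - max_k0 1 (\<Delta> n) \<alpha>)}) \<longlonglongrightarrow> exp (- (3 / pi\<^sup>2) * t powr 2)"
    proof (rule Lim_transform_eventually[THEN tendsto_eq_rhs])
      show "\<forall>\<^sub>F n in sequentially. measure lborel {\<alpha>\<in>{0..<1}. \<forall>T\<in>\<Delta> n. - (1 - eps n t) < - k0 1 T \<alpha>}
          = measure lborel {\<alpha>\<in>{0..<1}. t < sqrt (real (M n)) * sqrt (ln (real (M n))) * (1 - max_k0 1 (\<Delta> n) \<alpha>)}"
        using Mge[of 2]
      proof eventually_elim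
        case (elim n)
        have "(t < sqrt (real (M n)) * sqrt (ln (real (M n))) * (1 - max_k0 1 (\<Delta> n) \<alpha>)) \<longleftrightarrow> (\<forall>T\<in>\<Delta> n. - (1 - eps n t) < - k0 1 T \<alpha>)" for \<alpha>
        proof -
          have "0 < sqrt (real (M n) * ln (real (M n)))" using elim by simp
          then have "(t < sqrt (real (M n)) * sqrt (ln (real (M n))) * (1 - max_k0 1 (\<Delta> n) \<alpha>)) \<longleftrightarrow> eps n t < 1 - max_k0 1 (\<Delta> n) \<alpha>"
            unfolding eps_def real_sqrt_mult[symmetric] by (simp only: divide_less_eq mult.commute if_True)
          also have "... \<longleftrightarrow> max_k0 1 (\<Delta> n) \<alpha> < 1 - eps n t" by linarith
          also have "... \<longleftrightarrow> (\<forall>T\<in>\<Delta> n. k0 1 T \<alpha> < 1 - eps n t)"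
            unfolding max_k0_def using elim ne[of n] assms(1)[of n] by (subst Max_less_iff) auto
          finally show ?thesis by (simp only: neg_less_iff_less)
        qed
        then show ?case by simp
      qed
      show "exp (- (3 * t\<^sup>2 / pi\<^sup>2)) = exp (- (3 / pi\<^sup>2) * t powr 2)" using t by simp
    qed
  qed simp_all
  show ?thesis using part1 part2 unfolding M_def by blast
qed

end
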